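(* Let $E$ be a Banach space such that the dual $E'$ has the Radon-Nikodým property, and let $K\subset H^{1}(\mu,E)$. Then the following are equivalent. (1) $K$ is relatively weakly compact in $H^{1}(\mu,E)$. (2) $K^{\ast}$ is uniformly integrable, and for every sequence $\{M^{n}\}_{n}\subset K$ there exist convex combinations $N^{i}\in\mathrm{co}\{M^{n}:n\geq i\}$ ($i\in\mathbb{N}$) and $N\in H^{1}(\mu,E)$ such that $\{N^{i}\}_{i}$ converges in the u.c.p. topology to $N$. (3) $K^{\ast}$ is uniformly integrable, and for every sequence $\{M^{n}\}_{n}\subset K$ there exist convex combinations $N^{i}\in\mathrm{co}\{M^{n}:n\geq i\}$ ($i\in\mathbb{N}$) and $N\in H^{1}(\mu,E)$ such that, for each $t\in[0,\infty)$, $\{N^{i}_{t}\}_{i}$ converges $\mu$-a.e. to $N_{t}$ in $\sigma(E,E')$.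
   Context: Stochastic basis: $(X,\mathscr{F},\mu)$ is a complete probability space with a filtration $\{\mathscr{F}_{t}:t\geq0\}$ of sub-$\sigma$-algebras of $\mathscr{F}$ such that $\mathscr{F}_{0}$ is the $\sigma$-algebra generated by the $\mu$-null sets and $\mathscr{F}_{t}=\bigcap_{s>t}\mathscr{F}_{s}$ for all $t\geq0$. All processes are indexed by $[0,\infty)$ and identified when they agree outside an evanescent set, i.e. a set $A\subset[0,\infty)\times X$ whose projection onto $X$ is $\mu$-null. Banach spaces are real, $E'$ is the dual of $E$, and $\sigma(E,E')$ is the weak topology of $E$. $\mathrm{co}$ denotes the convex hull. For an $E$-valued process $M$, $M^{\ast}_{t}=\sup_{s\leq t}\Vert M_{s}\Vert_{E}$ and $M^{\ast}_{\infty}=\sup_{t>0}M^{\ast}_{t}$. $H^{1}(\mu,E)$ is the Banach space of càdlàg $E$-valued martingales $M$ such that $M^{\ast}_{\infty}\in L^{1}(\mu)$ and such that there is a terminal value $M_{\infty}\in L^{1}(\mu,E)$ (Bochner space) with $M_{t}=\mathbb{E}[M_{\infty}\mid\mathscr{F}_{t}]$ for all $t\in[0,\infty)$; its norm is $M\mapsto\Vert M^{\ast}_{\infty}\Vert_{L^{1}}$. For $K\subset H^{1}(\mu,E)$, $K^{\ast}=\{M^{\ast}_{\infty}:M\in K\}\subset L^{1}(\mu)$. A subset of $L^{1}(\mu)$ is uniformly integrable if it is $L^{1}$-bounded and for each $\varepsilon>0$ there is $\delta>0$ such that $\int_{A}|\xi|\,d\mu\leq\varepsilon$ for all $\xi$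 in the subset and all $A\in\mathscr{F}$ with $\mu(A)\leq\delta$. The u.c.p. topology on adapted $E$-valued càdlàg processes (modulo evanescence) is given by the metric $D(M,N)=\sum_{n=1}^{\infty}2^{-n}\int_{X}1\wedge(M-N)^{\ast}_{n}\,d\mu$. *)

theory Defs
  imports "HOL-Probability.Probability" "HOL-Library.Function_Algebras"
begin

instantiation "fun" :: (type, scaleR) scaleR
begin
definition "r *\<^sub>R f = (\<lambda>x. r *\<^sub>R f x)"
instance ..
end

instance "fun" :: (type, real_vector) real_vector
  by standard (simp_all add: scaleR_fun_def fun_eq_iff scaleR_add_right scaleR_add_left)


section \<open>Bochner integral in arbitrary Banach spaces\<close>

text \<open>
  The library predicate \<^const>\<open>has_bochner_integral\<close> is restricted to second countable spaces.
  The same definition makes sense without this restriction; approximability by simple functions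
  then forces the integrand to be essentially separably valued, so that one obtains exactly the
  strongly measurable, norm integrable functions.
\<close>

definition bochner_has_integral :: "'a measure \<Rightarrow> ('a \<Rightarrow> 'e::real_normed_vector) \<Rightarrow> 'e \<Rightarrow> bool" where
  "bochner_has_integral M f v \<longleftrightarrow>
     f \<in> borel_measurable M \<and>
     (\<exists>s. (\<forall>i::nat. Bochner_Integration.simple_bochner_integrable M (s i)) \<and>
          (\<lambda>i. \<integral>\<^sup>+x. ennreal (norm (f x - s i x)) \<partial>M) \<longlonglongrightarrow> 0 \<and>
          (\<lambda>i. Bochner_Integration.simple_bochner_integral M (s i)) \<longlonglongrightarrow> v)"

definition bochner_integrable :: "'a measure \<Rightarrow> ('a \<Rightarrow> 'e::real_normed_vector) \<Rightarrow> bool" where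
  "bochner_integrable M f \<longleftrightarrow> (\<exists>v. bochner_has_integral M f v)"

definition bochner_set_integral ::
    "'a measure \<Rightarrow> 'a set \<Rightarrow> ('a \<Rightarrow> 'e::real_normed_vector) \<Rightarrow> 'e" where
  "bochner_set_integral M A f = (THE v. bochner_has_integral M (\<lambda>x. indicator A x *\<^sub>R f x) v)"


section \<open>The Radon-Nikodym property\<close>

definition vector_measure :: "'b measure \<Rightarrow> ('b set \<Rightarrow> 'f::real_normed_vector) \<Rightarrow> bool" where
  "vector_measure M G \<longleftrightarrow>
     (\<forall>A::nat \<Rightarrow> 'b set. range A \<subseteq> sets M \<and> disjoint_family A \<longrightarrow> (\<lambda>n. G (A n)) sums G (\<Union>n. A n))"

definition bounded_variation :: "'b measure \<Rightarrow> ('b set \<Rightarrow> 'f::real_normed_vector) \<Rightarrow> bool" where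
  "bounded_variation M G \<longleftrightarrow>
     (\<exists>C. \<forall>\<A>. finite \<A> \<and> \<A> \<subseteq> sets M \<and> disjoint \<A> \<longrightarrow> (\<Sum>A\<in>\<A>. norm (G A)) \<le> C)"

definition RNP_wrt :: "'b measure \<Rightarrow> 'f::banach itself \<Rightarrow> bool" where
  "RNP_wrt M (_ :: 'f itself) \<longleftrightarrow>
     (\<forall>G :: 'b set \<Rightarrow> 'f.
        vector_measure M G \<and> bounded_variation M G \<and> (\<forall>A\<in>null_sets M. G A = 0) \<longrightarrow>
        (\<exists>g. bochner_integrable M g \<and> (\<forall>A\<in>sets M. G A = bochner_set_integral M A g)))"

text \<open>
  The Radon-Nikodym property asks for \<^const>\<open>RNP_wrt\<close> with respect to every finite measure space.
  HOL cannot quantify over the type carrying the measure space inside a hypothesis. We quantify over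
  all finite measures living on subsets of \<^typ>\<open>real\<close> and of a given type \<^typ>\<open>'b\<close>. The former
  contain Lebesgue measure on the unit interval, for which \<^const>\<open>RNP_wrt\<close> already implies
  \<^const>\<open>RNP_wrt\<close> for all finite measure spaces; so the property does not depend on \<^typ>\<open>'b\<close>.
\<close>

definition radon_nikodym_property :: "'b itself \<Rightarrow> 'f::banach itself \<Rightarrow> bool" where
  "radon_nikodym_property (_ :: 'b itself) (E :: 'f itself) \<longleftrightarrow>
     (\<forall>M :: 'b measure. finite_measure M \<longrightarrow> RNP_wrt M E) \<and>
     (\<forall>M :: real measure. finite_measure M \<longrightarrow> RNP_wrt M E)"


section \<open>Weak topologies\<close>

text \<open>The coarsest topology on \<^term>\<open>S\<close> making all functionals in \<^term>\<open>\<Phi>\<close> continuous.\<close>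

definition weak_topology_on :: "'b set \<Rightarrow> ('b \<Rightarrow> real) set \<Rightarrow> 'b topology" where
  "weak_topology_on S \<Phi> =
     topology_generated_by (insert S {{x \<in> S. \<phi> x \<in> U} | \<phi> U. \<phi> \<in> \<Phi> \<and> open U})"

definition weak_topology :: "'e::real_normed_vector topology" where
  "weak_topology = weak_topology_on UNIV (range (blinfun_apply :: ('e \<Rightarrow>\<^sub>L real) \<Rightarrow> 'e \<Rightarrow> real))"


section \<open>Stochastic basis and martingales\<close>

text \<open>
  Processes are functions \<^typ>\<open>real \<Rightarrow> 'a \<Rightarrow> 'e\<close> of which only the times \<open>t \<ge> 0\<close> and the points of
  the sample space matter; they are representatives of their classes modulo evanescence.
\<close>

definition stochastic_basis :: "'a measure \<Rightarrow> (real \<Rightarrow> 'a measure) \<Rightarrow> bool" where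
  "stochastic_basis P F \<longleftrightarrow>
     prob_space P \<and> complete_measure P \<and>
     (\<forall>t\<ge>0. subalgebra P (F t)) \<and>
     (\<forall>s t. 0 \<le> s \<and> s \<le> t \<longrightarrow> sets (F s) \<subseteq> sets (F t)) \<and>
     sets (F 0) = sigma_sets (space P) (null_sets P) \<and>
     (\<forall>t\<ge>0. sets (F t) = (\<Inter>s\<in>{t<..}. sets (F s)))"

definition is_cond_exp :: "'a measure \<Rightarrow> 'a measure \<Rightarrow> ('a \<Rightarrow> 'e::banach) \<Rightarrow> ('a \<Rightarrow> 'e) \<Rightarrow> bool" where
  "is_cond_exp P G f g \<longleftrightarrow>
     bochner_integrable P f \<and> bochner_integrable (restr_to_subalg P G) g \<and>
     (\<forall>A\<in>sets G. bochner_set_integral P A g = bochner_set_integral P A f)"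

definition cadlag :: "(real \<Rightarrow> 'e::topological_space) \<Rightarrow> bool" where
  "cadlag f \<longleftrightarrow>
     (\<forall>t\<ge>0. (f \<longlongrightarrow> f t) (at_right t)) \<and> (\<forall>t>0. \<exists>l. (f \<longlongrightarrow> l) (at_left t))"

definition running_max :: "(real \<Rightarrow> 'a \<Rightarrow> 'e::real_normed_vector) \<Rightarrow> real \<Rightarrow> 'a \<Rightarrow> ennreal" where
  "running_max M t x = (SUP s\<in>{0..t}. ennreal (norm (M s x)))"

definition total_max :: "(real \<Rightarrow> 'a \<Rightarrow> 'e::real_normed_vector) \<Rightarrow> 'a \<Rightarrow> ennreal" where
  "total_max M x = (SUP t\<in>{0<..}. running_max M t x)"

definition H1 :: "'a measure \<Rightarrow> (real \<Rightarrow> 'a measure) \<Rightarrow> (real \<Rightarrow> 'a \<Rightarrow> 'e::banach) set" where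
  "H1 P F = {M. (\<forall>x\<in>space P. cadlag (\<lambda>t. M t x)) \<and>
                total_max M \<in> borel_measurable P \<and> (\<integral>\<^sup>+x. total_max M x \<partial>P) < \<infinity> \<and>
                (\<exists>M_inf. \<forall>t\<ge>0. is_cond_exp P (F t) M_inf (M t))}"

definition H1_norm :: "'a measure \<Rightarrow> (real \<Rightarrow> 'a \<Rightarrow> 'e::banach) \<Rightarrow> real" where
  "H1_norm P M = enn2real (\<integral>\<^sup>+x. total_max M x \<partial>P)"

text \<open>
  A functional bounded by \<^const>\<open>H1_norm\<close> does not distinguish processes that agree up to
  evanescence, so these are the elements of the dual of the Banach space of equivalence classes.
  Accordingly the weak topology below is the preimage of the weak topology on the classes under the
  quotient map. It is not Hausdorff, but a set of representatives has compact closure iff the set of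
  their classes does.
\<close>

definition H1_dual ::
    "'a measure \<Rightarrow> (real \<Rightarrow> 'a measure) \<Rightarrow> ((real \<Rightarrow> 'a \<Rightarrow> 'e::banach) \<Rightarrow> real) set" where
  "H1_dual P F = {\<phi>.
     (\<forall>M\<in>H1 P F. \<forall>N\<in>H1 P F. \<phi> (M + N) = \<phi> M + \<phi> N) \<and>
     (\<forall>c. \<forall>M\<in>H1 P F. \<phi> (c *\<^sub>R M) = c * \<phi> M) \<and>
     (\<exists>C. \<forall>M\<in>H1 P F. \<bar>\<phi> M\<bar> \<le> C * H1_norm P M)}"

definition H1_weak_topology ::
    "'a measure \<Rightarrow> (real \<Rightarrow> 'a measure) \<Rightarrow> (real \<Rightarrow> 'a \<Rightarrow> 'e::banach) topology" where
  "H1_weak_topology P F = weak_topology_on (H1 P F) (H1_dual P F)"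

definition relatively_compact_in :: "'b topology \<Rightarrow> 'b set \<Rightarrow> bool" where
  "relatively_compact_in T K \<longleftrightarrow> compactin T (T closure_of K)"

text \<open>
  For \<^term>\<open>M \<in> H1 P F\<close> the function \<^term>\<open>total_max M\<close> is finite almost everywhere, so
  \<^const>\<open>enn2real\<close> only alters it on a null set.
\<close>

definition maximal_functions :: "(real \<Rightarrow> 'a \<Rightarrow> 'e::real_normed_vector) set \<Rightarrow> ('a \<Rightarrow> real) set" where
  "maximal_functions K = (\<lambda>M x. enn2real (total_max M x)) ` K"

definition uniformly_integrable :: "'a measure \<Rightarrow> ('a \<Rightarrow> real) set \<Rightarrow> bool" where
  "uniformly_integrable P Z \<longleftrightarrow>
     (\<forall>\<xi>\<in>Z. integrable P \<xi>) \<and>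
     (\<exists>C. \<forall>\<xi>\<in>Z. (\<integral>x. \<bar>\<xi> x\<bar> \<partial>P) \<le> C) \<and>
     (\<forall>\<epsilon>>0. \<exists>\<delta>>0. \<forall>\<xi>\<in>Z. \<forall>A\<in>sets P. measure P A \<le> \<delta> \<longrightarrow> (LINT x:A|P. \<bar>\<xi> x\<bar>) \<le> \<epsilon>)"

definition ucp_dist ::
    "'a measure \<Rightarrow> (real \<Rightarrow> 'a \<Rightarrow> 'e::real_normed_vector) \<Rightarrow> (real \<Rightarrow> 'a \<Rightarrow> 'e) \<Rightarrow> real" where
  "ucp_dist P M N =
     (\<Sum>n. (1 / 2) ^ Suc n * enn2real (\<integral>\<^sup>+x. min 1 (running_max (M - N) (real (Suc n)) x) \<partial>P))"

end

theory Submission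
  imports Defs
begin

text \<open>
  Everything is compared with the following block condition (0): every sequence in \<open>K\<close> has convex
  blocks \<open>N\<^sub>i \<in> co {M\<^sub>n | n \<ge> i}\<close> converging in the norm of \<open>H\<^sup>1\<close>. A weakly compact set satisfies (0) by Mazur's
  theorem, and its maximal functions are uniformly integrable by a gliding hump argument. Conversely a
  bounded set with (0) is relatively weakly compact: a point of the bidual in the weak-star closure of \<open>K\<close>
  at positive distance from \<open>H\<^sup>1\<close> would yield a sequence in \<open>K\<close> without norm convergent blocks.
  Norm convergence implies u.c.p. convergence, which implies a.e. convergence along a subsequence.

  From a.e. weak convergence to (0): by uniform integrability and Doob's weak type inequality, the \<open>H\<^sup>1\<close>-norm
  of convex combinations of the differences is controlled by the \<open>L\<^sup>1\<close>-norm of the terminal values.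
  These are weakly null in \<open>L\<^sup>1(E)\<close>, since the Radon-Nikodym property represents functionals on \<open>L\<^sup>1(E)\<close>
  by densities, which may be replaced by simple functions up to an error that is small on uniformly
  integrable sets, and since the martingales \<open>E[1\<^sub>B | F\<^sub>k]\<close> converge in \<open>L\<^sup>1\<close>. So convex combinations of the terminal values converge in norm.
\<close>


section \<open>The Hahn-Banach theorem\<close>

text \<open>Condition (0) serves as pivot because it asks for no description of the dual of H1 and
  no sequential compactness: cluster points and the separation theorem of Mazur and Orlicz suffice.
  The abstract part is stated for seminorms on subspaces, since a process is only a representative
  modulo evanescence.

  The obstacle on the martingale side is that (3) speaks of one time after another, while the norm
  sees all times at once. Two estimates bridge this, both uniform over K. Replacing the terminal
  time by time k inside an integral over B costs the integral of |E[1_B|F_l] - E[1_B|F_k]| against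
  the maximal function. And a maximal function with integral at least e exceeds e/3 with probability
  bounded below, so the weak type inequality at level e/3 stands in for the L1 maximal inequality,
  which is false. The terminal value has to be the L1 limit of M_k: an arbitrary closing variable is
  not controlled by the maximal function.

  As E may be nonseparable, sums of Borel functions are handled through simple approximations and
  completeness of the measure.\<close>

definition sublinear :: "('v::real_vector \<Rightarrow> real) \<Rightarrow> bool" where
  "sublinear q \<longleftrightarrow> (\<forall>x y. q (x + y) \<le> q x + q y) \<and> (\<forall>t\<ge>0. \<forall>x. q (t *\<^sub>R x) = t * q x)"

lemma sublinearD:
  assumes "sublinear q"
  shows "q (x + y) \<le> q x + q y" "t \<ge> 0 \<Longrightarrow> q (t *\<^sub>R x) = t * q x" "q 0 = 0" "- q (- x) \<le> q x"
proof -
  show 1: "q (x + y) \<le> q x + q y" for x y using assms by (auto simp: sublinear_def)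
  show "t \<ge> 0 \<Longrightarrow> q (t *\<^sub>R x) = t * q x" using assms by (auto simp: sublinear_def)
  have "q (0 *\<^sub>R 0) = 0 * q 0" using assms unfolding sublinear_def by blast
  then show 0: "q 0 = 0" by simp
  show "- q (- x) \<le> q x" using 1[of x "-x"] 0 by simp
qed

text \<open>The auxiliary functional of the Mazur-Orlicz theorem: for nonempty \<open>C\<close>, a
  linear functional lies below it exactly when it lies below \<open>q\<close> everywhere and is at
  least \<open>d\<close> on \<open>C\<close>.\<close>

definition sandwich :: "('v::real_vector \<Rightarrow> real) \<Rightarrow> 'v set \<Rightarrow> real \<Rightarrow> 'v \<Rightarrow> real" where
  "sandwich q C d x = (INF (t, c)\<in>{0..} \<times> C. q (x + t *\<^sub>R c) - t * d)"

text \<open>The infimum is finite because \<open>d \<le> q\<close> on \<open>C\<close> bounds every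
  competitor below by \<open>- q (- x)\<close>. Subadditivity rests on convexity:
  \<open>t *\<^sub>R c + s *\<^sub>R b\<close> equals \<open>(t + s) *\<^sub>R a\<close> with
  \<open>a\<close> in \<open>C\<close>, so competitors for \<open>x\<close> and \<open>y\<close>
  merge into one for \<open>x + y\<close>. The last two claims are the competitors with
  \<open>t = 0\<close> and \<open>t = 1\<close>.\<close>

lemma
  assumes q: "sublinear q" and C: "convex C" "C \<noteq> {}" "\<And>c. c \<in> C \<Longrightarrow> d \<le> q c"
  shows sublinear_sandwich: "sublinear (sandwich q C d)"
    and sandwich_le: "sandwich q C d x \<le> q x"
    and sandwich_uminus: "c \<in> C \<Longrightarrow> sandwich q C d (- c) \<le> - d"
proof -
  have bdd: "bdd_below ((\<lambda>(t, c). q (x + t *\<^sub>R c) - t * d) ` ({0..} \<times> C))" for x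
  proof (rule bdd_belowI2)
    fix p :: "real \<times> 'a" assume "p \<in> {0..} \<times> C"
    then obtain t c where p: "p = (t, c)" "t \<ge> 0" "c \<in> C" by auto
    have "q (t *\<^sub>R c) \<le> q (x + t *\<^sub>R c) + q (- x)"
      using sublinearD(1)[OF q, of "x + t *\<^sub>R c" "- x"] by simp
    moreover have "q (t *\<^sub>R c) \<ge> t * d"
      using sublinearD(2)[OF q p(2)] C(3)[OF p(3)] p(2) by (simp add: mult_left_mono)
    ultimately show "- q (- x) \<le> (case p of (t, c) \<Rightarrow> q (x + t *\<^sub>R c) - t * d)"
      using p by simp
  qed
  have le: "sandwich q C d x \<le> q (x + t *\<^sub>R c) - t * d" if "t \<ge> 0" "c \<in> C" for x t c
    unfolding sandwich_def using cINF_lower[OF bdd, of "(t, c)" x] that by simp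
  have ge: "b \<le> sandwich q C d x" if "\<And>t c. t \<ge> 0 \<Longrightarrow> c \<in> C \<Longrightarrow> b \<le> q (x + t *\<^sub>R c) - t * d" for b x
    unfolding sandwich_def using that C(2) by (intro cINF_greatest) auto
  obtain c0 where c0: "c0 \<in> C" using C(2) by auto
  have app: "\<exists>t c. t \<ge> 0 \<and> c \<in> C \<and> q (x + t *\<^sub>R c) - t * d < b" if "sandwich q C d x < b" for x b
    using ge[of b x] that by (force simp: not_less[symmetric])
  have add: "sandwich q C d (x + y) \<le> sandwich q C d x + sandwich q C d y" for x y
  proof (rule ccontr)
    let ?e = "sandwich q C d (x + y) - sandwich q C d x - sandwich q C d y"
    assume "\<not> ?thesis"
    then have e: "?e > 0" by simp
    obtain t c where 1: "t \<ge> 0" "c \<in> C" "q (x + t *\<^sub>R c) - t * d < sandwich q C d x + ?e/2"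
      using app[of x "sandwich q C d x + ?e/2"] e by auto
    obtain s b where 2: "s \<ge> 0" "b \<in> C" "q (y + s *\<^sub>R b) - s * d < sandwich q C d y + ?e/2"
      using app[of y "sandwich q C d y + ?e/2"] e by auto
    obtain a where a: "a \<in> C" "t *\<^sub>R c + s *\<^sub>R b = (t + s) *\<^sub>R a"
    proof (cases "t + s = 0")
      case True
      then have "t = 0" "s = 0" using 1 2 by auto
      then show ?thesis using that[of c] 1 by simp
    next
      case False
      then have "t + s > 0" using 1 2 by auto
      have "(t/(t+s)) *\<^sub>R c + (s/(t+s)) *\<^sub>R b \<in> C"
        using 1 2 \<open>t + s > 0\<close> by (intro convexD[OF C(1)]) (auto simp: add_divide_distrib[symmetric])
      then show ?thesis using that[of "(t/(t+s)) *\<^sub>R c + (s/(t+s)) *\<^sub>R b"] False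
        by (simp add: scaleR_add_right)
    qed
    have "sandwich q C d (x + y) \<le> q (x + y + (t + s) *\<^sub>R a) - (t + s) * d"
      using 1 2 a by (intro le) auto
    also have "x + y + (t + s) *\<^sub>R a = (x + t *\<^sub>R c) + (y + s *\<^sub>R b)" using a(2)[symmetric] by simp
    also have "q \<dots> \<le> q (x + t *\<^sub>R c) + q (y + s *\<^sub>R b)" by (rule sublinearD[OF q])
    finally show False using 1 2 by (simp add: algebra_simps) (smt (verit, ccfv_threshold) field_sum_of_halves)
  qed
  have zero: "sandwich q C d 0 = 0"
  proof (rule antisym)
    show "sandwich q C d 0 \<le> 0" using le[of 0 c0 0] c0 sublinearD(3)[OF q] by simp
    show "0 \<le> sandwich q C d 0"
      by (rule ge) (use C(3) sublinearD(2)[OF q] in \<open>simp add: mult_left_mono\<close>)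
  qed
  \<comment> \<open>One inequality for all positive factors is enough: applied to the inverse factor
    it gives the converse.\<close>
  have half: "sandwich q C d (r *\<^sub>R x) \<le> r * sandwich q C d x" if r: "r > 0" for r x
  proof -
    have "sandwich q C d (r *\<^sub>R x) / r \<le> sandwich q C d x"
    proof (rule ge)
      fix t :: real and c assume "0 \<le> t" "c \<in> C"
      then have "sandwich q C d (r *\<^sub>R x) \<le> q (r *\<^sub>R x + (r * t) *\<^sub>R c) - (r * t) * d"
        using r by (intro le) auto
      also have "r *\<^sub>R x + (r * t) *\<^sub>R c = r *\<^sub>R (x + t *\<^sub>R c)" by (simp add: scaleR_add_right)
      also have "q \<dots> = r * q (x + t *\<^sub>R c)" using r by (intro sublinearD(2)[OF q]) simp
      finally show "sandwich q C d (r *\<^sub>R x) / r \<le> q (x + t *\<^sub>R c) - t * d"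
        using r by (simp add: field_simps)
    qed
    then show ?thesis using r by (simp add: field_simps)
  qed
  have "sandwich q C d (r *\<^sub>R x) = r * sandwich q C d x" if r: "r \<ge> 0" for r x
  proof (cases "r = 0")
    case False
    then have r: "r > 0" using r by simp
    have "sandwich q C d x \<le> inverse r * sandwich q C d (r *\<^sub>R x)"
      using half[of "inverse r" "r *\<^sub>R x"] r by simp
    then show ?thesis using half[OF r, of x] r by (simp add: field_simps)
  qed (simp add: zero)
  with add show "sublinear (sandwich q C d)" by (simp add: sublinear_def)
  show "sandwich q C d x \<le> q x" using le[of 0 c0 x] c0 by simp
  show "sandwich q C d (- c) \<le> - d" if "c \<in> C" using le[of 1 c "-c"] that sublinearD(3)[OF q] by simp
qed

text \<open>Zorn's lemma for the pointwise infimum of a chain, which stays finite because every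
  sublinear minorant of \<open>q\<close> is bounded below by \<open>- q (- x)\<close>.\<close>

lemma sublinear_minimal:
  assumes q: "sublinear (q :: 'v::real_vector \<Rightarrow> real)"
  shows "\<exists>m. sublinear m \<and> m \<le> q \<and> (\<forall>p. sublinear p \<longrightarrow> p \<le> m \<longrightarrow> p = m)"
proof -
  \<comment> \<open>The order is reversed, so that the maximal element delivered by Zorn's lemma is
    a minimal functional.\<close>
  let ?A = "{p. sublinear p \<and> p \<le> q}" and ?P = "\<lambda>f g :: 'v \<Rightarrow> real. g \<le> f"
  have "\<exists>m\<in>?A. \<forall>a\<in>?A. ?P m a \<longrightarrow> a = m"
  proof (rule predicate_Zorn)
    show "partial_order_on ?A (relation_of ?P ?A)"
      by (rule partial_order_on_relation_ofI) auto
    fix C assume C: "C \<in> Chains (relation_of ?P ?A)"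
    then have CA: "C \<subseteq> ?A" by (auto simp: Chains_def relation_of_def)
    have chain: "a \<le> b \<or> b \<le> a" if "a \<in> C" "b \<in> C" for a b
      using C that by (auto simp: Chains_def relation_of_def)
    show "\<exists>u\<in>?A. \<forall>a\<in>C. ?P a u"
    proof (cases "C = {}")
      case True then show ?thesis using q by auto
    next
      case False
      define u where "u x = (INF p\<in>C. p x)" for x
      have bdd: "bdd_below ((\<lambda>p. p x) ` C)" for x
      proof (rule bdd_belowI2)
        fix p assume "p \<in> C"
        then have "sublinear p" "p (-x) \<le> q (-x)" using CA by (auto simp: le_fun_def)
        then show "- q (- x) \<le> p x" using sublinearD(4)[of p x] by simp
      qed
      have le: "u x \<le> p x" if "p \<in> C" for p x unfolding u_def by (rule cINF_lower[OF bdd that])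
      have ge: "b \<le> u x" if "\<And>p. p \<in> C \<Longrightarrow> b \<le> p x" for b x
        unfolding u_def using False that by (intro cINF_greatest) auto
      have "u (x + y) \<le> u x + u y" for x y
      proof -
        \<comment> \<open>Two members of the chain are compared through the smaller of them; this is
          where the chain property gives subadditivity of the infimum.\<close>
        have "u (x + y) - p' y \<le> p x" if p: "p \<in> C" "p' \<in> C" for p p'
        proof -
          obtain r where r: "r \<in> C" "r \<le> p" "r \<le> p'" using chain p by blast
          have "u (x + y) \<le> r x + r y" using le[OF r(1), of "x + y"] sublinearD(1)[of r x y] CA r(1) by fastforce
          then show ?thesis using r by (smt (verit) le_fun_def)
        qed
        then have "u (x + y) - p' y \<le> u x" if "p' \<in> C" for p' using that by (intro ge) auto
        then have "u (x + y) - u x \<le> u y" by (intro ge) (auto simp: algebra_simps)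
        then show ?thesis by simp
      qed
      moreover have "u (t *\<^sub>R x) = t * u x" if t: "t \<ge> 0" for t x
      proof -
        have eq: "p (t *\<^sub>R x) = t * p x" if "p \<in> C" for p x using sublinearD(2)[of p t] CA that t by auto
        show ?thesis
        proof (cases "t = 0")
          case True
          obtain p where p: "p \<in> C" using False by auto
          have "p 0 = 0" using CA p sublinearD(3) by blast
          then have "u 0 \<le> 0" using le[OF p, of 0] by simp
          moreover have "0 \<le> u 0" 
          proof (rule ge)
            fix r assume "r \<in> C"
            then have "sublinear r" using CA by auto
            then show "0 \<le> r 0" by (simp add: sublinearD(3))
          qed
          ultimately have "u 0 = 0" by simp
          then show ?thesis using True by simp
        next
          case False
          show ?thesis
          proof (rule antisym)
            have "u (t *\<^sub>R x) / t \<le> u x"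
              using False t le[of _ "t *\<^sub>R x"] eq by (intro ge) (simp add: field_simps)
            then show "u (t *\<^sub>R x) \<le> t * u x" using False t by (simp add: field_simps)
            show "t * u x \<le> u (t *\<^sub>R x)" 

            proof (rule ge)
              fix r assume r: "r \<in> C"
              show "t * u x \<le> r (t *\<^sub>R x)" unfolding eq[OF r] using le[OF r, of x] t by (rule mult_left_mono)
            qed
          qed
        qed
      qed
      ultimately have "sublinear u" by (simp add: sublinear_def)
      moreover have "u \<le> q"
      proof (rule le_funI)
        fix x
        obtain p where p: "p \<in> C" using False by auto
        then have "p x \<le> q x" using CA by (auto simp: le_fun_def)
        then show "u x \<le> q x" using le[OF p, of x] by simp
      qed
      ultimately show ?thesis using le by (auto simp: le_fun_def)
    qed
  qed
  then obtain m where m: "sublinear m" "m \<le> q" "\<forall>a\<in>?A. a \<le> m \<longrightarrow> a = m" by auto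
  then show ?thesis using order_trans by blast
qed

text \<open>A minimal sublinear functional is linear: its sandwich with the single point
  \<open>y\<close> at height \<open>m y\<close> lies below \<open>m\<close>, hence equals
  \<open>m\<close>, and then \<open>m (- y) \<le> - m y\<close>. Oddness together with subadditivity
  is additivity.\<close>

lemma sublinear_ge_linear:
  assumes q: "sublinear (q :: 'v::real_vector \<Rightarrow> real)"
  shows "\<exists>l. linear l \<and> l \<le> q"
proof -
  obtain m where m: "sublinear m" "m \<le> q" "\<And>p. sublinear p \<Longrightarrow> p \<le> m \<Longrightarrow> p = m"
    using sublinear_minimal[OF q] by blast
  have odd: "m (- y) = - m y" for y
  proof -
    note s = sublinear_sandwich[of m "{y}" "m y"] sandwich_le[of m "{y}" "m y"]
      sandwich_uminus[of m "{y}" "m y" y]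
    have "sandwich m {y} (m y) = m" using s m(1) by (intro m(3)) (auto simp: le_fun_def)
    then have "m (- y) \<le> - m y" using s(3) m(1) by simp
    then show ?thesis using sublinearD(4)[OF m(1), of y] by simp
  qed
  have "m (x + y) = m x + m y" for x y
    using sublinearD(1)[OF m(1), of x y] sublinearD(1)[OF m(1), of "x + y" "-y"] odd[of y] by simp
  moreover have "m (t *\<^sub>R x) = t * m x" for t x
    using sublinearD(2)[OF m(1), of t x] sublinearD(2)[OF m(1), of "-t" x] odd[of "t *\<^sub>R x"]
    by (cases "t \<ge> 0") auto
  ultimately have "linear m" by (intro linearI) auto
  then show ?thesis using m by blast
qed

text \<open>Any linear functional below the sandwich does both jobs. This single statement later
  serves as Hahn-Banach extension (one point) and as separation (a convex set at positive distance
  from the origin).\<close>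

lemma mazur_orlicz:
  assumes q: "sublinear (q :: 'v::real_vector \<Rightarrow> real)" and C: "convex C" "\<And>c. c \<in> C \<Longrightarrow> d \<le> q c"
  shows "\<exists>l. linear l \<and> (\<forall>x. l x \<le> q x) \<and> (\<forall>c\<in>C. d \<le> l c)"
proof (cases "C = {}")
  case True then show ?thesis using sublinear_ge_linear[OF q] by (auto simp: le_fun_def)
next
  case False
  note s = sublinear_sandwich[OF q C(1) False] sandwich_le[OF q C(1) False]
    sandwich_uminus[OF q C(1) False]
  obtain l where l: "linear l" "l \<le> sandwich q C d" using sublinear_ge_linear[OF s(1)] C(2) by blast
  have "l x \<le> q x" for x using l(2) s(2) C(2) by (meson le_funD order_trans)
  moreover have "d \<le> l c" if "c \<in> C" for c
    using le_funD[OF l(2), of "- c"] s(3)[OF C(2) that] linear_neg[OF l(1), of c] by simp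
  ultimately show ?thesis using l by blast
qed

text \<open>Relative to a subspace because martingales and Bochner integrable functions are subsets
  of full function types, outside of which the norm formulas have no meaning. Nonzero vectors of
  norm 0 are allowed, as needed for representatives of classes.\<close>

definition seminorm_on :: "'v::real_vector set \<Rightarrow> ('v \<Rightarrow> real) \<Rightarrow> bool" where
  "seminorm_on S p \<longleftrightarrow> subspace S \<and> (\<forall>x\<in>S. \<forall>y\<in>S. p (x + y) \<le> p x + p y) \<and>
     (\<forall>x\<in>S. \<forall>c. p (c *\<^sub>R x) = \<bar>c\<bar> * p x)"

lemma seminorm_onD:
  assumes "seminorm_on S p"
  shows "subspace S" "x \<in> S \<Longrightarrow> y \<in> S \<Longrightarrow> p (x + y) \<le> p x + p y"
    "x \<in> S \<Longrightarrow> p (c *\<^sub>R x) = \<bar>c\<bar> * p x" "x \<in> S \<Longrightarrow> p (- x) = p x" "x \<in> S \<Longrightarrow> 0 \<le> p x"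
    "x \<in> S \<Longrightarrow> y \<in> S \<Longrightarrow> p (x - y) = p (y - x)" "p 0 = 0"
proof -
  show S: "subspace S" and 2: "\<And>x y. x \<in> S \<Longrightarrow> y \<in> S \<Longrightarrow> p (x + y) \<le> p x + p y"
    and 3: "\<And>x c. x \<in> S \<Longrightarrow> p (c *\<^sub>R x) = \<bar>c\<bar> * p x"
    using assms by (auto simp: seminorm_on_def)
  show 4: "p (- x) = p x" if "x \<in> S" for x using 3[OF that, of "-1"] by simp
  show 7: "p 0 = 0" using 3[OF subspace_0[OF S], of 0] by simp
  show "0 \<le> p x" if "x \<in> S" for x
    using 2[OF that subspace_neg[OF S that]] 4[OF that] 7 by simp
  show "x \<in> S \<Longrightarrow> y \<in> S \<Longrightarrow> p (x - y) = p (y - x)" using 4[of "x - y"] subspace_diff[OF S] by simp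
qed

text \<open>Composing \<open>p\<close> with a linear projection onto \<open>S\<close> gives a
  sublinear functional on the whole type, so the functional obtained is linear everywhere while its
  bound is claimed on \<open>S\<close> only.\<close>

lemma mazur_orlicz_seminorm:
  assumes p: "seminorm_on S p" and C: "convex C" "C \<subseteq> S" "\<And>c. c \<in> C \<Longrightarrow> d \<le> p c"
  shows "\<exists>l. linear l \<and> (\<forall>x\<in>S. \<bar>l x\<bar> \<le> p x) \<and> (\<forall>c\<in>C. d \<le> l c)"
proof -
  have S: "subspace S" using seminorm_onD(1)[OF p] .
  obtain g :: "'a \<Rightarrow> 'a" where g: "linear g" "range g \<subseteq> S" "\<And>x. x \<in> S \<Longrightarrow> g x = x"
    using linear_exists_left_inverse_on[OF linear_id S] by auto
  have gS: "g x \<in> S" for x using g(2) by auto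
  have "sublinear (\<lambda>x. p (g x))"
    unfolding sublinear_def using seminorm_onD(2,3)[OF p] gS
    by (auto simp: linear_add[OF g(1)] linear_scale[OF g(1)])
  then obtain l where l: "linear l" "\<And>x. l x \<le> p (g x)" "\<And>c. c \<in> C \<Longrightarrow> d \<le> l c"
    using mazur_orlicz[of "\<lambda>x. p (g x)" C d] C g(3) by (metis subset_eq)
  have "\<bar>l x\<bar> \<le> p x" if x: "x \<in> S" for x
    using l(2)[of x] l(2)[of "-x"] g(3)[OF x] g(3)[OF subspace_neg[OF S x]] linear_neg[OF l(1), of x]
      seminorm_onD(4)[OF p x] by simp
  then show ?thesis using l by blast
qed

lemma hahn_banach_norming:
  assumes p: "seminorm_on S p" and x: "x \<in> S"
  shows "\<exists>l. linear l \<and> (\<forall>y\<in>S. \<bar>l y\<bar> \<le> p y) \<and> l x = p x"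
proof -
  obtain l where "linear l" "\<forall>y\<in>S. \<bar>l y\<bar> \<le> p y" "p x \<le> l x"
    using mazur_orlicz_seminorm[OF p, of "{x}" "p x"] x by auto
  then show ?thesis using x by (intro exI[of _ l]) force
qed

section \<open>Relative weak compactness and convex blocks\<close>

definition bounded_on :: "'v::real_vector set \<Rightarrow> ('v \<Rightarrow> real) \<Rightarrow> ('v \<Rightarrow> real) \<Rightarrow> real \<Rightarrow> bool" where
  "bounded_on S p \<phi> c \<longleftrightarrow> (\<forall>x\<in>S. \<bar>\<phi> x\<bar> \<le> c * p x)"

text \<open>Functionals are total functions constrained on \<open>S\<close> only and arbitrary
  elsewhere, so that for \<open>H1\<close> this is literally the set \<open>H1_dual\<close>.\<close>

definition dual_on :: "'v::real_vector set \<Rightarrow> ('v \<Rightarrow> real) \<Rightarrow> ('v \<Rightarrow> real) set" where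
  "dual_on S p = {\<phi>. (\<forall>x\<in>S. \<forall>y\<in>S. \<phi> (x + y) = \<phi> x + \<phi> y) \<and> (\<forall>c. \<forall>x\<in>S. \<phi> (c *\<^sub>R x) = c * \<phi> x) \<and>
     (\<exists>C. bounded_on S p \<phi> C)}"

lemma linear_in_dual_on:
  assumes "linear l" "bounded_on S p l c"
  shows "l \<in> dual_on S p"
  using assms by (auto simp: dual_on_def linear_add linear_scale)

context
  fixes S :: "'v::real_vector set" and p :: "'v \<Rightarrow> real"
  assumes p: "seminorm_on S p"
begin

lemma dual_onD:
  assumes "\<phi> \<in> dual_on S p"
  shows "x \<in> S \<Longrightarrow> y \<in> S \<Longrightarrow> \<phi> (x + y) = \<phi> x + \<phi> y" "x \<in> S \<Longrightarrow> \<phi> (c *\<^sub>R x) = c * \<phi> x"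
    "x \<in> S \<Longrightarrow> y \<in> S \<Longrightarrow> \<phi> (x - y) = \<phi> x - \<phi> y"
    "\<exists>C\<ge>0. bounded_on S p \<phi> C"
proof -
  show 1: "x \<in> S \<Longrightarrow> y \<in> S \<Longrightarrow> \<phi> (x + y) = \<phi> x + \<phi> y"
    and 2: "x \<in> S \<Longrightarrow> \<phi> (c *\<^sub>R x) = c * \<phi> x" for x y c
    using assms by (auto simp: dual_on_def)
  show "\<phi> (x - y) = \<phi> x - \<phi> y" if "x \<in> S" "y \<in> S" for x y
    using 1[OF that(1), of "(-1) *\<^sub>R y"] 2[OF that(2), of "-1"] subspace_neg[OF seminorm_onD(1)[OF p] that(2)] by simp
  obtain C where "bounded_on S p \<phi> C" using assms by (auto simp: dual_on_def)
  then have "bounded_on S p \<phi> \<bar>C\<bar>"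
    unfolding bounded_on_def using seminorm_onD(5)[OF p] by (meson abs_ge_self mult_right_mono order_trans)
  then show "\<exists>C\<ge>0. bounded_on S p \<phi> C" by (intro exI[of _ "\<bar>C\<bar>"]) auto
qed

lemma dual_on_add: "f \<in> dual_on S p \<Longrightarrow> g \<in> dual_on S p \<Longrightarrow> (\<lambda>x. f x + g x) \<in> dual_on S p"
  and bounded_on_add: "bounded_on S p f c \<Longrightarrow> bounded_on S p g d \<Longrightarrow> bounded_on S p (\<lambda>x. f x + g x) (c + d)"
proof -
  show b: "bounded_on S p (\<lambda>x. f x + g x) (c + d)" if "bounded_on S p f c" "bounded_on S p g d" for f g c d
  proof -
    have "\<bar>f x + g x\<bar> \<le> (c + d) * p x" if "x \<in> S" for x
      using \<open>bounded_on S p f c\<close> \<open>bounded_on S p g d\<close> that abs_triangle_ineq[of "f x" "g x"]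
      unfolding bounded_on_def by (force simp: algebra_simps)
    then show ?thesis by (simp add: bounded_on_def)
  qed
  show "f \<in> dual_on S p \<Longrightarrow> g \<in> dual_on S p \<Longrightarrow> (\<lambda>x. f x + g x) \<in> dual_on S p"
    unfolding dual_on_def using b[of f _ g] by (auto simp: algebra_simps)
qed

lemma dual_on_scale: "f \<in> dual_on S p \<Longrightarrow> (\<lambda>x. a * f x) \<in> dual_on S p"
  and bounded_on_scale: "bounded_on S p f c \<Longrightarrow> bounded_on S p (\<lambda>x. a * f x) (\<bar>a\<bar> * c)"
proof -
  show b: "bounded_on S p (\<lambda>x. a * f x) (\<bar>a\<bar> * c)" if "bounded_on S p f c" for f a c
    using that by (auto simp: bounded_on_def abs_mult mult.assoc mult_left_mono)
  show "f \<in> dual_on S p \<Longrightarrow> (\<lambda>x. a * f x) \<in> dual_on S p"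
    unfolding dual_on_def using b[of f _ a] by (auto simp: algebra_simps)
qed

lemma bounded_on_1_diff:
  assumes "bounded_on S p f 1" "f \<in> dual_on S p" "x \<in> S" "y \<in> S"
  shows "\<bar>f x - f y\<bar> \<le> p (x - y)"
  using assms dual_onD(3)[OF assms(2-4)] subspace_diff[OF seminorm_onD(1)[OF p] assms(3,4)]
  unfolding bounded_on_def by force

section \<open>The algebraic bidual and its distance from the space\<close>

definition linear_functional_on_dual :: "(('v \<Rightarrow> real) \<Rightarrow> real) \<Rightarrow> bool" where
  "linear_functional_on_dual z \<longleftrightarrow>
     (\<forall>f\<in>dual_on S p. \<forall>g\<in>dual_on S p. z (\<lambda>x. f x + g x) = z f + z g) \<and>
     (\<forall>f\<in>dual_on S p. \<forall>a. z (\<lambda>x. a * f x) = a * z f)"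

text \<open>One step of Helly's theorem: if \<open>z\<close> is at most \<open>\<theta>\<close> on
  the part of the unit ball of \<open>W\<close> that vanishes at \<open>x\<close>, then a multiple
  of evaluation at \<open>x\<close> can be subtracted so that the bound holds on all of
  \<open>W\<close>. The multiple is found as in the one-dimensional Hahn-Banach extension, between
  lower bounds from \<open>f x > 0\<close> and upper bounds from \<open>g x < 0\<close>.\<close>

lemma annihilator_step:
  assumes z: "linear_functional_on_dual z" and x: "x \<in> S"
    and W: "W \<subseteq> dual_on S p" "\<And>f g. f \<in> W \<Longrightarrow> g \<in> W \<Longrightarrow> (\<lambda>x. f x + g x) \<in> W" "\<And>f a. f \<in> W \<Longrightarrow> (\<lambda>x. a * f x) \<in> W"
    and ann: "\<And>f c. f \<in> W \<Longrightarrow> f x = 0 \<Longrightarrow> c \<ge> 0 \<Longrightarrow> bounded_on S p f c \<Longrightarrow> z f \<le> \<theta> * c"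
  shows "\<exists>a. \<forall>f\<in>W. \<forall>c\<ge>0. bounded_on S p f c \<longrightarrow> z f - a * f x \<le> \<theta> * c"
proof (cases "\<forall>f\<in>W. f x = 0")
  case True
  then show ?thesis using ann by (intro exI[of _ 0]) auto
next
  case False
  then obtain f0 where f0: "f0 \<in> W" "f0 x > 0"
    using W(3)[of _ "-1"] by (metis linorder_neqE_linordered_idom mult_minus1 neg_0_less_iff_less)
  obtain c0 where c0: "c0 \<ge> 0" "bounded_on S p f0 c0" using dual_onD(4) f0 W(1) by blast
  define g0 where "g0 = (\<lambda>x. (-1) * f0 x)"
  have g0: "g0 \<in> W" "g0 x < 0" "bounded_on S p g0 c0"
    using W(3)[OF f0(1), of "-1"] f0(2) bounded_on_scale[OF c0(2), of "-1"] by (auto simp: g0_def)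
  let ?L = "{(z f - \<theta> * c) / f x | f c. f \<in> W \<and> f x > 0 \<and> c \<ge> 0 \<and> bounded_on S p f c}"
  have le: "(z f - \<theta> * c) / f x \<le> (\<theta> * d - z g) / (- g x)"
    if f: "f \<in> W" "f x > 0" "c \<ge> 0" "bounded_on S p f c"
    and g: "g \<in> W" "g x < 0" "d \<ge> 0" "bounded_on S p g d" for f c g d
  proof -
    \<comment> \<open>This combination has nonnegative bound constants and vanishes at
      \<open>x\<close>; the hypothesis applied to it says exactly that the lower bound from
      \<open>f\<close> is at most the upper bound from \<open>g\<close>.\<close>
    let ?h = "\<lambda>y. (- g x) * f y + f x * g y"
    have "z ?h \<le> \<theta> * (\<bar>- g x\<bar> * c + \<bar>f x\<bar> * d)"
      using f g by (intro ann W bounded_on_add bounded_on_scale add_nonneg_nonneg mult_nonneg_nonneg abs_ge_zero) auto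
    moreover have "z ?h = (- g x) * z f + f x * z g"
    proof -
      have "(\<lambda>y. (- g x) * f y) \<in> dual_on S p" "(\<lambda>y. f x * g y) \<in> dual_on S p"
        using W(1) f(1) g(1) by (intro dual_on_scale; auto)+
      then show ?thesis using z W(1) f(1) g(1) unfolding linear_functional_on_dual_def by (metis subsetD)
    qed
    ultimately show ?thesis using f g by (simp add: field_simps)
  qed
  have bdd: "bdd_above ?L" by (rule bdd_aboveI[of _ "(\<theta> * c0 - z g0) / (- g0 x)"]) (use le g0 c0 in auto)
  have ne: "?L \<noteq> {}" using f0 c0 by auto
  define a where "a = Sup ?L"
  have "z f - a * f x \<le> \<theta> * c" if f: "f \<in> W" "c \<ge> 0" "bounded_on S p f c" for f c
  proof (cases "f x" "0::real" rule: linorder_cases)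
    case less
    have "a \<le> (\<theta> * c - z f) / (- f x)" unfolding a_def using ne le less f by (intro cSup_least) auto
    then show ?thesis using less by (simp add: field_simps)
  next
    case equal
    then show ?thesis using ann f by simp
  next
    case greater
    have "(z f - \<theta> * c) / f x \<le> a" unfolding a_def using f greater by (intro cSup_upper bdd) blast
    then show ?thesis using greater by (simp add: field_simps)
  qed
  then show ?thesis by blast
qed

text \<open>Smallness of \<open>z\<close> on the functionals that vanish at finitely many points
  means that \<open>z\<close> is within \<open>\<theta>\<close> of a vector. The induction removes
  one point at a time, which changes \<open>z\<close> into \<open>z\<close> minus a multiple of an
  evaluation; these multiples add up to \<open>y\<close>.\<close>

lemma annihilator_approx:
  assumes "linear_functional_on_dual z" "set xs \<subseteq> S"
    and "\<And>f c. f \<in> dual_on S p \<Longrightarrow> \<forall>x\<in>set xs. f x = 0 \<Longrightarrow> c \<ge> 0 \<Longrightarrow> bounded_on S p f c \<Longrightarrow> z f \<le> \<theta> * c"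
  shows "\<exists>y\<in>S. \<forall>f\<in>dual_on S p. \<forall>c\<ge>0. bounded_on S p f c \<longrightarrow> z f - f y \<le> \<theta> * c"
  using assms
proof (induction xs arbitrary: z)
  case Nil
  have "0 \<in> S" by (rule subspace_0[OF seminorm_onD(1)[OF p]])
  have f0: "f 0 = 0" if "f \<in> dual_on S p" for f using dual_onD(2)[OF that \<open>0 \<in> S\<close>, of 0] by simp
  have "z f - f 0 \<le> \<theta> * c" if "f \<in> dual_on S p" "c \<ge> 0" "bounded_on S p f c" for f c
    using Nil(3)[OF that(1) _ that(2,3)] f0[OF that(1)] by simp
  then show ?case using \<open>0 \<in> S\<close> by blast
next
  case (Cons x xs)
  let ?W = "{f \<in> dual_on S p. \<forall>x\<in>set xs. f x = 0}"
  have "\<exists>a. \<forall>f\<in>?W. \<forall>c\<ge>0. bounded_on S p f c \<longrightarrow> z f - a * f x \<le> \<theta> * c"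
    using Cons.prems dual_on_add dual_on_scale by (intro annihilator_step) auto
  then obtain a where a: "\<And>f c. f \<in> ?W \<Longrightarrow> c \<ge> 0 \<Longrightarrow> bounded_on S p f c \<Longrightarrow> z f - a * f x \<le> \<theta> * c" by blast
  have "\<exists>y\<in>S. \<forall>f\<in>dual_on S p. \<forall>c\<ge>0. bounded_on S p f c \<longrightarrow> (z f - a * f x) - f y \<le> \<theta> * c"
  proof (rule Cons.IH)
    show "linear_functional_on_dual (\<lambda>f. z f - a * f x)"
      using Cons.prems(1) by (auto simp: linear_functional_on_dual_def algebra_simps)
  qed (use Cons.prems a in auto)
  then obtain y where y: "y \<in> S" "\<And>f c. f \<in> dual_on S p \<Longrightarrow> c \<ge> 0 \<Longrightarrow> bounded_on S p f c \<Longrightarrow> (z f - a * f x) - f y \<le> \<theta> * c"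
    by blast
  have x: "x \<in> S" "a *\<^sub>R x \<in> S" using Cons.prems subspace_scale[OF seminorm_onD(1)[OF p]] by auto
  have "f (y + a *\<^sub>R x) = f y + a * f x" if "f \<in> dual_on S p" for f
    using dual_onD(1)[OF that y(1) x(2)] dual_onD(2)[OF that x(1)] by simp
  then show ?case using y x subspace_add[OF seminorm_onD(1)[OF p]]
    by (intro bexI[of _ "y + a *\<^sub>R x"]) (auto simp: algebra_simps)
qed

text \<open>
  If \<^term>\<open>z\<close> had distance more than \<open>\<theta>\<close> from \<^term>\<open>S\<close>, one could choose alternately functionals
  vanishing on all points chosen before, with \<^term>\<open>z\<close> of them larger than \<open>\<theta>\<close>, and points of
  \<^term>\<open>K\<close> on which these functionals are close to \<^term>\<open>z\<close>; the resulting sequence of points has no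
  norm convergent convex blocks.
\<close>

lemma bidual_approx_by_blocks:
  assumes K: "K \<subseteq> S"
    and blocks: "\<And>X. range X \<subseteq> K \<Longrightarrow> \<exists>Y. \<exists>y\<in>S. (\<forall>i. Y i \<in> convex hull (X ` {i..})) \<and> (\<lambda>i::nat. p (Y i - y)) \<longlonglongrightarrow> 0"
    and z: "linear_functional_on_dual z"
    and approx: "\<And>A e. finite A \<Longrightarrow> A \<subseteq> dual_on S p \<Longrightarrow> e > 0 \<Longrightarrow> \<exists>x\<in>K. \<forall>\<phi>\<in>A. \<bar>\<phi> x - z \<phi>\<bar> < e"
    and \<theta>: "\<theta> > 0"
  shows "\<exists>y\<in>S. \<forall>f\<in>dual_on S p. \<forall>c\<ge>0. bounded_on S p f c \<longrightarrow> z f - f y \<le> \<theta> * c"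
proof (rule ccontr)
  assume neg: "\<not> ?thesis"
  have S: "subspace S" by (rule seminorm_onD(1)[OF p])
  have ex_f: "\<exists>f. f \<in> dual_on S p \<and> bounded_on S p f 1 \<and> (\<forall>x\<in>set xs. f x = 0) \<and> z f > \<theta>" if xs: "set xs \<subseteq> S" for xs
  proof -
    have "\<exists>f c. f \<in> dual_on S p \<and> (\<forall>x\<in>set xs. f x = 0) \<and> c \<ge> 0 \<and> bounded_on S p f c \<and> \<not> z f \<le> \<theta> * c"
      using annihilator_approx[OF z xs, of \<theta>] neg by blast
    then obtain f c where f: "f \<in> dual_on S p" "\<forall>x\<in>set xs. f x = 0" "c \<ge> 0" "bounded_on S p f c" "z f > \<theta> * c"
      by (auto simp: not_le)
    \<comment> \<open>With bound 0 the functional would vanish on \<open>S\<close>, while a point of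
      \<open>K\<close> brings its value close to \<open>z f > 0\<close>. So it can be rescaled to
      bound 1.\<close>
    have "c \<noteq> 0"
    proof
      assume "c = 0"
      then have "z f > 0" using f by simp
      then obtain x where "x \<in> K" "\<bar>f x - z f\<bar> < z f" using approx[of "{f}" "z f"] f by auto
      moreover have "f x = 0" if "x \<in> S" for x using f(4) \<open>c = 0\<close> that by (auto simp: bounded_on_def)
      ultimately show False using K by auto
    qed
    then have c: "c > 0" using f by simp
    have "z (\<lambda>x. inverse c * f x) = inverse c * z f" using z f unfolding linear_functional_on_dual_def by blast
    moreover have "inverse c * z f > \<theta>" using f(5) c by (simp add: field_simps)
    moreover have "bounded_on S p (\<lambda>x. inverse c * f x) 1" using bounded_on_scale[OF f(4), of "inverse c"] c by simp
    ultimately show ?thesis using f c dual_on_scale[OF f(1), of "inverse c"]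
      by (intro exI[of _ "\<lambda>x. inverse c * f x"] conjI) auto
  qed
  \<comment> \<open>The pair at stage \<open>n\<close>: a functional of bound 1 that kills all
    earlier points, and a point at which this and all earlier functionals are within 1/(n+1) of
    their value under \<open>z\<close>. The array of values is thus about \<open>\<theta>\<close> or
    more on one side of the diagonal and 0 on the other.\<close>
  define Q where "Q h n r \<longleftrightarrow> fst r \<in> dual_on S p \<and> bounded_on S p (fst r) 1 \<and> snd r \<in> K \<and> z (fst r) > \<theta> \<and>
      (\<forall>m<n. fst r (snd (h m)) = 0) \<and> (\<forall>m<n. \<bar>fst (h m) (snd r) - z (fst (h m))\<bar> < 1 / Suc n) \<and>
      \<bar>fst r (snd r) - z (fst r)\<bar> < 1 / Suc n" for h :: "nat \<Rightarrow> ('v \<Rightarrow> real) \<times> 'v" and n r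
  have "\<exists>h. \<forall>n. Q h n (h n)"
  proof (rule dependent_wellorder_choice)
    fix r and f g :: "nat \<Rightarrow> ('v \<Rightarrow> real) \<times> 'v" and n :: nat
    assume "\<And>m. m < n \<Longrightarrow> f m = g m"
    then show "Q f n r = Q g n r" by (auto simp: Q_def)
  next
    fix n :: nat and h :: "nat \<Rightarrow> ('v \<Rightarrow> real) \<times> 'v"
    assume h: "\<And>m. m < n \<Longrightarrow> Q h m (h m)"
    have "set (map (\<lambda>m. snd (h m)) [0..<n]) \<subseteq> S" using h K by (auto simp: Q_def)
    from ex_f[OF this] obtain f where
      f: "f \<in> dual_on S p" "bounded_on S p f 1" "\<forall>m<n. f (snd (h m)) = 0" "z f > \<theta>" by auto
    have "\<exists>x\<in>K. \<forall>\<phi>\<in>insert f ((\<lambda>m. fst (h m)) ` {..<n}). \<bar>\<phi> x - z \<phi>\<bar> < 1 / Suc n"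
      using h f by (intro approx) (auto simp: Q_def)
    then obtain x where "x \<in> K" "\<forall>\<phi>\<in>insert f ((\<lambda>m. fst (h m)) ` {..<n}). \<bar>\<phi> x - z \<phi>\<bar> < 1 / Suc n" by blast
    then have "Q h n (f, x)" using f by (auto simp: Q_def)
    then show "\<exists>r. Q h n r" by blast
  qed
  then obtain h where h: "\<And>n. Q h n (h n)" by blast
  define f where "f n = fst (h n)" for n
  define X where "X n = snd (h n)" for n
  have f: "f n \<in> dual_on S p" "bounded_on S p (f n) 1" "z (f n) > \<theta>" and X: "X n \<in> K" "X n \<in> S"
    and fX0: "m < n \<Longrightarrow> f n (X m) = 0" for n m
    using h[of n] K by (auto simp: Q_def f_def X_def)
  have fX: "\<bar>f m (X n) - z (f m)\<bar> < 1 / Suc n" if "m \<le> n" for m n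
    using h[of n] that by (cases "m = n") (auto simp: Q_def f_def X_def)
  obtain Y y where Y: "y \<in> S" "\<And>i. Y i \<in> convex hull (X ` {i..})" "(\<lambda>i. p (Y i - y)) \<longlonglongrightarrow> 0"
    using blocks[of X] X by blast
  have convS: "convex S" by (rule subspace_imp_convex[OF S])
  have YS: "Y i \<in> S" for i using hull_minimal[of "X ` {i..}" S convex] X convS Y(2)[of i] by auto
  have fY: "\<theta> - 1 / Suc i \<le> f m (Y i)" if "m \<le> i" for m i
  proof -
    have "convex hull (X ` {i..}) \<subseteq> {v\<in>S. \<theta> - 1 / Suc i \<le> f m v}"
    proof (rule hull_minimal)
      have "\<theta> - 1 / Suc i \<le> f m (X n)" if "n \<ge> i" for n
      proof -
        have "1 / real (Suc n) \<le> 1 / Suc i" using that by (simp add: frac_le)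
        then show ?thesis using fX[of m n] f(3)[of m] \<open>m \<le> i\<close> that by linarith
      qed
      then show "X ` {i..} \<subseteq> {v\<in>S. \<theta> - 1 / Suc i \<le> f m v}" using X by auto
      show "convex {v\<in>S. \<theta> - 1 / Suc i \<le> f m v}"
      proof (rule convexI)
        fix a b u v assume ab: "a \<in> {v\<in>S. \<theta> - 1 / Suc i \<le> f m v}" "b \<in> {v\<in>S. \<theta> - 1 / Suc i \<le> f m v}"
          and uv: "0 \<le> u" "0 \<le> v" "u + v = (1::real)"
        have "f m (u *\<^sub>R a + v *\<^sub>R b) = u * f m a + v * f m b"
          using ab dual_onD(1)[OF f(1)] dual_onD(2)[OF f(1)] subspace_scale[OF S] by simp
        moreover have "u * (\<theta> - 1 / Suc i) + v * (\<theta> - 1 / Suc i) \<le> u * f m a + v * f m b"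
          using ab uv by (intro add_mono mult_left_mono) auto
        moreover have "u * (\<theta> - 1 / Suc i) + v * (\<theta> - 1 / Suc i) = \<theta> - 1 / Suc i"
          using uv by (metis distrib_right mult_1)
        ultimately show "u *\<^sub>R a + v *\<^sub>R b \<in> {v\<in>S. \<theta> - 1 / Suc i \<le> f m v}"
          using ab convexD[OF convS _ _ uv] by auto
      qed
    qed
    then show ?thesis using Y(2)[of i] by auto
  qed
  \<comment> \<open>For fixed \<open>m\<close> all late points have value nearly
    \<open>\<theta>\<close> or more under \<open>f m\<close>; this inequality passes to convex
    combinations and to their limit.\<close>
  have fy: "\<theta> \<le> f m y" for m
  proof (rule LIMSEQ_le)
    have "(\<lambda>i. \<theta> - 1 / Suc i) \<longlonglongrightarrow> \<theta> - 0"
      using LIMSEQ_inverse_real_of_nat by (intro tendsto_diff) (auto simp: inverse_eq_divide)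
    then show "(\<lambda>i. \<theta> - 1 / Suc i - p (Y i - y)) \<longlonglongrightarrow> \<theta>" using tendsto_diff[OF _ Y(3)] by fastforce
    show "\<exists>N. \<forall>i\<ge>N. \<theta> - 1 / Suc i - p (Y i - y) \<le> f m y"
    proof (intro exI[of _ m] allI impI)
      fix i assume "m \<le> i"
      then show "\<theta> - 1 / Suc i - p (Y i - y) \<le> f m y"
        using fY[of m i] bounded_on_1_diff[OF f(2,1) YS[of i] Y(1), of m] by linarith
    qed
  qed simp
  \<comment> \<open>A single block closer than \<open>\<theta>\<close> to the limit suffices: being
    a finite combination of the points, it is killed by all late functionals, which contradicts
    their value at \<open>y\<close>.\<close>
  obtain i where i: "p (Y i - y) < \<theta>"
    using order_tendstoD(2)[OF Y(3) \<theta>] by (auto simp: eventually_sequentially)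
  have "convex hull (X ` {i..}) \<subseteq> {v\<in>S. \<exists>N. \<forall>m\<ge>N. f m v = 0}"
  proof (rule hull_minimal)
    have "\<forall>m\<ge>Suc n. f m (X n) = 0" for n using fX0 by (auto simp: Suc_le_eq)
    then show "X ` {i..} \<subseteq> {v\<in>S. \<exists>N. \<forall>m\<ge>N. f m v = 0}" using X by blast
    show "convex {v\<in>S. \<exists>N. \<forall>m\<ge>N. f m v = 0}"
    proof (rule convexI)
      fix a b and u v :: real assume ab: "a \<in> {v\<in>S. \<exists>N. \<forall>m\<ge>N. f m v = 0}" "b \<in> {v\<in>S. \<exists>N. \<forall>m\<ge>N. f m v = 0}"
        and uv: "0 \<le> u" "0 \<le> v" "u + v = 1"
      then obtain N N' where N: "\<forall>m\<ge>N. f m a = 0" "\<forall>m\<ge>N'. f m b = 0" by auto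
      have "f m (u *\<^sub>R a + v *\<^sub>R b) = u * f m a + v * f m b" for m
        using ab dual_onD(1)[OF f(1)] dual_onD(2)[OF f(1)] subspace_scale[OF S] by simp
      then have "\<forall>m\<ge>max N N'. f m (u *\<^sub>R a + v *\<^sub>R b) = 0" using N by simp
      then show "u *\<^sub>R a + v *\<^sub>R b \<in> {v\<in>S. \<exists>N. \<forall>m\<ge>N. f m v = 0}"
        using ab convexD[OF convS _ _ uv] by blast
    qed
  qed
  then obtain N where "f N (Y i) = 0" using Y(2)[of i] by blast
  then show False using fy[of N] i bounded_on_1_diff[OF f(2,1) YS[of i] Y(1), of N] by linarith
qed

text \<open>Applied with \<open>\<theta>\<close> tending to 0, the block argument gives vectors of
  \<open>S\<close> converging to \<open>z\<close> in the dual norm. They are Cauchy by norming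
  functionals, and completeness supplies the vector that represents \<open>z\<close>.\<close>

lemma bidual_representation:
  assumes complete: "\<And>X. (\<And>n. X n \<in> S) \<Longrightarrow> (\<And>n::nat. p (X (Suc n) - X n) \<le> (1/2) ^ n) \<Longrightarrow> \<exists>x\<in>S. (\<lambda>n. p (X n - x)) \<longlonglongrightarrow> 0"
    and K: "K \<subseteq> S"
    and blocks: "\<And>X. range X \<subseteq> K \<Longrightarrow> \<exists>Y. \<exists>y\<in>S. (\<forall>i. Y i \<in> convex hull (X ` {i..})) \<and> (\<lambda>i::nat. p (Y i - y)) \<longlonglongrightarrow> 0"
    and approx: "\<And>A e. finite A \<Longrightarrow> A \<subseteq> dual_on S p \<Longrightarrow> e > 0 \<Longrightarrow> \<exists>x\<in>K. \<forall>\<phi>\<in>A. \<bar>\<phi> x - z \<phi>\<bar> < e"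
  shows "\<exists>x\<in>S. \<forall>\<phi>\<in>dual_on S p. z \<phi> = \<phi> x"
proof -
  have S: "subspace S" by (rule seminorm_onD(1)[OF p])
  have z: "linear_functional_on_dual z"
    unfolding linear_functional_on_dual_def
  proof (intro conjI ballI allI)
    fix f g assume fg: "f \<in> dual_on S p" "g \<in> dual_on S p"
    \<comment> \<open>The three functionals are approximated at one common point of
      \<open>K\<close>, where the identity is exact.\<close>
    show "z (\<lambda>x. f x + g x) = z f + z g"
    proof (rule ccontr)
      let ?e = "\<bar>z (\<lambda>x. f x + g x) - (z f + z g)\<bar>"
      assume "z (\<lambda>x. f x + g x) \<noteq> z f + z g"
      then have "?e / 3 > 0" by simp
      from approx[of "{f, g, \<lambda>x. f x + g x}", OF _ _ this] fg dual_on_add[OF fg] obtain x where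
        "\<bar>f x - z f\<bar> < ?e/3" "\<bar>g x - z g\<bar> < ?e/3" "\<bar>f x + g x - z (\<lambda>x. f x + g x)\<bar> < ?e/3" by auto
      then show False by (simp add: abs_if split: if_splits)
    qed
  next
    fix f a assume f: "f \<in> dual_on S p"
    show "z (\<lambda>x. a * f x) = a * z f"
    proof (rule ccontr)
      let ?e = "\<bar>z (\<lambda>x. a * f x) - a * z f\<bar> / (2 * (1 + \<bar>a\<bar>))"
      assume "z (\<lambda>x. a * f x) \<noteq> a * z f"
      then have e: "?e > 0" by simp
      from approx[of "{f, \<lambda>x. a * f x}", OF _ _ this] f dual_on_scale[OF f] obtain x where
        x: "\<bar>f x - z f\<bar> < ?e" "\<bar>a * f x - z (\<lambda>x. a * f x)\<bar> < ?e" by auto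
      have "\<bar>a * f x - a * z f\<bar> \<le> \<bar>a\<bar> * ?e"
        using x(1) by (simp add: right_diff_distrib[symmetric] abs_mult mult_left_mono less_imp_le del: times_divide_eq_right)
      then have "\<bar>z (\<lambda>x. a * f x) - a * z f\<bar> < (1 + \<bar>a\<bar>) * ?e"
        using x(2) by (simp add: distrib_right del: times_divide_eq_right) linarith
      also have "(1 + \<bar>a\<bar>) * ?e = \<bar>z (\<lambda>x. a * f x) - a * z f\<bar> / 2" by (simp add: field_simps)
      finally show False using e by (simp add: field_simps)
    qed
  qed
  \<comment> \<open>The error is half of (1/2)^n so that consecutive approximants differ by at most
    (1/2)^n, the rate demanded by \<open>complete\<close>.\<close>
  have "\<exists>y\<in>S. \<forall>f\<in>dual_on S p. \<forall>c\<ge>0. bounded_on S p f c \<longrightarrow> z f - f y \<le> ((1/2)^n / 2) * c" for n :: nat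
    by (rule bidual_approx_by_blocks[OF K blocks z approx]) auto
  then have "\<forall>n. \<exists>y. y \<in> S \<and> (\<forall>f\<in>dual_on S p. \<forall>c\<ge>0. bounded_on S p f c \<longrightarrow> z f - f y \<le> ((1/2)^n / 2) * c)"
    by blast
  from choice[OF this] have "\<exists>y. \<forall>n. y n \<in> S \<and> (\<forall>f\<in>dual_on S p. \<forall>c\<ge>0. bounded_on S p f c \<longrightarrow> z f - f (y n) \<le> ((1/2)^n / 2) * c)" .
  then obtain y where yS: "\<And>n. y n \<in> S"
    and y: "\<And>n f c. f \<in> dual_on S p \<Longrightarrow> c \<ge> 0 \<Longrightarrow> bounded_on S p f c \<Longrightarrow> z f - f (y n) \<le> ((1/2)^n / 2) * c"
    by blast
  \<comment> \<open>The one-sided bound for \<open>f\<close> and for its negative is a two-sided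
    one.\<close>
  have y': "\<bar>z f - f (y n)\<bar> \<le> ((1/2)^n / 2) * c" if f: "f \<in> dual_on S p" "c \<ge> 0" "bounded_on S p f c" for f n c
  proof -
    have "z (\<lambda>x. (-1) * f x) = (-1) * z f" using z f unfolding linear_functional_on_dual_def by blast
    then have "- (z f - f (y n)) \<le> ((1/2)^n / 2) * c"
      using y[OF dual_on_scale[OF f(1), of "-1"] f(2), of n] bounded_on_scale[OF f(3), of "-1"] by simp
    with y[OF f, of n] show ?thesis by linarith
  qed
  have "p (y (Suc n) - y n) \<le> (1/2) ^ n" for n
  proof -
    obtain l where l: "linear l" "\<forall>x\<in>S. \<bar>l x\<bar> \<le> p x" "l (y (Suc n) - y n) = p (y (Suc n) - y n)"
      using hahn_banach_norming[OF p subspace_diff[OF S yS yS]] by blast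
    then have b: "bounded_on S p l 1" by (simp add: bounded_on_def)
    have e: "\<bar>z l - l (y n)\<bar> \<le> (1/2)^n / 2" "\<bar>z l - l (y (Suc n))\<bar> \<le> (1/2)^(Suc n) / 2"
      using y'[OF linear_in_dual_on[OF l(1) b] _ b, of n] y'[OF linear_in_dual_on[OF l(1) b] _ b, of "Suc n"] by simp_all
    have "l (y (Suc n) - y n) = (z l - l (y n)) - (z l - l (y (Suc n)))"
      by (simp add: linear_diff[OF l(1)])
    also have "\<dots> \<le> (1/2)^n / 2 + (1/2)^(Suc n) / 2"
      using abs_le_D1[OF e(1)] abs_le_D2[OF e(2)] by linarith
    also have "\<dots> \<le> (1/2)^n" by simp
    finally show ?thesis using l by simp
  qed
  then obtain x where x: "x \<in> S" "(\<lambda>n. p (y n - x)) \<longlonglongrightarrow> 0" using complete[of y, OF yS] by blast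
  have "z f = f x" if f: "f \<in> dual_on S p" for f
  proof -
    obtain c where c: "c \<ge> 0" "bounded_on S p f c" using dual_onD(4)[OF f] by blast
    have "(\<lambda>n. f (y n)) \<longlonglongrightarrow> z f"
    proof (rule Lim_transform_bound[of _ _ sequentially, THEN LIM_zero_cancel])
      show "\<forall>\<^sub>F n in sequentially. norm (f (y n) - z f) \<le> norm (((1/2)^n / 2) * c)"
        using y'[OF f c] c by (intro always_eventually allI) (simp add: abs_minus_commute)
      show "(\<lambda>n. ((1/2)^n / 2) * c) \<longlonglongrightarrow> 0"
        by (intro tendsto_mult_left_zero tendsto_divide_zero LIMSEQ_realpow_zero) auto
    qed
    moreover have "(\<lambda>n. f (y n)) \<longlonglongrightarrow> f x"
    proof (rule Lim_transform_bound[of _ _ sequentially, THEN LIM_zero_cancel])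
      show "\<forall>\<^sub>F n in sequentially. norm (f (y n) - f x) \<le> norm (c * p (y n - x))"
        using c dual_onD(3)[OF f yS x(1)] subspace_diff[OF S yS x(1)] seminorm_onD(5)[OF p]
        unfolding bounded_on_def by (intro always_eventually allI) (force simp: abs_mult)
      show "(\<lambda>n. c * p (y n - x)) \<longlonglongrightarrow> 0" using x(2) by (rule tendsto_mult_right_zero)
    qed
    ultimately show ?thesis by (rule LIMSEQ_unique)
  qed
  then show ?thesis using x by blast
qed

end

section \<open>Compactness and cluster points in weak topologies\<close>

lemma topspace_weak_topology_on [simp]: "topspace (weak_topology_on S \<Phi>) = S"
  unfolding weak_topology_on_def by (auto simp: topology_generated_by_topspace)

lemma openin_weak_topology_on:
  assumes "\<phi> \<in> \<Phi>" "open U"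
  shows "openin (weak_topology_on S \<Phi>) {x \<in> S. \<phi> x \<in> U}"
  unfolding weak_topology_on_def using assms by (intro topology_generated_by_Basis) auto

text \<open>The weak topology is the initial topology of the evaluation map into the product of
  copies of the real line. Preimages commute with unions and intersections, so the representation
  survives every rule that generates open sets.\<close>

lemma openin_weak_topology_on_pullback:
  assumes "openin (weak_topology_on S \<Phi>) U"
  shows "\<exists>V. openin (product_topology (\<lambda>_. euclideanreal) \<Phi>) V \<and> U = {x \<in> S. restrict (\<lambda>\<phi>. \<phi> x) \<Phi> \<in> V}"
proof -
  let ?T = "product_topology (\<lambda>_. euclideanreal) \<Phi>" and ?J = "\<lambda>x. restrict (\<lambda>\<phi>. \<phi> x) \<Phi>"
  have "generate_topology_on (insert S {{x \<in> S. \<phi> x \<in> U} |\<phi> U. \<phi> \<in> \<Phi> \<and> open U}) U"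
    using assms by (simp add: weak_topology_on_def openin_topology_generated_by_iff)
  then show ?thesis
  proof (induction rule: generate_topology_on.induct)
    case Empty
    then show ?case by (intro exI[of _ "{}"]) auto
  next
    case (Int a b)
    then obtain V W where "openin ?T V" "a = {x \<in> S. ?J x \<in> V}" "openin ?T W" "b = {x \<in> S. ?J x \<in> W}" by blast
    then show ?case by (intro exI[of _ "V \<inter> W"]) (auto simp del: restrict_apply)
  next
    case (UN \<K>)
    then have "\<forall>k\<in>\<K>. \<exists>V. openin ?T V \<and> k = {x \<in> S. ?J x \<in> V}" by blast
    from bchoice[OF this] obtain V where
      V: "\<And>k. k \<in> \<K> \<Longrightarrow> openin ?T (V k) \<and> k = {x \<in> S. ?J x \<in> V k}" by blast
    have "\<Union>\<K> = {x \<in> S. ?J x \<in> (\<Union>k\<in>\<K>. V k)}" using V by blast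
    moreover have "openin ?T (\<Union>k\<in>\<K>. V k)" using V by (intro openin_Union) blast
    ultimately show ?case by (intro exI conjI)
  next
    case (Basis s)
    then consider "s = S" | \<phi> U where "s = {x \<in> S. \<phi> x \<in> U}" "\<phi> \<in> \<Phi>" "open U" by blast
    then show ?case
    proof cases
      case 1
      have "openin ?T (topspace ?T)" by (rule openin_topspace)
      then show ?thesis using 1 by (intro exI[of _ "topspace ?T"]) auto
    next
      case 2
      have "continuous_map ?T euclideanreal (\<lambda>z. z \<phi>)" using 2 by (intro continuous_map_product_projection)
      then have "openin ?T {z \<in> topspace ?T. z \<phi> \<in> U}" using 2 by (auto simp: continuous_map_def)
      then show ?thesis using 2 by (intro exI[of _ "{z \<in> topspace ?T. z \<phi> \<in> U}"]) auto
    qed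
  qed
qed

lemma continuous_map_weak_topology_on:
  "continuous_map (weak_topology_on S \<Phi>) (product_topology (\<lambda>_. euclideanreal) \<Phi>) (\<lambda>x. restrict (\<lambda>\<phi>. \<phi> x) \<Phi>)"
proof -
  have "continuous_map (weak_topology_on S \<Phi>) euclideanreal \<phi>" if "\<phi> \<in> \<Phi>" for \<phi>
    unfolding continuous_map_def using openin_weak_topology_on[OF that] by auto
  then show ?thesis by (auto simp: continuous_map_componentwise)
qed

text \<open>Tychonoff, as in the Banach-Alaoglu theorem: the image of \<open>K\<close> under
  evaluation lies in a product of compact intervals, so its closure is compact. The hypothesis
  \<open>rep\<close> places every point of that closure in the image of \<open>S\<close>, which is
  what allows compactness to be carried back.\<close>

lemma relatively_compact_in_weak_topology_onI:
  assumes K: "K \<subseteq> S" and bdd: "\<And>\<phi>. \<phi> \<in> \<Phi> \<Longrightarrow> \<exists>c. \<forall>x\<in>K. \<bar>\<phi> x\<bar> \<le> c"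
    and rep: "\<And>z. (\<And>A e. finite A \<Longrightarrow> A \<subseteq> \<Phi> \<Longrightarrow> e > 0 \<Longrightarrow> \<exists>x\<in>K. \<forall>\<phi>\<in>A. \<bar>\<phi> x - z \<phi>\<bar> < e) \<Longrightarrow>
      \<exists>x\<in>S. \<forall>\<phi>\<in>\<Phi>. z \<phi> = \<phi> x"
  shows "relatively_compact_in (weak_topology_on S \<Phi>) K"
proof -
  let ?T = "product_topology (\<lambda>_. euclideanreal) \<Phi>" and ?J = "\<lambda>x. restrict (\<lambda>\<phi>. \<phi> x) \<Phi>"
    and ?W = "weak_topology_on S \<Phi>"
  let ?Z = "?T closure_of (?J ` K)"
  obtain c where c: "\<And>\<phi> x. \<phi> \<in> \<Phi> \<Longrightarrow> x \<in> K \<Longrightarrow> \<bar>\<phi> x\<bar> \<le> c \<phi>" using bdd by metis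
  have box: "compactin ?T (PiE \<Phi> (\<lambda>\<phi>. {- c \<phi>..c \<phi>}))"
    by (subst compactin_PiE) (auto simp: compactin_euclidean_iff)
  have "closedin ?T (PiE \<Phi> (\<lambda>\<phi>. {- c \<phi>..c \<phi>}))" by (subst closedin_product_topology) auto
  moreover have "?J ` K \<subseteq> PiE \<Phi> (\<lambda>\<phi>. {- c \<phi>..c \<phi>})"
  proof (rule image_subsetI)
    fix x assume "x \<in> K"
    then show "?J x \<in> PiE \<Phi> (\<lambda>\<phi>. {- c \<phi>..c \<phi>})" using c[of _ x] by (force simp: abs_le_iff)
  qed
  ultimately have Zbox: "?Z \<subseteq> PiE \<Phi> (\<lambda>\<phi>. {- c \<phi>..c \<phi>})" by (intro closure_of_minimal)
  have Z: "compactin ?T ?Z" using box Zbox by (rule closed_compactin) auto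
  \<comment> \<open>Basic neighbourhoods in the product restrict finitely many coordinates, so
    membership in the closure is precisely the premise of \<open>rep\<close>.\<close>
  have ZJ: "\<exists>x\<in>S. z = ?J x" if z: "z \<in> ?Z" for z
  proof -
    have "\<exists>x\<in>K. \<forall>\<phi>\<in>A. \<bar>\<phi> x - z \<phi>\<bar> < e" if A: "finite A" "A \<subseteq> \<Phi>" "e > 0" for A e
    proof -
      let ?V = "PiE \<Phi> (\<lambda>\<phi>. if \<phi> \<in> A then ball (z \<phi>) e else UNIV)"
      have "{i. (if i \<in> A then ball (z i) e else UNIV) \<noteq> UNIV} \<subseteq> A" by auto
      then have "openin ?T ?V"
        using A(1) finite_subset by (subst openin_PiE_gen) fastforce
      moreover have "z \<in> ?V" using Zbox z A by (auto simp: PiE_def Pi_def)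
      ultimately obtain x where "x \<in> K" "?J x \<in> ?V" using z unfolding in_closure_of by blast
      moreover then have "\<bar>\<phi> x - z \<phi>\<bar> < e" if "\<phi> \<in> A" for \<phi>
        using that A(2) by (auto simp: PiE_def Pi_def dist_real_def abs_minus_commute split: if_splits)
      ultimately show ?thesis by blast
    qed
    then obtain x where x: "x \<in> S" "\<forall>\<phi>\<in>\<Phi>. z \<phi> = \<phi> x" using rep[of z] by auto
    have "z = ?J x" using x(2) Zbox z by (intro PiE_ext[of z \<Phi> "\<lambda>\<phi>. UNIV"]) auto
    then show ?thesis using x by blast
  qed
  have inZ: "?J x \<in> ?Z \<longleftrightarrow> x \<in> ?W closure_of K" if x: "x \<in> S" for x
  proof
    assume "x \<in> ?W closure_of K"
    then show "?J x \<in> ?Z"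
      using continuous_map_image_closure_subset[OF continuous_map_weak_topology_on[of S \<Phi>], of K] x by blast
  next
    assume z: "?J x \<in> ?Z"
    have "\<exists>y\<in>K. y \<in> U" if U: "x \<in> U" "openin ?W U" for U
    proof -
      obtain V where V: "openin ?T V" "U = {x \<in> S. ?J x \<in> V}"
        using openin_weak_topology_on_pullback[OF U(2)] by blast
      then obtain y where "y \<in> K" "?J y \<in> V" using z U(1) unfolding in_closure_of by blast
      then show ?thesis using V K by auto
    qed
    then show "x \<in> ?W closure_of K" using x by (auto simp: in_closure_of)
  qed
  show ?thesis
    unfolding relatively_compact_in_def compactin_def
  proof (intro conjI allI impI)
    show "?W closure_of K \<subseteq> topspace ?W" by (rule closure_of_subset_topspace)
    fix \<U> assume \<U>: "Ball \<U> (openin ?W) \<and> ?W closure_of K \<subseteq> \<Union>\<U>"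
    have "\<forall>U\<in>\<U>. \<exists>V. openin ?T V \<and> U = {x \<in> S. ?J x \<in> V}"
      using \<U> by (intro ballI openin_weak_topology_on_pullback) blast
    from bchoice[OF this] obtain V where
      V: "\<And>U. U \<in> \<U> \<Longrightarrow> openin ?T (V U) \<and> U = {x \<in> S. ?J x \<in> V U}" by blast
    have "?Z \<subseteq> \<Union>(V ` \<U>)"
    proof
      fix z assume z: "z \<in> ?Z"
      then obtain x where x: "x \<in> S" "z = ?J x" using ZJ by blast
      then have "x \<in> ?W closure_of K" using inZ z by blast
      then obtain U where "U \<in> \<U>" "x \<in> U" using \<U> by blast
      then have "z \<in> V U" using V x by blast
      then show "z \<in> \<Union>(V ` \<U>)" using \<open>U \<in> \<U>\<close> by blast
    qed
    then obtain \<F> where \<F>: "finite \<F>" "\<F> \<subseteq> V ` \<U>" "?Z \<subseteq> \<Union>\<F>"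
      using compactinD[OF Z, of "V ` \<U>"] V by (auto simp del: UN_simps)
    then obtain \<G> where \<G>: "finite \<G>" "\<G> \<subseteq> \<U>" "\<F> = V ` \<G>" by (meson finite_subset_image)
    have "?W closure_of K \<subseteq> \<Union>\<G>"
    proof
      fix x assume x: "x \<in> ?W closure_of K"
      then have "x \<in> S" by (auto simp: in_closure_of)
      then have "?J x \<in> ?Z" using inZ x by blast
      then obtain U where "U \<in> \<G>" "?J x \<in> V U" using \<F> \<G> by blast
      then show "x \<in> \<Union>\<G>" using V \<G> \<open>x \<in> S\<close> by blast
    qed
    then show "\<exists>\<F>. finite \<F> \<and> \<F> \<subseteq> \<U> \<and> ?W closure_of K \<subseteq> \<Union>\<F>" using \<G> by blast
  qed
qed

text \<open>Otherwise every point of \<open>S\<close> has a weak neighbourhood that the sequence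
  finally leaves. Finitely many of these cover the closure of \<open>K\<close>, hence the sequence
  itself. Only a cluster point is claimed; no weakly convergent subsequence is extracted.\<close>

lemma weak_cluster_point:
  fixes X :: "nat \<Rightarrow> 'v::real_vector"
  assumes K: "K \<subseteq> S" and rc: "relatively_compact_in (weak_topology_on S \<Phi>) K" and X: "range X \<subseteq> K"
  shows "\<exists>y\<in>S. \<forall>A e i. finite A \<longrightarrow> A \<subseteq> \<Phi> \<longrightarrow> e > 0 \<longrightarrow> (\<exists>n\<ge>i. \<forall>\<phi>\<in>A. \<bar>\<phi> (X n) - \<phi> y\<bar> < e)"
proof (rule ccontr)
  let ?W = "weak_topology_on S \<Phi>"
  assume neg: "\<not> ?thesis"
  have "\<forall>y\<in>S. \<exists>U. openin ?W U \<and> y \<in> U \<and> (\<exists>i. \<forall>n\<ge>i. X n \<notin> U)"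
  proof
    fix y assume y: "y \<in> S"
    have "\<not> (\<forall>A e i. finite A \<longrightarrow> A \<subseteq> \<Phi> \<longrightarrow> e > 0 \<longrightarrow> (\<exists>n\<ge>i. \<forall>\<phi>\<in>A. \<bar>\<phi> (X n) - \<phi> y\<bar> < e))"
      using neg y unfolding Set.bex_simps(8) by (rule bspec)
    then obtain A e i where A: "finite A" "A \<subseteq> \<Phi>" "e > 0" "\<And>n. n \<ge> i \<Longrightarrow> \<not> (\<forall>\<phi>\<in>A. \<bar>\<phi> (X n) - \<phi> y\<bar> < e)"
      by blast
    \<comment> \<open>The additional index keeps the family nonempty for the intersection rule;
      outside \<open>A\<close> it contributes the whole set \<open>S\<close>.\<close>
    define U where "U = (\<Inter>\<phi>\<in>insert (\<lambda>_. 0) A. if \<phi> \<in> A then {x\<in>S. \<phi> x \<in> ball (\<phi> y) e} else S)"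
    have "openin ?W U"
      unfolding U_def
    proof (rule openin_Inter)
      show "openin ?W B" if B: "B \<in> (\<lambda>\<phi>. if \<phi> \<in> A then {x\<in>S. \<phi> x \<in> ball (\<phi> y) e} else S) ` insert (\<lambda>_. 0) A" for B
      proof -
        obtain \<phi> where \<phi>: "B = (if \<phi> \<in> A then {x\<in>S. \<phi> x \<in> ball (\<phi> y) e} else S)" using B by blast
        have "openin ?W S" using openin_topspace[of ?W] by simp
        then show ?thesis using openin_weak_topology_on[of \<phi> \<Phi> "ball (\<phi> y) e" S] A(2) \<phi> by auto
      qed
    qed (use A in auto)
    moreover have "y \<in> U" using y A(3) by (auto simp: U_def)
    moreover have "X n \<notin> U" if "n \<ge> i" for n
    proof
      assume "X n \<in> U"
      then have "\<phi> (X n) \<in> ball (\<phi> y) e" if "\<phi> \<in> A" for \<phi>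
      proof -
        have "X n \<in> (if \<phi> \<in> A then {x\<in>S. \<phi> x \<in> ball (\<phi> y) e} else S)"
          by (rule INT_D[OF \<open>X n \<in> U\<close>[unfolded U_def] insertI2[OF \<open>\<phi> \<in> A\<close>]])
        then show ?thesis using that by simp
      qed
      then have "\<forall>\<phi>\<in>A. \<bar>\<phi> (X n) - \<phi> y\<bar> < e" by (simp add: dist_real_def abs_minus_commute)
      with A(4)[OF that] show False by (rule notE)
    qed
    ultimately show "\<exists>U. openin ?W U \<and> y \<in> U \<and> (\<exists>i. \<forall>n\<ge>i. X n \<notin> U)" by blast
  qed
  from bchoice[OF this] obtain U where
    U: "\<And>y. y \<in> S \<Longrightarrow> openin ?W (U y) \<and> y \<in> U y" "\<forall>y\<in>S. \<exists>i. \<forall>n\<ge>i. X n \<notin> U y" by blast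
  from bchoice[OF U(2)] obtain i where i: "\<And>y n. y \<in> S \<Longrightarrow> n \<ge> i y \<Longrightarrow> X n \<notin> U y" by blast
  have sub: "K \<subseteq> ?W closure_of K" "?W closure_of K \<subseteq> S"
    using K closure_of_subset[of K ?W] closure_of_subset_topspace[of ?W K] by auto
  have "\<exists>\<F>. finite \<F> \<and> \<F> \<subseteq> U ` S \<and> ?W closure_of K \<subseteq> \<Union>\<F>"
    by (rule compactinD[OF rc[unfolded relatively_compact_in_def]]) (use U sub in blast)+
  then obtain D where D: "finite D" "D \<subseteq> S" "?W closure_of K \<subseteq> \<Union>(U ` D)" by (metis finite_subset_image)
  define n where "n = Max (insert 0 (i ` D))"
  obtain y where y: "y \<in> D" "X n \<in> U y" using D(3) sub(1) X by blast
  have "i y \<le> n" unfolding n_def using D y by (intro Max_ge) auto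
  then show False using i[of y n] y D by blast
qed

text \<open>Mazur's theorem at a cluster point \<open>y\<close>: if the hull of a tail stayed away
  from \<open>y\<close>, a functional would be bounded below by a positive number on all differences
  from \<open>y\<close>, although it comes arbitrarily close to 0 along that tail. The same
  \<open>y\<close> serves every tail, so the blocks converge.\<close>

lemma blocks_of_relatively_weakly_compact:
  fixes X :: "nat \<Rightarrow> 'v::real_vector"
  assumes p: "seminorm_on S p" and K: "K \<subseteq> S"
    and rc: "relatively_compact_in (weak_topology_on S (dual_on S p)) K" and X: "range X \<subseteq> K"
  shows "\<exists>Y. \<exists>y\<in>S. (\<forall>i. Y i \<in> convex hull (X ` {i..})) \<and> (\<lambda>i::nat. p (Y i - y)) \<longlonglongrightarrow> 0"
proof -
  have S: "subspace S" by (rule seminorm_onD(1)[OF p])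
  obtain y where y: "y \<in> S" "\<And>A e i. finite A \<Longrightarrow> A \<subseteq> dual_on S p \<Longrightarrow> e > 0 \<Longrightarrow> \<exists>n\<ge>i. \<forall>\<phi>\<in>A. \<bar>\<phi> (X n) - \<phi> y\<bar> < e"
    using weak_cluster_point[OF K rc X] by blast
  have hullS: "convex hull (X ` {i..}) \<subseteq> S" for i
    using X K by (intro hull_minimal subspace_imp_convex[OF S]) auto
  have "\<exists>c\<in>convex hull (X ` {i..}). p (c - y) < 1 / Suc i" for i
  proof (rule ccontr)
    assume neg: "\<not> ?thesis"
    let ?C = "(\<lambda>x. x - y) ` (convex hull (X ` {i..}))"
    have "\<exists>l. linear l \<and> (\<forall>x\<in>S. \<bar>l x\<bar> \<le> p x) \<and> (\<forall>c\<in>?C. 1 / Suc i \<le> l c)"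
    proof (rule mazur_orlicz_seminorm[OF p])
      show "convex ?C" by (rule convex_translation_subtract) (rule convex_convex_hull)
      show "?C \<subseteq> S" using hullS[of i] y(1) subspace_diff[OF S] by auto
      show "1 / Suc i \<le> p c" if "c \<in> ?C" for c using neg that by auto
    qed
    then obtain l where l: "linear l" "\<forall>x\<in>S. \<bar>l x\<bar> \<le> p x" "\<And>c. c \<in> ?C \<Longrightarrow> 1 / Suc i \<le> l c" by blast
    then have "l \<in> dual_on S p" by (intro linear_in_dual_on[of _ _ _ 1]) (auto simp: bounded_on_def)
    then obtain n where n: "n \<ge> i" "\<bar>l (X n) - l y\<bar> < 1 / Suc i" using y(2)[of "{l}" "1 / Suc i" i] by auto
    have "X n - y \<in> ?C" using n(1) by (intro imageI hull_inc) auto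
    from l(3)[OF this] n(2) show False by (simp add: linear_diff[OF l(1)])
  qed
  then obtain Y where Y: "\<And>i. Y i \<in> convex hull (X ` {i..})" "\<And>i. p (Y i - y) < 1 / Suc i" by metis
  have "(\<lambda>i. p (Y i - y)) \<longlonglongrightarrow> 0"
  proof (rule tendsto_sandwich[of "\<lambda>_. 0" _ _ "\<lambda>i. 1 / real (Suc i)"])
    show "(\<lambda>i. 1 / real (Suc i)) \<longlonglongrightarrow> 0" using LIMSEQ_inverse_real_of_nat by (simp add: inverse_eq_divide)
    show "\<forall>\<^sub>F i in sequentially. 0 \<le> p (Y i - y)"
      using Y(1) hullS y(1) subspace_diff[OF S] seminorm_onD(5)[OF p] by (intro always_eventually) blast
  qed (use Y(2) in \<open>auto intro!: always_eventually less_imp_le\<close>)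
  then show ?thesis using Y y by blast
qed

text \<open>The uniform boundedness principle by a gliding hump. Norming functionals of points with
  \<open>p (x n) \<ge> n * 3 ^ n\<close> are summed with weights 3^-j, and the sum has value at
  least n/2 in absolute value at \<open>x n\<close>.\<close>

lemma weakly_bounded_imp_bounded:
  assumes p: "seminorm_on S p" and K: "K \<subseteq> S"
    and bdd: "\<And>\<phi>. \<phi> \<in> dual_on S p \<Longrightarrow> \<exists>c. \<forall>x\<in>K. \<bar>\<phi> x\<bar> \<le> c"
  shows "\<exists>c. \<forall>x\<in>K. p x \<le> c"
proof (rule ccontr)
  assume "\<not> ?thesis"
  then have "\<exists>x\<in>K. p x \<ge> real n * 3 ^ n" for n :: nat by (meson linear)
  then obtain x where x: "\<And>n. x n \<in> K" "\<And>n. p (x n) \<ge> real n * 3 ^ n" by metis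
  let ?w = "\<lambda>n::nat. (1 / 3 :: real) ^ n"
  \<comment> \<open>The sign of the norming functional is chosen so that it does not cancel the
    contribution of the earlier terms.\<close>
  define Q where "Q h n r \<longleftrightarrow> linear r \<and> (\<forall>y\<in>S. \<bar>r y\<bar> \<le> p y) \<and>
      \<bar>(\<Sum>j<n. ?w j * h j (x n)) + ?w n * r (x n)\<bar> \<ge> ?w n * p (x n)" for h and n :: nat and r
  have "\<exists>h. \<forall>n. Q h n (h n)"
  proof (rule dependent_wellorder_choice)
    fix r and f g :: "nat \<Rightarrow> 'a \<Rightarrow> real" and n :: nat
    assume "\<And>m. m < n \<Longrightarrow> f m = g m"
    then have "(\<Sum>j<n. ?w j * f j (x n)) = (\<Sum>j<n. ?w j * g j (x n))" by simp
    then show "Q f n r = Q g n r" by (simp add: Q_def)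
  next
    fix h and n :: nat
    obtain l where l: "linear l" "\<forall>y\<in>S. \<bar>l y\<bar> \<le> p y" "l (x n) = p (x n)"
      using hahn_banach_norming[OF p, of "x n"] x K by blast
    have "linear (\<lambda>y. - l y)" using l(1) by (rule linear_compose_neg)
    moreover have "?w n * p (x n) \<ge> 0" using seminorm_onD(5)[OF p, of "x n"] x(1)[of n] K by auto
    ultimately show "\<exists>r. Q h n r"
      using l by (cases "(\<Sum>j<n. ?w j * h j (x n)) \<ge> 0")
        (force simp: Q_def intro: exI[of _ l], force simp: Q_def intro: exI[of _ "\<lambda>y. - l y"])
  qed
  then obtain h where h: "\<And>n. linear (h n)" "\<And>n y. y \<in> S \<Longrightarrow> \<bar>h n y\<bar> \<le> p y"
    "\<And>n. \<bar>(\<Sum>j<n. ?w j * h j (x n)) + ?w n * h n (x n)\<bar> \<ge> ?w n * p (x n)"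
    unfolding Q_def by blast
  have summ: "summable (\<lambda>j. ?w j * p y)" for y by (intro summable_mult2 summable_geometric) simp
  have bd: "\<bar>?w j * h j y\<bar> \<le> ?w j * p y" if "y \<in> S" for j y
    using h(2)[OF that, of j] by (simp add: abs_mult mult_left_mono)
  have sumh: "summable (\<lambda>j. ?w j * h j y)" if "y \<in> S" for y
    by (rule summable_comparison_test'[OF summ[of y], of 0]) (use bd[OF that] in simp)
  define \<phi> where "\<phi> y = (\<Sum>j. ?w j * h j y)" for y
  have w0: "(\<Sum>j. ?w j) = 3/2" by (subst suminf_geometric) auto
  have "\<phi> \<in> dual_on S p"
  proof -
    have "\<phi> (y + z) = \<phi> y + \<phi> z" if "y \<in> S" "z \<in> S" for y z
      unfolding \<phi>_def using sumh that by (simp add: linear_add[OF h(1)] distrib_left suminf_add)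
    moreover have "\<phi> (c *\<^sub>R y) = c * \<phi> y" if "y \<in> S" for y c
      unfolding \<phi>_def using suminf_mult[OF sumh[OF that], of c] by (simp add: linear_scale[OF h(1)] ac_simps)
    moreover have "\<bar>\<phi> y\<bar> \<le> 3/2 * p y" if "y \<in> S" for y
    proof -
      have "\<bar>\<phi> y\<bar> \<le> (\<Sum>j. ?w j * p y)"
        unfolding \<phi>_def using norm_suminf_le[OF _ summ, of "\<lambda>j. ?w j * h j y" y] bd[OF that] by simp
      also have "\<dots> = 3/2 * p y" using w0 by (subst suminf_mult2[symmetric]) (auto intro: summable_geometric)
      finally show ?thesis .
    qed
    ultimately show ?thesis unfolding dual_on_def bounded_on_def by blast
  qed
  then obtain c where c: "\<And>y. y \<in> K \<Longrightarrow> \<bar>\<phi> y\<bar> \<le> c" using bdd by blast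
  have "real n / 2 \<le> \<bar>\<phi> (x n)\<bar>" for n
  proof -
    have xS: "x n \<in> S" using x K by auto
    have "\<phi> (x n) = (\<Sum>j. ?w (j + Suc n) * h (j + Suc n) (x n)) + (\<Sum>j<Suc n. ?w j * h j (x n))"
      unfolding \<phi>_def by (rule suminf_split_initial_segment[OF sumh[OF xS]])
    \<comment> \<open>The ratio 1/3 is small enough: the weights beyond \<open>n\<close> add up to
      half of the weight at \<open>n\<close>, so at least half of the main term survives.\<close>
    moreover have "\<bar>\<Sum>j. ?w (j + Suc n) * h (j + Suc n) (x n)\<bar> \<le> ?w n * p (x n) / 2"
    proof -
      have s: "summable (\<lambda>j. ?w (j + Suc n) * p (x n))"
        using summ by (rule summable_ignore_initial_segment)
      have "\<bar>\<Sum>j. ?w (j + Suc n) * h (j + Suc n) (x n)\<bar> \<le> (\<Sum>j. ?w (j + Suc n) * p (x n))"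
        using norm_suminf_le[OF _ s, of "\<lambda>j. ?w (j + Suc n) * h (j + Suc n) (x n)"] bd[OF xS]
        by (simp only: real_norm_def)
      also have "\<dots> = (\<Sum>j. ?w j * (?w (Suc n) * p (x n)))" by (simp add: power_add ac_simps)
      also have "\<dots> = 3/2 * (?w (Suc n) * p (x n))" using w0 by (subst suminf_mult2[symmetric]) (auto intro: summable_geometric)
      finally show ?thesis by (simp add: mult.commute)
    qed
    moreover have "\<bar>\<Sum>j<Suc n. ?w j * h j (x n)\<bar> \<ge> ?w n * p (x n)" using h(3)[of n] by simp
    moreover have "\<bar>b\<bar> \<ge> e / 2" if "b = t + s" "\<bar>t\<bar> \<le> e / 2" "\<bar>s\<bar> \<ge> e" for b t s e :: real
      using that by (auto simp: abs_if split: if_splits)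
    ultimately have "\<bar>\<phi> (x n)\<bar> \<ge> ?w n * p (x n) / 2" by blast
    moreover have "?w n * p (x n) \<ge> ?w n * (real n * 3 ^ n)" using x(2)[of n] by (intro mult_left_mono) auto
    moreover have "?w n * (real n * 3 ^ n) = real n" by (simp add: power_divide)
    ultimately show ?thesis by linarith
  qed
  moreover obtain n :: nat where "real n > 2 * c" using reals_Archimedean2 by blast
  ultimately show False using c[OF x(1)[of n]] by (smt (verit) field_sum_of_halves)
qed

lemma relatively_weakly_compact_of_blocks:
  assumes p: "seminorm_on S p"
    and complete: "\<And>X. (\<And>n. X n \<in> S) \<Longrightarrow> (\<And>n::nat. p (X (Suc n) - X n) \<le> (1/2) ^ n) \<Longrightarrow> \<exists>x\<in>S. (\<lambda>n. p (X n - x)) \<longlonglongrightarrow> 0"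
    and K: "K \<subseteq> S" and bdd: "\<And>x. x \<in> K \<Longrightarrow> p x \<le> b"
    and blocks: "\<And>X. range X \<subseteq> K \<Longrightarrow> \<exists>Y. \<exists>y\<in>S. (\<forall>i. Y i \<in> convex hull (X ` {i..})) \<and> (\<lambda>i::nat. p (Y i - y)) \<longlonglongrightarrow> 0"
  shows "relatively_compact_in (weak_topology_on S (dual_on S p)) K"
proof (rule relatively_compact_in_weak_topology_onI[OF K])
  show "\<exists>c. \<forall>x\<in>K. \<bar>\<phi> x\<bar> \<le> c" if \<phi>: "\<phi> \<in> dual_on S p" for \<phi>
  proof -
    obtain C where C: "C \<ge> 0" "bounded_on S p \<phi> C" using dual_onD(4)[OF p \<phi>] by blast
    have "\<bar>\<phi> x\<bar> \<le> C * b" if "x \<in> K" for x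
      using C bdd[OF that] K that mult_left_mono[of "p x" b C] unfolding bounded_on_def by force
    then show ?thesis by blast
  qed
  fix z assume z: "\<And>A e. finite A \<Longrightarrow> A \<subseteq> dual_on S p \<Longrightarrow> e > 0 \<Longrightarrow> \<exists>x\<in>K. \<forall>\<phi>\<in>A. \<bar>\<phi> x - z \<phi>\<bar> < e"
  show "\<exists>x\<in>S. \<forall>\<phi>\<in>dual_on S p. z \<phi> = \<phi> x"
    by (rule bidual_representation[OF p complete K blocks z])
qed

section \<open>The Bochner integral\<close>

lemma ennreal_squeeze_0:
  fixes u v :: "nat \<Rightarrow> ennreal"
  assumes "\<And>i. u i \<le> v i" "v \<longlonglongrightarrow> 0"
  shows "u \<longlonglongrightarrow> 0"
  by (rule tendsto_sandwich[OF _ _ tendsto_const assms(2)]) (use assms(1) in auto)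

lemma simple_bochner_integral_zero: "Bochner_Integration.simple_bochner_integral M (\<lambda>x. 0) = 0"
  by (auto simp: simple_bochner_integral_def intro!: sum.neutral)

locale complete_finite_measure = complete_measure M + finite_measure M for M :: "'a measure"
begin

text \<open>Changing a function on a null set changes each preimage by a subset of a null set, and
  in a complete measure these are measurable.\<close>

lemma borel_measurable_cong_AE:
  assumes g: "g \<in> measurable M (borel :: 'b::topological_space measure)" and eq: "AE x in M. f x = g x"
  shows "f \<in> borel_measurable M"
proof (rule measurableI)
  fix A :: "'b set" assume A: "A \<in> sets borel"
  show "f -` A \<inter> space M \<in> sets M"
  proof (rule in_sets_AE)
    show "g -` A \<inter> space M \<in> sets M" using g A by (rule measurable_sets)
    show "AE x in M. x \<in> g -` A \<inter> space M \<longleftrightarrow> x \<in> f -` A \<inter> space M" using eq by eventually_elim auto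
  qed auto
qed auto

lemma borel_measurable_AE_LIMSEQ:
  fixes f :: "'a \<Rightarrow> 'b::metric_space"
  assumes g: "\<And>i::nat. g i \<in> borel_measurable M" and lim: "AE x in M. (\<lambda>i. g i x) \<longlonglongrightarrow> f x"
  shows "f \<in> borel_measurable M"
proof -
  obtain N where N: "N \<in> null_sets M" "{x\<in>space M. \<not> (\<lambda>i. g i x) \<longlonglongrightarrow> f x} \<subseteq> N"
    using lim by (auto elim!: AE_E simp: null_sets_def)
  define g' where "g' i x = (if x \<in> N then undefined else g i x)" for i x
  define f' where "f' x = (if x \<in> N then undefined else f x)" for x
  have [measurable]: "N \<in> sets M" using N by auto
  have "g' i \<in> borel_measurable M" for i unfolding g'_def using g[of i] by measurable
  moreover have "(\<lambda>i. g' i x) \<longlonglongrightarrow> f' x" if "x \<in> space M" for x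
    using N that by (auto simp: g'_def f'_def)
  ultimately have "f' \<in> borel_measurable M" by (rule borel_measurable_LIMSEQ_metric)
  moreover have "AE x in M. f x = f' x" using AE_not_in[OF N(1)] by eventually_elim (simp add: f'_def)
  ultimately show ?thesis by (rule borel_measurable_cong_AE)
qed

abbreviation sint :: "('a \<Rightarrow> 'e::real_normed_vector) \<Rightarrow> 'e" where
  "sint \<equiv> Bochner_Integration.simple_bochner_integral M"

abbreviation l1dist :: "('a \<Rightarrow> 'e::real_normed_vector) \<Rightarrow> ('a \<Rightarrow> 'e) \<Rightarrow> ennreal" where
  "l1dist f g \<equiv> \<integral>\<^sup>+x. ennreal (norm (f x - g x)) \<partial>M"

lemma simple_bochner_integrableI:
  "simple_function M s \<Longrightarrow> Bochner_Integration.simple_bochner_integrable M s"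
  by (auto intro!: simple_bochner_integrable.intros)

text \<open>In a finite measure space the requirement that a simple function have support of finite
  measure is automatic.\<close>

lemma simple_bochner_integrable_iff:
  "Bochner_Integration.simple_bochner_integrable M s \<longleftrightarrow> simple_function M s"
  using simple_bochner_integrableI by (auto elim: simple_bochner_integrable.cases)

text \<open>For a nonseparable range two Borel functions need not form a measurable pair. If one of
  them takes finitely many values, the space splits into finitely many measurable pieces on which it
  is constant.\<close>

lemma borel_measurable_simple_arg:
  fixes h :: "'b::topological_space \<Rightarrow> 'c::topological_space \<Rightarrow> 'd::topological_space"
  assumes f: "f \<in> borel_measurable M" and s: "simple_function M s" and h: "\<And>c. continuous_on UNIV (\<lambda>y. h y c)"
  shows "(\<lambda>x. h (f x) (s x)) \<in> borel_measurable M"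
proof (rule measurable_compose_countable'[where I="s ` space M" and f="\<lambda>c x. h (f x) c"])
  show "(\<lambda>x. h (f x) c) \<in> borel_measurable M" for c
    by (rule measurable_compose[OF f borel_measurable_continuous_onI[OF h]])
  show "s \<in> measurable M (count_space (s ` space M))"
    using measurable_simple_function[OF s] by (auto simp: measurable_def)
  show "countable (s ` space M)" using s by (auto simp: simple_function_def countable_finite)
qed

lemma borel_measurable_diff_simple:
  fixes f :: "'a \<Rightarrow> 'e::real_normed_vector"
  assumes "f \<in> borel_measurable M" "simple_function M s"
  shows "(\<lambda>x. f x - s x) \<in> borel_measurable M"
  by (rule borel_measurable_simple_arg[OF assms]) (intro continuous_intros)

text \<open>Without second countability, sums of measurable functions need not be measurable. Strongly
  measurable functions are closed under sums, thanks to completeness of the measure.\<close>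

definition strongly_measurable :: "('a \<Rightarrow> 'e::real_normed_vector) \<Rightarrow> bool" where
  "strongly_measurable f \<longleftrightarrow> (\<exists>s. (\<forall>i::nat. simple_function M (s i)) \<and> (AE x in M. (\<lambda>i. s i x) \<longlonglongrightarrow> f x))"

lemma strongly_measurable_add:
  assumes "strongly_measurable f" "strongly_measurable g"
  shows "strongly_measurable (\<lambda>x. f x + g x)"
proof -
  obtain s r where "\<And>i. simple_function M (s i)" "AE x in M. (\<lambda>i::nat. s i x) \<longlonglongrightarrow> f x"
    "\<And>i. simple_function M (r i)" "AE x in M. (\<lambda>i::nat. r i x) \<longlonglongrightarrow> g x"
    using assms unfolding strongly_measurable_def by blast
  note sr = this
  have "simple_function M (\<lambda>x. s i x + r i x)" for i
    using simple_function_compose2[OF sr(1) sr(3), of "(+)"] .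
  moreover have "AE x in M. (\<lambda>i. s i x + r i x) \<longlonglongrightarrow> f x + g x"
    using sr(2,4) by eventually_elim (intro tendsto_add)
  ultimately show ?thesis unfolding strongly_measurable_def
    by (intro exI[of _ "\<lambda>i x. s i x + r i x"] conjI allI)
qed

text \<open>One strongly measurable partner is enough: the difference is an almost everywhere limit
  of differences with simple functions.\<close>

lemma borel_measurable_diff_strongly:
  assumes f: "f \<in> borel_measurable M" and g: "strongly_measurable g"
  shows "(\<lambda>x. f x - g x) \<in> borel_measurable M"
proof -
  obtain s where s: "\<And>i. simple_function M (s i)" "AE x in M. (\<lambda>i::nat. s i x) \<longlonglongrightarrow> g x"
    using g unfolding strongly_measurable_def by blast
  show ?thesis
  proof (rule borel_measurable_AE_LIMSEQ)
    show "(\<lambda>x. f x - s i x) \<in> borel_measurable M" for i by (rule borel_measurable_diff_simple[OF f s(1)])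
    show "AE x in M. (\<lambda>i. f x - s i x) \<longlonglongrightarrow> f x - g x" using s(2) by eventually_elim (intro tendsto_intros)
  qed
qed

lemma strongly_measurable_imp_borel: "strongly_measurable f \<Longrightarrow> f \<in> borel_measurable M"
  unfolding strongly_measurable_def by (auto intro: borel_measurable_AE_LIMSEQ borel_measurable_simple_function)

text \<open>The distances are real functions tending to 0 in L1, so along a subsequence they tend to
  0 almost everywhere. The shift by \<open>n\<close> discards the initial terms, whose distances
  might be infinite.\<close>

lemma strongly_measurable_if_l1_limit:
  assumes f: "f \<in> borel_measurable M" and s: "\<And>i::nat. simple_function M (s i)" and lim: "(\<lambda>i. l1dist f (s i)) \<longlonglongrightarrow> 0"
  shows "strongly_measurable f"
proof -
  define u where "u i x = norm (f x - s i x)" for i x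
  have [measurable]: "u i \<in> borel_measurable M" for i
    unfolding u_def using borel_measurable_diff_simple[OF f s] by measurable
  have "\<forall>\<^sub>F i in sequentially. l1dist f (s i) < 1" using lim by (rule order_tendstoD) simp
  then obtain n where n: "\<And>i. i \<ge> n \<Longrightarrow> l1dist f (s i) < 1" by (auto simp: eventually_sequentially)
  have int: "integrable M (u (i + n))" for i
    using n[of "i + n"] by (intro integrableI_bounded) (auto simp: u_def intro: less_trans[OF _ ennreal_one_less_top])
  have "(\<lambda>i. \<integral>\<^sup>+x. ennreal (norm (u (i + n) x)) \<partial>M) \<longlonglongrightarrow> 0"
    using LIMSEQ_ignore_initial_segment[OF lim, of n] by (simp add: u_def)
  then have "(\<lambda>i. ennreal (\<integral>x. norm (u (i + n) x) \<partial>M)) \<longlonglongrightarrow> ennreal 0"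
    using int by (subst (asm) nn_integral_eq_integral) auto
  then have "(\<lambda>i. \<integral>x. norm (u (i + n) x) \<partial>M) \<longlonglongrightarrow> 0"
    by (subst (asm) tendsto_ennreal_iff) auto
  from tendsto_L1_AE_subseq[OF int this] obtain r where
    "AE x in M. (\<lambda>i. u (r i + n) x) \<longlonglongrightarrow> 0" by blast
  then have "AE x in M. (\<lambda>i. s (r i + n) x) \<longlonglongrightarrow> f x"
  proof eventually_elim
    case (elim x)
    then have "(\<lambda>i. f x - s (r i + n) x) \<longlonglongrightarrow> 0" by (simp add: u_def tendsto_norm_zero_iff)
    from tendsto_diff[OF tendsto_const[of "f x"] this] show ?case by simp
  qed
  then show ?thesis unfolding strongly_measurable_def using s by (intro exI[of _ "\<lambda>i. s (r i + n)"]) auto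
qed

lemma bochner_has_integral_strongly: "bochner_has_integral M f v \<Longrightarrow> strongly_measurable f"
  unfolding bochner_has_integral_def simple_bochner_integrable_iff using strongly_measurable_if_l1_limit by blast

lemma bochner_integrable_strongly: "bochner_integrable M f \<Longrightarrow> strongly_measurable f"
  unfolding bochner_integrable_def using bochner_has_integral_strongly by blast

lemma simple_bochner_integral_bounded_general:
  fixes f :: "'a \<Rightarrow> 'e::real_normed_vector"
  assumes f: "f \<in> borel_measurable M" and s: "simple_function M s" and t: "simple_function M t"
  shows "ennreal (norm (sint s - sint t)) \<le> l1dist f s + l1dist f t"
proof -
  note st = simple_bochner_integrableI[OF s] simple_bochner_integrableI[OF t]
  have "ennreal (norm (sint s - sint t)) =
      norm (sint (\<lambda>x. s x - t x))"
    using st by (subst simple_bochner_integral_diff) auto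
  also have "\<dots> \<le> sint (\<lambda>x. norm (s x - t x))"
    using simple_bochner_integrable_compose2[of "(-)" M "s" "t"] st
    by (auto intro!: simple_bochner_integral_norm_bound)
  also have "\<dots> = (\<integral>\<^sup>+x. norm (s x - t x) \<partial>M)"
    using simple_bochner_integrable_compose2[of "\<lambda>x y. norm (x - y)" M "s" "t"] st
    by (auto intro!: simple_bochner_integral_eq_nn_integral)
  also have "\<dots> \<le> (\<integral>\<^sup>+x. ennreal (norm (f x - s x)) + ennreal (norm (f x - t x)) \<partial>M)"
  proof (intro nn_integral_mono)
    fix x
    have "norm (s x - t x) \<le> norm (f x - s x) + norm (f x - t x)"
      by (metis dual_order.refl norm_diff_triangle_le norm_minus_commute)
    then show "ennreal (norm (s x - t x)) \<le> ennreal (norm (f x - s x)) + ennreal (norm (f x - t x))"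
      by (metis ennreal_leI ennreal_plus norm_ge_zero)
  qed
  also have "\<dots> = l1dist f s + l1dist f t"
    using borel_measurable_diff_simple[OF f s] borel_measurable_diff_simple[OF f t] by (intro nn_integral_add) auto
  finally show ?thesis .
qed

text \<open>Additivity of the nonnegative integral needs both distances measurable; strong
  measurability of \<open>g\<close> and simplicity of \<open>s\<close> provide this while
  \<open>f\<close> is just Borel.\<close>

lemma l1dist_triangle:
  assumes f: "f \<in> borel_measurable M" and g: "strongly_measurable g" and s: "simple_function M s"
  shows "l1dist f s \<le> l1dist f g + l1dist g s"
proof -
  have "l1dist f s \<le> (\<integral>\<^sup>+x. ennreal (norm (f x - g x)) + ennreal (norm (g x - s x)) \<partial>M)"
    by (intro nn_integral_mono) (metis ennreal_leI ennreal_plus norm_ge_zero norm_diff_triangle_le order_refl)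
  also have "\<dots> = l1dist f g + l1dist g s"
    using borel_measurable_diff_strongly[OF f g] borel_measurable_diff_simple[OF strongly_measurable_imp_borel[OF g] s]
    by (intro nn_integral_add) auto
  finally show ?thesis .
qed

lemma bochner_has_integral_unique:
  assumes "bochner_has_integral M f v" "bochner_has_integral M f w"
  shows "v = w"
proof -
  obtain s t where s: "\<And>i. simple_function M (s i)" "(\<lambda>i. l1dist f (s i)) \<longlonglongrightarrow> 0"
      "(\<lambda>i. sint (s i)) \<longlonglongrightarrow> v" and
    t: "\<And>i. simple_function M (t i)" "(\<lambda>i. l1dist f (t i)) \<longlonglongrightarrow> 0"
      "(\<lambda>i. sint (t i)) \<longlonglongrightarrow> w" and f: "f \<in> borel_measurable M"
    using assms unfolding bochner_has_integral_def simple_bochner_integrable_iff by auto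
  have "(\<lambda>i. ennreal (norm (sint (s i) - sint (t i)))) \<longlonglongrightarrow> 0"
  proof (rule tendsto_sandwich[of "\<lambda>_. 0" _ _ "\<lambda>i. l1dist f (s i) + l1dist f (t i)"])
    show "(\<lambda>i. l1dist f (s i) + l1dist f (t i)) \<longlonglongrightarrow> 0" using tendsto_add[OF s(2) t(2)] by simp
  qed (use simple_bochner_integral_bounded_general[OF f s(1) t(1)] in auto)
  then have "(\<lambda>i. norm (sint (s i) - sint (t i))) \<longlonglongrightarrow> 0"
    unfolding ennreal_0[symmetric] by (subst (asm) tendsto_ennreal_iff) auto
  moreover have "(\<lambda>i. norm (sint (s i) - sint (t i))) \<longlonglongrightarrow> norm (v - w)"
    using s t by (intro tendsto_intros)
  ultimately have "norm (v - w) = 0" by (metis LIMSEQ_unique)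
  then show ?thesis by simp
qed

text \<open>A diagonal choice: each \<open>g i\<close> is replaced by a simple function within
  1/(i+1) both in L1 and in the value of the integral. The integrals of these are Cauchy, and
  completeness of the range gives the integral of \<open>f\<close>.\<close>

lemma bochner_has_integral_l1_limit:
  fixes f :: "'a \<Rightarrow> 'e::banach"
  assumes f: "f \<in> borel_measurable M" and g: "\<And>i::nat. bochner_has_integral M (g i) (v i)"
    and lim: "(\<lambda>i. l1dist f (g i)) \<longlonglongrightarrow> 0"
  shows "\<exists>w. bochner_has_integral M f w \<and> v \<longlonglongrightarrow> w"
proof -
  have sm: "strongly_measurable (g i)" for i using bochner_has_integral_strongly[OF g] .
  have "\<exists>s. simple_function M s \<and> l1dist (g i) s < 1 / Suc i \<and>
      norm (sint s - v i) < 1 / Suc i" for i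
  proof -
    obtain s where s: "\<And>k. simple_function M (s k)" "(\<lambda>k. l1dist (g i) (s k)) \<longlonglongrightarrow> 0"
      "(\<lambda>k. sint (s k)) \<longlonglongrightarrow> v i"
      using g[of i] unfolding bochner_has_integral_def simple_bochner_integrable_iff by auto
    have "\<forall>\<^sub>F k in sequentially. l1dist (g i) (s k) < 1 / Suc i" using s(2) by (rule order_tendstoD) simp
    moreover have "\<forall>\<^sub>F k in sequentially. norm (sint (s k) - v i) < 1 / Suc i"
      using tendstoD[OF s(3), of "1 / Suc i"] by (simp add: dist_norm)
    ultimately have "\<forall>\<^sub>F k in sequentially. l1dist (g i) (s k) < 1 / Suc i \<and>
      norm (sint (s k) - v i) < 1 / Suc i" by (rule eventually_conj)
    from eventually_happens'[OF sequentially_bot this] show ?thesis using s(1) by blast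
  qed
  then obtain s where s: "\<And>i. simple_function M (s i)" "\<And>i. l1dist (g i) (s i) < 1 / Suc i"
    "\<And>i. norm (sint (s i) - v i) < 1 / Suc i" by metis
  have inv0: "(\<lambda>i. 1 / real (Suc i)) \<longlonglongrightarrow> 0" using LIMSEQ_inverse_real_of_nat by (simp add: inverse_eq_divide)
  have lim_s: "(\<lambda>i. l1dist f (s i)) \<longlonglongrightarrow> 0"
  proof (rule tendsto_sandwich[of "\<lambda>_. 0" _ _ "\<lambda>i. l1dist f (g i) + ennreal (1 / Suc i)"])
    show "\<forall>\<^sub>F i in sequentially. l1dist f (s i) \<le> l1dist f (g i) + ennreal (1 / Suc i)"
      using l1dist_triangle[OF f sm s(1)] s(2) by (intro always_eventually allI) (meson add_left_mono less_imp_le order_trans)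
    have "(\<lambda>i. ennreal (1 / Suc i)) \<longlonglongrightarrow> ennreal 0" using inv0 by (intro tendsto_ennrealI)
    from tendsto_add[OF lim this] show "(\<lambda>i. l1dist f (g i) + ennreal (1 / Suc i)) \<longlonglongrightarrow> 0" by simp
  qed auto
  let ?I = "\<lambda>i. sint (s i)"
  have "Cauchy ?I"
  proof (rule metric_CauchyI)
    fix e :: real assume e: "e > 0"
    have "\<forall>\<^sub>F i in sequentially. l1dist f (s i) < ennreal (e / 2)" using lim_s by (rule order_tendstoD) (use e in simp)
    then obtain n where n: "\<And>i. i \<ge> n \<Longrightarrow> l1dist f (s i) < ennreal (e / 2)" by (auto simp: eventually_sequentially)
    have "dist (?I i) (?I j) < e" if "i \<ge> n" "j \<ge> n" for i j
    proof -
      have "ennreal (norm (?I i - ?I j)) \<le> l1dist f (s i) + l1dist f (s j)"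
        by (rule simple_bochner_integral_bounded_general[OF f s(1) s(1)])
      also have "\<dots> < ennreal (e / 2) + ennreal (e / 2)" using n that by (intro add_strict_mono) auto
      also have "\<dots> = ennreal e" using e by (simp add: ennreal_plus[symmetric] del: ennreal_plus)
      finally show ?thesis using e by (simp add: ennreal_less_iff dist_norm)
    qed
    then show "\<exists>n. \<forall>i\<ge>n. \<forall>j\<ge>n. dist (?I i) (?I j) < e" by blast
  qed
  then obtain w where w: "?I \<longlonglongrightarrow> w" by (auto simp: Cauchy_convergent_iff convergent_def)
  have "bochner_has_integral M f w"
    unfolding bochner_has_integral_def simple_bochner_integrable_iff using f s(1) lim_s w by blast
  moreover have "v \<longlonglongrightarrow> w"
  proof -
    have "(\<lambda>i. ?I i - v i) \<longlonglongrightarrow> 0"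
      by (rule Lim_null_comparison[OF always_eventually inv0]) (use s(3) in \<open>auto intro: less_imp_le\<close>)
    from tendsto_diff[OF w this] show ?thesis by simp
  qed
  ultimately show ?thesis by blast
qed

lemma bochner_has_integral_simple:
  "simple_function M s \<Longrightarrow> bochner_has_integral M s (sint s)"
  unfolding bochner_has_integral_def simple_bochner_integrable_iff
  by (auto intro!: exI[of _ "\<lambda>_. s"] borel_measurable_simple_function)

text \<open>For a Banach space the existence of the limit of integrals is implied by L1
  approximability, so this criterion makes no mention of the value of the integral.\<close>

lemma bochner_integrable_iff_approx:
  fixes f :: "'a \<Rightarrow> 'e::banach"
  shows "bochner_integrable M f \<longleftrightarrow>
    f \<in> borel_measurable M \<and> (\<forall>e>0. \<exists>s. simple_function M s \<and> l1dist f s < ennreal e)"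
proof
  assume "bochner_integrable M f"
  then obtain s where s: "f \<in> borel_measurable M" "\<And>k. simple_function M (s k)" "(\<lambda>k. l1dist f (s k)) \<longlonglongrightarrow> 0"
    unfolding bochner_integrable_def bochner_has_integral_def simple_bochner_integrable_iff by auto
  have "\<exists>s. simple_function M s \<and> l1dist f s < ennreal e" if e: "e > 0" for e
  proof -
    have "\<forall>\<^sub>F k in sequentially. l1dist f (s k) < e" using s(3) by (rule order_tendstoD) (use e in simp)
    then show ?thesis using s(2) by (auto simp: eventually_sequentially)
  qed
  then show "f \<in> borel_measurable M \<and> (\<forall>e>0. \<exists>s. simple_function M s \<and> l1dist f s < ennreal e)" using s by blast
next
  assume A: "f \<in> borel_measurable M \<and> (\<forall>e>0. \<exists>s. simple_function M s \<and> l1dist f s < ennreal e)"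
  have "\<forall>i. \<exists>s. simple_function M s \<and> l1dist f s < ennreal (1 / Suc i)" using A by auto
  then obtain s where s: "\<And>i. simple_function M (s i)" "\<And>i. l1dist f (s i) < ennreal (1 / Suc i)" by metis
  have "(\<lambda>i. l1dist f (s i)) \<longlonglongrightarrow> 0"
  proof (rule tendsto_sandwich[of "\<lambda>_. 0" _ _ "\<lambda>i. ennreal (1 / Suc i)"])
    have "(\<lambda>i. 1 / real (Suc i)) \<longlonglongrightarrow> 0" using LIMSEQ_inverse_real_of_nat by (simp add: inverse_eq_divide)
    then have "(\<lambda>i. ennreal (1 / Suc i)) \<longlonglongrightarrow> ennreal 0" by (intro tendsto_ennrealI)
    then show "(\<lambda>i. ennreal (1 / Suc i)) \<longlonglongrightarrow> 0" by simp
  qed (use s(2) in \<open>auto intro!: always_eventually less_imp_le\<close>)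
  then show "bochner_integrable M f"
    using bochner_has_integral_l1_limit[of f s, OF _ bochner_has_integral_simple[OF s(1)]] A
    unfolding bochner_integrable_def by blast
qed

definition bint :: "('a \<Rightarrow> 'e::real_normed_vector) \<Rightarrow> 'e" where
  "bint f = (THE v. bochner_has_integral M f v)"

lemma bint_eq: "bochner_has_integral M f v \<Longrightarrow> bint f = v"
  unfolding bint_def by (rule the_equality) (auto intro: bochner_has_integral_unique)

lemma bint_has_integral: "bochner_integrable M f \<Longrightarrow> bochner_has_integral M f (bint f)"
  unfolding bochner_integrable_def using bint_eq by metis

lemma bochner_set_integral_eq: "bochner_set_integral M A f = bint (\<lambda>x. indicator A x *\<^sub>R f x)"
  by (simp add: bochner_set_integral_def bint_def)

lemma bochner_has_integral_add:
  assumes "bochner_has_integral M f v" "bochner_has_integral M g w"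
  shows "bochner_has_integral M (\<lambda>x. f x + g x) (v + w)"
proof -
  obtain s t where s: "\<And>i. simple_function M (s i)" "(\<lambda>i. l1dist f (s i)) \<longlonglongrightarrow> 0"
      "(\<lambda>i. sint (s i)) \<longlonglongrightarrow> v" and
    t: "\<And>i. simple_function M (t i)" "(\<lambda>i. l1dist g (t i)) \<longlonglongrightarrow> 0"
      "(\<lambda>i. sint (t i)) \<longlonglongrightarrow> w" and
      fg: "f \<in> borel_measurable M" "g \<in> borel_measurable M"
    using assms unfolding bochner_has_integral_def simple_bochner_integrable_iff by auto
  have m: "(\<lambda>x. f x + g x) \<in> borel_measurable M"
    using assms by (intro strongly_measurable_imp_borel strongly_measurable_add bochner_has_integral_strongly)
  have "l1dist (\<lambda>x. f x + g x) (\<lambda>x. s i x + t i x) \<le> l1dist f (s i) + l1dist g (t i)" for i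
  proof -
    have "l1dist (\<lambda>x. f x + g x) (\<lambda>x. s i x + t i x) \<le> (\<integral>\<^sup>+x. ennreal (norm (f x - s i x)) + ennreal (norm (g x - t i x)) \<partial>M)"
      by (intro nn_integral_mono) (metis ennreal_leI ennreal_plus norm_ge_zero norm_diff_triangle_ineq)
    also have "\<dots> = l1dist f (s i) + l1dist g (t i)"
      using borel_measurable_diff_simple[OF fg(1) s(1)] borel_measurable_diff_simple[OF fg(2) t(1)]
      by (intro nn_integral_add) auto
    finally show ?thesis .
  qed
  then have "(\<lambda>i. l1dist (\<lambda>x. f x + g x) (\<lambda>x. s i x + t i x)) \<longlonglongrightarrow> 0"
    by (rule ennreal_squeeze_0) (use tendsto_add[OF s(2) t(2)] in simp)
  moreover have "(\<lambda>i. sint (\<lambda>x. s i x + t i x)) \<longlonglongrightarrow> v + w"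
    using tendsto_add[OF s(3) t(3)] by (subst simple_bochner_integral_add) (auto intro: simple_bochner_integrableI s t)
  ultimately show ?thesis
    unfolding bochner_has_integral_def simple_bochner_integrable_iff
    using m simple_function_compose2[OF s(1) t(1), where h="(+)"] by (intro conjI exI[of _ "\<lambda>i x. s i x + t i x"] allI)
qed

lemma bochner_has_integral_bounded_linear:
  fixes T :: "'e::real_normed_vector \<Rightarrow> 'f::real_normed_vector"
  assumes T: "bounded_linear T" and f: "bochner_has_integral M f v"
  shows "bochner_has_integral M (\<lambda>x. T (f x)) (T v)"
proof -
  obtain s where s: "\<And>i. simple_function M (s i)" "(\<lambda>i. l1dist f (s i)) \<longlonglongrightarrow> 0"
      "(\<lambda>i. sint (s i)) \<longlonglongrightarrow> v" "f \<in> borel_measurable M"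
    using f unfolding bochner_has_integral_def simple_bochner_integrable_iff by auto
  obtain K where K: "K > 0" "\<And>x. norm (T x) \<le> norm x * K" using bounded_linear.pos_bounded[OF T] by blast
  have m: "(\<lambda>x. T (f x)) \<in> borel_measurable M"
    by (rule measurable_compose[OF s(4) borel_measurable_continuous_onI])
       (use T in \<open>auto intro: linear_continuous_on\<close>)
  have "l1dist (\<lambda>x. T (f x)) (\<lambda>x. T (s i x)) \<le> ennreal K * l1dist f (s i)" for i
  proof -
    have "l1dist (\<lambda>x. T (f x)) (\<lambda>x. T (s i x)) \<le> (\<integral>\<^sup>+x. ennreal K * ennreal (norm (f x - s i x)) \<partial>M)"
      using K(2) K(1)
      by (intro nn_integral_mono)
         (simp add: ennreal_mult[symmetric] linear_diff[OF bounded_linear.linear[OF T], symmetric] ennreal_leI mult.commute)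
    also have "\<dots> = ennreal K * l1dist f (s i)"
      using borel_measurable_diff_simple[OF s(4,1)] by (intro nn_integral_cmult) auto
    finally show ?thesis .
  qed
  moreover have "(\<lambda>i. ennreal K * l1dist f (s i)) \<longlonglongrightarrow> 0"
    using ennreal_tendsto_cmult[OF _ s(2), of "ennreal K"] by simp
  ultimately have "(\<lambda>i. l1dist (\<lambda>x. T (f x)) (\<lambda>x. T (s i x))) \<longlonglongrightarrow> 0"
    by (rule ennreal_squeeze_0)
  moreover have "(\<lambda>i. sint (\<lambda>x. T (s i x))) \<longlonglongrightarrow> T v"
    using bounded_linear.tendsto[OF T s(3)]
    by (subst simple_bochner_integral_linear) (auto intro: simple_bochner_integrableI s bounded_linear.linear[OF T])
  ultimately show ?thesis
    unfolding bochner_has_integral_def simple_bochner_integrable_iff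
    using m simple_function_compose1[OF s(1), where g=T] by (intro conjI exI[of _ "\<lambda>i x. T (s i x)"] allI)
qed

lemma bochner_has_integral_scaleR:
  "bochner_has_integral M f v \<Longrightarrow> bochner_has_integral M (\<lambda>x. c *\<^sub>R f x) (c *\<^sub>R v)"
  by (rule bochner_has_integral_bounded_linear[OF bounded_linear_scaleR_right])

lemma bochner_has_integral_diff:
  assumes "bochner_has_integral M f v" "bochner_has_integral M g w"
  shows "bochner_has_integral M (\<lambda>x. f x - g x) (v - w)"
  using bochner_has_integral_add[OF assms(1) bochner_has_integral_scaleR[OF assms(2), of "-1"]] by simp

lemma bochner_has_integral_zero: "bochner_has_integral M (\<lambda>x. 0) 0"
  using bochner_has_integral_simple[of "\<lambda>x. 0"] by (simp add: simple_bochner_integral_zero)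

lemma bochner_has_integral_real_iff:
  fixes f :: "'a \<Rightarrow> real"
  shows "bochner_has_integral M f v \<longleftrightarrow> has_bochner_integral M f v"
  unfolding bochner_has_integral_def has_bochner_integral.simps by auto

lemma bochner_integrable_real_iff:
  fixes f :: "'a \<Rightarrow> real"
  shows "bochner_integrable M f \<longleftrightarrow> integrable M f"
  by (auto simp: bochner_integrable_def bochner_has_integral_real_iff integrable.simps)

lemma bochner_has_integral_norm_bound:
  assumes f: "bochner_has_integral M f v"
  shows "integrable M (\<lambda>x. norm (f x))" "norm v \<le> (\<integral>x. norm (f x) \<partial>M)"
proof -
  obtain s where s: "\<And>i. simple_function M (s i)" "(\<lambda>i. l1dist f (s i)) \<longlonglongrightarrow> 0"
      "(\<lambda>i. sint (s i)) \<longlonglongrightarrow> v" "f \<in> borel_measurable M"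
    using f unfolding bochner_has_integral_def simple_bochner_integrable_iff by auto
  have z: "simple_function M (\<lambda>x. 0)" by simp
  have le: "l1dist f (\<lambda>x. 0) \<le> l1dist f (s i) + l1dist (s i) (\<lambda>x. 0)" for i
    using s(1) by (intro l1dist_triangle s(4) z) (auto simp: strongly_measurable_def intro!: exI[of _ "\<lambda>_. s i"])
  have "\<forall>\<^sub>F k in sequentially. l1dist f (s k) < 1" using s(2) by (rule order_tendstoD) simp
  then obtain k where k: "l1dist f (s k) < 1" by (auto simp: eventually_sequentially)
  have "l1dist (s k) (\<lambda>x. 0) < \<infinity>"
  proof -
    have "simple_function M (\<lambda>x. norm (s k x))" by (rule simple_function_compose1[OF s(1)])
    from simple_bochner_integral_eq_nn_integral[OF simple_bochner_integrableI[OF this], symmetric]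
    have "l1dist (s k) (\<lambda>x. 0) = ennreal (sint (\<lambda>x. norm (s k x)))"
      by simp
    then show ?thesis by (simp only: ennreal_less_top infinity_ennreal_def)
  qed
  then have fin: "l1dist f (\<lambda>x. 0) < \<infinity>"
    
    using le_less_trans[OF le[of k]] less_trans[OF k ennreal_one_less_top] by simp
  then show int: "integrable M (\<lambda>x. norm (f x))"
    using measurable_compose[OF s(4) borel_measurable_norm] by (intro integrableI_bounded) auto
  have "ennreal (norm v) \<le> l1dist f (\<lambda>x. 0)"
  proof (rule LIMSEQ_le)
    show "(\<lambda>i. ennreal (norm (sint (s i)))) \<longlonglongrightarrow> ennreal (norm v)"
      using s(3) by (intro tendsto_ennrealI tendsto_norm)
    show "(\<lambda>i. l1dist f (s i) + l1dist f (\<lambda>x. 0)) \<longlonglongrightarrow> l1dist f (\<lambda>x. 0)"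
      using tendsto_add[OF s(2) tendsto_const[of "l1dist f (\<lambda>x. 0)"]] by simp
    show "\<exists>N. \<forall>n\<ge>N. ennreal (norm (sint (s n))) \<le> l1dist f (s n) + l1dist f (\<lambda>x. 0)"
      using simple_bochner_integral_bounded_general[OF s(4) s(1) z] by (simp add: simple_bochner_integral_zero)
  qed
  also have "\<dots> = ennreal (\<integral>x. norm (f x) \<partial>M)" using int by (simp add: nn_integral_eq_integral)
  finally show "norm v \<le> (\<integral>x. norm (f x) \<partial>M)" by (simp add: ennreal_le_iff)
qed

lemma bochner_integrable_indicator:
  fixes f :: "'a \<Rightarrow> 'e::banach"
  assumes f: "bochner_integrable M f" and A: "A \<in> sets M"
  shows "bochner_integrable M (\<lambda>x. indicator A x *\<^sub>R f x)"
  unfolding bochner_integrable_iff_approx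
proof (intro conjI allI impI)
  have f': "f \<in> borel_measurable M" using f bochner_integrable_iff_approx by blast
  have "(\<lambda>x. if x \<in> A then f x else 0) \<in> borel_measurable M" using f' A by measurable
  moreover have "(\<lambda>x. indicator A x *\<^sub>R f x) = (\<lambda>x. if x \<in> A then f x else 0)" by auto
  ultimately show m: "(\<lambda>x. indicator A x *\<^sub>R f x) \<in> borel_measurable M" by metis
  fix e :: real assume "e > 0"
  then obtain s where s: "simple_function M s" "l1dist f s < ennreal e" using f bochner_integrable_iff_approx by blast
  have "simple_function M (\<lambda>x. indicator A x *\<^sub>R s x)"
    using simple_function_compose2[OF simple_function_indicator[OF A] s(1), of "\<lambda>a b. (a::real) *\<^sub>R b"] by simp
  moreover have "l1dist (\<lambda>x. indicator A x *\<^sub>R f x) (\<lambda>x. indicator A x *\<^sub>R s x) \<le> l1dist f s"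
    by (intro nn_integral_mono) (auto simp: indicator_def)
  ultimately show "\<exists>s. simple_function M s \<and> l1dist (\<lambda>x. indicator A x *\<^sub>R f x) s < ennreal e"
    using s(2) le_less_trans by blast
qed

end

text \<open>Telescoping with summable increments. The majorants are extended reals because they
  arise as integrands whose sum is finite only almost everywhere; completeness of L1 and of H1 both
  apply this at each such point.\<close>

lemma fast_cauchy_limit:
  fixes a :: "nat \<Rightarrow> 'e::banach" and u :: "nat \<Rightarrow> ennreal"
  assumes u: "\<And>n. ennreal (norm (a (Suc n) - a n)) \<le> u n" and fin: "(\<Sum>n. u n) < \<infinity>"
  shows "a \<longlonglongrightarrow> lim a" "ennreal (norm (lim a - a n)) \<le> (\<Sum>j. u (j + n))"
proof -
  let ?d = "\<lambda>n. norm (a (Suc n) - a n)"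
  have "(\<Sum>n. ennreal (?d n)) \<le> (\<Sum>n. u n)" using u by (intro suminf_le) auto
  then have "(\<Sum>n. ennreal (?d n)) < \<infinity>" using fin by (rule le_less_trans)
  then have sd: "summable ?d" by (intro summable_suminf_not_top) auto
  then have "summable (\<lambda>n. a (Suc n) - a n)" by (rule summable_norm_cancel)
  then have "convergent (\<lambda>n. a n - a 0)"
    by (simp add: summable_iff_convergent sum_lessThan_telescope)
  then have "convergent a" by (simp add: convergent_diff_const_right_iff)
  then show lim: "a \<longlonglongrightarrow> lim a" by (simp add: convergent_LIMSEQ_iff)
  have le: "norm (a (k + n) - a n) \<le> (\<Sum>j. ?d (j + n))" for k
  proof -
    have "a (k + n) - a n = (\<Sum>j<k. a (Suc (j + n)) - a (j + n))"
      using sum_lessThan_telescope[of "\<lambda>j. a (j + n)" k] by simp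
    also have "norm \<dots> \<le> (\<Sum>j<k. ?d (j + n))" by (rule norm_sum)
    also have "\<dots> \<le> (\<Sum>j. ?d (j + n))"
      using summable_ignore_initial_segment[OF sd, of n] by (intro sum_le_suminf) auto
    finally show ?thesis .
  qed
  have "norm (lim a - a n) \<le> (\<Sum>j. ?d (j + n))"
  proof (rule LIMSEQ_le_const2)
    show "(\<lambda>k. norm (a (k + n) - a n)) \<longlonglongrightarrow> norm (lim a - a n)"
      using LIMSEQ_ignore_initial_segment[OF lim, of n] by (intro tendsto_intros)
  qed (use le in auto)
  then have "ennreal (norm (lim a - a n)) \<le> ennreal (\<Sum>j. ?d (j + n))" by (rule ennreal_leI)
  also have "\<dots> = (\<Sum>j. ennreal (?d (j + n)))"
    using summable_ignore_initial_segment[OF sd, of n] by (intro suminf_ennreal2[symmetric]) auto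
  also have "\<dots> \<le> (\<Sum>j. u (j + n))" using u by (intro suminf_le) auto
  finally show "ennreal (norm (lim a - a n)) \<le> (\<Sum>j. u (j + n))" .
qed

lemma suminf_geometric_tail_ennreal: "(\<Sum>j. ennreal ((1/2) ^ (j + n))) = ennreal (2 * (1/2) ^ n)"
proof -
  have "(\<Sum>j. (1/2::real) ^ (j + n)) = 2 * (1/2) ^ n"
    using suminf_mult2[of "\<lambda>j. (1/2::real)^j" "(1/2)^n"] by (simp add: suminf_geometric power_add)
  moreover have "summable (\<lambda>j. (1/2::real) ^ (j + n))"
    by (rule summable_ignore_initial_segment) (simp add: summable_geometric)
  ultimately show ?thesis by (subst suminf_ennreal2) auto
qed

context complete_finite_measure
begin

lemma bochner_integrable_add: "bochner_integrable M f \<Longrightarrow> bochner_integrable M g \<Longrightarrow> bochner_integrable M (\<lambda>x. f x + g x)"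
  and bint_add: "bochner_integrable M f \<Longrightarrow> bochner_integrable M g \<Longrightarrow> bint (\<lambda>x. f x + g x) = bint f + bint g"
  unfolding bochner_integrable_def using bochner_has_integral_add bint_eq by metis+

lemma bochner_integrable_diff: "bochner_integrable M f \<Longrightarrow> bochner_integrable M g \<Longrightarrow> bochner_integrable M (\<lambda>x. f x - g x)"
  and bint_diff: "bochner_integrable M f \<Longrightarrow> bochner_integrable M g \<Longrightarrow> bint (\<lambda>x. f x - g x) = bint f - bint g"
  unfolding bochner_integrable_def using bochner_has_integral_diff bint_eq by metis+

lemma bochner_integrable_scaleR: "bochner_integrable M f \<Longrightarrow> bochner_integrable M (\<lambda>x. c *\<^sub>R f x)"
  and bint_scaleR: "bochner_integrable M f \<Longrightarrow> bint (\<lambda>x. c *\<^sub>R f x) = c *\<^sub>R bint f"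
  unfolding bochner_integrable_def using bochner_has_integral_scaleR bint_eq by metis+

lemma bochner_integrable_simple: "simple_function M s \<Longrightarrow> bochner_integrable M s"
  unfolding bochner_integrable_def using bochner_has_integral_simple by blast

lemma bochner_integrable_bounded_linear:
  "bounded_linear T \<Longrightarrow> bochner_integrable M f \<Longrightarrow> bochner_integrable M (\<lambda>x. T (f x))"
  and bint_bounded_linear: "bounded_linear T \<Longrightarrow> bochner_integrable M f \<Longrightarrow> bint (\<lambda>x. T (f x)) = T (bint f)"
  unfolding bochner_integrable_def using bochner_has_integral_bounded_linear bint_eq by metis+

lemma bochner_integrable_norm: "bochner_integrable M f \<Longrightarrow> integrable M (\<lambda>x. norm (f x))"
  unfolding bochner_integrable_def using bochner_has_integral_norm_bound(1) by blast

lemma norm_bint_le: "bochner_integrable M f \<Longrightarrow> norm (bint f) \<le> (\<integral>x. norm (f x) \<partial>M)"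
  using bint_has_integral bochner_has_integral_norm_bound(2) by blast

lemma bint_real: "integrable M f \<Longrightarrow> bint f = (\<integral>x. f x \<partial>M)" for f :: "'a \<Rightarrow> real"
  by (rule bint_eq) (simp add: bochner_has_integral_real_iff has_bochner_integral_integrable)

lemma bochner_has_integral_scaleR_left:
  "integrable M h \<Longrightarrow> bochner_has_integral M (\<lambda>x. h x *\<^sub>R c) ((\<integral>x. h x \<partial>M) *\<^sub>R c)"
  by (rule bochner_has_integral_bounded_linear[OF bounded_linear_scaleR_left])
     (simp add: bochner_has_integral_real_iff has_bochner_integral_integrable)

lemma l1dist_eq_integral:
  assumes "bochner_integrable M f" "bochner_integrable M g"
  shows "l1dist f g = ennreal (\<integral>x. norm (f x - g x) \<partial>M)"
  using bochner_integrable_norm[OF bochner_integrable_diff[OF assms]] by (intro nn_integral_eq_integral) auto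

lemma bochner_approx_simple:
  fixes f :: "'a \<Rightarrow> 'e::banach"
  assumes f: "bochner_integrable M f" and e: "e > 0"
  shows "\<exists>s. simple_function M s \<and> (\<integral>x. norm (f x - s x) \<partial>M) < e"
proof -
  obtain s where s: "simple_function M s" "l1dist f s < ennreal e" using f e bochner_integrable_iff_approx by blast
  then show ?thesis using l1dist_eq_integral[OF f bochner_integrable_simple[OF s(1)]] e
    by (auto simp: ennreal_less_iff)
qed

lemma bint_l1_limit:
  fixes f :: "'a \<Rightarrow> 'e::banach"
  assumes f: "f \<in> borel_measurable M" and g: "\<And>i::nat. bochner_integrable M (g i)"
    and lim: "(\<lambda>i. l1dist f (g i)) \<longlonglongrightarrow> 0"
  shows "bochner_integrable M f" "(\<lambda>i. bint (g i)) \<longlonglongrightarrow> bint f"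
proof -
  obtain w where w: "bochner_has_integral M f w" "(\<lambda>i. bint (g i)) \<longlonglongrightarrow> w"
    using bochner_has_integral_l1_limit[OF f bint_has_integral[OF g] lim] by blast
  then show "bochner_integrable M f" "(\<lambda>i. bint (g i)) \<longlonglongrightarrow> bint f" using bint_eq[OF w(1)]
    by (auto simp: bochner_integrable_def)
qed

text \<open>The Riesz-Fischer argument: a subsequence with increments summable in L1 converges
  almost everywhere, the tail of the increments dominates its distance from the limit, and the
  Cauchy property carries convergence over to the whole sequence.\<close>

lemma bochner_l1_complete:
  fixes g :: "nat \<Rightarrow> 'a \<Rightarrow> 'e::banach"
  assumes g: "\<And>i. bochner_integrable M (g i)"
    and cauchy: "\<And>e. e > 0 \<Longrightarrow> \<exists>n. \<forall>i\<ge>n. \<forall>j\<ge>n. (\<integral>x. norm (g i x - g j x) \<partial>M) < e"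
  shows "\<exists>f. bochner_integrable M f \<and> (\<lambda>i. \<integral>x. norm (f x - g i x) \<partial>M) \<longlonglongrightarrow> 0"
proof -
  have "\<forall>k. \<exists>n. \<forall>i\<ge>n. \<forall>j\<ge>n. (\<integral>x. norm (g i x - g j x) \<partial>M) < (1/2) ^ k" using cauchy by simp
  then obtain N where N: "\<And>k i j. i \<ge> N k \<Longrightarrow> j \<ge> N k \<Longrightarrow> (\<integral>x. norm (g i x - g j x) \<partial>M) < (1/2) ^ k" by metis
  \<comment> \<open>Taking the maximum puts both \<open>r k\<close> and \<open>r (Suc k)\<close>
    beyond \<open>N k\<close>, so the estimate of stage \<open>k\<close> applies to consecutive
    members.\<close>
  define r where "r k = Max (N ` {..k})" for k
  have r: "N j \<le> r k" if "j \<le> k" for j k unfolding r_def using that by (intro Max_ge) auto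
  define a where "a k = g (r k)" for k
  have a: "bochner_integrable M (a k)" for k unfolding a_def by (rule g)
  have dint: "integrable M (\<lambda>x. norm (g i x - g j x))" for i j by (intro bochner_integrable_norm bochner_integrable_diff g)
  define u where "u k x = ennreal (norm (a (Suc k) x - a k x))" for k x
  have um: "u k \<in> borel_measurable M" for k
    unfolding u_def a_def by (rule measurable_compose[OF borel_measurable_integrable[OF dint]]) auto
  have u_int: "(\<integral>\<^sup>+x. u k x \<partial>M) \<le> ennreal ((1/2) ^ k)" for k
    unfolding u_def a_def using N[of k "r (Suc k)" "r k"] r dint
    by (subst nn_integral_eq_integral) (auto intro!: ennreal_leI less_imp_le)
  have tail: "(\<integral>\<^sup>+x. (\<Sum>j. u (j + n) x) \<partial>M) \<le> ennreal (2 * (1/2) ^ n)" for n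
  proof -
    have "(\<integral>\<^sup>+x. (\<Sum>j. u (j + n) x) \<partial>M) = (\<Sum>j. \<integral>\<^sup>+x. u (j + n) x \<partial>M)"
      by (intro nn_integral_suminf um)
    also have "\<dots> \<le> (\<Sum>j. ennreal ((1/2) ^ (j + n)))" using u_int by (intro suminf_le) auto
    finally show ?thesis by (simp add: suminf_geometric_tail_ennreal)
  qed
  have "AE x in M. (\<Sum>j. u j x) \<noteq> \<infinity>"
  proof (rule nn_integral_PInf_AE)
    show "(\<lambda>x. \<Sum>j. u j x) \<in> borel_measurable M" using um by measurable
    have "(\<integral>\<^sup>+x. (\<Sum>j. u j x) \<partial>M) \<le> ennreal 2" using tail[of 0] by simp
    then show "(\<integral>\<^sup>+x. (\<Sum>j. u j x) \<partial>M) \<noteq> \<infinity>" by (auto simp: top_unique)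
  qed
  then have fin: "AE x in M. (\<Sum>j. u j x) < \<infinity>" by (simp add: less_top)
  define f where "f x = lim (\<lambda>k. a k x)" for x
  have fm: "f \<in> borel_measurable M"
  proof (rule borel_measurable_AE_LIMSEQ)
    show "a k \<in> borel_measurable M" for k
      using a by (intro strongly_measurable_imp_borel bochner_integrable_strongly)
    show "AE x in M. (\<lambda>k. a k x) \<longlonglongrightarrow> f x"
      using fin
    proof eventually_elim
      case (elim x)
      show ?case unfolding f_def by (rule fast_cauchy_limit(1)[OF _ elim]) (simp add: u_def)
    qed
  qed
  have le: "l1dist f (a n) \<le> ennreal (2 * (1/2) ^ n)" for n
  proof -
    have "AE x in M. ennreal (norm (f x - a n x)) \<le> (\<Sum>j. u (j + n) x)"
      using fin
    proof eventually_elim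
      case (elim x)
      show ?case unfolding f_def by (rule fast_cauchy_limit(2)[OF _ elim]) (simp add: u_def)
    qed
    then have "l1dist f (a n) \<le> (\<integral>\<^sup>+x. (\<Sum>j. u (j + n) x) \<partial>M)" by (rule nn_integral_mono_AE)
    then show ?thesis using tail order_trans by blast
  qed
  have lim0: "(\<lambda>n. 2 * (1/2) ^ n :: real) \<longlonglongrightarrow> 0" by (intro tendsto_mult_right_zero LIMSEQ_realpow_zero) auto
  have "(\<lambda>n. l1dist f (a n)) \<longlonglongrightarrow> 0"
    by (rule ennreal_squeeze_0[OF le]) (use tendsto_ennrealI[OF lim0] in simp)
  then have f: "bochner_integrable M f" by (rule bint_l1_limit(1)[OF fm a])
  have fd: "integrable M (\<lambda>x. norm (f x - g j x))" for j by (intro bochner_integrable_norm bochner_integrable_diff f g)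
  have le': "(\<integral>x. norm (f x - a n x) \<partial>M) \<le> 2 * (1/2) ^ n" for n
    using le[of n] unfolding l1dist_eq_integral[OF f a] by (simp add: ennreal_le_iff)
  have "(\<lambda>i. \<integral>x. norm (f x - g i x) \<partial>M) \<longlonglongrightarrow> 0"
  proof (rule LIMSEQ_I)
    fix e :: real assume e: "e > 0"
    have "\<forall>\<^sub>F n in sequentially. 2 * (1/2) ^ n < e / 2" using lim0 by (rule order_tendstoD) (use e in simp)
    then obtain n1 where n1: "2 * (1/2) ^ n1 < e / 2" by (auto simp: eventually_sequentially)
    have "norm ((\<integral>x. norm (f x - g i x) \<partial>M) - 0) < e" if i: "i \<ge> N n1" for i
    proof -
      have "(\<integral>x. norm (f x - g i x) \<partial>M) \<le> (\<integral>x. norm (f x - a n1 x) + norm (a n1 x - g i x) \<partial>M)"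
        unfolding a_def using fd dint
        by (intro integral_mono Bochner_Integration.integrable_add) (auto intro: norm_diff_triangle_le)
      also have "\<dots> = (\<integral>x. norm (f x - a n1 x) \<partial>M) + (\<integral>x. norm (a n1 x - g i x) \<partial>M)"
        unfolding a_def using fd dint by (intro Bochner_Integration.integral_add)
      also have "\<dots> < 2 * (1/2) ^ n1 + (1/2) ^ n1"
        using le'[of n1] N[of n1 "r n1" i] r[of n1 n1] i unfolding a_def by (intro add_le_less_mono) auto
      also have "\<dots> < e" using n1 e by (simp add: field_simps)
      finally show ?thesis by simp
    qed
    then show "\<exists>n. \<forall>i\<ge>n. norm ((\<integral>x. norm (f x - g i x) \<partial>M) - 0) < e" by blast
  qed
  then show ?thesis using f by blast
qed

end

section \<open>Conditional expectations\<close>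

context complete_finite_measure
begin

lemma integrable_indicator_sets: "B \<in> sets M \<Longrightarrow> integrable M (indicator B :: 'a \<Rightarrow> real)"
  by (rule integrable_real_indicator) (auto simp: emeasure_finite less_top[symmetric])

text \<open>Completeness of the restricted measure is what allows the whole theory of the Bochner
  integral to be instantiated at the sub-sigma-algebra.\<close>

definition complete_subalgebra :: "'a measure \<Rightarrow> bool" where
  "complete_subalgebra G \<longleftrightarrow> subalgebra M G \<and> complete_measure (restr_to_subalg M G)"

lemma complete_finite_measure_restr:
  assumes "complete_subalgebra G"
  shows "complete_finite_measure (restr_to_subalg M G)"
  using assms finite_measure_restr_to_subalg[of M G] finite_measure_axioms
  unfolding complete_subalgebra_def complete_finite_measure_def by (auto simp: less_top)

lemma simple_function_restr:
  assumes G: "subalgebra M G" and s: "simple_function (restr_to_subalg M G) s"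
  shows "simple_function M s"
    "Bochner_Integration.simple_bochner_integral (restr_to_subalg M G) s = sint s"
proof -
  show 1: "simple_function M s"
    using s G unfolding simple_function_def space_restr_to_subalg sets_restr_to_subalg[OF G] subalgebra_def by blast
  have "{x \<in> space M. s x = y} \<in> sets G" if "y \<in> s ` space M" for y
  proof -
    have "{x \<in> space M. s x = y} = s -` {y} \<inter> space M" by auto
    then show ?thesis using s that unfolding simple_function_def space_restr_to_subalg sets_restr_to_subalg[OF G] by metis
  qed
  then show "Bochner_Integration.simple_bochner_integral (restr_to_subalg M G) s = sint s"
    unfolding simple_bochner_integral_def space_restr_to_subalg
    by (intro sum.cong refl arg_cong2[where f=scaleR]) (simp add: measure_def emeasure_restr_to_subalg[OF G])
qed

text \<open>Simple functions of the subalgebra are simple, and distances measurable for the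
  subalgebra have the same integral, so one approximating sequence serves both measures.\<close>

lemma bochner_integrable_restr:
  assumes G: "complete_subalgebra G" and f: "bochner_integrable (restr_to_subalg M G) f"
  shows "bochner_integrable M f"
proof -
  interpret R: complete_finite_measure "restr_to_subalg M G" by (rule complete_finite_measure_restr[OF G])
  have sub: "subalgebra M G" using G by (simp add: complete_subalgebra_def)
  obtain v s where s: "\<And>i. simple_function (restr_to_subalg M G) (s i)" "(\<lambda>i. R.l1dist f (s i)) \<longlonglongrightarrow> 0"
      "(\<lambda>i. Bochner_Integration.simple_bochner_integral (restr_to_subalg M G) (s i)) \<longlonglongrightarrow> v"
      "f \<in> borel_measurable (restr_to_subalg M G)"
    using f unfolding bochner_integrable_def bochner_has_integral_def R.simple_bochner_integrable_iff by auto
  have "R.l1dist f (s i) = l1dist f (s i)" for i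
  proof (rule nn_integral_subalgebra2[OF sub])
    have "(\<lambda>x. f x - s i x) \<in> borel_measurable (restr_to_subalg M G)"
      by (rule R.borel_measurable_diff_simple[OF s(4) s(1)])
    then have "(\<lambda>x. f x - s i x) \<in> borel_measurable G"
      by (simp cong: measurable_cong_sets add: sets_restr_to_subalg[OF sub])
    then show "(\<lambda>x. ennreal (norm (f x - s i x))) \<in> borel_measurable G" by measurable
  qed
  moreover have "f \<in> borel_measurable M"
  proof (rule measurable_from_subalg[OF sub])
    show "f \<in> borel_measurable G" using s(4) by (simp cong: measurable_cong_sets add: sets_restr_to_subalg[OF sub])
  qed
  ultimately have "bochner_has_integral M f v"
    using s unfolding bochner_has_integral_def simple_bochner_integrable_iff
    by (intro conjI exI[of _ s] allI) (auto simp: simple_function_restr[OF sub])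
  then show ?thesis by (auto simp: bochner_integrable_def)
qed

lemma subalgebra_sets: "subalgebra M G \<Longrightarrow> A \<in> sets G \<Longrightarrow> A \<in> sets M"
  by (auto simp: subalgebra_def)

lemma is_cond_expD:
  assumes "complete_subalgebra G" "is_cond_exp M G f g"
  shows "bochner_integrable M f" "bochner_integrable M g" "bochner_integrable (restr_to_subalg M G) g"
    "A \<in> sets G \<Longrightarrow> bint (\<lambda>x. indicator A x *\<^sub>R g x) = bint (\<lambda>x. indicator A x *\<^sub>R f x)"
  using assms bochner_integrable_restr by (auto simp: is_cond_exp_def bochner_set_integral_eq)

lemma is_cond_expI:
  assumes "bochner_integrable M f" "bochner_integrable (restr_to_subalg M G) g"
    "\<And>A. A \<in> sets G \<Longrightarrow> bint (\<lambda>x. indicator A x *\<^sub>R g x) = bint (\<lambda>x. indicator A x *\<^sub>R f x)"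
  shows "is_cond_exp M G f g"
  using assms by (auto simp: is_cond_exp_def bochner_set_integral_eq)

lemma is_cond_exp_add:
  fixes f f' g g' :: "'a \<Rightarrow> 'e::banach"
  assumes G: "complete_subalgebra G" and fg: "is_cond_exp M G f g" "is_cond_exp M G f' g'"
  shows "is_cond_exp M G (\<lambda>x. f x + f' x) (\<lambda>x. g x + g' x)"
proof -
  interpret R: complete_finite_measure "restr_to_subalg M G" by (rule complete_finite_measure_restr[OF G])
  note d = is_cond_expD[OF G fg(1)] is_cond_expD[OF G fg(2)]
  have "bint (\<lambda>x. indicator A x *\<^sub>R (g x + g' x)) = bint (\<lambda>x. indicator A x *\<^sub>R (f x + f' x))" if A: "A \<in> sets G" for A
  proof -
    have A': "A \<in> sets M" using G A by (auto simp: complete_subalgebra_def intro: subalgebra_sets)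
    show ?thesis unfolding scaleR_add_right using d A A' by (simp add: bint_add bochner_integrable_indicator)
  qed
  then show ?thesis using d by (intro is_cond_expI bochner_integrable_add R.bochner_integrable_add) auto
qed

lemma is_cond_exp_scaleR:
  fixes f g :: "'a \<Rightarrow> 'e::banach"
  assumes G: "complete_subalgebra G" and fg: "is_cond_exp M G f g"
  shows "is_cond_exp M G (\<lambda>x. c *\<^sub>R f x) (\<lambda>x. c *\<^sub>R g x)"
proof -
  interpret R: complete_finite_measure "restr_to_subalg M G" by (rule complete_finite_measure_restr[OF G])
  note d = is_cond_expD[OF G fg]
  have "bint (\<lambda>x. indicator A x *\<^sub>R c *\<^sub>R g x) = bint (\<lambda>x. indicator A x *\<^sub>R c *\<^sub>R f x)" if A: "A \<in> sets G" for A
  proof -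
    have A': "A \<in> sets M" using G A by (auto simp: complete_subalgebra_def intro: subalgebra_sets)
    have "bint (\<lambda>x. c *\<^sub>R (indicator A x *\<^sub>R g x)) = bint (\<lambda>x. c *\<^sub>R (indicator A x *\<^sub>R f x))"
      using d A A' by (simp add: bint_scaleR bochner_integrable_indicator del: scaleR_scaleR)
    then show ?thesis by (simp add: mult.commute)
  qed
  then show ?thesis using d by (intro is_cond_expI bochner_integrable_scaleR R.bochner_integrable_scaleR) auto
qed

lemma is_cond_exp_diff:
  fixes f f' g g' :: "'a \<Rightarrow> 'e::banach"
  assumes G: "complete_subalgebra G" and fg: "is_cond_exp M G f g" "is_cond_exp M G f' g'"
  shows "is_cond_exp M G (\<lambda>x. f x - f' x) (\<lambda>x. g x - g' x)"
  using is_cond_exp_add[OF G fg(1) is_cond_exp_scaleR[OF G fg(2), of "-1"]] by simp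

lemma integral_norm_indicator_approx:
  fixes f g :: "'a \<Rightarrow> 'e::banach"
  assumes f: "bochner_integrable M f" and g: "bochner_integrable M g" and A: "A \<in> sets M"
  shows "(\<integral>x. indicator A x * norm (f x) \<partial>M) \<le> (\<integral>x. indicator A x * norm (g x) \<partial>M) + (\<integral>x. indicator A x * norm (f x - g x) \<partial>M)"
proof -
  have i: "integrable M (\<lambda>x. indicator A x * norm (h x))" if "bochner_integrable M h" for h :: "'a \<Rightarrow> 'e"
    using integrable_mult_indicator[OF A bochner_integrable_norm[OF that]] by simp
  have "(\<integral>x. indicator A x * norm (f x) \<partial>M) \<le> (\<integral>x. indicator A x * norm (g x) + indicator A x * norm (f x - g x) \<partial>M)"
    using i[OF f] i[OF g] i[OF bochner_integrable_diff[OF f g]]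
    by (intro integral_mono Bochner_Integration.integrable_add) (auto simp: indicator_def norm_triangle_sub)
  also have "\<dots> = (\<integral>x. indicator A x * norm (g x) \<partial>M) + (\<integral>x. indicator A x * norm (f x - g x) \<partial>M)"
    using i[OF g] i[OF bochner_integrable_diff[OF f g]] by (intro Bochner_Integration.integral_add)
  finally show ?thesis .
qed

lemma integrable_indicator_norm:
  fixes h :: "'a \<Rightarrow> 'e::banach"
  assumes "bochner_integrable M h" "A \<in> sets M"
  shows "integrable M (\<lambda>x. indicator A x * norm (h x))"
  using integrable_mult_indicator[OF assms(2) bochner_integrable_norm[OF assms(1)]] by simp

lemma integral_simple_split:
  fixes h :: "'a \<Rightarrow> real"
  assumes s: "simple_function M s" and h: "integrable M h" and D: "D \<in> sets M"
  shows "(\<integral>x. indicator D x * h x \<partial>M) = (\<Sum>c\<in>s ` space M. \<integral>x. indicator (D \<inter> (s -` {c} \<inter> space M)) x * h x \<partial>M)"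
proof -
  have fin: "finite (s ` space M)" using s by (simp add: simple_function_def)
  have sets: "D \<inter> (s -` {c} \<inter> space M) \<in> sets M" if "c \<in> s ` space M" for c
    using s D that by (auto simp: simple_function_def)
  have "(\<integral>x. indicator D x * h x \<partial>M) = (\<integral>x. (\<Sum>c\<in>s ` space M. indicator (D \<inter> (s -` {c} \<inter> space M)) x * h x) \<partial>M)"
  proof (rule Bochner_Integration.integral_cong[OF refl])
    fix x assume x: "x \<in> space M"
    have "(\<Sum>c\<in>s ` space M. indicator (D \<inter> (s -` {c} \<inter> space M)) x * h x) =
        (\<Sum>c\<in>s ` space M. if c = s x then indicator D x * h x else 0)"
      using x by (intro sum.cong) (auto simp: indicator_def)
    also have "\<dots> = indicator D x * h x" using fin x by (simp add: sum.delta)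
    finally show "indicator D x * h x = (\<Sum>c\<in>s ` space M. indicator (D \<inter> (s -` {c} \<inter> space M)) x * h x)" by simp
  qed
  also have "\<dots> = (\<Sum>c\<in>s ` space M. \<integral>x. indicator (D \<inter> (s -` {c} \<inter> space M)) x * h x \<partial>M)"
    using integrable_mult_indicator[OF sets h] by (intro Bochner_Integration.integral_sum) auto
  finally show ?thesis .
qed

text \<open>Contractivity of conditional expectation, localized to events of the subalgebra. On a
  level set of a simple function the integral of the norm is the norm of the vector integral, and
  vector integrals over events of \<open>G\<close> are the same for \<open>g\<close> and
  \<open>f\<close>. Summing over the level sets of an approximation of \<open>g\<close> gives the
  claim up to an error.\<close>

lemma cond_exp_norm_le:
  fixes f g :: "'a \<Rightarrow> 'e::banach"
  assumes G: "complete_subalgebra G" and fg: "is_cond_exp M G f g" and D: "D \<in> sets G"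
  shows "(\<integral>x. indicator D x * norm (g x) \<partial>M) \<le> (\<integral>x. indicator D x * norm (f x) \<partial>M)"
proof (rule field_le_epsilon)
  fix e :: real assume e: "e > 0"
  interpret R: complete_finite_measure "restr_to_subalg M G" by (rule complete_finite_measure_restr[OF G])
  have sub: "subalgebra M G" using G by (simp add: complete_subalgebra_def)
  note d = is_cond_expD[OF G fg]
  have DM: "D \<in> sets M" using D sub by (rule subalgebra_sets[rotated])
  \<comment> \<open>The approximation is taken for the restricted measure, because the level sets of
    \<open>s\<close> have to belong to \<open>G\<close>.\<close>
  obtain s where s: "simple_function (restr_to_subalg M G) s" "(\<integral>x. norm (g x - s x) \<partial>restr_to_subalg M G) < e / 2"
    using R.bochner_approx_simple[OF d(3), of "e/2"] e by auto
  have sM: "simple_function M s" by (rule simple_function_restr[OF sub s(1)])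
  have sb: "bochner_integrable M s" by (rule bochner_integrable_simple[OF sM])
  have gs: "bochner_integrable M (\<lambda>x. g x - s x)" by (rule bochner_integrable_diff[OF d(2) sb])
  have "(\<lambda>x. norm (g x - s x)) \<in> borel_measurable (restr_to_subalg M G)"
    using R.bochner_integrable_norm[OF R.bochner_integrable_diff[OF d(3) R.bochner_integrable_simple[OF s(1)]]] by simp
  then have "(\<lambda>x. norm (g x - s x)) \<in> borel_measurable G"
    by (simp cong: measurable_cong_sets add: sets_restr_to_subalg[OF sub])
  from integral_subalgebra2[OF sub this] have gs_le: "(\<integral>x. norm (g x - s x) \<partial>M) < e / 2" using s(2) by simp
  let ?D = "\<lambda>c. D \<inter> (s -` {c} \<inter> space M)"
  have DcG: "?D c \<in> sets G" if "c \<in> s ` space M" for c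
    using s(1) D that by (auto simp: simple_function_def space_restr_to_subalg sets_restr_to_subalg[OF sub])
  have Dc: "?D c \<in> sets M" if "c \<in> s ` space M" for c using DcG[OF that] sub by (rule subalgebra_sets[rotated])
  have le_c: "(\<integral>x. indicator (?D c) x * norm (s x) \<partial>M) \<le>
      (\<integral>x. indicator (?D c) x * norm (f x) \<partial>M) + (\<integral>x. indicator (?D c) x * norm (g x - s x) \<partial>M)"
    if c: "c \<in> s ` space M" for c
  proof -
    let ?A = "?D c"
    have A: "?A \<in> sets M" by (rule Dc[OF c])
    have "(\<integral>x. indicator ?A x * norm (s x) \<partial>M) = (\<integral>x. indicator ?A x * norm c \<partial>M)"
      by (intro Bochner_Integration.integral_cong) (auto simp: indicator_def)
    also have "\<dots> = measure M ?A * norm c" using A by simp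
    also have "\<dots> = norm (measure M ?A *\<^sub>R c)" by simp
    also have "measure M ?A *\<^sub>R c = bint (\<lambda>x. indicator ?A x *\<^sub>R s x)"
    proof -
      have "bochner_has_integral M (\<lambda>x. indicator ?A x *\<^sub>R c) (measure M ?A *\<^sub>R c)"
        using bochner_has_integral_scaleR_left[OF integrable_indicator_sets[OF A], of c] A by simp
      moreover have "(\<lambda>x. indicator ?A x *\<^sub>R c) = (\<lambda>x. indicator ?A x *\<^sub>R s x)" by (auto simp: indicator_def)
      ultimately show ?thesis by (metis bint_eq)
    qed
    also have "\<dots> = bint (\<lambda>x. indicator ?A x *\<^sub>R g x - indicator ?A x *\<^sub>R (g x - s x))"
      by (simp add: scaleR_diff_right)
    also have "\<dots> = bint (\<lambda>x. indicator ?A x *\<^sub>R g x) - bint (\<lambda>x. indicator ?A x *\<^sub>R (g x - s x))"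
      by (intro bint_diff bochner_integrable_indicator d gs A)
    also have "\<dots> = bint (\<lambda>x. indicator ?A x *\<^sub>R f x) - bint (\<lambda>x. indicator ?A x *\<^sub>R (g x - s x))"
      using d(4)[OF DcG[OF c]] by simp
    also have "norm \<dots> \<le> norm (bint (\<lambda>x. indicator ?A x *\<^sub>R f x)) + norm (bint (\<lambda>x. indicator ?A x *\<^sub>R (g x - s x)))"
      by (rule norm_triangle_ineq4)
    also have "\<dots> \<le> (\<integral>x. norm (indicator ?A x *\<^sub>R f x) \<partial>M) + (\<integral>x. norm (indicator ?A x *\<^sub>R (g x - s x)) \<partial>M)"
      by (intro add_mono norm_bint_le bochner_integrable_indicator d gs A)
    finally show ?thesis by simp
  qed
  have "(\<integral>x. indicator D x * norm (s x) \<partial>M) = (\<Sum>c\<in>s ` space M. \<integral>x. indicator (?D c) x * norm (s x) \<partial>M)"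
    by (rule integral_simple_split[OF sM bochner_integrable_norm[OF sb] DM])
  also have "\<dots> \<le> (\<Sum>c\<in>s ` space M. (\<integral>x. indicator (?D c) x * norm (f x) \<partial>M) + (\<integral>x. indicator (?D c) x * norm (g x - s x) \<partial>M))"
    by (intro sum_mono le_c)
  also have "\<dots> = (\<integral>x. indicator D x * norm (f x) \<partial>M) + (\<integral>x. indicator D x * norm (g x - s x) \<partial>M)"
    unfolding sum.distrib integral_simple_split[OF sM bochner_integrable_norm[OF d(1)] DM]
      integral_simple_split[OF sM bochner_integrable_norm[OF gs] DM] ..
  finally have 1: "(\<integral>x. indicator D x * norm (s x) \<partial>M) \<le> \<dots>" .
  have 2: "(\<integral>x. indicator D x * norm (g x - s x) \<partial>M) \<le> (\<integral>x. norm (g x - s x) \<partial>M)"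
    using integrable_indicator_norm[OF gs DM] bochner_integrable_norm[OF gs]
    by (intro integral_mono) (auto simp: indicator_def)
  show "(\<integral>x. indicator D x * norm (g x) \<partial>M) \<le> (\<integral>x. indicator D x * norm (f x) \<partial>M) + e"
    using integral_norm_indicator_approx[OF d(2) sb DM] 1 2 gs_le by linarith
qed

lemma cond_exp_norm_le_space:
  fixes f g :: "'a \<Rightarrow> 'e::banach"
  assumes G: "complete_subalgebra G" and fg: "is_cond_exp M G f g"
  shows "(\<integral>x. norm (g x) \<partial>M) \<le> (\<integral>x. norm (f x) \<partial>M)"
proof -
  have "space M \<in> sets G" using G by (metis complete_subalgebra_def sets.top subalgebra_def)
  from cond_exp_norm_le[OF G fg this] show ?thesis
    by (simp cong: Bochner_Integration.integral_cong)
qed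

lemma is_cond_exp_indicator:
  fixes c :: "'e::banach"
  assumes G: "complete_subalgebra G" and B: "B \<in> sets M"
  shows "is_cond_exp M G (\<lambda>x. indicator B x *\<^sub>R c) (\<lambda>x. real_cond_exp M G (indicator B) x *\<^sub>R c)"
proof (rule is_cond_expI)
  have sub: "subalgebra M G" using G by (simp add: complete_subalgebra_def)
  interpret S: finite_measure_subalgebra M G by standard (rule sub)
  interpret R: complete_finite_measure "restr_to_subalg M G" by (rule complete_finite_measure_restr[OF G])
  have iB: "integrable M (indicator B :: 'a \<Rightarrow> real)" by (rule integrable_indicator_sets[OF B])
  have h: "integrable M (real_cond_exp M G (indicator B))" by (rule S.real_cond_exp_int(1)[OF iB])
  then have "integrable (restr_to_subalg M G) (real_cond_exp M G (indicator B))"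
    by (rule integrable_in_subalg[OF sub borel_measurable_cond_exp])
  then show "bochner_integrable (restr_to_subalg M G) (\<lambda>x. real_cond_exp M G (indicator B) x *\<^sub>R c)"
    using R.bochner_has_integral_scaleR_left unfolding bochner_integrable_def by blast
  show "bochner_integrable M (\<lambda>x. indicator B x *\<^sub>R c)"
    using bochner_has_integral_scaleR_left[OF iB] unfolding bochner_integrable_def by blast
  fix A assume A: "A \<in> sets G"
  then have AM: "A \<in> sets M" using sub by (rule subalgebra_sets[rotated])
  have "bint (\<lambda>x. (indicator A x * u x) *\<^sub>R c) = (\<integral>x. indicator A x * u x \<partial>M) *\<^sub>R c" if "integrable M u" for u :: "'a \<Rightarrow> real"
    using integrable_mult_indicator[OF AM that] by (intro bint_eq bochner_has_integral_scaleR_left) simp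
  from this[OF h] this[OF iB] show "bint (\<lambda>x. indicator A x *\<^sub>R real_cond_exp M G (indicator B) x *\<^sub>R c) = bint (\<lambda>x. indicator A x *\<^sub>R indicator B x *\<^sub>R c)"
    using S.real_cond_exp_intA[OF iB A] by (simp add: set_lebesgue_integral_def)
qed

section \<open>Convergence of closed martingales in L1\<close>

lemma real_cond_exp_indicator_bounds:
  assumes G: "subalgebra M G" and B: "B \<in> sets M"
  shows "AE x in M. 0 \<le> real_cond_exp M G (indicator B) x \<and> real_cond_exp M G (indicator B) x \<le> 1"
proof -
  interpret S: finite_measure_subalgebra M G by standard (rule G)
  have iB: "integrable M (indicator B :: 'a \<Rightarrow> real)" by (rule integrable_indicator_sets[OF B])
  have "AE x in M. real_cond_exp M G (indicator B) x \<ge> 0" using B by (intro S.real_cond_exp_pos) auto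
  moreover have "AE x in M. real_cond_exp M G (indicator B) x \<le> 1"
    by (rule S.real_cond_exp_le_c[OF iB]) (auto simp: indicator_def)
  ultimately show ?thesis by eventually_elim simp
qed

text \<open>Orthogonality of martingale increments: the squared L2 norms \<open>a k\<close> increase
  and are bounded by the total mass, and \<open>a l - a k\<close> is the squared L2 distance of the
  corresponding conditional expectations. Cauchy-Schwarz descends to L1.\<close>

lemma martingale_indicator_cauchy:
  assumes F: "\<And>k::nat. subalgebra M (F k)" "\<And>k l. k \<le> l \<Longrightarrow> sets (F k) \<subseteq> sets (F l)" and B: "B \<in> sets M" and e: "e > 0"
  shows "\<exists>n. \<forall>k\<ge>n. \<forall>l\<ge>n. (\<integral>x. \<bar>real_cond_exp M (F k) (indicator B) x - real_cond_exp M (F l) (indicator B) x\<bar> \<partial>M) < e"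
proof -
  define h where "h k = real_cond_exp M (F k) (indicator B)" for k
  have S: "finite_measure_subalgebra M (F k)" for k by standard (rule F)
  have sig: "sigma_finite_subalgebra M (F k)" for k using S by (rule finite_measure_subalgebra_is_sigma_finite)
  have iB: "integrable M (indicator B :: 'a \<Rightarrow> real)" by (rule integrable_indicator_sets[OF B])
  have hm: "h k \<in> borel_measurable M" "h k \<in> borel_measurable (F k)" for k by (auto simp: h_def)
  have sp: "space (F k) = space (F l)" for k l using F(1) by (simp add: subalgebra_def)
  have hml: "h k \<in> borel_measurable (F l)" if "k \<le> l" for k l
    using hm(2)[of k] F(2)[OF that] sp[of k l] by (auto simp: measurable_def)
  have hb: "AE x in M. 0 \<le> h k x \<and> h k x \<le> 1" for k
    unfolding h_def by (rule real_cond_exp_indicator_bounds[OF F(1) B])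
  have hh: "integrable M (\<lambda>x. h k x * h l x)" for k l
  proof (rule integrable_const_bound[where B=1])
    show "AE x in M. norm (h k x * h l x) \<le> 1"
      using hb[of k] hb[of l] by eventually_elim (auto simp: abs_mult intro: mult_le_one)
  qed (use hm in measurable)
  have hB: "integrable M (\<lambda>x. h k x * indicator B x)" for k
  proof (rule integrable_const_bound[where B=1])
    show "AE x in M. norm (h k x * indicator B x) \<le> 1"
      using hb[of k] by eventually_elim (auto simp: abs_mult indicator_def)
  qed (use hm B in measurable)
  define a where "a k = (\<integral>x. h k x * h k x \<partial>M)" for k
  \<comment> \<open>For \<open>k \<le> l\<close> the function \<open>h k\<close> is measurable for
    both subalgebras, so either conditional expectation can be undone against it; both sides equal
    the integral of \<open>h k\<close> over \<open>B\<close>.\<close>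
  have cross: "(\<integral>x. h k x * h l x \<partial>M) = a k" if "k \<le> l" for k l
  proof -
    have "(\<integral>x. h k x * h l x \<partial>M) = (\<integral>x. h k x * indicator B x \<partial>M)"
      unfolding h_def[of l]
      using sigma_finite_subalgebra.real_cond_exp_intg(2)[OF sig hB hml[OF that]] B by simp
    moreover have "a k = (\<integral>x. h k x * indicator B x \<partial>M)"
      unfolding a_def h_def[of k]
      using sigma_finite_subalgebra.real_cond_exp_intg(2)[OF sig hB hm(2)] B by (simp add: h_def)
    ultimately show ?thesis by simp
  qed
  have diff: "(\<integral>x. (h l x - h k x)\<^sup>2 \<partial>M) = a l - a k" if "k \<le> l" for k l
  proof -
    have "(\<integral>x. (h l x - h k x)\<^sup>2 \<partial>M) = (\<integral>x. h l x * h l x - 2 * (h k x * h l x) + h k x * h k x \<partial>M)"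
      by (intro Bochner_Integration.integral_cong) (auto simp: power2_eq_square algebra_simps)
    also have "\<dots> = a l - 2 * a k + a k" using hh cross[OF that] by (simp add: a_def)
    finally show ?thesis by simp
  qed
  have inc: "incseq a"
  proof (rule incseq_SucI)
    fix k
    have "0 \<le> (\<integral>x. (h (Suc k) x - h k x)\<^sup>2 \<partial>M)" by simp
    then show "a k \<le> a (Suc k)" using diff[of k "Suc k"] by simp
  qed
  have bd: "a k \<le> measure M (space M)" for k
  proof -
    have "a k \<le> (\<integral>x. 1 \<partial>M)" unfolding a_def
    proof (rule integral_mono_AE[OF hh])
      show "AE x in M. h k x * h k x \<le> 1" using hb[of k] by eventually_elim (auto intro: mult_le_one)
    qed simp
    then show ?thesis by simp
  qed
  \<comment> \<open>The added 1 keeps this positive for a vanishing measure. With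
    \<open>t = e / \<mu>\<close> below, the tolerance \<open>e\<^sup>2 / \<mu>\<close> bounds the
    variance term by \<open>e\<close>, and the term \<open>t\<close> times the total mass is below
    \<open>e\<close>; half of their sum is below \<open>e\<close>.\<close>
  define \<mu> where "\<mu> = measure M (space M) + 1"
  have \<mu>: "\<mu> > 0" unfolding \<mu>_def by (simp add: add_nonneg_pos)
  obtain L where "a \<longlonglongrightarrow> L" using incseq_convergent[OF inc] bd by metis
  then have "Cauchy a" by (rule LIMSEQ_imp_Cauchy)
  then obtain n where n: "\<And>k l. k \<ge> n \<Longrightarrow> l \<ge> n \<Longrightarrow> dist (a k) (a l) < e\<^sup>2 / \<mu>"
    using metric_CauchyD[of a "e\<^sup>2 / \<mu>"] e \<mu> by auto
  have main: "(\<integral>x. \<bar>h l x - h k x\<bar> \<partial>M) < e" if kl: "n \<le> k" "k \<le> l" for k l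
  proof -
    have sq: "integrable M (\<lambda>x. (h l x - h k x)\<^sup>2)"
    proof -
      have "integrable M (\<lambda>x. h l x * h l x - 2 * (h k x * h l x) + h k x * h k x)" using hh by simp
      moreover have "(\<lambda>x. h l x * h l x - 2 * (h k x * h l x) + h k x * h k x) = (\<lambda>x. (h l x - h k x)\<^sup>2)"
        by (auto simp: power2_eq_square algebra_simps)
      ultimately show ?thesis by simp
    qed
    have int: "integrable M (\<lambda>x. \<bar>h l x - h k x\<bar>)"
    proof (rule integrable_const_bound[where B=1])
      show "AE x in M. norm \<bar>h l x - h k x\<bar> \<le> 1" using hb[of k] hb[of l] by eventually_elim auto
    qed (use hm in measurable)
    txt \<open>Cauchy-Schwarz, in the form \<open>2 * u \<le> u\<^sup>2 / t + t\<close>.\<close>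
    define t where "t = e / \<mu>"
    have t: "t > 0" using e \<mu> by (simp add: t_def)
    have am: "\<bar>u\<bar> \<le> (u\<^sup>2 / t + t) / 2" for u :: real
    proof -
      have "0 \<le> (\<bar>u\<bar> - t)\<^sup>2 / t" using t by simp
      then show ?thesis using t by (simp add: power2_eq_square field_simps)
    qed
    have "(\<integral>x. \<bar>h l x - h k x\<bar> \<partial>M) \<le> (\<integral>x. ((h l x - h k x)\<^sup>2 / t + t) / 2 \<partial>M)"
      using sq by (intro integral_mono int am) simp
    also have "\<dots> = ((\<integral>x. (h l x - h k x)\<^sup>2 \<partial>M) / t + t * measure M (space M)) / 2"
      using sq by simp
    also have "(\<integral>x. (h l x - h k x)\<^sup>2 \<partial>M) = a l - a k" by (rule diff[OF kl(2)])
    also have "(a l - a k) / t \<le> (e\<^sup>2 / \<mu>) / t"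
      using n[of k l] kl t by (intro divide_right_mono) (auto simp: dist_real_def)
    also have "(e\<^sup>2 / \<mu>) / t = e" using e \<mu> by (simp add: t_def power2_eq_square)
    also have "t * measure M (space M) < t * \<mu>" using t by (simp add: \<mu>_def)
    also have "t * \<mu> = e" using \<mu> by (simp add: t_def)
    finally show ?thesis by simp
  qed
  have "(\<integral>x. \<bar>h k x - h l x\<bar> \<partial>M) < e" if "n \<le> k" "n \<le> l" for k l
    using main[of k l] main[of l k] that by (cases "k \<le> l") (auto simp: abs_minus_commute)
  then show ?thesis unfolding h_def by blast
qed

text \<open>By contractivity an L1 approximation of \<open>f\<close> by a simple function
  approximates all its conditional expectations with the same error, and a simple function leads to
  finitely many martingales of indicators.\<close>

lemma martingale_cauchy:
  fixes f :: "'a \<Rightarrow> 'e::banach"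
  assumes F: "\<And>k::nat. complete_subalgebra (F k)" "\<And>k l. k \<le> l \<Longrightarrow> sets (F k) \<subseteq> sets (F l)"
    and m: "\<And>k. is_cond_exp M (F k) f (m k)" and e: "e > 0"
  shows "\<exists>n. \<forall>k\<ge>n. \<forall>l\<ge>n. (\<integral>x. norm (m k x - m l x) \<partial>M) < e"
proof -
  have f: "bochner_integrable M f" by (rule is_cond_expD(1)[OF F(1) m])
  have sub: "subalgebra M (F k)" for k using F(1) by (simp add: complete_subalgebra_def)
  obtain s where s: "simple_function M s" "(\<integral>x. norm (f x - s x) \<partial>M) < e / 3"
    using bochner_approx_simple[OF f, of "e/3"] e by auto
  let ?C = "s ` space M"
  have fin: "finite ?C" using s by (simp add: simple_function_def)
  define B where "B c = s -` {c} \<inter> space M" for c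
  have B: "B c \<in> sets M" if "c \<in> ?C" for c using s that by (auto simp: simple_function_def B_def)
  define h where "h c k = real_cond_exp M (F k) (indicator (B c))" for c k
  define H where "H k x = (\<Sum>c\<in>?C. h c k x *\<^sub>R c)" for k x
  \<comment> \<open>The same simple function as a finite sum of indicators, to which linearity of
    conditional expectation applies. It agrees with \<open>s\<close> on the space only, which is all
    that the integrals see.\<close>
  define s' where "s' x = (\<Sum>c\<in>?C. indicator (B c) x *\<^sub>R c)" for x
  have s': "s' x = s x" if "x \<in> space M" for x
  proof -
    have "s' x = (\<Sum>c\<in>?C. if c = s x then c else 0)"
      unfolding s'_def using that by (intro sum.cong) (auto simp: B_def indicator_def)
    then show ?thesis using fin that by simp
  qed
  have sH: "is_cond_exp M (F k) s' (H k)" for k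
  proof -
    have zero: "is_cond_exp M (F k) (\<lambda>x. 0) (\<lambda>x. 0 :: 'e)"
      using is_cond_exp_scaleR[OF F(1) m, where c=0] by simp
    have "is_cond_exp M (F k) (\<lambda>x. \<Sum>c\<in>C. indicator (B c) x *\<^sub>R c) (\<lambda>x. \<Sum>c\<in>C. h c k x *\<^sub>R c)" if "C \<subseteq> ?C" "finite C" for C
      using that(2,1)
    proof (induction C rule: finite_induct)
      case (insert c C)
      then have "is_cond_exp M (F k) (\<lambda>x. indicator (B c) x *\<^sub>R c + (\<Sum>c\<in>C. indicator (B c) x *\<^sub>R c))
          (\<lambda>x. h c k x *\<^sub>R c + (\<Sum>c\<in>C. h c k x *\<^sub>R c))"
        unfolding h_def by (intro is_cond_exp_add[OF F(1)] is_cond_exp_indicator[OF F(1)] B) auto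
      then show ?case unfolding sum.insert[OF insert(1,2)] .
    qed (simp add: zero)
    from this[OF order_refl fin] show ?thesis by (simp add: s'_def[abs_def] H_def[abs_def])
  qed
  have mH: "(\<integral>x. norm (m k x - H k x) \<partial>M) < e / 3" for k
  proof -
    have "(\<integral>x. norm (m k x - H k x) \<partial>M) \<le> (\<integral>x. norm (f x - s' x) \<partial>M)"
      by (rule cond_exp_norm_le_space[OF F(1) is_cond_exp_diff[OF F(1) m sH]])
    also have "\<dots> = (\<integral>x. norm (f x - s x) \<partial>M)" by (intro Bochner_Integration.integral_cong) (auto simp: s')
    finally show ?thesis using s by simp
  qed
  \<comment> \<open>Chosen so that errors \<open>\<kappa>\<close> in the coefficients add up to at
    most e/3; the 1 guards against a simple function whose values are all zero.\<close>
  define \<kappa> where "\<kappa> = e / (3 * (1 + (\<Sum>c\<in>?C. norm c)))"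
  have pos: "1 + (\<Sum>c\<in>?C. norm c) > 0" by (intro add_pos_nonneg sum_nonneg) auto
  then have \<kappa>: "\<kappa> > 0" using e by (simp add: \<kappa>_def)
  have "\<forall>c\<in>?C. \<exists>n. \<forall>k\<ge>n. \<forall>l\<ge>n. (\<integral>x. \<bar>h c k x - h c l x\<bar> \<partial>M) < \<kappa>"
    unfolding h_def by (intro ballI martingale_indicator_cauchy sub F(2) B \<kappa>)
  from bchoice[OF this] obtain N where N: "\<And>c k l. c \<in> ?C \<Longrightarrow> k \<ge> N c \<Longrightarrow> l \<ge> N c \<Longrightarrow> (\<integral>x. \<bar>h c k x - h c l x\<bar> \<partial>M) < \<kappa>"
    by blast
  define n where "n = Max (insert 0 (N ` ?C))"
  have n: "N c \<le> n" if "c \<in> ?C" for c unfolding n_def using fin that by (intro Max_ge) auto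
  have mb: "bochner_integrable M (m k)" for k by (rule is_cond_expD(2)[OF F(1) m])
  have Hb: "bochner_integrable M (H k)" for k by (rule is_cond_expD(2)[OF F(1) sH])
  have hi: "integrable M (h c k)" if "c \<in> ?C" for c k
  proof -
    interpret S: finite_measure_subalgebra M "F k" by standard (rule sub)
    show ?thesis unfolding h_def using B[OF that] by (intro S.real_cond_exp_int(1) integrable_indicator_sets)
  qed
  have "(\<integral>x. norm (m k x - m l x) \<partial>M) < e" if kl: "k \<ge> n" "l \<ge> n" for k l
  proof -
    note i = bochner_integrable_norm[OF bochner_integrable_diff[OF mb Hb]]
      bochner_integrable_norm[OF bochner_integrable_diff[OF mb mb]]
      bochner_integrable_norm[OF bochner_integrable_diff[OF Hb Hb]]
    have "(\<integral>x. norm (m k x - m l x) \<partial>M) \<le> (\<integral>x. norm (m k x - H k x) + norm (m l x - H l x) + norm (H k x - H l x) \<partial>M)"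
    proof (rule integral_mono)
      fix x
      have "norm (a - b + c) \<le> norm a + norm b + norm c" for a b c :: 'e
        using norm_triangle_ineq[of "a - b" c] norm_triangle_ineq4[of a b] by linarith
      from this[of "m k x - H k x" "m l x - H l x" "H k x - H l x"]
      show "norm (m k x - m l x) \<le> norm (m k x - H k x) + norm (m l x - H l x) + norm (H k x - H l x)" by simp
    qed (use i in simp_all)
    also have "\<dots> = (\<integral>x. norm (m k x - H k x) \<partial>M) + (\<integral>x. norm (m l x - H l x) \<partial>M) + (\<integral>x. norm (H k x - H l x) \<partial>M)"
      using i by simp
    also have "(\<integral>x. norm (H k x - H l x) \<partial>M) \<le> (\<integral>x. (\<Sum>c\<in>?C. \<bar>h c k x - h c l x\<bar> * norm c) \<partial>M)"
    proof (rule integral_mono)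
      fix x
      have "H k x - H l x = (\<Sum>c\<in>?C. (h c k x - h c l x) *\<^sub>R c)"
        by (simp add: H_def sum_subtractf scaleR_diff_left)
      then show "norm (H k x - H l x) \<le> (\<Sum>c\<in>?C. \<bar>h c k x - h c l x\<bar> * norm c)"
        using norm_sum[of "\<lambda>c. (h c k x - h c l x) *\<^sub>R c" ?C] by simp
    qed (use i hi in \<open>auto intro!: Bochner_Integration.integrable_sum Bochner_Integration.integrable_mult_left
        Bochner_Integration.integrable_abs Bochner_Integration.integrable_diff\<close>)
    also have "\<dots> = (\<Sum>c\<in>?C. (\<integral>x. \<bar>h c k x - h c l x\<bar> \<partial>M) * norm c)"
      using hi by (subst Bochner_Integration.integral_sum) auto
    also have "\<dots> \<le> (\<Sum>c\<in>?C. \<kappa> * norm c)"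
      using N kl n by (intro sum_mono mult_right_mono) (meson less_imp_le order_trans, simp)
    also have "\<dots> = \<kappa> * (\<Sum>c\<in>?C. norm c)" by (simp add: sum_distrib_left)
    also have "\<dots> \<le> e / 3"
    proof -
      have "\<kappa> * (\<Sum>c\<in>?C. norm c) \<le> \<kappa> * (1 + (\<Sum>c\<in>?C. norm c))" using \<kappa> by (intro mult_left_mono) auto
      also have "\<dots> = e / 3" using pos by (simp add: \<kappa>_def field_simps)
      finally show ?thesis .
    qed
    finally show ?thesis using mH[of k] mH[of l] by simp
  qed
  then show ?thesis by blast
qed

end

section \<open>Functionals on Bochner integrable functions\<close>

context complete_finite_measure
begin

lemma abs_integral_blinfun_le:
  fixes f :: "'a \<Rightarrow> 'e::banach" and c :: "'e \<Rightarrow>\<^sub>L real"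
  assumes f: "bochner_integrable M f" and A: "A \<in> sets M"
  shows "integrable M (\<lambda>x. indicator A x * c (f x))"
    "\<bar>\<integral>x. indicator A x * c (f x) \<partial>M\<bar> \<le> norm c * (\<integral>x. indicator A x * norm (f x) \<partial>M)"
proof -
  have "bochner_integrable M (\<lambda>x. c (f x))"
    by (rule bochner_integrable_bounded_linear[OF blinfun.bounded_linear_right f])
  then have "integrable M (\<lambda>x. c (f x))" by (simp add: bochner_integrable_real_iff)
  from integrable_mult_indicator[OF A this] show i: "integrable M (\<lambda>x. indicator A x * c (f x))" by simp
  have "\<bar>\<integral>x. indicator A x * c (f x) \<partial>M\<bar> \<le> (\<integral>x. \<bar>indicator A x * c (f x)\<bar> \<partial>M)"
    by (rule integral_abs_bound)
  also have "\<dots> \<le> (\<integral>x. norm c * (indicator A x * norm (f x)) \<partial>M)"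
  proof (rule integral_mono)
    show "\<bar>indicator A x * c (f x)\<bar> \<le> norm c * (indicator A x * norm (f x))" for x
      using norm_blinfun[of c "f x"] by (auto simp: indicator_def)
  qed (use i integrable_indicator_norm[OF f A] in auto)
  finally show "\<bar>\<integral>x. indicator A x * c (f x) \<partial>M\<bar> \<le> norm c * (\<integral>x. indicator A x * norm (f x) \<partial>M)" by simp
qed

context
  fixes \<phi> :: "('a \<Rightarrow> 'e::banach) \<Rightarrow> real"
  assumes lin: "linear \<phi>" and bd: "\<And>f. bochner_integrable M f \<Longrightarrow> \<bar>\<phi> f\<bar> \<le> (\<integral>x. norm (f x) \<partial>M)"
begin

text \<open>The vector measure with values in the dual of E whose density is meant to represent the
  functional; it takes an event to the functional's action on vectors carried by that event.\<close>

definition l1_measure :: "'a set \<Rightarrow> 'e \<Rightarrow>\<^sub>L real" where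
  "l1_measure A = Blinfun (\<lambda>v. \<phi> (\<lambda>x. indicator (A \<inter> space M) x *\<^sub>R v))"

lemma l1_functional_add: "\<phi> (\<lambda>x. f x + g x) = \<phi> f + \<phi> g"
  using linear_add[OF lin, of f g] by (simp add: plus_fun_def)

lemma l1_functional_diff: "\<phi> (\<lambda>x. f x - g x) = \<phi> f - \<phi> g"
  using linear_diff[OF lin, of f g] by (simp add: fun_diff_def)

lemma l1_functional_scale: "\<phi> (\<lambda>x. c *\<^sub>R f x) = c * \<phi> f"
  using linear_scale[OF lin, of c f] by (simp add: scaleR_fun_def)

lemma l1_functional_sum: "finite I \<Longrightarrow> \<phi> (\<lambda>x. \<Sum>i\<in>I. f i x) = (\<Sum>i\<in>I. \<phi> (f i))"
proof (induction I rule: finite_induct)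
  case empty
  then show ?case using linear_0[OF lin] by (simp add: zero_fun_def)
qed (simp add: l1_functional_add)

lemma l1_functional_indicator_le:
  assumes A: "A \<in> sets M"
  shows "\<bar>\<phi> (\<lambda>x. indicator A x *\<^sub>R v)\<bar> \<le> norm v * measure M A"
proof -
  have "bochner_integrable M (\<lambda>x. indicator A x *\<^sub>R v)"
    using bochner_has_integral_scaleR_left[OF integrable_indicator_sets[OF A]] by (auto simp: bochner_integrable_def)
  from bd[OF this] show ?thesis using A by (simp add: mult.commute)
qed

lemma l1_measure_apply:
  assumes A: "A \<in> sets M"
  shows "l1_measure A v = \<phi> (\<lambda>x. indicator A x *\<^sub>R v)"
proof -
  have [simp]: "A \<inter> space M = A" using sets.sets_into_space[OF A] by blast
  have "bounded_linear (\<lambda>v. \<phi> (\<lambda>x. indicator A x *\<^sub>R v))"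
  proof (rule bounded_linear_intro[where K="measure M A"])
    show "\<phi> (\<lambda>x. indicator A x *\<^sub>R (v + w)) = \<phi> (\<lambda>x. indicator A x *\<^sub>R v) + \<phi> (\<lambda>x. indicator A x *\<^sub>R w)" for v w
      by (simp add: scaleR_add_right l1_functional_add)
    show "\<phi> (\<lambda>x. indicator A x *\<^sub>R (r *\<^sub>R v)) = r *\<^sub>R \<phi> (\<lambda>x. indicator A x *\<^sub>R v)" for r v
      using l1_functional_scale[of r "\<lambda>x. indicator A x *\<^sub>R v"] by (simp add: mult.commute)
    show "norm (\<phi> (\<lambda>x. indicator A x *\<^sub>R v)) \<le> norm v * measure M A" for v using l1_functional_indicator_le[OF A] by simp
  qed
  then show ?thesis by (simp add: l1_measure_def bounded_linear_Blinfun_apply)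
qed

lemma norm_l1_measure_le: "A \<in> sets M \<Longrightarrow> norm (l1_measure A) \<le> measure M A"
  using l1_functional_indicator_le by (intro norm_blinfun_bound) (auto simp: l1_measure_apply mult.commute)

lemma l1_measure_Un:
  assumes "A \<in> sets M" "B \<in> sets M" "A \<inter> B = {}"
  shows "l1_measure (A \<union> B) = l1_measure A + l1_measure B"
proof (rule blinfun_eqI)
  fix v :: 'e
  have "(\<lambda>x. indicator (A \<union> B) x *\<^sub>R v) = (\<lambda>x. indicator A x *\<^sub>R v + indicator B x *\<^sub>R v)"
    using assms(3) by (auto simp: indicator_def fun_eq_iff)
  then show "l1_measure (A \<union> B) v = (l1_measure A + l1_measure B) v"
    using assms by (simp add: l1_measure_apply blinfun.add_left l1_functional_add)
qed

lemma l1_measure_UN: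
  assumes "range A \<subseteq> sets M" "disjoint_family A"
  shows "l1_measure (\<Union>i<n::nat. A i) = (\<Sum>i<n. l1_measure (A i))"
proof (induction n)
  case 0
  show ?case using norm_l1_measure_le[of "{}"] by simp
next
  case (Suc n)
  have "A i \<inter> A n = {}" if "i < n" for i using assms(2) that by (simp add: disjoint_family_on_def)
  then have "(\<Union>i<n. A i) \<inter> A n = {}" by blast
  moreover have "(\<Union>i<Suc n. A i) = (\<Union>i<n. A i) \<union> A n" by (auto simp: less_Suc_eq)
  ultimately show ?case using assms(1) Suc by (simp add: l1_measure_Un subset_eq)
qed

text \<open>The norm of the measure of an event is at most its scalar measure. This domination turns
  finite into countable additivity: what remains after \<open>n\<close> sets has norm at most the
  measure of the remaining union.\<close>

lemma vector_measure_l1_measure: "vector_measure M l1_measure"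
  unfolding vector_measure_def
proof (intro allI impI)
  fix A :: "nat \<Rightarrow> 'a set" assume A: "range A \<subseteq> sets M \<and> disjoint_family A"
  have m: "(\<lambda>n. measure M (A n)) sums measure M (\<Union>n. A n)" using A by (intro finite_measure_UNION) auto
  have "norm ((\<Sum>i<n. l1_measure (A i)) - l1_measure (\<Union>n. A n)) \<le> measure M (\<Union>n. A n) - (\<Sum>i<n. measure M (A i))" for n
  proof -
    let ?U = "\<Union>i<n. A i" and ?V = "(\<Union>n. A n) - (\<Union>i<n. A i)"
    have s: "?U \<in> sets M" "?V \<in> sets M" "(\<Union>n. A n) \<in> sets M" using A by (auto simp: subset_eq)
    have "?U \<union> ?V = (\<Union>n. A n)" by auto
    then have "l1_measure (\<Union>n. A n) = l1_measure ?U + l1_measure ?V" using l1_measure_Un[OF s(1,2)] by auto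
    then have "norm ((\<Sum>i<n. l1_measure (A i)) - l1_measure (\<Union>n. A n)) = norm (l1_measure ?V)"
      using A by (simp add: l1_measure_UN)
    also have "\<dots> \<le> measure M ?V" by (rule norm_l1_measure_le[OF s(2)])
    also have "\<dots> = measure M (\<Union>n. A n) - measure M ?U" using s by (intro finite_measure_Diff) auto
    also have "measure M ?U = (\<Sum>i<n. measure M (A i))"
      using A by (intro finite_measure_finite_Union) (auto simp: disjoint_family_on_def)
    finally show ?thesis .
  qed
  then have "(\<lambda>n. (\<Sum>i<n. l1_measure (A i)) - l1_measure (\<Union>n. A n)) \<longlonglongrightarrow> 0"
  proof (rule Lim_null_comparison[OF always_eventually, OF allI])
    show "(\<lambda>n. measure M (\<Union>n. A n) - (\<Sum>i<n. measure M (A i))) \<longlonglongrightarrow> 0"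
      using tendsto_diff[OF tendsto_const[of "measure M (\<Union>n. A n)"] m[unfolded sums_def]] by simp
  qed
  then show "(\<lambda>n. l1_measure (A n)) sums l1_measure (\<Union>n. A n)" unfolding sums_def by (rule LIM_zero_cancel)
qed

lemma bounded_variation_l1_measure: "bounded_variation M l1_measure"
  unfolding bounded_variation_def
proof (intro exI[of _ "measure M (space M)"] allI impI)
  fix \<A> assume A: "finite \<A> \<and> \<A> \<subseteq> sets M \<and> disjoint \<A>"
  have "(\<Sum>A\<in>\<A>. norm (l1_measure A)) \<le> (\<Sum>A\<in>\<A>. measure M A)" using A norm_l1_measure_le by (intro sum_mono) auto
  also have "\<dots> = measure M (\<Union>A\<in>\<A>. A)"
    using A by (intro finite_measure_finite_Union[symmetric]) (auto simp: disjoint_family_on_def disjoint_def)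
  also have "\<dots> \<le> measure M (space M)" using A by (intro bounded_measure)
  finally show "(\<Sum>A\<in>\<A>. norm (l1_measure A)) \<le> measure M (space M)" .
qed

text \<open>Where the density is within \<open>\<kappa>\<close> of a constant functional
  \<open>c\<close>, the functional acts nearly like integration of \<open>c\<close>. This is read
  off from the vector measure for one event and one vector, summed for simple functions, and
  extended to all \<open>f\<close> by density in L1.\<close>

lemma l1_functional_piece:
  fixes c :: "'e \<Rightarrow>\<^sub>L real"
  assumes g: "bochner_integrable M g" and rep: "\<And>A. A \<in> sets M \<Longrightarrow> l1_measure A = bint (\<lambda>x. indicator A x *\<^sub>R g x)"
    and B: "B \<in> sets M" and near: "\<And>x. x \<in> B \<Longrightarrow> norm (g x - c) \<le> \<kappa>" and \<kappa>: "\<kappa> \<ge> 0"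
    and f: "bochner_integrable M f"
  shows "\<bar>\<phi> (\<lambda>x. indicator B x *\<^sub>R f x) - (\<integral>x. indicator B x * c (f x) \<partial>M)\<bar> \<le> \<kappa> * (\<integral>x. indicator B x * norm (f x) \<partial>M)"
proof -
  have gc: "bochner_integrable M (\<lambda>x. g x - c)"
    by (intro bochner_integrable_diff g bochner_integrable_simple) simp
  have single: "\<bar>l1_measure A v - measure M A * c v\<bar> \<le> \<kappa> * (measure M A * norm v)" if A: "A \<in> sets M" "A \<subseteq> B" for A v
  proof -
    have "bint (\<lambda>x. indicator A x *\<^sub>R c) = measure M A *\<^sub>R c"
      using bochner_has_integral_scaleR_left[OF integrable_indicator_sets[OF A(1)], of c] A by (intro bint_eq) simp
    then have "l1_measure A - measure M A *\<^sub>R c = bint (\<lambda>x. indicator A x *\<^sub>R g x) - bint (\<lambda>x. indicator A x *\<^sub>R c)"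
      using rep[OF A(1)] by simp
    also have "\<dots> = bint (\<lambda>x. indicator A x *\<^sub>R g x - indicator A x *\<^sub>R c)"
      by (intro bint_diff[symmetric] bochner_integrable_indicator g A bochner_integrable_simple) simp
    also have "\<dots> = bint (\<lambda>x. indicator A x *\<^sub>R (g x - c))" by (simp add: scaleR_diff_right)
    finally have eq: "l1_measure A - measure M A *\<^sub>R c = bint (\<lambda>x. indicator A x *\<^sub>R (g x - c))" .
    have "norm (l1_measure A - measure M A *\<^sub>R c) \<le> (\<integral>x. norm (indicator A x *\<^sub>R (g x - c)) \<partial>M)"
      unfolding eq by (intro norm_bint_le bochner_integrable_indicator gc A)
    also have "\<dots> \<le> (\<integral>x. indicator A x * \<kappa> \<partial>M)"
    proof (rule integral_mono)
      show "integrable M (\<lambda>x. norm (indicator A x *\<^sub>R (g x - c)))"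
        by (intro bochner_integrable_norm bochner_integrable_indicator gc A)
      show "integrable M (\<lambda>x. indicator A x * \<kappa>)" using integrable_indicator_sets[OF A(1)] by simp
      show "norm (indicator A x *\<^sub>R (g x - c)) \<le> indicator A x * \<kappa>" for x
        using near[of x] A by (auto simp: indicator_def)
    qed
    also have "\<dots> = \<kappa> * measure M A" using A by simp
    finally have n: "norm (l1_measure A - measure M A *\<^sub>R c) \<le> \<kappa> * measure M A" .
    have "\<bar>l1_measure A v - measure M A * c v\<bar> = norm ((l1_measure A - measure M A *\<^sub>R c) v)"
      by (simp add: blinfun.diff_left blinfun.scaleR_left)
    also have "\<dots> \<le> norm (l1_measure A - measure M A *\<^sub>R c) * norm v" by (rule norm_blinfun)
    also have "\<dots> \<le> (\<kappa> * measure M A) * norm v" using n by (rule mult_right_mono) simp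
    finally show ?thesis by (simp add: mult.assoc)
  qed
  have simple: "\<bar>\<phi> (\<lambda>x. indicator B x *\<^sub>R s x) - (\<integral>x. indicator B x * c (s x) \<partial>M)\<bar> \<le> \<kappa> * (\<integral>x. indicator B x * norm (s x) \<partial>M)"
    if s: "simple_function M s" for s :: "'a \<Rightarrow> 'e"
  proof -
    let ?C = "s ` space M" and ?D = "\<lambda>v. B \<inter> (s -` {v} \<inter> space M)"
    have fin: "finite ?C" using s by (simp add: simple_function_def)
    have D: "?D v \<in> sets M" if "v \<in> ?C" for v using s B that by (auto simp: simple_function_def)
    have sb: "bochner_integrable M s" by (rule bochner_integrable_simple[OF s])
    have eq: "indicator B x *\<^sub>R s x = (\<Sum>v\<in>?C. indicator (?D v) x *\<^sub>R v)" for x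
    proof (cases "x \<in> space M")
      case True
      have "(\<Sum>v\<in>?C. indicator (?D v) x *\<^sub>R v) = (\<Sum>v\<in>?C. if v = s x then indicator B x *\<^sub>R s x else 0)"
        using True by (intro sum.cong) (auto simp: indicator_def)
      then show ?thesis using fin True by simp
    next
      case False
      then show ?thesis using sets.sets_into_space[OF B] by (auto simp: indicator_def)
    qed
    have "\<phi> (\<lambda>x. indicator B x *\<^sub>R s x) = (\<Sum>v\<in>?C. l1_measure (?D v) v)"
      unfolding eq l1_functional_sum[OF fin] by (intro sum.cong refl) (simp add: l1_measure_apply D)
    moreover have "(\<integral>x. indicator B x * c (s x) \<partial>M) = (\<Sum>v\<in>?C. measure M (?D v) * c v)"
    proof -
      have "integrable M (\<lambda>x. c (s x))"
        using bochner_integrable_bounded_linear[OF blinfun.bounded_linear_right[of c] sb] by (simp add: bochner_integrable_real_iff)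
      from integral_simple_split[OF s this B] have
        "(\<integral>x. indicator B x * c (s x) \<partial>M) = (\<Sum>v\<in>?C. \<integral>x. indicator (?D v) x * c (s x) \<partial>M)" .
      also have "\<dots> = (\<Sum>v\<in>?C. \<integral>x. indicator (?D v) x * c v \<partial>M)"
        by (intro sum.cong refl Bochner_Integration.integral_cong) (auto simp: indicator_def)
      also have "\<dots> = (\<Sum>v\<in>?C. measure M (?D v) * c v)" using D by (intro sum.cong) auto
      finally show ?thesis .
    qed
    moreover have "(\<integral>x. indicator B x * norm (s x) \<partial>M) = (\<Sum>v\<in>?C. measure M (?D v) * norm v)"
    proof -
      from integral_simple_split[OF s bochner_integrable_norm[OF sb] B] have
        "(\<integral>x. indicator B x * norm (s x) \<partial>M) = (\<Sum>v\<in>?C. \<integral>x. indicator (?D v) x * norm (s x) \<partial>M)" .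
      also have "\<dots> = (\<Sum>v\<in>?C. \<integral>x. indicator (?D v) x * norm v \<partial>M)"
        by (intro sum.cong refl Bochner_Integration.integral_cong) (auto simp: indicator_def)
      also have "\<dots> = (\<Sum>v\<in>?C. measure M (?D v) * norm v)" using D by (intro sum.cong) auto
      finally show ?thesis .
    qed
    moreover have "\<bar>(\<Sum>v\<in>?C. l1_measure (?D v) v) - (\<Sum>v\<in>?C. measure M (?D v) * c v)\<bar> \<le> (\<Sum>v\<in>?C. \<kappa> * (measure M (?D v) * norm v))"
      unfolding sum_subtractf[symmetric] using D
      by (intro order_trans[OF sum_abs] sum_mono single) auto
    ultimately show ?thesis by (simp add: sum_distrib_left)
  qed
  show ?thesis
  proof (rule field_le_epsilon)
    fix e :: real assume e: "e > 0"
    \<comment> \<open>Passing from \<open>s\<close> back to \<open>f\<close> costs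
      \<open>\<eta>\<close> for the functional, \<open>norm c * \<eta>\<close> for the integral of
      \<open>c\<close>, and \<open>\<kappa> * \<eta>\<close> on the right-hand side; together
      exactly \<open>e\<close>.\<close>
    define \<eta> where "\<eta> = e / (\<kappa> + 1 + norm c)"
    have pos: "\<kappa> + 1 + norm c > 0" using \<kappa> norm_ge_zero[of c] by linarith
    then have \<eta>: "\<eta> > 0" using e by (simp add: \<eta>_def)
    obtain s where s: "simple_function M s" "(\<integral>x. norm (f x - s x) \<partial>M) < \<eta>"
      using bochner_approx_simple[OF f \<eta>] by blast
    have sb: "bochner_integrable M s" by (rule bochner_integrable_simple[OF s(1)])
    have fs: "bochner_integrable M (\<lambda>x. f x - s x)" by (rule bochner_integrable_diff[OF f sb])
    have fsB: "(\<integral>x. indicator B x * norm (f x - s x) \<partial>M) \<le> \<eta>"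
    proof -
      have "(\<integral>x. indicator B x * norm (f x - s x) \<partial>M) \<le> (\<integral>x. norm (f x - s x) \<partial>M)"
        using integrable_indicator_norm[OF fs B] bochner_integrable_norm[OF fs]
        by (intro integral_mono) (auto simp: indicator_def)
      then show ?thesis using s(2) by simp
    qed
    have "\<phi> (\<lambda>x. indicator B x *\<^sub>R f x) - \<phi> (\<lambda>x. indicator B x *\<^sub>R s x) = \<phi> (\<lambda>x. indicator B x *\<^sub>R (f x - s x))"
      by (simp add: scaleR_diff_right l1_functional_diff)
    then have 1: "\<bar>\<phi> (\<lambda>x. indicator B x *\<^sub>R f x) - \<phi> (\<lambda>x. indicator B x *\<^sub>R s x)\<bar> \<le> \<eta>"
      using bd[OF bochner_integrable_indicator[OF fs B]] fsB by simp
    have "(\<integral>x. indicator B x * c (f x) \<partial>M) - (\<integral>x. indicator B x * c (s x) \<partial>M) = (\<integral>x. indicator B x * c (f x) - indicator B x * c (s x) \<partial>M)"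
      using abs_integral_blinfun_le(1)[OF f B] abs_integral_blinfun_le(1)[OF sb B]
      by (intro Bochner_Integration.integral_diff[symmetric]) auto
    also have "\<dots> = (\<integral>x. indicator B x * c (f x - s x) \<partial>M)"
      by (simp add: blinfun.diff_right right_diff_distrib)
    finally have "\<bar>(\<integral>x. indicator B x * c (f x) \<partial>M) - (\<integral>x. indicator B x * c (s x) \<partial>M)\<bar> \<le> norm c * (\<integral>x. indicator B x * norm (f x - s x) \<partial>M)"
      using abs_integral_blinfun_le(2)[OF fs B, of c] by simp
    also have "\<dots> \<le> norm c * \<eta>" using fsB by (rule mult_left_mono) simp
    finally have 2: "\<bar>(\<integral>x. indicator B x * c (f x) \<partial>M) - (\<integral>x. indicator B x * c (s x) \<partial>M)\<bar> \<le> norm c * \<eta>" .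
    have "(\<integral>x. indicator B x * norm (s x) \<partial>M) \<le> (\<integral>x. indicator B x * norm (f x) \<partial>M) + (\<integral>x. indicator B x * norm (s x - f x) \<partial>M)"
      by (rule integral_norm_indicator_approx[OF sb f B])
    then have "(\<integral>x. indicator B x * norm (s x) \<partial>M) \<le> (\<integral>x. indicator B x * norm (f x) \<partial>M) + \<eta>"
      using fsB by (simp add: norm_minus_commute)
    then have 3: "\<kappa> * (\<integral>x. indicator B x * norm (s x) \<partial>M) \<le> \<kappa> * (\<integral>x. indicator B x * norm (f x) \<partial>M) + \<kappa> * \<eta>"
      unfolding distrib_left[symmetric] using \<kappa> by (rule mult_left_mono)
    have "\<kappa> * \<eta> + \<eta> + norm c * \<eta> = (\<kappa> + 1 + norm c) * \<eta>" by (simp add: distrib_right)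
    also have "\<dots> = e" using pos by (simp add: \<eta>_def)
    finally have "\<kappa> * \<eta> + \<eta> + norm c * \<eta> = e" .
    then show "\<bar>\<phi> (\<lambda>x. indicator B x *\<^sub>R f x) - (\<integral>x. indicator B x * c (f x) \<partial>M)\<bar> \<le> \<kappa> * (\<integral>x. indicator B x * norm (f x) \<partial>M) + e"
      using 1 2 3 simple[OF s(1)] by linarith
  qed
qed

text \<open>The density \<open>g\<close> is merely integrable, so it is replaced by a simple
  function \<open>r\<close>. Outside an event of small measure the two are uniformly close, and on
  that event uniform integrability makes the \<open>f n\<close> negligible. What is left is a finite
  sum of scalar integrals, each tending to 0 by \<open>weak\<close>.\<close>

lemma l1_functional_weakly_null:
  fixes f :: "nat \<Rightarrow> 'a \<Rightarrow> 'e"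
  assumes RNP: "RNP_wrt M TYPE('e \<Rightarrow>\<^sub>L real)"
    and f: "\<And>n. bochner_integrable M (f n)" and C: "\<And>n. (\<integral>x. norm (f n x) \<partial>M) \<le> C"
    and ui: "\<And>e. e > 0 \<Longrightarrow> \<exists>d>0. \<forall>n. \<forall>A\<in>sets M. measure M A \<le> d \<longrightarrow> (\<integral>x. indicator A x * norm (f n x) \<partial>M) \<le> e"
    and weak: "\<And>(c :: 'e \<Rightarrow>\<^sub>L real) B. B \<in> sets M \<Longrightarrow> (\<lambda>n. \<integral>x. indicator B x * c (f n x) \<partial>M) \<longlonglongrightarrow> 0"
  shows "(\<lambda>n. \<phi> (f n)) \<longlonglongrightarrow> 0"
proof -
  have "\<forall>A\<in>null_sets M. l1_measure A = 0"
    using norm_l1_measure_le by (force simp: measure_def null_sets_def)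
  then obtain g where g: "bochner_integrable M g" and rep: "\<And>A. A \<in> sets M \<Longrightarrow> l1_measure A = bint (\<lambda>x. indicator A x *\<^sub>R g x)"
    using RNP vector_measure_l1_measure bounded_variation_l1_measure unfolding RNP_wrt_def bochner_set_integral_eq by blast
  have C0: "C \<ge> 0" using order_trans[OF Bochner_Integration.integral_nonneg C[of 0]] by simp
  show ?thesis
  proof (rule LIMSEQ_I)
    fix e :: real assume e: "e > 0"
    obtain d where d: "d > 0" "\<And>n A. A \<in> sets M \<Longrightarrow> measure M A \<le> d \<Longrightarrow> (\<integral>x. indicator A x * norm (f n x) \<partial>M) \<le> e / 4"
      using ui[of "e/4"] e by auto
    \<comment> \<open>The error budget has three parts of e/4: the small event, the distance between
      \<open>g\<close> and \<open>r\<close> times the L1 bound \<open>C\<close>, and the finite sum.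
      The 1 avoids division by zero.\<close>
    define \<kappa> where "\<kappa> = e / (4 * (C + 1))"
    have \<kappa>: "\<kappa> > 0" using e C0 by (simp add: \<kappa>_def)
    have "\<kappa> * C \<le> \<kappa> * (C + 1)" using \<kappa> by (intro mult_left_mono) auto
    also have "\<dots> = e / 4" using C0 by (simp add: \<kappa>_def field_simps)
    finally have \<kappa>C: "\<kappa> * C \<le> e / 4" .
    \<comment> \<open>With accuracy \<open>\<kappa> * d\<close> Markov's inequality bounds the
      measure of the event where \<open>g\<close> and \<open>r\<close> differ by more than
      \<open>\<kappa>\<close> by \<open>d\<close>.\<close>
    obtain r where r: "simple_function M r" "(\<integral>x. norm (g x - r x) \<partial>M) < \<kappa> * d"
      using bochner_approx_simple[OF g, of "\<kappa> * d"] \<kappa> d by auto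
    have gr: "bochner_integrable M (\<lambda>x. g x - r x)" by (intro bochner_integrable_diff g bochner_integrable_simple r)
    note gri = bochner_integrable_norm[OF gr]
    define A where "A = {x\<in>space M. norm (g x - r x) \<le> \<kappa>}"
    have A: "A \<in> sets M" unfolding A_def using borel_measurable_integrable[OF gri] by measurable
    let ?A' = "space M - A"
    have A': "?A' \<in> sets M" using A by auto
    have "measure M ?A' \<le> d"
    proof -
      have "\<kappa> * measure M ?A' = (\<integral>x. indicator ?A' x * \<kappa> \<partial>M)" using A' by simp
      also have "\<dots> \<le> (\<integral>x. norm (g x - r x) \<partial>M)"
      proof (rule integral_mono)
        show "integrable M (\<lambda>x. indicator ?A' x * \<kappa>)" using integrable_indicator_sets[OF A'] by simp
        show "indicator ?A' x * \<kappa> \<le> norm (g x - r x)" for x by (auto simp: A_def indicator_def)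
      qed (rule gri)
      also have "\<dots> \<le> \<kappa> * d" using r by simp
      finally show ?thesis using \<kappa> by simp
    qed
    then have small: "\<bar>\<phi> (\<lambda>x. indicator ?A' x *\<^sub>R f n x)\<bar> \<le> e / 4" for n
      using bd[OF bochner_integrable_indicator[OF f[of n] A']] d(2)[OF A', of n] by simp
    let ?R = "r ` space M" and ?B = "\<lambda>c. A \<inter> (r -` {c} \<inter> space M)"
    have fin: "finite ?R" using r by (simp add: simple_function_def)
    have B: "?B c \<in> sets M" if "c \<in> ?R" for c using r A that by (auto simp: simple_function_def)
    have split: "indicator A x *\<^sub>R v = (\<Sum>c\<in>?R. indicator (?B c) x *\<^sub>R v)" for x and v :: 'e
    proof (cases "x \<in> space M")
      case True
      have "(\<Sum>c\<in>?R. indicator (?B c) x *\<^sub>R v) = (\<Sum>c\<in>?R. if c = r x then indicator A x *\<^sub>R v else 0)"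
        using True by (intro sum.cong) (auto simp: indicator_def)
      then show ?thesis using fin True by simp
    qed (auto simp: A_def indicator_def)
    define \<psi> where "\<psi> n = (\<Sum>c\<in>?R. \<integral>x. indicator (?B c) x * c (f n x) \<partial>M)" for n
    have "\<psi> \<longlonglongrightarrow> 0" unfolding \<psi>_def using tendsto_sum[OF weak[OF B]] by simp
    then obtain N where N: "\<And>n. n \<ge> N \<Longrightarrow> \<bar>\<psi> n\<bar> < e / 4"
      using LIMSEQ_D[of \<psi> 0 "e / 4"] e by auto
    have near: "\<bar>\<phi> (\<lambda>x. indicator A x *\<^sub>R f n x) - \<psi> n\<bar> \<le> e / 4" for n
    proof -
      have "\<phi> (\<lambda>x. indicator A x *\<^sub>R f n x) = (\<Sum>c\<in>?R. \<phi> (\<lambda>x. indicator (?B c) x *\<^sub>R f n x))"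
        unfolding split by (rule l1_functional_sum[OF fin])
      then have "\<bar>\<phi> (\<lambda>x. indicator A x *\<^sub>R f n x) - \<psi> n\<bar> =
          \<bar>\<Sum>c\<in>?R. \<phi> (\<lambda>x. indicator (?B c) x *\<^sub>R f n x) - (\<integral>x. indicator (?B c) x * c (f n x) \<partial>M)\<bar>"
        by (simp add: \<psi>_def sum_subtractf)
      also have "\<dots> \<le> (\<Sum>c\<in>?R. \<kappa> * (\<integral>x. indicator (?B c) x * norm (f n x) \<partial>M))"
      proof (intro order_trans[OF sum_abs] sum_mono)
        fix c assume "c \<in> ?R"
        then show "\<bar>\<phi> (\<lambda>x. indicator (?B c) x *\<^sub>R f n x) - (\<integral>x. indicator (?B c) x * c (f n x) \<partial>M)\<bar>
          \<le> \<kappa> * (\<integral>x. indicator (?B c) x * norm (f n x) \<partial>M)"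
          using \<kappa> by (intro l1_functional_piece[OF g rep B _ _ f]) (auto simp: A_def)
      qed
      also have "\<dots> = \<kappa> * (\<integral>x. indicator A x * norm (f n x) \<partial>M)"
        unfolding integral_simple_split[OF r(1) bochner_integrable_norm[OF f] A] by (simp add: sum_distrib_left)
      also have "(\<integral>x. indicator A x * norm (f n x) \<partial>M) \<le> (\<integral>x. norm (f n x) \<partial>M)"
        using integrable_indicator_norm[OF f A] bochner_integrable_norm[OF f]
        by (intro integral_mono) (auto simp: indicator_def)
      also have "\<dots> \<le> C" by (rule C)
      finally show ?thesis using \<kappa>C \<kappa> by simp
    qed
    have "norm (\<phi> (f n) - 0) < e" if "n \<ge> N" for n
    proof -
      \<comment> \<open>The pieces add up to \<open>f n\<close> on the space only. The difference
        has L1 norm 0, so the bound on the functional shows that it does not notice.\<close>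
      have "bochner_integrable M (\<lambda>x. f n x - (indicator A x *\<^sub>R f n x + indicator ?A' x *\<^sub>R f n x))"
        by (intro bochner_integrable_diff bochner_integrable_add bochner_integrable_indicator f A A')
      from bd[OF this] have "\<phi> (\<lambda>x. f n x - (indicator A x *\<^sub>R f n x + indicator ?A' x *\<^sub>R f n x)) = 0"
      proof -
        assume *: "\<bar>\<phi> (\<lambda>x. f n x - (indicator A x *\<^sub>R f n x + indicator ?A' x *\<^sub>R f n x))\<bar> \<le>
          (\<integral>x. norm (f n x - (indicator A x *\<^sub>R f n x + indicator ?A' x *\<^sub>R f n x)) \<partial>M)"
        have "(\<integral>x. norm (f n x - (indicator A x *\<^sub>R f n x + indicator ?A' x *\<^sub>R f n x)) \<partial>M) = (\<integral>x. 0 \<partial>M)"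
          by (intro Bochner_Integration.integral_cong) (auto simp: indicator_def)
        with * show ?thesis by simp
      qed
      then have "\<phi> (f n) = \<phi> (\<lambda>x. indicator A x *\<^sub>R f n x) + \<phi> (\<lambda>x. indicator ?A' x *\<^sub>R f n x)"
        by (simp add: l1_functional_diff l1_functional_add)
      moreover have "\<bar>a + b\<bar> < e" if "\<bar>a - c\<bar> \<le> e / 4" "\<bar>b\<bar> \<le> e / 4" "\<bar>c\<bar> < e / 4" for a b c :: real
        using that e by (simp add: abs_if split: if_splits)
      ultimately show ?thesis using near[of n] small[of n] N[OF that] by simp
    qed
    then show "\<exists>N. \<forall>n\<ge>N. norm (\<phi> (f n) - 0) < e" by blast
  qed
qed

end

end

section \<open>The space H1\<close>

lemma total_max_eq: "total_max M x = (SUP s\<in>{0..}. ennreal (norm (M s x)))"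
proof (rule antisym)
  show "total_max M x \<le> (SUP s\<in>{0..}. ennreal (norm (M s x)))"
    unfolding total_max_def running_max_def by (intro SUP_least SUP_upper) auto
  have "ennreal (norm (M s x)) \<le> total_max M x" if "s \<ge> 0" for s
  proof -
    have "ennreal (norm (M s x)) \<le> running_max M (s + 1) x"
      unfolding running_max_def using that by (intro SUP_upper) auto
    also have "\<dots> \<le> total_max M x" unfolding total_max_def using that by (intro SUP_upper) auto
    finally show ?thesis .
  qed
  then show "(SUP s\<in>{0..}. ennreal (norm (M s x))) \<le> total_max M x" by (intro SUP_least) auto
qed

lemma norm_le_total_max: "t \<ge> 0 \<Longrightarrow> ennreal (norm (M t x)) \<le> total_max M x"
  unfolding total_max_eq by (intro SUP_upper) auto

lemma running_max_le_total_max: "running_max M t x \<le> total_max M x"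
  unfolding running_max_def by (intro SUP_least norm_le_total_max) auto

lemma norm_le_running_max: "0 \<le> s \<Longrightarrow> s \<le> t \<Longrightarrow> ennreal (norm (M s x)) \<le> running_max M t x"
  unfolding running_max_def by (intro SUP_upper) auto

lemma total_max_add: "total_max (M + N) x \<le> total_max M x + total_max N x"
  unfolding total_max_eq[of "M + N"]
proof (intro SUP_least)
  fix s :: real assume "s \<in> {0..}"
  have "ennreal (norm ((M + N) s x)) \<le> ennreal (norm (M s x)) + ennreal (norm (N s x))"
    by (simp add: plus_fun_def norm_triangle_ineq flip: ennreal_plus)
  also have "\<dots> \<le> total_max M x + total_max N x"
    using \<open>s \<in> {0..}\<close> by (intro add_mono norm_le_total_max) auto
  finally show "ennreal (norm ((M + N) s x)) \<le> total_max M x + total_max N x" .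
qed

lemma total_max_scaleR: "total_max (c *\<^sub>R M) x = ennreal \<bar>c\<bar> * total_max M x"
  unfolding total_max_eq SUP_mult_left_ennreal by (simp add: scaleR_fun_def ennreal_mult)

text \<open>Right-continuity: a strict violation at \<open>s\<close> would persist on an interval to
  the right, which contains a rational. This makes the maximal functions countable suprema, hence
  measurable.\<close>

lemma norm_le_SUP_dense:
  fixes f :: "real \<Rightarrow> 'e::real_normed_vector"
  assumes f: "(f \<longlongrightarrow> f s) (at_right s)" and sr: "s < r" and le: "\<And>q. q \<in> \<rat> \<Longrightarrow> s < q \<Longrightarrow> q < r \<Longrightarrow> ennreal (norm (f q)) \<le> c"
  shows "ennreal (norm (f s)) \<le> c"
proof (rule ccontr)
  assume "\<not> ?thesis"
  then have "c < ennreal (norm (f s))" by simp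
  moreover have "((\<lambda>u. ennreal (norm (f u))) \<longlongrightarrow> ennreal (norm (f s))) (at_right s)"
    using f by (intro tendsto_ennrealI tendsto_norm)
  ultimately have "\<forall>\<^sub>F u in at_right s. c < ennreal (norm (f u))" by (intro order_tendstoD)
  then obtain b where b: "b > s" "\<And>u. s < u \<Longrightarrow> u < b \<Longrightarrow> c < ennreal (norm (f u))"
    unfolding eventually_at_right_field by blast
  obtain q where "q \<in> \<rat>" "s < q" "q < min b r" using Rats_dense_in_real[of s "min b r"] b(1) sr by auto
  then show False using b(2)[of q] le[of q] by simp
qed

definition nonneg_rats :: "real set" where "nonneg_rats = \<rat> \<inter> {0..}"

lemma countable_nonneg_rats: "countable nonneg_rats" and nonneg_rats_ne: "nonneg_rats \<noteq> {}"
  unfolding nonneg_rats_def using countable_rat by (auto intro: countable_Int1)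

lemma total_max_rats:
  assumes "cadlag (\<lambda>t. M t x)"
  shows "total_max M x = (SUP q\<in>nonneg_rats. ennreal (norm (M q x)))"
proof (rule antisym)
  show "(SUP q\<in>nonneg_rats. ennreal (norm (M q x))) \<le> total_max M x"
    by (intro SUP_least norm_le_total_max) (auto simp: nonneg_rats_def)
  show "total_max M x \<le> (SUP q\<in>nonneg_rats. ennreal (norm (M q x)))"
    unfolding total_max_eq
  proof (intro SUP_least)
    fix s :: real assume s: "s \<in> {0..}"
    show "ennreal (norm (M s x)) \<le> (SUP q\<in>nonneg_rats. ennreal (norm (M q x)))"
    proof (rule norm_le_SUP_dense[where r="s + 1"])
      show "((\<lambda>t. M t x) \<longlongrightarrow> M s x) (at_right s)" using assms s by (auto simp: cadlag_def)
      show "ennreal (norm (M q x)) \<le> (SUP q\<in>nonneg_rats. ennreal (norm (M q x)))" if "q \<in> \<rat>" "s < q" for q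
        using that s by (intro SUP_upper) (auto simp: nonneg_rats_def)
    qed simp
  qed
qed

text \<open>The endpoint \<open>T\<close> has to be added to the rationals, since approximation from
  the right would leave the interval there.\<close>

lemma running_max_rats:
  assumes "cadlag (\<lambda>t. M t x)" "T \<ge> 0"
  shows "running_max M T x = (SUP q\<in>insert T (\<rat> \<inter> {0..T}). ennreal (norm (M q x)))"
proof (rule antisym)
  show "(SUP q\<in>insert T (\<rat> \<inter> {0..T}). ennreal (norm (M q x))) \<le> running_max M T x"
    using assms(2) by (intro SUP_least norm_le_running_max) auto
  show "running_max M T x \<le> (SUP q\<in>insert T (\<rat> \<inter> {0..T}). ennreal (norm (M q x)))"
    unfolding running_max_def
  proof (intro SUP_least)
    fix s :: real assume s: "s \<in> {0..T}"
    show "ennreal (norm (M s x)) \<le> (SUP q\<in>insert T (\<rat> \<inter> {0..T}). ennreal (norm (M q x)))"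
    proof (cases "s = T")
      case False
      show ?thesis
      proof (rule norm_le_SUP_dense[where r=T])
        show "((\<lambda>t. M t x) \<longlongrightarrow> M s x) (at_right s)" using assms s by (auto simp: cadlag_def)
        show "s < T" using s False by simp
        show "ennreal (norm (M q x)) \<le> (SUP q\<in>insert T (\<rat> \<inter> {0..T}). ennreal (norm (M q x)))" if "q \<in> \<rat>" "s < q" "q < T" for q
          using that s by (intro SUP_upper) auto
      qed
    qed (auto intro: SUP_upper)
  qed
qed

lemma cadlag_add:
  fixes f g :: "real \<Rightarrow> 'e::real_normed_vector"
  assumes "cadlag f" "cadlag g"
  shows "cadlag (\<lambda>t. f t + g t)"
  unfolding cadlag_def
proof (intro conjI allI impI)
  show "((\<lambda>t. f t + g t) \<longlongrightarrow> f t + g t) (at_right t)" if "t \<ge> 0" for t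
    using assms that by (intro tendsto_add) (auto simp: cadlag_def)
  show "\<exists>l. ((\<lambda>t. f t + g t) \<longlongrightarrow> l) (at_left t)" if "t > 0" for t
  proof -
    have "\<exists>l. (f \<longlongrightarrow> l) (at_left t)" "\<exists>m. (g \<longlongrightarrow> m) (at_left t)"
      using assms that by (simp_all add: cadlag_def)
    then obtain l m where "(f \<longlongrightarrow> l) (at_left t)" "(g \<longlongrightarrow> m) (at_left t)" by (elim exE)
    then have "((\<lambda>t. f t + g t) \<longlongrightarrow> l + m) (at_left t)" by (rule tendsto_add)
    then show ?thesis by (rule exI)
  qed
qed

lemma cadlag_scaleR:
  fixes f :: "real \<Rightarrow> 'e::real_normed_vector"
  assumes "cadlag f"
  shows "cadlag (\<lambda>t. c *\<^sub>R f t)"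
  unfolding cadlag_def
proof (intro conjI allI impI)
  show "((\<lambda>t. c *\<^sub>R f t) \<longlongrightarrow> c *\<^sub>R f t) (at_right t)" if "t \<ge> 0" for t
    using assms that by (intro tendsto_intros) (auto simp: cadlag_def)
  show "\<exists>l. ((\<lambda>t. c *\<^sub>R f t) \<longlongrightarrow> l) (at_left t)" if "t > 0" for t
  proof -
    have "\<exists>l. (f \<longlongrightarrow> l) (at_left t)" using assms that by (simp add: cadlag_def)
    then obtain l where "(f \<longlongrightarrow> l) (at_left t)" by (elim exE)
    then have "((\<lambda>t. c *\<^sub>R f t) \<longlongrightarrow> c *\<^sub>R l) (at_left t)" by (intro tendsto_intros)
    then show ?thesis by (rule exI)
  qed
qed

lemma cadlag_const: "cadlag (\<lambda>t. c :: 'e::topological_space)"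
  unfolding cadlag_def by auto

section \<open>The stochastic basis and the vector space H1\<close>

locale stoch_basis = prob_space P + complete_measure P for P :: "'a measure" +
  fixes F :: "real \<Rightarrow> 'a measure"
  assumes subalg: "\<And>t. t \<ge> 0 \<Longrightarrow> subalgebra P (F t)"
    and filtration: "\<And>s t. 0 \<le> s \<Longrightarrow> s \<le> t \<Longrightarrow> sets (F s) \<subseteq> sets (F t)"
    and null_in_F0: "null_sets P \<subseteq> sets (F 0)"

lemma stoch_basisI:
  assumes "stochastic_basis P F"
  shows "stoch_basis P F"
proof -
  have "null_sets P \<subseteq> sets (F 0)" using assms by (auto simp: stochastic_basis_def)
  then show ?thesis using assms unfolding stochastic_basis_def stoch_basis_def stoch_basis_axioms_def by blast
qed

sublocale stoch_basis \<subseteq> complete_finite_measure P by unfold_locales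

context stoch_basis
begin

text \<open>The null sets are in the filtration from time 0 on, so at every time the restricted
  measure is complete and conditional expectations can be handled in nonseparable spaces.\<close>

lemma complete_subalgebra_F:
  assumes t: "t \<ge> 0"
  shows "complete_subalgebra (F t)"
  unfolding complete_subalgebra_def
proof
  show s: "subalgebra P (F t)" by (rule subalg[OF t])
  show "complete_measure (restr_to_subalg P (F t))"
  proof
    fix A B assume "B \<subseteq> A" "A \<in> null_sets (restr_to_subalg P (F t))"
    then have "B \<in> null_sets P" unfolding null_sets_restr_to_subalg[OF s] using complete2 by blast
    then show "B \<in> sets (restr_to_subalg P (F t))"
      using null_in_F0 filtration[of 0 t] t by (auto simp: sets_restr_to_subalg[OF s])
  qed
qed

lemma is_cond_exp_F:
  assumes "t \<ge> 0" "is_cond_exp P (F t) f g"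
  shows "bochner_integrable P f" "bochner_integrable P g" "g \<in> borel_measurable (F t)" "g \<in> borel_measurable P"
proof -
  note d = is_cond_expD[OF complete_subalgebra_F[OF assms(1)] assms(2)]
  show "bochner_integrable P f" "bochner_integrable P g" using d by auto
  show "g \<in> borel_measurable P" using d by (intro strongly_measurable_imp_borel bochner_integrable_strongly)
  have "g \<in> borel_measurable (restr_to_subalg P (F t))"
    using d(3) by (auto simp: bochner_integrable_def bochner_has_integral_def)
  then show "g \<in> borel_measurable (F t)" by (simp cong: measurable_cong_sets add: sets_restr_to_subalg[OF subalg[OF assms(1)]])
qed

lemma total_max_measurable:
  assumes "\<And>x. x \<in> space P \<Longrightarrow> cadlag (\<lambda>t. M t x)" "\<And>t. t \<ge> 0 \<Longrightarrow> M t \<in> borel_measurable P"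
  shows "total_max M \<in> borel_measurable P"
proof -
  have "(\<lambda>x. SUP q\<in>nonneg_rats. ennreal (norm (M q x))) \<in> borel_measurable P"
    using assms(2) by (intro borel_measurable_SUP countable_nonneg_rats) (auto simp: nonneg_rats_def)
  moreover have "total_max M x = (SUP q\<in>nonneg_rats. ennreal (norm (M q x)))" if "x \<in> space P" for x
    using assms(1)[OF that] by (rule total_max_rats)
  ultimately show ?thesis by (subst measurable_cong)
qed

lemma running_max_measurable:
  assumes "\<And>x. x \<in> space P \<Longrightarrow> cadlag (\<lambda>t. M t x)" "\<And>t. t \<ge> 0 \<Longrightarrow> M t \<in> borel_measurable P" "T \<ge> 0"
  shows "running_max M T \<in> borel_measurable P"
proof -
  have "countable (insert T (\<rat> \<inter> {0..T}))" using countable_rat by (auto intro: countable_Int1)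
  then have "(\<lambda>x. SUP q\<in>insert T (\<rat> \<inter> {0..T}). ennreal (norm (M q x))) \<in> borel_measurable P"
    using assms(2,3) by (intro borel_measurable_SUP) auto
  moreover have "running_max M T x = (SUP q\<in>insert T (\<rat> \<inter> {0..T}). ennreal (norm (M q x)))" if "x \<in> space P" for x
    using assms(1)[OF that] assms(3) by (rule running_max_rats)
  ultimately show ?thesis by (subst measurable_cong)
qed

lemma H1D:
  fixes M :: "real \<Rightarrow> 'a \<Rightarrow> 'e::banach"
  assumes "M \<in> H1 P F"
  shows "x \<in> space P \<Longrightarrow> cadlag (\<lambda>t. M t x)" "total_max M \<in> borel_measurable P" "(\<integral>\<^sup>+x. total_max M x \<partial>P) < \<infinity>"
    "\<exists>f. \<forall>t\<ge>0. is_cond_exp P (F t) f (M t)" "t \<ge> 0 \<Longrightarrow> bochner_integrable P (M t)" "t \<ge> 0 \<Longrightarrow> M t \<in> borel_measurable P"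
    "t \<ge> 0 \<Longrightarrow> M t \<in> borel_measurable (F t)"
proof -
  show "x \<in> space P \<Longrightarrow> cadlag (\<lambda>t. M t x)" "total_max M \<in> borel_measurable P" "(\<integral>\<^sup>+x. total_max M x \<partial>P) < \<infinity>"
    and f: "\<exists>f. \<forall>t\<ge>0. is_cond_exp P (F t) f (M t)" using assms by (auto simp: H1_def)
  show "t \<ge> 0 \<Longrightarrow> bochner_integrable P (M t)" "t \<ge> 0 \<Longrightarrow> M t \<in> borel_measurable P" "t \<ge> 0 \<Longrightarrow> M t \<in> borel_measurable (F t)"
    using f is_cond_exp_F by blast+
qed

lemma H1I:
  fixes M :: "real \<Rightarrow> 'a \<Rightarrow> 'e::banach"
  assumes "\<And>x. x \<in> space P \<Longrightarrow> cadlag (\<lambda>t. M t x)" "(\<integral>\<^sup>+x. total_max M x \<partial>P) < \<infinity>"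
    "\<And>t. t \<ge> 0 \<Longrightarrow> is_cond_exp P (F t) f (M t)"
  shows "M \<in> H1 P F"
proof -
  have "total_max M \<in> borel_measurable P"
    using assms(1,3) is_cond_exp_F(4) by (intro total_max_measurable) blast+
  then show ?thesis using assms by (auto simp: H1_def)
qed

lemma subspace_H1: "subspace (H1 P F :: (real \<Rightarrow> 'a \<Rightarrow> 'e::banach) set)"
proof (rule subspaceI)
  fix M N :: "real \<Rightarrow> 'a \<Rightarrow> 'e" assume M: "M \<in> H1 P F"
  obtain f where f: "\<And>t. t \<ge> 0 \<Longrightarrow> is_cond_exp P (F t) f (M t)" using H1D(4)[OF M] by blast
  show "c *\<^sub>R M \<in> H1 P F" for c
  proof (rule H1I)
    show "cadlag (\<lambda>t. (c *\<^sub>R M) t x)" if "x \<in> space P" for x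
      using cadlag_scaleR[OF H1D(1)[OF M that], of c] by (simp add: scaleR_fun_def)
    have "(\<integral>\<^sup>+x. total_max (c *\<^sub>R M) x \<partial>P) = ennreal \<bar>c\<bar> * (\<integral>\<^sup>+x. total_max M x \<partial>P)"
      unfolding total_max_scaleR by (rule nn_integral_cmult[OF H1D(2)[OF M]])
    then show "(\<integral>\<^sup>+x. total_max (c *\<^sub>R M) x \<partial>P) < \<infinity>" using H1D(3)[OF M] by (simp add: ennreal_mult_less_top)
    show "is_cond_exp P (F t) (\<lambda>x. c *\<^sub>R f x) ((c *\<^sub>R M) t)" if "t \<ge> 0" for t
      using is_cond_exp_scaleR[OF complete_subalgebra_F[OF that] f[OF that], of c] by (simp add: scaleR_fun_def)
  qed
  then have "0 *\<^sub>R M \<in> H1 P F" by blast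
  assume N: "N \<in> H1 P F"
  obtain g where g: "\<And>t. t \<ge> 0 \<Longrightarrow> is_cond_exp P (F t) g (N t)" using H1D(4)[OF N] by blast
  show "M + N \<in> H1 P F"
  proof (rule H1I)
    show "cadlag (\<lambda>t. (M + N) t x)" if "x \<in> space P" for x
      using cadlag_add[OF H1D(1)[OF M that] H1D(1)[OF N that]] by (simp add: plus_fun_def)
    have "(\<integral>\<^sup>+x. total_max (M + N) x \<partial>P) \<le> (\<integral>\<^sup>+x. total_max M x + total_max N x \<partial>P)"
      by (intro nn_integral_mono total_max_add)
    also have "\<dots> = (\<integral>\<^sup>+x. total_max M x \<partial>P) + (\<integral>\<^sup>+x. total_max N x \<partial>P)"
      by (intro nn_integral_add H1D(2) M N)
    also have "\<dots> < \<infinity>" using H1D(3)[OF M] H1D(3)[OF N] by simp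
    finally show "(\<integral>\<^sup>+x. total_max (M + N) x \<partial>P) < \<infinity>" .
    show "is_cond_exp P (F t) (\<lambda>x. f x + g x) ((M + N) t)" if "t \<ge> 0" for t
      using is_cond_exp_add[OF complete_subalgebra_F[OF that] f[OF that] g[OF that]] by (simp add: plus_fun_def)
  qed
next
  show "(0 :: real \<Rightarrow> 'a \<Rightarrow> 'e) \<in> H1 P F"
  proof (rule H1I)
    have "total_max (0 :: real \<Rightarrow> 'a \<Rightarrow> 'e) = (\<lambda>x. 0)" unfolding total_max_eq by (simp add: fun_eq_iff)
    then show "(\<integral>\<^sup>+x. total_max (0 :: real \<Rightarrow> 'a \<Rightarrow> 'e) x \<partial>P) < \<infinity>" by simp
    show "is_cond_exp P (F t) (\<lambda>x. 0) (0 t)" if t: "t \<ge> 0" for t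
    proof (rule is_cond_expI)
      interpret R: complete_finite_measure "restr_to_subalg P (F t)"
        by (rule complete_finite_measure_restr[OF complete_subalgebra_F[OF t]])
      show "bochner_integrable P (\<lambda>x. 0)" using bochner_has_integral_zero by (auto simp: bochner_integrable_def)
      show "bochner_integrable (restr_to_subalg P (F t)) (0 t)"
        using R.bochner_has_integral_zero by (auto simp: bochner_integrable_def zero_fun_def)
    qed simp
  qed (simp add: cadlag_const)
qed

definition max_fun :: "(real \<Rightarrow> 'a \<Rightarrow> 'e::banach) \<Rightarrow> 'a \<Rightarrow> real" where
  "max_fun M x = enn2real (total_max M x)"

text \<open>The maximal function integrated over an event. For fixed \<open>B\<close> it is a
  seminorm on H1, so uniform integrability becomes a statement about seminorms, which pass to convex
  hulls and admit norming functionals that feel only \<open>B\<close>.\<close>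

definition H1_norm_on :: "'a set \<Rightarrow> (real \<Rightarrow> 'a \<Rightarrow> 'e::banach) \<Rightarrow> real" where
  "H1_norm_on B M = (\<integral>x. indicator B x * max_fun M x \<partial>P)"

lemma max_fun_nonneg: "max_fun M x \<ge> 0" by (simp add: max_fun_def)

lemma AE_total_max:
  fixes M :: "real \<Rightarrow> 'a \<Rightarrow> 'e::banach"
  assumes M: "M \<in> H1 P F"
  shows "AE x in P. total_max M x = ennreal (max_fun M x)"
proof -
  have "AE x in P. total_max M x \<noteq> \<infinity>"
    using H1D(2,3)[OF M] by (intro nn_integral_PInf_AE) auto
  then show ?thesis by eventually_elim (simp add: max_fun_def less_top)
qed

lemma max_fun_integrable:
  fixes M :: "real \<Rightarrow> 'a \<Rightarrow> 'e::banach"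
  assumes M: "M \<in> H1 P F"
  shows "integrable P (max_fun M)" "B \<in> sets P \<Longrightarrow> integrable P (\<lambda>x. indicator B x * max_fun M x)"
    "(\<integral>\<^sup>+x. total_max M x \<partial>P) = ennreal (\<integral>x. max_fun M x \<partial>P)"
proof -
  have m: "max_fun M \<in> borel_measurable P" unfolding max_fun_def[abs_def] using H1D(2)[OF M] by measurable
  have eq: "(\<integral>\<^sup>+x. total_max M x \<partial>P) = (\<integral>\<^sup>+x. ennreal (max_fun M x) \<partial>P)"
    by (rule nn_integral_cong_AE[OF AE_total_max[OF M]])
  show 1: "integrable P (max_fun M)"
    using m H1D(3)[OF M] eq by (intro integrableI_bounded) (auto simp: max_fun_nonneg)
  show "integrable P (\<lambda>x. indicator B x * max_fun M x)" if "B \<in> sets P"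
    using integrable_mult_indicator[OF that 1] by simp
  show "(\<integral>\<^sup>+x. total_max M x \<partial>P) = ennreal (\<integral>x. max_fun M x \<partial>P)"
    unfolding eq using 1 by (intro nn_integral_eq_integral) (auto simp: max_fun_nonneg)
qed

lemma H1_norm_eq:
  fixes M :: "real \<Rightarrow> 'a \<Rightarrow> 'e::banach"
  assumes M: "M \<in> H1 P F"
  shows "H1_norm P M = H1_norm_on (space P) M" "H1_norm P M = (\<integral>x. max_fun M x \<partial>P)"
proof -
  have "0 \<le> (\<integral>x. max_fun M x \<partial>P)" by (intro Bochner_Integration.integral_nonneg max_fun_nonneg)
  then show 1: "H1_norm P M = (\<integral>x. max_fun M x \<partial>P)"
    by (simp add: H1_norm_def max_fun_integrable(3)[OF M])
  show "H1_norm P M = H1_norm_on (space P) M"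
    unfolding 1 H1_norm_on_def by (intro Bochner_Integration.integral_cong) auto
qed

lemma max_fun_add:
  fixes M N :: "real \<Rightarrow> 'a \<Rightarrow> 'e::banach"
  assumes M: "M \<in> H1 P F" and N: "N \<in> H1 P F"
  shows "AE x in P. max_fun (M + N) x \<le> max_fun M x + max_fun N x"
  using AE_total_max[OF M] AE_total_max[OF N] AE_total_max[OF subspace_add[OF subspace_H1 M N]]
proof eventually_elim
  case (elim x)
  have "ennreal (max_fun (M + N) x) \<le> ennreal (max_fun M x + max_fun N x)"
    using total_max_add[of M N x] elim by (simp add: max_fun_nonneg)
  then show ?case by (simp add: max_fun_nonneg add_nonneg_nonneg ennreal_le_iff del: ennreal_plus)
qed

lemma max_fun_scaleR: "max_fun (c *\<^sub>R M) x = \<bar>c\<bar> * max_fun M x"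
  by (simp add: max_fun_def total_max_scaleR enn2real_mult)

lemma norm_le_max_fun:
  fixes M :: "real \<Rightarrow> 'a \<Rightarrow> 'e::banach"
  assumes M: "M \<in> H1 P F"
  shows "AE x in P. \<forall>t\<ge>0. norm (M t x) \<le> max_fun M x"
  using AE_total_max[OF M]
proof eventually_elim
  case (elim x)
  then show ?case using norm_le_total_max[of _ M x] max_fun_nonneg[of M x] by (simp add: ennreal_le_iff)
qed

lemma seminorm_H1_norm_on:
  assumes B: "B \<in> sets P"
  shows "seminorm_on (H1 P F) (H1_norm_on B :: (real \<Rightarrow> 'a \<Rightarrow> 'e::banach) \<Rightarrow> real)"
  unfolding seminorm_on_def
proof (intro conjI ballI allI subspace_H1)
  fix M N :: "real \<Rightarrow> 'a \<Rightarrow> 'e" and c :: real assume M: "M \<in> H1 P F"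
  show "H1_norm_on B (c *\<^sub>R M) = \<bar>c\<bar> * H1_norm_on B M"
    by (simp add: H1_norm_on_def max_fun_scaleR mult.left_commute)
  assume N: "N \<in> H1 P F"
  note i = max_fun_integrable(2)[OF M B] max_fun_integrable(2)[OF N B] max_fun_integrable(2)[OF subspace_add[OF subspace_H1 M N] B]
  have "H1_norm_on B (M + N) \<le> (\<integral>x. indicator B x * max_fun M x + indicator B x * max_fun N x \<partial>P)"
    unfolding H1_norm_on_def
  proof (rule integral_mono_AE)
    show "AE x in P. indicator B x * max_fun (M + N) x \<le> indicator B x * max_fun M x + indicator B x * max_fun N x"
      using max_fun_add[OF M N] by eventually_elim (auto simp: indicator_def)
  qed (use i in auto)
  also have "\<dots> = H1_norm_on B M + H1_norm_on B N" unfolding H1_norm_on_def using i by simp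
  finally show "H1_norm_on B (M + N) \<le> H1_norm_on B M + H1_norm_on B N" .
qed

lemma seminorm_H1_norm: "seminorm_on (H1 P F) (H1_norm P :: (real \<Rightarrow> 'a \<Rightarrow> 'e::banach) \<Rightarrow> real)"
proof -
  note s = seminorm_H1_norm_on[OF sets.top]
  show ?thesis
    using s H1_norm_eq(1) subspace_add[OF subspace_H1] subspace_scale[OF subspace_H1] unfolding seminorm_on_def by metis
qed

lemma H1_norm_on_le_H1_norm:
  fixes M :: "real \<Rightarrow> 'a \<Rightarrow> 'e::banach"
  assumes M: "M \<in> H1 P F" and A: "A \<in> sets P"
  shows "H1_norm_on A M \<le> H1_norm P M"
  unfolding H1_norm_eq(1)[OF M] H1_norm_on_def
  using max_fun_integrable(2)[OF M A] max_fun_integrable(2)[OF M sets.top] sets.sets_into_space[OF A]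
  by (intro integral_mono) (auto simp: indicator_def max_fun_nonneg)

lemma H1_dual_eq: "H1_dual P F = dual_on (H1 P F) (H1_norm P :: (real \<Rightarrow> 'a \<Rightarrow> 'e::banach) \<Rightarrow> real)"
  unfolding H1_dual_def dual_on_def bounded_on_def by simp

text \<open>The closing variable in \<open>H1\<close> may carry information about no time at all.
  Convergence in L1 along the integers selects the variable whose norm over any event is dominated
  by the maximal function.\<close>

definition terminal_value :: "(real \<Rightarrow> 'a \<Rightarrow> 'e::banach) \<Rightarrow> ('a \<Rightarrow> 'e) \<Rightarrow> bool" where
  "terminal_value M f \<longleftrightarrow> bochner_integrable P f \<and> (\<forall>t\<ge>0. is_cond_exp P (F t) f (M t)) \<and>
     (\<lambda>k::nat. \<integral>x. norm (f x - M (real k) x) \<partial>P) \<longlonglongrightarrow> 0"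

lemma bint_indicator_l1_limit:
  fixes f :: "'a \<Rightarrow> 'e::banach"
  assumes f: "bochner_integrable P f" and g: "\<And>i::nat. bochner_integrable P (g i)"
    and lim: "(\<lambda>i. \<integral>x. norm (f x - g i x) \<partial>P) \<longlonglongrightarrow> 0" and A: "A \<in> sets P"
  shows "(\<lambda>i. bint (\<lambda>x. indicator A x *\<^sub>R g i x)) \<longlonglongrightarrow> bint (\<lambda>x. indicator A x *\<^sub>R f x)"
proof (rule bint_l1_limit(2))
  note fA = bochner_integrable_indicator[OF f A] and gA = bochner_integrable_indicator[OF g A]
  show "(\<lambda>x. indicator A x *\<^sub>R f x) \<in> borel_measurable P"
    using fA by (intro strongly_measurable_imp_borel bochner_integrable_strongly)
  show "bochner_integrable P (\<lambda>x. indicator A x *\<^sub>R g i x)" for i by (rule gA)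
  have "(\<lambda>i. ennreal (\<integral>x. norm (f x - g i x) \<partial>P)) \<longlonglongrightarrow> 0" using tendsto_ennrealI[OF lim] by simp
  then have "(\<lambda>i. l1dist f (g i)) \<longlonglongrightarrow> 0" by (simp add: l1dist_eq_integral f g)
  then show "(\<lambda>i. l1dist (\<lambda>x. indicator A x *\<^sub>R f x) (\<lambda>x. indicator A x *\<^sub>R g i x)) \<longlonglongrightarrow> 0"
    by (rule ennreal_squeeze_0[rotated]) (intro nn_integral_mono, auto simp: indicator_def)
qed

text \<open>An L1 limit along the integers closes the martingale: over an event of time
  \<open>t\<close> the integrals of \<open>M k\<close> are constant as soon as \<open>k\<close>
  passes \<open>t\<close>. It is applied to members of H1 and to limits of Cauchy sequences of
  such.\<close>

lemma terminal_valueI: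
  fixes M :: "real \<Rightarrow> 'a \<Rightarrow> 'e::banach"
  assumes adapted: "\<And>t. t \<ge> 0 \<Longrightarrow> bochner_integrable (restr_to_subalg P (F t)) (M t)"
    and mart: "\<And>s t A. 0 \<le> s \<Longrightarrow> s \<le> t \<Longrightarrow> A \<in> sets (F s) \<Longrightarrow> bint (\<lambda>x. indicator A x *\<^sub>R M s x) = bint (\<lambda>x. indicator A x *\<^sub>R M t x)"
    and cauchy: "\<And>e. e > 0 \<Longrightarrow> \<exists>n::nat. \<forall>i\<ge>n. \<forall>j\<ge>n. (\<integral>x. norm (M (real i) x - M (real j) x) \<partial>P) < e"
  shows "\<exists>f. terminal_value M f"
proof -
  have b: "bochner_integrable P (M t)" if "t \<ge> 0" for t
    by (rule bochner_integrable_restr[OF complete_subalgebra_F[OF that] adapted[OF that]])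
  obtain f where f: "bochner_integrable P f" "(\<lambda>k::nat. \<integral>x. norm (f x - M (real k) x) \<partial>P) \<longlonglongrightarrow> 0"
    using bochner_l1_complete[of "\<lambda>k. M (real k)"] b cauchy by auto
  have "is_cond_exp P (F t) f (M t)" if t: "t \<ge> 0" for t
  proof (rule is_cond_expI[OF f(1) adapted[OF t]])
    fix A assume A: "A \<in> sets (F t)"
    then have AP: "A \<in> sets P" by (rule subalgebra_sets[OF subalg[OF t]])
    have "(\<lambda>k. bint (\<lambda>x. indicator A x *\<^sub>R M (real k) x)) \<longlonglongrightarrow> bint (\<lambda>x. indicator A x *\<^sub>R f x)"
      by (rule bint_indicator_l1_limit[OF f(1) _ f(2) AP]) (simp add: b)
    moreover have "\<forall>\<^sub>F k in sequentially. bint (\<lambda>x. indicator A x *\<^sub>R M (real k) x) = bint (\<lambda>x. indicator A x *\<^sub>R M t x)"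
    proof -
      obtain n :: nat where "t \<le> real n" using real_arch_simple by blast
      then show ?thesis using mart[OF t _ A] by (intro eventually_sequentiallyI[of n]) (metis of_nat_mono order_trans)
    qed
    ultimately have "(\<lambda>k::nat. bint (\<lambda>x. indicator A x *\<^sub>R M t x)) \<longlonglongrightarrow> bint (\<lambda>x. indicator A x *\<^sub>R f x)"
      by (rule Lim_transform_eventually)
    then show "bint (\<lambda>x. indicator A x *\<^sub>R M t x) = bint (\<lambda>x. indicator A x *\<^sub>R f x)"
      using LIMSEQ_unique tendsto_const by blast
  qed
  then show ?thesis using f by (auto simp: terminal_value_def)
qed

lemma H1_martingale:
  fixes M :: "real \<Rightarrow> 'a \<Rightarrow> 'e::banach"
  assumes M: "M \<in> H1 P F"
  shows "t \<ge> 0 \<Longrightarrow> bochner_integrable (restr_to_subalg P (F t)) (M t)"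
    "0 \<le> s \<Longrightarrow> s \<le> t \<Longrightarrow> A \<in> sets (F s) \<Longrightarrow> bint (\<lambda>x. indicator A x *\<^sub>R M s x) = bint (\<lambda>x. indicator A x *\<^sub>R M t x)"
    "e > 0 \<Longrightarrow> \<exists>n::nat. \<forall>i\<ge>n. \<forall>j\<ge>n. (\<integral>x. norm (M (real i) x - M (real j) x) \<partial>P) < e"
proof -
  obtain f where f: "\<And>t. t \<ge> 0 \<Longrightarrow> is_cond_exp P (F t) f (M t)" using H1D(4)[OF M] by blast
  show "t \<ge> 0 \<Longrightarrow> bochner_integrable (restr_to_subalg P (F t)) (M t)"
    using is_cond_expD(3)[OF complete_subalgebra_F f] by blast
  show "bint (\<lambda>x. indicator A x *\<^sub>R M s x) = bint (\<lambda>x. indicator A x *\<^sub>R M t x)" if st: "0 \<le> s" "s \<le> t" "A \<in> sets (F s)"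
  proof -
    have t: "0 \<le> t" "A \<in> sets (F t)" using st filtration[of s t] by auto
    show ?thesis
      using is_cond_expD(4)[OF complete_subalgebra_F[OF st(1)] f[OF st(1)] st(3)]
        is_cond_expD(4)[OF complete_subalgebra_F[OF t(1)] f[OF t(1)] t(2)] by simp
  qed
  show "\<exists>n::nat. \<forall>i\<ge>n. \<forall>j\<ge>n. (\<integral>x. norm (M (real i) x - M (real j) x) \<partial>P) < e" if "e > 0"
    by (rule martingale_cauchy[where F="\<lambda>k. F (real k)" and f=f])
       (intro complete_subalgebra_F f that filtration; simp)+
qed

lemma H1_terminal_value: "M \<in> H1 P F \<Longrightarrow> \<exists>f. terminal_value M f"
  by (rule terminal_valueI) (auto intro: H1_martingale)

text \<open>The event is split according to the first time at which the level is exceeded. Each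
  piece belongs to the sigma-algebra of its time, so the localized contraction property replaces
  \<open>M t\<close> by \<open>f\<close> on it.\<close>

lemma doob_finite:
  fixes M :: "real \<Rightarrow> 'a \<Rightarrow> 'e::banach"
  assumes M: "\<And>t. t \<ge> 0 \<Longrightarrow> is_cond_exp P (F t) f (M t)" and T: "finite T" "T \<subseteq> {0..}" and l: "l \<ge> 0"
  shows "l * prob {x\<in>space P. \<exists>t\<in>T. norm (M t x) > l} \<le> (\<integral>x. norm (f x) \<partial>P)"
proof -
  have f: "bochner_integrable P f" using is_cond_exp_F(1)[OF _ M, of 0] by simp
  note fn = bochner_integrable_norm[OF f]
  \<comment> \<open>The event that \<open>t\<close> is the first time in \<open>T\<close> with norm
    above \<open>l\<close>.\<close>
  define D where "D t = {x\<in>space P. norm (M t x) > l \<and> (\<forall>s\<in>T. s < t \<longrightarrow> norm (M s x) \<le> l)}" for t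
  have DF: "D t \<in> sets (F t)" if t: "t \<in> T" for t
  proof -
    have sp: "space (F s) = space P" if "s \<ge> 0" for s using subalg[OF that] by (simp add: subalgebra_def)
    have t0: "t \<ge> 0" using T t by auto
    have m: "M s \<in> borel_measurable (F t)" if "s \<in> T" "s \<le> t" for s
    proof -
      have s0: "s \<ge> 0" using T that by auto
      have "sets (F s) \<subseteq> sets (F t)" "space (F s) = space (F t)" using filtration[OF s0 that(2)] sp[OF s0] sp[OF t0] by auto
      then show ?thesis using is_cond_exp_F(3)[OF s0 M[OF s0]] by (auto simp: measurable_def)
    qed
    have "D t = {x\<in>space (F t). norm (M t x) > l} \<inter> (\<Inter>s\<in>{s\<in>T. s < t} \<union> {t}. if s < t then {x\<in>space (F t). norm (M s x) \<le> l} else space (F t))"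
      using sp[OF t0] by (auto simp: D_def)
    moreover have "{x\<in>space (F t). norm (M t x) > l} \<in> sets (F t)" using m[OF t order_refl] by measurable
    moreover have "{x\<in>space (F t). norm (M s x) \<le> l} \<in> sets (F t)" if "s \<in> T" "s < t" for s using m[OF that(1) less_imp_le[OF that(2)]] by measurable
    then have "(\<Inter>s\<in>{s\<in>T. s < t} \<union> {t}. if s < t then {x\<in>space (F t). norm (M s x) \<le> l} else space (F t)) \<in> sets (F t)"
      using T by (intro sets.finite_INT) auto
    ultimately show ?thesis by auto
  qed
  have DP: "D t \<in> sets P" if "t \<in> T" for t using DF[OF that] T that by (intro subalgebra_sets[OF subalg]) auto
  have disj: "disjoint_family_on D T"
    unfolding disjoint_family_on_def D_def by (force simp: not_le dest: linorder_neqE)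
  have un: "{x\<in>space P. \<exists>t\<in>T. norm (M t x) > l} = (\<Union>t\<in>T. D t)"
  proof (rule antisym)
    show "{x\<in>space P. \<exists>t\<in>T. norm (M t x) > l} \<subseteq> (\<Union>t\<in>T. D t)"
    proof
      fix x assume x: "x \<in> {x\<in>space P. \<exists>t\<in>T. norm (M t x) > l}"
      let ?S = "{t\<in>T. norm (M t x) > l}"
      have S: "finite ?S" "?S \<noteq> {}" using T x by auto
      have "Min ?S \<in> ?S" using S by (rule Min_in)
      moreover have "norm (M s x) \<le> l" if "s \<in> T" "s < Min ?S" for s
        using Min_le[OF S(1), of s] that by (auto simp: not_le[symmetric])
      ultimately show "x \<in> (\<Union>t\<in>T. D t)" using x by (auto simp: D_def)
    qed
  qed (auto simp: D_def)
  have "l * prob {x\<in>space P. \<exists>t\<in>T. norm (M t x) > l} = (\<Sum>t\<in>T. l * prob (D t))"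
    unfolding un using disj DP T by (subst finite_measure_finite_Union) (auto simp: sum_distrib_left)
  also have "\<dots> \<le> (\<Sum>t\<in>T. \<integral>x. indicator (D t) x * norm (f x) \<partial>P)"
  proof (rule sum_mono)
    fix t assume t: "t \<in> T"
    then have t0: "t \<ge> 0" using T by auto
    have "l * prob (D t) = (\<integral>x. indicator (D t) x * l \<partial>P)" using DP[OF t] by simp
    also have "\<dots> \<le> (\<integral>x. indicator (D t) x * norm (M t x) \<partial>P)"
    proof (rule integral_mono)
      show "integrable P (\<lambda>x. indicator (D t) x * l)" using integrable_indicator_sets[OF DP[OF t]] by simp
      show "integrable P (\<lambda>x. indicator (D t) x * norm (M t x))"
        by (rule integrable_indicator_norm[OF is_cond_exp_F(2)[OF t0 M[OF t0]] DP[OF t]])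
      show "indicator (D t) x * l \<le> indicator (D t) x * norm (M t x)" for x by (auto simp: D_def indicator_def)
    qed
    also have "\<dots> \<le> (\<integral>x. indicator (D t) x * norm (f x) \<partial>P)"
      by (rule cond_exp_norm_le[OF complete_subalgebra_F[OF t0] M[OF t0] DF[OF t]])
    finally show "l * prob (D t) \<le> (\<integral>x. indicator (D t) x * norm (f x) \<partial>P)" .
  qed
  also have "\<dots> = (\<integral>x. (\<Sum>t\<in>T. indicator (D t) x * norm (f x)) \<partial>P)"
    using integrable_indicator_norm[OF f DP] by (intro Bochner_Integration.integral_sum[symmetric]) auto
  also have "\<dots> \<le> (\<integral>x. norm (f x) \<partial>P)"
  proof (rule integral_mono)
    show "integrable P (\<lambda>x. \<Sum>t\<in>T. indicator (D t) x * norm (f x))"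
      using integrable_indicator_norm[OF f DP] by (intro Bochner_Integration.integrable_sum) auto
    fix x
    have "(\<Sum>t\<in>T. indicator (D t) x :: real) = indicator (\<Union>t\<in>T. D t) x"
      using disj T by (simp add: indicator_UN_disjoint)
    then show "(\<Sum>t\<in>T. indicator (D t) x * norm (f x)) \<le> norm (f x)"
      by (simp add: sum_distrib_right[symmetric] indicator_def)
  qed (rule fn)
  finally show ?thesis .
qed

text \<open>The rationals are exhausted by finite sets of times and the measure is continuous along
  the increasing events. The strict inequality in the event is essential: a supremum above
  \<open>l\<close> is already exceeded at some rational time.\<close>

lemma doob:
  fixes M :: "real \<Rightarrow> 'a \<Rightarrow> 'e::banach"
  assumes M: "M \<in> H1 P F" and f: "\<And>t. t \<ge> 0 \<Longrightarrow> is_cond_exp P (F t) f (M t)" and l: "l \<ge> 0"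
  shows "l * prob {x\<in>space P. max_fun M x > l} \<le> (\<integral>x. norm (f x) \<partial>P)"
proof -
  define q where "q = from_nat_into nonneg_rats"
  have q: "range q = nonneg_rats" unfolding q_def by (rule range_from_nat_into[OF nonneg_rats_ne countable_nonneg_rats])
  define E where "E n = {x\<in>space P. \<exists>t\<in>q ` {..<n}. norm (M t x) > l}" for n
  have q0: "q n \<ge> 0" for n using q by (auto simp: nonneg_rats_def)
  have E: "E n \<in> sets P" for n
  proof -
    have "E n = (\<Union>i\<in>{..<n}. {x\<in>space P. norm (M (q i) x) > l})" by (auto simp: E_def)
    moreover have "{x\<in>space P. norm (M (q i) x) > l} \<in> sets P" for i using H1D(6)[OF M q0[of i]] by measurable
    ultimately show ?thesis by auto
  qed
  have "incseq E" by (auto simp: incseq_def E_def) 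
  then have lim: "(\<lambda>n. prob (E n)) \<longlonglongrightarrow> prob (\<Union>n. E n)"
    using E by (intro finite_Lim_measure_incseq) auto
  have sub: "{x\<in>space P. max_fun M x > l} \<subseteq> (\<Union>n. E n)"
  proof
    fix x assume x: "x \<in> {x\<in>space P. max_fun M x > l}"
    \<comment> \<open>An infinite supremum is turned into 0 by \<open>enn2real\<close>, so the two
      cases are treated separately.\<close>
    have "ennreal l < total_max M x"
    proof (cases "total_max M x < top")
      case True
      then have "total_max M x = ennreal (max_fun M x)" by (simp add: max_fun_def)
      then show ?thesis using x l by (simp add: ennreal_lessI)
    next
      case False
      then show ?thesis using less_top by (metis ennreal_less_top order_less_le_trans not_less)
    qed
    then have "ennreal l < (SUP t\<in>nonneg_rats. ennreal (norm (M t x)))" using total_max_rats[of M x, OF H1D(1)[OF M]] x by simp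
    then obtain t where "t \<in> nonneg_rats" "ennreal l < ennreal (norm (M t x))" by (auto simp: less_SUP_iff)
    moreover then obtain n where "t = q n" using q by blast
    ultimately have "x \<in> E (Suc n)" using x l by (auto simp: E_def ennreal_less_iff)
    then show "x \<in> (\<Union>n. E n)" by blast
  qed
  have "l * prob {x\<in>space P. max_fun M x > l} \<le> l * prob (\<Union>n. E n)"
    using E sub l by (intro mult_left_mono finite_measure_mono) auto
  also have "\<dots> \<le> (\<integral>x. norm (f x) \<partial>P)"
  proof (rule LIMSEQ_le_const2)
    show "(\<lambda>n. l * prob (E n)) \<longlonglongrightarrow> l * prob (\<Union>n. E n)" using lim by (intro tendsto_intros)
    have "l * prob (E n) \<le> (\<integral>x. norm (f x) \<partial>P)" for n
      unfolding E_def using q0 by (intro doob_finite f l) auto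
    then show "\<exists>N. \<forall>n\<ge>N. l * prob (E n) \<le> (\<integral>x. norm (f x) \<partial>P)" by blast
  qed
  finally show ?thesis .
qed

end

section \<open>Completeness of H1\<close>

lemma suminf_tail_ennreal_tendsto_0:
  fixes u :: "nat \<Rightarrow> ennreal"
  assumes fin: "(\<Sum>j. u j) < \<infinity>"
  shows "(\<lambda>n. \<Sum>j. u (j + n)) \<longlonglongrightarrow> 0"
proof -
  have ufin: "u j < \<infinity>" for j by (rule ennreal_suminf_lessD[OF fin])
  define v where "v j = enn2real (u j)" for j
  have uv: "u j = ennreal (v j)" and v0: "v j \<ge> 0" for j using ufin[of j] by (auto simp: v_def)
  have sv: "summable v" using fin v0 unfolding uv by (intro summable_suminf_not_top) auto
  have eq: "(\<Sum>j. u (j + n)) = ennreal ((\<Sum>j. v j) - (\<Sum>i<n. v i))" for n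
  proof -
    have "(\<Sum>j. u (j + n)) = ennreal (\<Sum>j. v (j + n))"
      unfolding uv using v0 summable_ignore_initial_segment[OF sv] by (intro suminf_ennreal2) auto
    then show ?thesis using suminf_minus_initial_segment[OF sv, of n] by simp
  qed
  have "(\<lambda>n. (\<Sum>j. v j) - (\<Sum>i<n. v i)) \<longlonglongrightarrow> (\<Sum>j. v j) - (\<Sum>j. v j)"
    by (intro tendsto_diff tendsto_const summable_LIMSEQ sv)
  then show ?thesis unfolding eq using tendsto_ennrealI by fastforce
qed

text \<open>Uniform convergence allows limits to be interchanged. Right limits are prescribed; for
  left limits the numbers \<open>l n\<close> are first shown to be Cauchy by the uniform
  estimate.\<close>

lemma cadlag_uniform_limit:
  fixes f :: "real \<Rightarrow> 'e::banach"
  assumes g: "\<And>n::nat. cadlag (g n)" and le: "\<And>n t. t \<ge> 0 \<Longrightarrow> ennreal (norm (f t - g n t)) \<le> r n" and r: "r \<longlonglongrightarrow> 0"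
  shows "cadlag f"
proof -
  have ev: "\<forall>\<^sub>F n in sequentially. \<forall>t\<ge>0. norm (f t - g n t) < e" if e: "e > 0" for e
  proof -
    have "\<forall>\<^sub>F n in sequentially. r n < ennreal e" using r by (rule order_tendstoD) (use e in simp)
    then show ?thesis
    proof eventually_elim
      case (elim n)
      then have "ennreal (norm (f t - g n t)) < ennreal e" if "t \<ge> 0" for t using le[OF that, of n] by (rule le_less_trans[rotated])
      then show ?case using e by (auto simp: ennreal_less_iff)
    qed
  qed
  have unif: "uniform_limit {0..} g f sequentially"
    unfolding uniform_limit_iff using ev by (simp add: dist_norm norm_minus_commute Ball_def)
  show ?thesis
    unfolding cadlag_def
  proof (intro conjI allI impI)
    fix t :: real assume t: "t \<ge> 0"
    have "(f \<longlongrightarrow> f t) (at t within {t<..})"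
    proof (rule swap_uniform_limit[where F=sequentially and f=g and g="\<lambda>n. g n t"])
      show "\<forall>\<^sub>F n in sequentially. (g n \<longlongrightarrow> g n t) (at t within {t<..})"
        using g t by (auto simp: cadlag_def)
      show "(\<lambda>n. g n t) \<longlonglongrightarrow> f t" using unif t by (intro tendsto_uniform_limitI[OF unif]) auto
      show "uniform_limit {t<..} g f sequentially" by (rule uniform_limit_on_subset[OF unif]) (use t in auto)
    qed simp
    then show "(f \<longlongrightarrow> f t) (at_right t)" .
  next
    fix t :: real assume t: "t > 0"
    have "\<forall>n. \<exists>l. (g n \<longlongrightarrow> l) (at_left t)" using g t by (simp add: cadlag_def)
    from choice[OF this] obtain l where l: "\<And>n. (g n \<longlongrightarrow> l n) (at_left t)" by blast
    \<comment> \<open>Left limits are taken within \<open>{0..<t}\<close> because the uniform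
      estimate holds for nonnegative times only.\<close>
    have nz: "at t within {0..<t} \<noteq> bot" using at_within_eq_bot_iff[of t "{0..<t}"] t by (auto simp: trivial_limit_within islimpt_Ico)
    have l': "(g n \<longlongrightarrow> l n) (at t within {0..<t})" for n by (rule tendsto_within_subset[OF l]) auto
    have "Cauchy l"
    proof (rule metric_CauchyI)
      fix e :: real assume e: "e > 0"
      obtain N where N: "\<And>n s. n \<ge> N \<Longrightarrow> s \<ge> 0 \<Longrightarrow> norm (f s - g n s) < e / 4"
        using ev[of "e/4"] e by (auto simp: eventually_sequentially)
      have "dist (l m) (l n) < e" if "m \<ge> N" "n \<ge> N" for m n
      proof -
        have "norm (l m - l n) \<le> e / 2"
        proof (rule tendsto_upperbound[OF _ _ nz])
          show "((\<lambda>s. norm (g m s - g n s)) \<longlongrightarrow> norm (l m - l n)) (at t within {0..<t})"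
            using l' by (intro tendsto_intros)
          have "norm (g m s - g n s) \<le> e / 2" if s: "s \<in> {0..<t}" for s
          proof -
            have "norm ((f s - g n s) - (f s - g m s)) \<le> norm (f s - g n s) + norm (f s - g m s)" by (rule norm_triangle_ineq4)
            then show ?thesis using N[OF \<open>m \<ge> N\<close>, of s] N[OF \<open>n \<ge> N\<close>, of s] s by simp
          qed
          then show "\<forall>\<^sub>F s in at t within {0..<t}. norm (g m s - g n s) \<le> e / 2"
            by (auto simp: eventually_at_filter)
        qed
        then show ?thesis using e by (simp add: dist_norm)
      qed
      then show "\<exists>N. \<forall>m\<ge>N. \<forall>n\<ge>N. dist (l m) (l n) < e" by blast
    qed
    then obtain L where L: "l \<longlonglongrightarrow> L" by (auto simp: Cauchy_convergent_iff convergent_def)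
    have "(f \<longlongrightarrow> L) (at t within {0..<t})"
    proof (rule swap_uniform_limit[where F=sequentially and f=g and g=l])
      show "\<forall>\<^sub>F n in sequentially. (g n \<longlongrightarrow> l n) (at t within {0..<t})" using l' by simp
      show "uniform_limit {0..<t} g f sequentially" by (rule uniform_limit_on_subset[OF unif]) auto
    qed (use L in auto)
    moreover have "at t within {0..<t} = at_left t" by (rule at_within_nhd[where S="{0<..}"]) (use t in auto)
    ultimately show "\<exists>l. (f \<longlongrightarrow> l) (at_left t)" by auto
  qed
qed

context stoch_basis
begin

text \<open>The summed maximal functions of the increments dominate the distance from the limit
  uniformly in time. Hence almost all paths converge uniformly, and the errors of the maximal
  function and of each fixed time obey the same integrable bound.\<close>

lemma H1_complete:
  fixes X :: "nat \<Rightarrow> real \<Rightarrow> 'a \<Rightarrow> 'e::banach"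
  assumes X: "\<And>n. X n \<in> H1 P F" and fast: "\<And>n. H1_norm P (X (Suc n) - X n) \<le> (1/2) ^ n"
  shows "\<exists>M\<in>H1 P F. (\<lambda>n. H1_norm P (X n - M)) \<longlonglongrightarrow> 0"
proof -
  define u where "u n = total_max (X (Suc n) - X n)" for n
  have XX: "X (Suc n) - X n \<in> H1 P F" for n by (intro subspace_diff[OF subspace_H1] X)
  have um: "u n \<in> borel_measurable P" for n unfolding u_def by (rule H1D(2)[OF XX])
  have ui: "(\<integral>\<^sup>+x. u n x \<partial>P) \<le> ennreal ((1/2) ^ n)" for n
    unfolding u_def max_fun_integrable(3)[OF XX] using fast[of n] unfolding H1_norm_eq(2)[OF XX] by (rule ennreal_leI)
  define r where "r n x = (\<Sum>j. u (j + n) x)" for n x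
  have rm: "r n \<in> borel_measurable P" for n unfolding r_def using um by measurable
  have r_int: "(\<integral>\<^sup>+x. r n x \<partial>P) \<le> ennreal (2 * (1/2) ^ n)" for n
  proof -
    have "(\<integral>\<^sup>+x. r n x \<partial>P) = (\<Sum>j. \<integral>\<^sup>+x. u (j + n) x \<partial>P)" unfolding r_def by (intro nn_integral_suminf um)
    also have "\<dots> \<le> (\<Sum>j. ennreal ((1/2) ^ (j + n)))" using ui by (intro suminf_le) auto
    finally show ?thesis by (simp add: suminf_geometric_tail_ennreal)
  qed
  have lim0: "(\<lambda>n. 2 * (1/2) ^ n :: real) \<longlonglongrightarrow> 0" by (intro tendsto_mult_right_zero LIMSEQ_realpow_zero) auto
  define G where "G = {x\<in>space P. r 0 x < \<infinity>}"
  have "AE x in P. r 0 x \<noteq> \<infinity>"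
    using rm r_int[of 0] by (intro nn_integral_PInf_AE) (auto simp: top_unique)
  then have AE_G: "AE x in P. x \<in> G" using AE_space by eventually_elim (auto simp: G_def less_top)
  \<comment> \<open>The value 0 off \<open>G\<close> keeps every path cadlag. The exceptional set is
    null and so belongs to all the sigma-algebras, which preserves adaptedness.\<close>
  define M where "M t x = (if x \<in> G then lim (\<lambda>n. X n t x) else 0)" for t x
  have diff_le: "ennreal (norm (X (Suc n) t x - X n t x)) \<le> u n x" if "t \<ge> 0" for n t x
    using norm_le_total_max[OF that, of "X (Suc n) - X n" x] by (simp add: u_def fun_diff_def)
  have conv: "(\<lambda>n. X n t x) \<longlonglongrightarrow> M t x" and err: "ennreal (norm (M t x - X n t x)) \<le> r n x"
    if "x \<in> G" "t \<ge> 0" for x t n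
  proof -
    have fin: "(\<Sum>j. u j x) < \<infinity>" using that by (simp add: G_def r_def)
    show "(\<lambda>n. X n t x) \<longlonglongrightarrow> M t x" "ennreal (norm (M t x - X n t x)) \<le> r n x"
      using fast_cauchy_limit[of "\<lambda>n. X n t x" "\<lambda>n. u n x", OF diff_le[OF that(2)] fin] that(1)
      by (simp_all add: M_def r_def)
  qed
  have cadlag: "cadlag (\<lambda>t. M t x)" if "x \<in> space P" for x
  proof (cases "x \<in> G")
    case True
    show ?thesis
    proof (rule cadlag_uniform_limit[where g="\<lambda>n t. X n t x" and r="\<lambda>n. r n x"])
      show "(\<lambda>n. r n x) \<longlonglongrightarrow> 0"
        unfolding r_def using True by (intro suminf_tail_ennreal_tendsto_0) (simp add: G_def r_def)
    qed (rule H1D(1)[OF X that], rule err[OF True])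
  qed (simp add: M_def cadlag_const)
  have l1_le: "(\<integral>\<^sup>+x. ennreal (norm (M t x - X n t x)) \<partial>P) \<le> ennreal (2 * (1/2) ^ n)" if t: "t \<ge> 0" for t n
  proof -
    have "AE x in P. ennreal (norm (M t x - X n t x)) \<le> r n x" using AE_G by eventually_elim (rule err[OF _ t])
    from nn_integral_mono_AE[OF this] r_int[of n] show ?thesis by (rule order_trans)
  qed
  have adapted: "bochner_integrable (restr_to_subalg P (F t)) (M t)" if t: "t \<ge> 0" for t
  proof -
    note cs = complete_subalgebra_F[OF t] and sub = subalg[OF t]
    interpret R: complete_finite_measure "restr_to_subalg P (F t)" by (rule complete_finite_measure_restr[OF cs])
    have Xb: "bochner_integrable (restr_to_subalg P (F t)) (X n t)" for n by (rule H1_martingale(1)[OF X t])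
    have "space P - G \<in> null_sets P" using AE_G by (auto simp: AE_iff_null_sets set_diff_eq)
    then have "space P - G \<in> null_sets (restr_to_subalg P (F t))"
      unfolding null_sets_restr_to_subalg[OF sub] using null_in_F0 filtration[of 0 t] t by auto
    from AE_not_in[OF this] have AE_G': "AE x in restr_to_subalg P (F t). x \<in> G"
      using AE_space by eventually_elim (auto simp: space_restr_to_subalg)
    have Mm: "M t \<in> borel_measurable (restr_to_subalg P (F t))"
    proof (rule R.borel_measurable_AE_LIMSEQ)
      show "X n t \<in> borel_measurable (restr_to_subalg P (F t))" for n
        by (rule R.strongly_measurable_imp_borel[OF R.bochner_integrable_strongly[OF Xb]])
      show "AE x in restr_to_subalg P (F t). (\<lambda>n. X n t x) \<longlonglongrightarrow> M t x"
        using AE_G' by eventually_elim (rule conv[OF _ t])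
    qed
    have "R.l1dist (M t) (X n t) \<le> ennreal (2 * (1/2) ^ n)" for n
    proof -
      have "(\<lambda>x. M t x - X n t x) \<in> borel_measurable (restr_to_subalg P (F t))"
        by (rule R.borel_measurable_diff_strongly[OF Mm R.bochner_integrable_strongly[OF Xb]])
      then have "(\<lambda>x. M t x - X n t x) \<in> borel_measurable (F t)"
        by (simp cong: measurable_cong_sets add: sets_restr_to_subalg[OF sub])
      then have "(\<lambda>x. ennreal (norm (M t x - X n t x))) \<in> borel_measurable (F t)" by measurable
      from nn_integral_subalgebra2[OF sub this] show ?thesis using l1_le[OF t] by simp
    qed
    then have "(\<lambda>n. R.l1dist (M t) (X n t)) \<longlonglongrightarrow> 0"
      by (rule ennreal_squeeze_0) (use tendsto_ennrealI[OF lim0] in simp)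
    then show ?thesis by (rule R.bint_l1_limit(1)[OF Mm Xb])
  qed
  have Mb: "bochner_integrable P (M t)" if "t \<ge> 0" for t
    by (rule bochner_integrable_restr[OF complete_subalgebra_F[OF that] adapted[OF that]])
  have l1_le': "(\<integral>x. norm (M t x - X n t x) \<partial>P) \<le> 2 * (1/2) ^ n" if t: "t \<ge> 0" for t n
    using l1_le[OF t, of n] unfolding l1dist_eq_integral[OF Mb[OF t] H1D(5)[OF X t]] by (simp add: ennreal_le_iff)
  have l1_lim: "(\<lambda>n. \<integral>x. norm (M t x - X n t x) \<partial>P) \<longlonglongrightarrow> 0" if t: "t \<ge> 0" for t
    by (rule tendsto_sandwich[OF _ _ tendsto_const lim0]) (use l1_le'[OF t] in auto)
  have "\<exists>f. terminal_value M f"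
  proof (rule terminal_valueI[OF adapted])
    fix s t :: real and A assume st: "0 \<le> s" "s \<le> t" "A \<in> sets (F s)"
    then have t: "0 \<le> t" and A: "A \<in> sets P" using subalgebra_sets[OF subalg] by auto
    have "(\<lambda>n. bint (\<lambda>x. indicator A x *\<^sub>R X n s x)) \<longlonglongrightarrow> bint (\<lambda>x. indicator A x *\<^sub>R M s x)"
      by (intro bint_indicator_l1_limit Mb H1D(5) X st A l1_lim)
    moreover have "(\<lambda>n. bint (\<lambda>x. indicator A x *\<^sub>R X n s x)) \<longlonglongrightarrow> bint (\<lambda>x. indicator A x *\<^sub>R M t x)"
      unfolding H1_martingale(2)[OF X st] by (intro bint_indicator_l1_limit Mb H1D(5) X t A l1_lim)
    ultimately show "bint (\<lambda>x. indicator A x *\<^sub>R M s x) = bint (\<lambda>x. indicator A x *\<^sub>R M t x)" by (rule LIMSEQ_unique)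
  next
    fix e :: real assume e: "e > 0"
    \<comment> \<open>The approximation error does not depend on time, so one fixed \<open>n\<close>
      passes the Cauchy property along the integers from \<open>X n\<close> to
      \<open>M\<close>.\<close>
    have "\<forall>\<^sub>F n in sequentially. 2 * (1/2) ^ n < e / 3" using lim0 by (rule order_tendstoD) (use e in simp)
    then obtain n where n: "2 * (1/2) ^ n < e / 3" by (auto simp: eventually_sequentially)
    obtain k where k: "\<And>i j. i \<ge> k \<Longrightarrow> j \<ge> k \<Longrightarrow> (\<integral>x. norm (X n (real i) x - X n (real j) x) \<partial>P) < e / 3"
      using H1_martingale(3)[OF X, of "e/3" n] e by auto
    have "(\<integral>x. norm (M (real i) x - M (real j) x) \<partial>P) < e" if ij: "i \<ge> k" "j \<ge> k" for i j
    proof -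
      have b: "bochner_integrable P (X n (real m))" "bochner_integrable P (M (real m))" for m
        using H1D(5)[OF X] Mb by auto
      note i = bochner_integrable_norm[OF bochner_integrable_diff[OF b(2) b(1)]]
        bochner_integrable_norm[OF bochner_integrable_diff[OF b(2) b(2)]]
        bochner_integrable_norm[OF bochner_integrable_diff[OF b(1) b(1)]]
      have "(\<integral>x. norm (M (real i) x - M (real j) x) \<partial>P) \<le>
          (\<integral>x. norm (M (real i) x - X n (real i) x) + norm (M (real j) x - X n (real j) x) + norm (X n (real i) x - X n (real j) x) \<partial>P)"
      proof (rule integral_mono)
        fix x
        have "norm (a - b + c) \<le> norm a + norm b + norm c" for a b c :: 'e
          using norm_triangle_ineq[of "a - b" c] norm_triangle_ineq4[of a b] by linarith
        from this[of "M (real i) x - X n (real i) x" "M (real j) x - X n (real j) x" "X n (real i) x - X n (real j) x"]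
        show "norm (M (real i) x - M (real j) x) \<le> norm (M (real i) x - X n (real i) x) + norm (M (real j) x - X n (real j) x) + norm (X n (real i) x - X n (real j) x)"
          by simp
      qed (use i in simp_all)
      also have "\<dots> = (\<integral>x. norm (M (real i) x - X n (real i) x) \<partial>P) + (\<integral>x. norm (M (real j) x - X n (real j) x) \<partial>P) + (\<integral>x. norm (X n (real i) x - X n (real j) x) \<partial>P)"
        using i by simp
      also have "\<dots> < e" using l1_le'[of "real i" n] l1_le'[of "real j" n] n k[OF ij] by simp
      finally show ?thesis .
    qed
    then show "\<exists>n. \<forall>i\<ge>n. \<forall>j\<ge>n. (\<integral>x. norm (M (real i) x - M (real j) x) \<partial>P) < e" by blast
  qed
  then obtain f where f: "terminal_value M f" by blast
  have err_max: "AE x in P. total_max (M - X n) x \<le> r n x" for n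
    using AE_G
  proof eventually_elim
    case (elim x)
    show ?case unfolding total_max_eq using err[OF elim] by (intro SUP_least) (auto simp: fun_diff_def)
  qed
  have err_int: "(\<integral>\<^sup>+x. total_max (M - X n) x \<partial>P) \<le> ennreal (2 * (1/2) ^ n)" for n
    using nn_integral_mono_AE[OF err_max[of n]] r_int[of n] by (rule order_trans)
  have MH: "M \<in> H1 P F"
  proof (rule H1I[OF cadlag])
    have "AE x in P. total_max M x \<le> r 0 x + total_max (X 0) x"
      using err_max[of 0]
    proof eventually_elim
      case (elim x)
      have "total_max M x \<le> total_max (M - X 0) x + total_max (X 0) x" using total_max_add[of "M - X 0" "X 0" x] by simp
      also have "\<dots> \<le> r 0 x + total_max (X 0) x" using elim by (rule add_right_mono)
      finally show ?case .
    qed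
    then have "(\<integral>\<^sup>+x. total_max M x \<partial>P) \<le> (\<integral>\<^sup>+x. r 0 x + total_max (X 0) x \<partial>P)" by (rule nn_integral_mono_AE)
    also have "\<dots> = (\<integral>\<^sup>+x. r 0 x \<partial>P) + (\<integral>\<^sup>+x. total_max (X 0) x \<partial>P)" by (intro nn_integral_add rm H1D(2)[OF X])
    also have "\<dots> < \<infinity>" using le_less_trans[OF r_int[of 0] ennreal_less_top] H1D(3)[OF X] by simp
    finally show "(\<integral>\<^sup>+x. total_max M x \<partial>P) < \<infinity>" .
    show "is_cond_exp P (F t) f (M t)" if "t \<ge> 0" for t using f that by (auto simp: terminal_value_def)
  qed
  have "H1_norm P (X n - M) \<le> 2 * (1/2) ^ n" for n
  proof -
    have "H1_norm P (X n - M) = H1_norm P (M - X n)" by (rule seminorm_onD(6)[OF seminorm_H1_norm X MH])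
    also have "\<dots> \<le> 2 * (1/2) ^ n" unfolding H1_norm_def using enn2real_mono[OF err_int[of n]] by simp
    finally show ?thesis .
  qed
  then have "(\<lambda>n. H1_norm P (X n - M)) \<longlonglongrightarrow> 0"
    by (intro tendsto_sandwich[OF _ _ tendsto_const lim0])
       (auto intro!: always_eventually seminorm_onD(5)[OF seminorm_H1_norm] subspace_diff[OF subspace_H1] X MH)
  then show ?thesis using MH by blast
qed

end

section \<open>Uniform integrability and weak limits\<close>

text \<open>Together with minimality of the hull this passes every seminorm bound from a set to its
  convex combinations.\<close>

lemma convex_seminorm_ball:
  assumes p: "seminorm_on S p"
  shows "convex {x\<in>S. p x \<le> b}"
proof (rule convexI)
  fix x y and u v :: real
  assume xy: "x \<in> {x\<in>S. p x \<le> b}" "y \<in> {x\<in>S. p x \<le> b}" and uv: "0 \<le> u" "0 \<le> v" "u + v = 1"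
  note S = seminorm_onD(1)[OF p]
  have s: "u *\<^sub>R x \<in> S" "v *\<^sub>R y \<in> S" using xy subspace_scale[OF S] by auto
  have "p (u *\<^sub>R x + v *\<^sub>R y) \<le> p (u *\<^sub>R x) + p (v *\<^sub>R y)" by (rule seminorm_onD(2)[OF p s])
  also have "\<dots> = u * p x + v * p y" using seminorm_onD(3)[OF p] xy uv by simp
  also have "\<dots> \<le> u * b + v * b" using xy uv by (intro add_mono mult_left_mono) auto
  also have "\<dots> = b" using uv by (metis distrib_right mult_1)
  finally show "u *\<^sub>R x + v *\<^sub>R y \<in> {x\<in>S. p x \<le> b}" using subspace_add[OF S s] by simp
qed

lemma (in complete_finite_measure) seminorm_l1:
  "seminorm_on {f. bochner_integrable M f} (\<lambda>f. \<integral>x. norm (f x :: 'e::banach) \<partial>M)"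
  unfolding seminorm_on_def
proof (intro conjI ballI allI)
  show "subspace {f. bochner_integrable M (f :: 'a \<Rightarrow> 'e)}"
  proof (rule subspaceI)
    show "0 \<in> {f. bochner_integrable M (f :: 'a \<Rightarrow> 'e)}"
      using bochner_has_integral_zero by (auto simp: bochner_integrable_def zero_fun_def)
    show "f + g \<in> {f. bochner_integrable M f}" if "f \<in> {f. bochner_integrable M f}" "g \<in> {f. bochner_integrable M f}" for f g :: "'a \<Rightarrow> 'e"
      using bochner_integrable_add[of f g] that by (simp add: plus_fun_def)
    show "c *\<^sub>R f \<in> {f. bochner_integrable M f}" if "f \<in> {f. bochner_integrable M f}" for f :: "'a \<Rightarrow> 'e" and c
      using bochner_integrable_scaleR[of f c] that by (simp add: scaleR_fun_def)
  qed
  fix f g :: "'a \<Rightarrow> 'e" and c assume f: "f \<in> {f. bochner_integrable M f}"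
  show "(\<integral>x. norm ((c *\<^sub>R f) x) \<partial>M) = \<bar>c\<bar> * (\<integral>x. norm (f x) \<partial>M)" by (simp add: scaleR_fun_def)
  assume g: "g \<in> {f. bochner_integrable M f}"
  have i: "integrable M (\<lambda>x. norm (f x))" "integrable M (\<lambda>x. norm (g x))" "integrable M (\<lambda>x. norm (f x + g x))"
    using f g bochner_integrable_add[of f g] by (auto intro: bochner_integrable_norm)
  have "(\<integral>x. norm (f x + g x) \<partial>M) \<le> (\<integral>x. norm (f x) + norm (g x) \<partial>M)"
    using i by (intro integral_mono) (auto simp: norm_triangle_ineq)
  then show "(\<integral>x. norm ((f + g) x) \<partial>M) \<le> (\<integral>x. norm (f x) \<partial>M) + (\<integral>x. norm (g x) \<partial>M)"
    using i by (simp add: plus_fun_def)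
qed

context stoch_basis
begin

definition equi_integrable :: "(real \<Rightarrow> 'a \<Rightarrow> 'e::banach) set \<Rightarrow> bool" where
  "equi_integrable K \<longleftrightarrow> (\<exists>C. \<forall>M\<in>K. H1_norm P M \<le> C) \<and>
     (\<forall>e>0. \<exists>d>0. \<forall>M\<in>K. \<forall>A\<in>sets P. prob A \<le> d \<longrightarrow> H1_norm_on A M \<le> e)"

lemma uniformly_integrable_iff:
  assumes K: "K \<subseteq> H1 P F"
  shows "uniformly_integrable P (maximal_functions K) \<longleftrightarrow> equi_integrable K"
proof -
  have eq: "maximal_functions K = max_fun ` K" by (auto simp: maximal_functions_def max_fun_def[abs_def])
  have int: "\<forall>\<xi>\<in>maximal_functions K. integrable P \<xi>" unfolding eq using K max_fun_integrable(1) by blast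
  have 1: "(\<integral>x. \<bar>max_fun M x\<bar> \<partial>P) = H1_norm P M" if "M \<in> K" for M
    using H1_norm_eq(2)[of M] K that by (simp add: abs_of_nonneg[OF max_fun_nonneg] subset_eq)
  have 2: "(LINT x:A|P. \<bar>max_fun M x\<bar>) = H1_norm_on A M" for A M
    by (simp add: abs_of_nonneg[OF max_fun_nonneg] H1_norm_on_def set_lebesgue_integral_def)
  show ?thesis
    unfolding uniformly_integrable_def equi_integrable_def using int by (simp add: eq 1 2)
qed

text \<open>Every \<open>M k\<close> is dominated by the maximal function, and the L1 limit inherits
  the bound. So uniform integrability of the maximal functions passes to the terminal
  values.\<close>

lemma integral_norm_terminal_le:
  fixes M :: "real \<Rightarrow> 'a \<Rightarrow> 'e::banach"
  assumes M: "M \<in> H1 P F" and f: "terminal_value M f" and A: "A \<in> sets P"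
  shows "(\<integral>x. indicator A x * norm (f x) \<partial>P) \<le> H1_norm_on A M"
proof (rule LIMSEQ_le_const)
  have fb: "bochner_integrable P f" and lim: "(\<lambda>k::nat. \<integral>x. norm (f x - M (real k) x) \<partial>P) \<longlonglongrightarrow> 0"
    using f by (auto simp: terminal_value_def)
  show "(\<lambda>k::nat. H1_norm_on A M + (\<integral>x. norm (f x - M (real k) x) \<partial>P)) \<longlonglongrightarrow> H1_norm_on A M"
    using tendsto_add[OF tendsto_const lim] by simp
  have "(\<integral>x. indicator A x * norm (f x) \<partial>P) \<le> H1_norm_on A M + (\<integral>x. norm (f x - M (real k) x) \<partial>P)" for k
  proof -
    have Mb: "bochner_integrable P (M (real k))" by (rule H1D(5)[OF M]) simp
    have fM: "bochner_integrable P (\<lambda>x. f x - M (real k) x)" by (rule bochner_integrable_diff[OF fb Mb])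
    have "(\<integral>x. indicator A x * norm (M (real k) x) \<partial>P) \<le> H1_norm_on A M"
      unfolding H1_norm_on_def
    proof (rule integral_mono_AE[OF integrable_indicator_norm[OF Mb A] max_fun_integrable(2)[OF M A]])
      show "AE x in P. indicator A x * norm (M (real k) x) \<le> indicator A x * max_fun M x"
        using norm_le_max_fun[OF M] by eventually_elim (auto simp: indicator_def)
    qed
    moreover have "(\<integral>x. indicator A x * norm (f x - M (real k) x) \<partial>P) \<le> (\<integral>x. norm (f x - M (real k) x) \<partial>P)"
      using integrable_indicator_norm[OF fM A] bochner_integrable_norm[OF fM]
      by (intro integral_mono) (auto simp: indicator_def)
    ultimately show ?thesis using integral_norm_indicator_approx[OF fb Mb A] by linarith
  qed
  then show "\<exists>N. \<forall>k\<ge>N. (\<integral>x. indicator A x * norm (f x) \<partial>P) \<le> H1_norm_on A M + (\<integral>x. norm (f x - M (real k) x) \<partial>P)" by blast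
qed

text \<open>The time index is moved from the martingale to the indicator: integrating
  \<open>c (M k)\<close> over \<open>B\<close> equals integrating \<open>h B k\<close> times
  \<open>c (M l)\<close>. The bound sees the martingale through its maximal function alone, hence is
  uniform over uniformly integrable families.\<close>

lemma integral_indicator_increment_le:
  fixes M :: "real \<Rightarrow> 'a \<Rightarrow> 'e::banach" and c :: "'e \<Rightarrow>\<^sub>L real" and k l :: nat
  defines "h \<equiv> \<lambda>B k. real_cond_exp P (F (real k)) (indicator B)"
  assumes M: "M \<in> H1 P F" and B: "B \<in> sets P" and kl: "k \<le> l"
  shows "\<bar>(\<integral>x. indicator B x * c (M (real l) x) \<partial>P) - (\<integral>x. indicator B x * c (M (real k) x) \<partial>P)\<bar>
     \<le> norm c * (\<integral>x. \<bar>h B l x - h B k x\<bar> * max_fun M x \<partial>P)"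
    and "integrable P (\<lambda>x. \<bar>h B l x - h B k x\<bar> * max_fun M x)"
proof -
  have sub: "subalgebra P (F (real k))" for k by (rule subalg) simp
  have sig: "sigma_finite_subalgebra P (F (real k))" for k
    by (rule finite_measure_subalgebra_is_sigma_finite) (standard, rule sub)
  have h01: "AE x in P. 0 \<le> h B k x \<and> h B k x \<le> 1" for k
    unfolding h_def by (rule real_cond_exp_indicator_bounds[OF sub B])
  have hm: "h B k \<in> borel_measurable P" "h B k \<in> borel_measurable (F (real k))" for k by (auto simp: h_def)
  let ?X = "\<lambda>k x. c (M (real k) x)"
  have Mb: "bochner_integrable P (M (real k))" for k by (rule H1D(5)[OF M]) simp
  have Xi: "integrable P (?X k)" for k
    using bochner_integrable_bounded_linear[OF blinfun.bounded_linear_right[of c] Mb] by (simp add: bochner_integrable_real_iff)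
  have Xm: "?X k \<in> borel_measurable (F (real k))" for k
    by (rule measurable_compose[OF H1D(7)[OF M] borel_measurable_continuous_onI]) (auto intro: continuous_intros)
  have bdd: "integrable P (\<lambda>x. g x * w x)" if "integrable P w" "g \<in> borel_measurable P" "AE x in P. \<bar>g x\<bar> \<le> 1" for g w :: "'a \<Rightarrow> real"
  proof (rule Bochner_Integration.integrable_bound[OF that(1)])
    show "(\<lambda>x. g x * w x) \<in> borel_measurable P" using that(1,2) by measurable
    show "AE x in P. norm (g x * w x) \<le> norm (w x)"
      using that(3) by eventually_elim (simp add: abs_mult mult_left_le_one_le)
  qed
  have h1: "AE x in P. \<bar>h B k x\<bar> \<le> 1" for k using h01[of k] by eventually_elim simp
  have hX: "integrable P (\<lambda>x. h B k x * ?X j x)" for k j by (rule bdd[OF Xi hm(1) h1])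
  have BX: "(\<integral>x. indicator B x * ?X k x \<partial>P) = (\<integral>x. h B k x * ?X k x \<partial>P)" for k
  proof -
    have "integrable P (\<lambda>x. ?X k x * indicator B x)"
      using integrable_mult_indicator[OF B Xi[of k]] by (simp add: mult.commute)
    from sigma_finite_subalgebra.real_cond_exp_intg(2)[OF sig this Xm] B
    show ?thesis by (simp add: h_def mult.commute)
  qed
  have mart: "AE x in P. real_cond_exp P (F (real k)) (?X l) x = ?X k x"
  proof (rule sigma_finite_subalgebra.real_cond_exp_charact[OF sig _ Xi Xi Xm])
    fix A assume A: "A \<in> sets (F (real k))"
    then have AP: "A \<in> sets P" using subalgebra_sets[OF sub] by blast
    have "(\<integral>x. indicator A x * ?X j x \<partial>P) = c (bint (\<lambda>x. indicator A x *\<^sub>R M (real j) x))" for j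
    proof -
      have "bint (\<lambda>x. c (indicator A x *\<^sub>R M (real j) x)) = c (bint (\<lambda>x. indicator A x *\<^sub>R M (real j) x))"
        by (intro bint_bounded_linear blinfun.bounded_linear_right bochner_integrable_indicator Mb AP)
      moreover have "bint (\<lambda>x. indicator A x * ?X j x) = (\<integral>x. indicator A x * ?X j x \<partial>P)"
        by (rule bint_real[OF abs_integral_blinfun_le(1)[OF Mb AP]])
      ultimately show ?thesis by (simp add: blinfun.scaleR_right)
    qed
    then show "(LINT x:A|P. ?X l x) = (LINT x:A|P. ?X k x)"
      using H1_martingale(2)[OF M, of "real k" "real l" A] A kl by (simp add: set_lebesgue_integral_def)
  qed
  have "(\<integral>x. h B k x * ?X k x \<partial>P) = (\<integral>x. h B k x * real_cond_exp P (F (real k)) (?X l) x \<partial>P)"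
  proof (rule integral_cong_AE)
    show "AE x in P. h B k x * ?X k x = h B k x * real_cond_exp P (F (real k)) (?X l) x"
      using mart by eventually_elim simp
  qed (use hm Xi in measurable)
  also have "\<dots> = (\<integral>x. h B k x * ?X l x \<partial>P)"
    using Xi by (intro sigma_finite_subalgebra.real_cond_exp_intg(2)[OF sig hX hm(2)]) auto
  \<comment> \<open>Two conditionings at time \<open>k\<close>: the indicator is replaced by its
    conditional expectation, then \<open>M k\<close> by the later \<open>M l\<close>.\<close>
  finally have Bk: "(\<integral>x. indicator B x * ?X k x \<partial>P) = (\<integral>x. h B k x * ?X l x \<partial>P)" using BX by simp
  have d1: "AE x in P. \<bar>\<bar>h B l x - h B k x\<bar>\<bar> \<le> 1" using h01[of k] h01[of l] by eventually_elim auto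
  have dm: "(\<lambda>x. \<bar>h B l x - h B k x\<bar>) \<in> borel_measurable P" using hm by measurable
  show int: "integrable P (\<lambda>x. \<bar>h B l x - h B k x\<bar> * max_fun M x)"
    by (rule bdd[OF max_fun_integrable(1)[OF M] dm d1])
  have "(\<integral>x. indicator B x * ?X l x \<partial>P) - (\<integral>x. indicator B x * ?X k x \<partial>P) = (\<integral>x. h B l x * ?X l x - h B k x * ?X l x \<partial>P)"
    unfolding BX[of l] Bk using hX by simp
  also have "\<bar>\<dots>\<bar> \<le> (\<integral>x. \<bar>h B l x * ?X l x - h B k x * ?X l x\<bar> \<partial>P)" by (rule integral_abs_bound)
  also have "\<dots> \<le> (\<integral>x. norm c * (\<bar>h B l x - h B k x\<bar> * max_fun M x) \<partial>P)"
  proof (rule integral_mono_AE)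
    show "AE x in P. \<bar>h B l x * ?X l x - h B k x * ?X l x\<bar> \<le> norm c * (\<bar>h B l x - h B k x\<bar> * max_fun M x)"
      using norm_le_max_fun[OF M]
    proof eventually_elim
      case (elim x)
      have "\<bar>?X l x\<bar> \<le> norm c * norm (M (real l) x)" using norm_blinfun[of c "M (real l) x"] by simp
      also have "\<dots> \<le> norm c * max_fun M x" using elim by (intro mult_left_mono) auto
      finally have "\<bar>h B l x - h B k x\<bar> * \<bar>?X l x\<bar> \<le> \<bar>h B l x - h B k x\<bar> * (norm c * max_fun M x)"
        by (rule mult_left_mono) simp
      then show ?case by (simp add: abs_mult[symmetric] left_diff_distrib mult.left_commute)
    qed
  qed (use hX int in auto)
  also have "\<dots> = norm c * (\<integral>x. \<bar>h B l x - h B k x\<bar> * max_fun M x \<partial>P)" by simp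
  finally show "\<bar>(\<integral>x. indicator B x * ?X l x \<partial>P) - (\<integral>x. indicator B x * ?X k x \<partial>P)\<bar>
     \<le> norm c * (\<integral>x. \<bar>h B l x - h B k x\<bar> * max_fun M x \<partial>P)" .
qed

text \<open>Splitting at the level \<open>\<eta>\<close> trades a weight between 0 and 1 for a small
  multiple of the norm and an integral over an event, which is small once the weight has small
  integral.\<close>

lemma integral_max_fun_split_le:
  fixes M :: "real \<Rightarrow> 'a \<Rightarrow> 'e::banach"
  assumes M: "M \<in> H1 P F" and g: "g \<in> borel_measurable P" "AE x in P. 0 \<le> g x \<and> g x \<le> 1" and \<eta>: "\<eta> \<ge> 0"
  shows "(\<integral>x. g x * max_fun M x \<partial>P) \<le> \<eta> * H1_norm P M + H1_norm_on {x\<in>space P. g x > \<eta>} M"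
proof -
  let ?A = "{x\<in>space P. g x > \<eta>}"
  have A: "?A \<in> sets P" using g(1) by measurable
  have "(\<integral>x. g x * max_fun M x \<partial>P) \<le> (\<integral>x. \<eta> * max_fun M x + indicator ?A x * max_fun M x \<partial>P)"
  proof (rule integral_mono_AE)
    show "integrable P (\<lambda>x. g x * max_fun M x)"
    proof (rule Bochner_Integration.integrable_bound[OF max_fun_integrable(1)[OF M]])
      show "(\<lambda>x. g x * max_fun M x) \<in> borel_measurable P" using max_fun_integrable(1)[OF M] g(1) by measurable
      show "AE x in P. norm (g x * max_fun M x) \<le> norm (max_fun M x)"
        using g(2) by eventually_elim (simp add: abs_mult mult_left_le_one_le)
    qed
    show "AE x in P. g x * max_fun M x \<le> \<eta> * max_fun M x + indicator ?A x * max_fun M x"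
      using g(2) AE_space
    proof eventually_elim
      case (elim x)
      have "g x \<le> \<eta> + indicator ?A x" using elim \<eta> by (auto simp: indicator_def)
      from mult_right_mono[OF this max_fun_nonneg[of M x]] show ?case by (simp add: distrib_right)
    qed
  qed (use max_fun_integrable[OF M] A in auto)
  also have "\<dots> = \<eta> * H1_norm P M + H1_norm_on ?A M"
    using max_fun_integrable[OF M] A by (simp add: H1_norm_eq(2)[OF M] H1_norm_on_def)
  finally show ?thesis .
qed

lemma prob_gt_le:
  assumes g: "integrable P g" "\<And>x. g x \<ge> 0" and \<eta>: "\<eta> > 0"
  shows "prob {x\<in>space P. g x > \<eta>} \<le> (\<integral>x. g x \<partial>P) / \<eta>"
proof -
  have A: "{x\<in>space P. g x > \<eta>} \<in> sets P" using borel_measurable_integrable[OF g(1)] by measurable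
  have "\<eta> * prob {x\<in>space P. g x > \<eta>} = (\<integral>x. \<eta> * indicator {x\<in>space P. g x > \<eta>} x \<partial>P)" using A by simp
  also have "\<dots> \<le> (\<integral>x. g x \<partial>P)"
  proof (rule integral_mono)
    show "integrable P (\<lambda>x. \<eta> * indicator {x\<in>space P. g x > \<eta>} x)" using integrable_indicator_sets[OF A] by simp
    show "\<eta> * indicator {x\<in>space P. g x > \<eta>} x \<le> g x" for x using g(2)[of x] by (auto simp: indicator_def)
  qed (rule g(1))
  finally show ?thesis using \<eta> by (simp add: pos_le_divide_eq mult.commute)
qed

text \<open>An interchange of limits: the passage from time \<open>k\<close> to the terminal value
  is uniform in \<open>n\<close>, so one large \<open>k\<close> reduces the claim to a fixed time.
  There Vitali's argument applies, convergence almost everywhere together with uniform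
  integrability.\<close>

lemma terminal_weakly_null:
  fixes Z :: "nat \<Rightarrow> real \<Rightarrow> 'a \<Rightarrow> 'e::banach" and c :: "'e \<Rightarrow>\<^sub>L real"
  assumes Z: "\<And>n. Z n \<in> H1 P F" and f: "\<And>n. terminal_value (Z n) (f n)" and ui: "equi_integrable (range Z)"
    and weak: "\<And>t. t \<ge> 0 \<Longrightarrow> AE x in P. (\<lambda>n. c (Z n t x)) \<longlonglongrightarrow> 0" and B: "B \<in> sets P"
  shows "(\<lambda>n. \<integral>x. indicator B x * c (f n x) \<partial>P) \<longlonglongrightarrow> 0"
proof (rule LIMSEQ_I)
  fix e :: real assume e: "e > 0"
  obtain C where C: "\<And>n. H1_norm P (Z n) \<le> C" using ui by (auto simp: equi_integrable_def)
  have C0: "C \<ge> 0" using C[of 0] seminorm_onD(5)[OF seminorm_H1_norm Z, of 0] by simp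
  \<comment> \<open>Scaled so that \<open>norm c * e'\<close> is at most e/4. The split at level
    \<open>\<eta>\<close> produces \<open>e'\<close> twice, which makes e/2.\<close>
  define e' where "e' = (e / 4) / (norm c + 1)"
  have c1: "norm c + 1 > 0" using norm_ge_zero[of c] by linarith
  have e': "e' > 0" using e c1 by (simp add: e'_def)
  have ce': "norm c * e' \<le> e / 4"
  proof -
    have "norm c * e' \<le> (norm c + 1) * e'" using e' by (intro mult_right_mono) auto
    also have "\<dots> = e / 4" using c1 by (simp add: e'_def del: divide_divide_eq_left)
    finally show ?thesis .
  qed
  \<comment> \<open>The part below the level contributes at most \<open>\<eta>\<close> times the
    norm bound, which this keeps below \<open>e'\<close>.\<close>
  define \<eta> where "\<eta> = e' / (C + 1)"
  have \<eta>: "\<eta> > 0" using e' C0 by (simp add: \<eta>_def)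
  have \<eta>C: "\<eta> * H1_norm P (Z n) \<le> e'" for n
  proof -
    have "\<eta> * H1_norm P (Z n) \<le> \<eta> * (C + 1)" using C[of n] \<eta> by (intro mult_left_mono) auto
    also have "\<dots> = e'" using C0 by (simp add: \<eta>_def)
    finally show ?thesis .
  qed
  obtain d where d: "d > 0" "\<And>n A. A \<in> sets P \<Longrightarrow> prob A \<le> d \<Longrightarrow> H1_norm_on A (Z n) \<le> e'"
    using ui e' unfolding equi_integrable_def by blast
  let ?h = "\<lambda>k. real_cond_exp P (F (real k)) (indicator B)"
  have sub: "subalgebra P (F (real k))" for k by (rule subalg) simp
  \<comment> \<open>The L1 distance \<open>d * \<eta>\<close> is what Markov's inequality at level
    \<open>\<eta>\<close> turns into probability at most \<open>d\<close>.\<close>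
  obtain k where k: "\<And>l. l \<ge> k \<Longrightarrow> (\<integral>x. \<bar>?h l x - ?h k x\<bar> \<partial>P) < d * \<eta>"
  proof -
    have "\<exists>n. \<forall>k\<ge>n. \<forall>l\<ge>n. (\<integral>x. \<bar>?h k x - ?h l x\<bar> \<partial>P) < d * \<eta>"
      by (rule martingale_indicator_cauchy[of "\<lambda>k. F (real k)", OF sub filtration B]) (use d \<eta> in auto)
    then show ?thesis using that by blast
  qed
  have fb: "bochner_integrable P (f n)" for n using f by (auto simp: terminal_value_def)
  have Zb: "bochner_integrable P (Z n (real l))" for n l by (rule H1D(5)[OF Z]) simp
  have tail: "\<bar>(\<integral>x. indicator B x * c (Z n (real l) x) \<partial>P) - (\<integral>x. indicator B x * c (Z n (real k) x) \<partial>P)\<bar> \<le> e / 2"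
    if l: "l \<ge> k" for l n
  proof -
    have b: "AE x in P. 0 \<le> \<bar>?h l x - ?h k x\<bar> \<and> \<bar>?h l x - ?h k x\<bar> \<le> 1"
      using real_cond_exp_indicator_bounds[OF sub[of k] B] real_cond_exp_indicator_bounds[OF sub[of l] B]
      by eventually_elim auto
    have hi: "integrable P (\<lambda>x. \<bar>?h l x - ?h k x\<bar>)"
      by (rule integrable_const_bound[where B=1]) (use b in auto)
    have "prob {x\<in>space P. \<bar>?h l x - ?h k x\<bar> > \<eta>} \<le> (\<integral>x. \<bar>?h l x - ?h k x\<bar> \<partial>P) / \<eta>"
      by (rule prob_gt_le[OF hi _ \<eta>]) simp
    also have "\<dots> \<le> d" using k[OF l] \<eta> by (simp add: field_simps)
    finally have "H1_norm_on {x\<in>space P. \<bar>?h l x - ?h k x\<bar> > \<eta>} (Z n) \<le> e'" by (intro d) auto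
    then have "(\<integral>x. \<bar>?h l x - ?h k x\<bar> * max_fun (Z n) x \<partial>P) \<le> 2 * e'"
      using integral_max_fun_split_le[OF Z _ b, of \<eta> n] \<eta> \<eta>C[of n] by simp
    then have "norm c * (\<integral>x. \<bar>?h l x - ?h k x\<bar> * max_fun (Z n) x \<partial>P) \<le> norm c * (2 * e')"
      by (rule mult_left_mono) simp
    also have "\<dots> \<le> e / 2" using ce' by simp
    finally show ?thesis using integral_indicator_increment_le(1)[OF Z B l, of c n] by simp
  qed
  have near: "\<bar>(\<integral>x. indicator B x * c (f n x) \<partial>P) - (\<integral>x. indicator B x * c (Z n (real k) x) \<partial>P)\<bar> \<le> e / 2" for n
  proof (rule LIMSEQ_le_const2)
    have "(\<lambda>l. bint (\<lambda>x. indicator B x *\<^sub>R Z n (real l) x)) \<longlonglongrightarrow> bint (\<lambda>x. indicator B x *\<^sub>R f n x)"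
      using f[of n] by (intro bint_indicator_l1_limit fb Zb B) (auto simp: terminal_value_def)
    then have "(\<lambda>l. c (bint (\<lambda>x. indicator B x *\<^sub>R Z n (real l) x))) \<longlonglongrightarrow> c (bint (\<lambda>x. indicator B x *\<^sub>R f n x))"
      by (intro tendsto_intros)
    moreover have "c (bint (\<lambda>x. indicator B x *\<^sub>R w x)) = (\<integral>x. indicator B x * c (w x) \<partial>P)" if w: "bochner_integrable P w" for w
    proof -
      have "bint (\<lambda>x. c (indicator B x *\<^sub>R w x)) = c (bint (\<lambda>x. indicator B x *\<^sub>R w x))"
        by (intro bint_bounded_linear blinfun.bounded_linear_right bochner_integrable_indicator w B)
      moreover have "bint (\<lambda>x. indicator B x * c (w x)) = (\<integral>x. indicator B x * c (w x) \<partial>P)"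
        by (rule bint_real[OF abs_integral_blinfun_le(1)[OF w B]])
      ultimately show ?thesis by (simp add: blinfun.scaleR_right)
    qed
    ultimately have "(\<lambda>l. \<integral>x. indicator B x * c (Z n (real l) x) \<partial>P) \<longlonglongrightarrow> (\<integral>x. indicator B x * c (f n x) \<partial>P)"
      using Zb fb by simp
    then show "(\<lambda>l. \<bar>(\<integral>x. indicator B x * c (Z n (real l) x) \<partial>P) - (\<integral>x. indicator B x * c (Z n (real k) x) \<partial>P)\<bar>)
        \<longlonglongrightarrow> \<bar>(\<integral>x. indicator B x * c (f n x) \<partial>P) - (\<integral>x. indicator B x * c (Z n (real k) x) \<partial>P)\<bar>"
      by (intro tendsto_intros)
    show "\<exists>N. \<forall>l\<ge>N. \<bar>(\<integral>x. indicator B x * c (Z n (real l) x) \<partial>P) - (\<integral>x. indicator B x * c (Z n (real k) x) \<partial>P)\<bar> \<le> e / 2"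
      using tail by blast
  qed
  have "(\<lambda>n. \<integral>x. indicator B x * c (Z n (real k) x) \<partial>P) \<longlonglongrightarrow> 0"
  proof (rule LIMSEQ_I)
    fix r :: real assume r: "r > 0"
    define r' where "r' = (r / 2) / (norm c + 1)"
    have r': "r' > 0" using r c1 by (simp add: r'_def)
    have cr': "norm c * r' \<le> r / 2"
    proof -
      have "norm c * r' \<le> (norm c + 1) * r'" using r' by (intro mult_right_mono) auto
      also have "\<dots> = r / 2" using c1 by (simp add: r'_def del: divide_divide_eq_left)
      finally show ?thesis .
    qed
    obtain d where d: "d > 0" "\<And>n A. A \<in> sets P \<Longrightarrow> prob A \<le> d \<Longrightarrow> H1_norm_on A (Z n) \<le> r'"
      using ui r' unfolding equi_integrable_def by blast
    \<comment> \<open>Truncation at 1 makes dominated convergence available. As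
      \<open>\<rho> / 2\<close> lies below 1, a truncated value of at most \<open>\<rho> / 2\<close>
      bounds the untruncated one, and r/4 leaves room for the r/2 from the exceptional
      event.\<close>
    define \<rho> where "\<rho> = min 1 (r / 4)"
    have \<rho>: "\<rho> > 0" "\<rho> \<le> 1" "\<rho> \<le> r / 4" using r by (auto simp: \<rho>_def)
    let ?X = "\<lambda>n x. c (Z n (real k) x)"
    have Xi: "integrable P (?X n)" for n
      using bochner_integrable_bounded_linear[OF blinfun.bounded_linear_right[of c] Zb] by (simp add: bochner_integrable_real_iff)
    have Xm: "?X n \<in> borel_measurable P" for n using Xi by simp
    have "(\<lambda>n. \<integral>x. min 1 \<bar>?X n x\<bar> \<partial>P) \<longlonglongrightarrow> (\<integral>x. 0 \<partial>P)"
    proof (rule integral_dominated_convergence[where w="\<lambda>_. 1"])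
      show "AE x in P. (\<lambda>n. min 1 \<bar>?X n x\<bar>) \<longlonglongrightarrow> 0"
        using weak[of "real k", OF of_nat_0_le_iff]
      proof eventually_elim
        case (elim x)
        have "(\<lambda>n. min 1 \<bar>?X n x\<bar>) \<longlonglongrightarrow> min 1 \<bar>0\<bar>" using elim by (intro tendsto_intros)
        then show ?case by simp
      qed
    qed (use Xm in auto)
    then have "(\<lambda>n. \<integral>x. min 1 \<bar>?X n x\<bar> \<partial>P) \<longlonglongrightarrow> 0" by simp
    then have "\<forall>\<^sub>F n in sequentially. (\<integral>x. min 1 \<bar>?X n x\<bar> \<partial>P) < d * (\<rho> / 2)" by (rule order_tendstoD) (use d \<rho> in simp)
    then obtain N where N: "\<And>n. n \<ge> N \<Longrightarrow> (\<integral>x. min 1 \<bar>?X n x\<bar> \<partial>P) < d * (\<rho> / 2)" by (auto simp: eventually_sequentially)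
    have "norm ((\<integral>x. indicator B x * ?X n x \<partial>P) - 0) < r" if n: "n \<ge> N" for n
    proof -
      let ?A = "{x\<in>space P. min 1 \<bar>?X n x\<bar> > \<rho> / 2}"
      have A: "?A \<in> sets P" using Xm[of n] by measurable
      have mi: "integrable P (\<lambda>x. min 1 \<bar>?X n x\<bar>)" by (rule integrable_const_bound[where B=1]) (use Xm in auto)
      have "prob ?A \<le> (\<integral>x. min 1 \<bar>?X n x\<bar> \<partial>P) / (\<rho> / 2)" by (rule prob_gt_le[OF mi]) (use \<rho> in auto)
      also have "\<dots> \<le> d" using N[OF n] \<rho> by (simp add: field_simps)
      finally have "H1_norm_on ?A (Z n) \<le> r'" by (intro d A)
      then have A_le: "norm c * H1_norm_on ?A (Z n) \<le> r / 2" using cr' mult_left_mono[of _ r' "norm c"] by force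
      have "\<bar>\<integral>x. indicator B x * ?X n x \<partial>P\<bar> \<le> (\<integral>x. \<bar>indicator B x * ?X n x\<bar> \<partial>P)" by (rule integral_abs_bound)
      also have "\<dots> \<le> (\<integral>x. \<rho> + norm c * (indicator ?A x * max_fun (Z n) x) \<partial>P)"
      proof (rule integral_mono_AE)
        show "integrable P (\<lambda>x. \<bar>indicator B x * ?X n x\<bar>)" using abs_integral_blinfun_le(1)[OF Zb B] by (rule integrable_abs)
        show "integrable P (\<lambda>x. \<rho> + norm c * (indicator ?A x * max_fun (Z n) x))"
          using max_fun_integrable(2)[OF Z A] by simp
        show "AE x in P. \<bar>indicator B x * ?X n x\<bar> \<le> \<rho> + norm c * (indicator ?A x * max_fun (Z n) x)"
          using norm_le_max_fun[OF Z[of n]] AE_space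
        proof eventually_elim
          case (elim x)
          have 1: "\<bar>?X n x\<bar> \<le> norm c * max_fun (Z n) x"
          proof -
            have "\<bar>?X n x\<bar> \<le> norm c * norm (Z n (real k) x)" using norm_blinfun[of c "Z n (real k) x"] by simp
            also have "\<dots> \<le> norm c * max_fun (Z n) x" using elim by (intro mult_left_mono) auto
            finally show ?thesis .
          qed
          show ?case
          proof (cases "x \<in> ?A")
            case True
            then show ?thesis using 1 \<rho> by (auto simp: indicator_def)
          next
            case False
            then have "\<bar>?X n x\<bar> \<le> \<rho>" using elim \<rho> by (auto simp: min_def split: if_splits)
            then show ?thesis using False \<rho> by (auto simp: indicator_def)
          qed
        qed
      qed
      also have "\<dots> = \<rho> + norm c * H1_norm_on ?A (Z n)"
        using max_fun_integrable(2)[OF Z A] by (simp add: H1_norm_on_def prob_space)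
      also have "\<dots> < r" using A_le \<rho> r by linarith
      finally show ?thesis by simp
    qed
    then show "\<exists>N. \<forall>n\<ge>N. norm ((\<integral>x. indicator B x * ?X n x \<partial>P) - 0) < r" by blast
  qed
  then obtain N where N: "\<And>n. n \<ge> N \<Longrightarrow> \<bar>\<integral>x. indicator B x * c (Z n (real k) x) \<partial>P\<bar> < e / 2"
    using LIMSEQ_D[of _ 0 "e/2"] e by fastforce
  have "norm ((\<integral>x. indicator B x * c (f n x) \<partial>P) - 0) < e" if "n \<ge> N" for n
    using near[of n] N[OF that] by (simp add: abs_if split: if_splits)
  then show "\<exists>N. \<forall>n\<ge>N. norm ((\<integral>x. indicator B x * c (f n x) \<partial>P) - 0) < e" by blast
qed

end

section \<open>Convergence in the weak topology of E\<close>

lemma limitin_weak_topology_imp: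
  fixes x :: "nat \<Rightarrow> 'e::real_normed_vector" and c :: "'e \<Rightarrow>\<^sub>L real"
  assumes "limitin weak_topology x l sequentially"
  shows "(\<lambda>n. c (x n)) \<longlonglongrightarrow> c l"
proof (rule topological_tendstoI)
  fix V :: "real set" assume V: "open V" "c l \<in> V"
  have "openin weak_topology {y \<in> UNIV. c y \<in> V}"
    unfolding weak_topology_def using V by (intro openin_weak_topology_on) auto
  then show "\<forall>\<^sub>F n in sequentially. c (x n) \<in> V"
    using assms V(2) unfolding limitin_def by (auto elim!: allE[of _ "{y \<in> UNIV. c y \<in> V}"])
qed

lemma limitin_weak_topologyI:
  fixes x :: "nat \<Rightarrow> 'e::real_normed_vector"
  assumes "x \<longlonglongrightarrow> l"
  shows "limitin weak_topology x l sequentially"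
proof -
  have "continuous_map euclidean (weak_topology :: 'e topology) id"
    unfolding weak_topology_def weak_topology_on_def continuous_on_generated_topo_iff
  proof (intro conjI allI impI)
    fix U :: "'e set" assume "U \<in> insert UNIV {{x \<in> UNIV. \<phi> x \<in> U} |\<phi> U. \<phi> \<in> range (blinfun_apply :: ('e \<Rightarrow>\<^sub>L real) \<Rightarrow> _) \<and> open U}"
    then consider "U = UNIV" | c V where "U = {x. blinfun_apply (c :: 'e \<Rightarrow>\<^sub>L real) x \<in> V}" "open V" by auto
    then show "openin euclidean (id -` U \<inter> topspace euclidean)"
    proof cases
      case 2
      have "open (blinfun_apply c -` V)" using 2(2) by (intro open_vimage continuous_intros)
      then show ?thesis using 2(1) by (simp add: vimage_def)
    qed simp
  qed auto
  from continuous_map_limit[OF this, of x l sequentially] assms show ?thesis by (simp add: o_def)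
qed

context stoch_basis
begin

text \<open>Absolute continuity of the integral: the maximal function is truncated at a level beyond
  which it has integral below e/2, and below that level the probability of the event
  decides.\<close>

lemma H1_norm_on_small:
  fixes M :: "real \<Rightarrow> 'a \<Rightarrow> 'e::banach"
  assumes M: "M \<in> H1 P F" and e: "e > 0"
  shows "\<exists>d>0. \<forall>A\<in>sets P. prob A \<le> d \<longrightarrow> H1_norm_on A M \<le> e"
proof -
  note i = max_fun_integrable(1)[OF M]
  have "(\<lambda>n. \<integral>x. indicator {x\<in>space P. max_fun M x > real n} x * max_fun M x \<partial>P) \<longlonglongrightarrow> (\<integral>x. 0 \<partial>P)"
  proof (rule integral_dominated_convergence[where w="max_fun M"])
    show "(\<lambda>x. indicator {x\<in>space P. max_fun M x > real n} x * max_fun M x) \<in> borel_measurable P" for n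
      using i by measurable
    show "AE x in P. (\<lambda>n. indicator {x\<in>space P. max_fun M x > real n} x * max_fun M x) \<longlonglongrightarrow> 0"
    proof (rule AE_I2)
      fix x
      obtain N where "max_fun M x \<le> real N" using real_arch_simple by blast
      then have "\<forall>\<^sub>F n in sequentially. indicator {x\<in>space P. max_fun M x > real n} x * max_fun M x = 0"
        by (intro eventually_sequentiallyI[of N]) (auto simp: indicator_def)
      then show "(\<lambda>n. indicator {x\<in>space P. max_fun M x > real n} x * max_fun M x) \<longlonglongrightarrow> 0" by (rule tendsto_eventually)
    qed
    show "AE x in P. norm (indicator {x\<in>space P. max_fun M x > real n} x * max_fun M x) \<le> max_fun M x" for n
      by (auto simp: indicator_def max_fun_nonneg)
  qed (use i in auto)
  then have "(\<lambda>n. \<integral>x. indicator {x\<in>space P. max_fun M x > real n} x * max_fun M x \<partial>P) \<longlonglongrightarrow> 0" by simp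
  then have "\<forall>\<^sub>F n in sequentially. (\<integral>x. indicator {x\<in>space P. max_fun M x > real n} x * max_fun M x \<partial>P) < e / 2"
    by (rule order_tendstoD) (use e in simp)
  then obtain n :: nat where n: "(\<integral>x. indicator {x\<in>space P. max_fun M x > real n} x * max_fun M x \<partial>P) < e / 2"
    by (auto simp: eventually_sequentially)
  let ?B = "{x\<in>space P. max_fun M x > real n}"
  have B: "?B \<in> sets P" using i by measurable
  define d where "d = (e / 2) / (real n + 1)"
  have d: "d > 0" using e by (simp add: d_def)
  have "H1_norm_on A M \<le> e" if A: "A \<in> sets P" "prob A \<le> d" for A
  proof -
    have "H1_norm_on A M \<le> (\<integral>x. real n * indicator A x + indicator ?B x * max_fun M x \<partial>P)"
      unfolding H1_norm_on_def
    proof (rule integral_mono_AE)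
      show "AE x in P. indicator A x * max_fun M x \<le> real n * indicator A x + indicator ?B x * max_fun M x"
        using AE_space by eventually_elim (auto simp: indicator_def max_fun_nonneg)
    qed (use max_fun_integrable(2)[OF M] A B integrable_indicator_sets[OF A(1)] in auto)
    also have "\<dots> = real n * prob A + (\<integral>x. indicator ?B x * max_fun M x \<partial>P)"
      using max_fun_integrable(2)[OF M B] A integrable_indicator_sets[OF A(1)] by simp
    also have "real n * prob A \<le> (real n + 1) * d" using A d by (intro mult_mono) auto
    also have "(real n + 1) * d = e / 2" by (simp add: d_def del: divide_divide_eq_left)
    finally show ?thesis using n by simp
  qed
  then show ?thesis using d by blast
qed

section \<open>From weakly convergent to norm convergent blocks\<close>

lemma hull_H1_norm_on_le:
  fixes K :: "(real \<Rightarrow> 'a \<Rightarrow> 'e::banach) set"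
  assumes "K \<subseteq> H1 P F" "A \<in> sets P" "\<And>M. M \<in> K \<Longrightarrow> H1_norm_on A M \<le> b" "z \<in> convex hull K"
  shows "z \<in> H1 P F" "H1_norm_on A z \<le> b"
proof -
  have "convex hull K \<subseteq> {M\<in>H1 P F. H1_norm_on A M \<le> b}"
    using assms by (intro hull_minimal convex_seminorm_ball seminorm_H1_norm_on) auto
  then show "z \<in> H1 P F" "H1_norm_on A z \<le> b" using assms(4) by auto
qed

text \<open>If the norm stayed at least \<open>e\<close> on the hull, uniform integrability and
  Doob's inequality would keep the L1 norm of all corresponding terminal values at least
  \<open>(e / 3) * d\<close>. A separating functional would then be bounded away from 0 along the
  weakly null sequence of terminal values.\<close>

lemma norm_blocks_of_weakly_null:
  fixes Z :: "nat \<Rightarrow> real \<Rightarrow> 'a \<Rightarrow> 'e::banach"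
  assumes RNP: "RNP_wrt P TYPE('e \<Rightarrow>\<^sub>L real)"
    and Z: "\<And>n. Z n \<in> H1 P F" and ui: "equi_integrable (range Z)"
    and weak: "\<And>t (c :: 'e \<Rightarrow>\<^sub>L real). t \<ge> 0 \<Longrightarrow> AE x in P. (\<lambda>n. c (Z n t x)) \<longlonglongrightarrow> 0" and e: "e > 0"
  shows "\<exists>z\<in>convex hull (Z ` {i..}). H1_norm P z < e"
proof (rule ccontr)
  assume neg: "\<not> ?thesis"
  have "\<forall>n. \<exists>f. terminal_value (Z n) f" using H1_terminal_value[OF Z] by blast
  from choice[OF this] obtain f where f: "\<And>n. terminal_value (Z n) (f n)" by blast
  obtain d where d: "d > 0" "\<And>n A. A \<in> sets P \<Longrightarrow> prob A \<le> d \<Longrightarrow> H1_norm_on A (Z n) \<le> e / 3"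
    using ui e unfolding equi_integrable_def by (metis rangeI zero_less_divide_iff zero_less_numeral)
  \<comment> \<open>The hull of the pairs forms the martingale and its closing variable with the
    same coefficients; its projections are the two hulls.\<close>
  let ?W = "convex hull ((\<lambda>n. (Z n, f n)) ` {i..})"
  have fstW: "fst ` ?W = convex hull (Z ` {i..})" and sndW: "snd ` ?W = convex hull (f ` {i..})"
    using convex_hull_linear_image[OF linear_fst, of "(\<lambda>n. (Z n, f n)) ` {i..}"]
      convex_hull_linear_image[OF linear_snd, of "(\<lambda>n. (Z n, f n)) ` {i..}"] by (simp_all add: image_image)
  have W: "?W \<subseteq> {(z, g). \<forall>t\<ge>0. is_cond_exp P (F t) g (z t)}"
  proof (rule hull_minimal)
    show "(\<lambda>n. (Z n, f n)) ` {i..} \<subseteq> {(z, g). \<forall>t\<ge>0. is_cond_exp P (F t) g (z t)}"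
      using f by (auto simp: terminal_value_def)
    show "convex {(z :: real \<Rightarrow> 'a \<Rightarrow> 'e, g). \<forall>t\<ge>0. is_cond_exp P (F t) g (z t)}"
    proof (rule convexI)
      fix p q :: "(real \<Rightarrow> 'a \<Rightarrow> 'e) \<times> ('a \<Rightarrow> 'e)" and u v :: real
      assume pq: "p \<in> {(z, g). \<forall>t\<ge>0. is_cond_exp P (F t) g (z t)}" "q \<in> {(z, g). \<forall>t\<ge>0. is_cond_exp P (F t) g (z t)}"
      obtain z g z' g' where eq: "p = (z, g)" "q = (z', g')" by (metis surj_pair)
      have zg: "\<forall>t\<ge>0. is_cond_exp P (F t) g (z t)" "\<forall>t\<ge>0. is_cond_exp P (F t) g' (z' t)"
        using pq by (auto simp: eq)
      have "is_cond_exp P (F t) ((\<lambda>x. u *\<^sub>R g x + v *\<^sub>R g' x)) (\<lambda>x. u *\<^sub>R z t x + v *\<^sub>R z' t x)" if "t \<ge> 0" for t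
        using complete_subalgebra_F[OF that] zg that by (intro is_cond_exp_add is_cond_exp_scaleR) auto
      then show "u *\<^sub>R p + v *\<^sub>R q \<in> {(z, g). \<forall>t\<ge>0. is_cond_exp P (F t) g (z t)}"
        by (simp add: eq plus_fun_def scaleR_fun_def)
    qed
  qed
  have lower: "(e / 3) * d \<le> (\<integral>x. norm (g x) \<partial>P)" if zg: "(z, g) \<in> ?W" for z g
  proof -
    have zh: "z \<in> convex hull (Z ` {i..})" using zg fstW by force
    have small: "H1_norm_on A z \<le> e / 3" if "A \<in> sets P" "prob A \<le> d" for A
      by (rule hull_H1_norm_on_le(2)[OF _ that(1) _ zh]) (use Z d that in auto)
    have zH: "z \<in> H1 P F" by (rule hull_H1_norm_on_le(1)[OF _ _ _ zh, of "{}"]) (use Z d in \<open>auto simp: H1_norm_on_def\<close>)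
    let ?E = "{x\<in>space P. max_fun z x > e / 3}"
    have E: "?E \<in> sets P" using max_fun_integrable(1)[OF zH] by measurable
    have "e \<le> H1_norm P z" using neg zh by (auto simp: not_less)
    also have "\<dots> = (\<integral>x. max_fun z x \<partial>P)" by (rule H1_norm_eq(2)[OF zH])
    also have "\<dots> \<le> (\<integral>x. e / 3 + indicator ?E x * max_fun z x \<partial>P)"
    proof (rule integral_mono_AE)
      show "AE x in P. max_fun z x \<le> e / 3 + indicator ?E x * max_fun z x"
        using AE_space by eventually_elim (use e in \<open>auto simp: indicator_def\<close>)
    qed (use max_fun_integrable[OF zH] E in auto)
    also have "\<dots> = e / 3 + H1_norm_on ?E z"
      using max_fun_integrable(2)[OF zH E] by (simp add: H1_norm_on_def prob_space)
    \<comment> \<open>At least 2e/3 of the integral sits above the level e/3. An event of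
      probability at most \<open>d\<close> could carry only e/3 of it.\<close>
    finally have "H1_norm_on ?E z > e / 3" using e by simp
    then have "d < prob ?E" using small[OF E] by (meson not_le)
    then have "(e / 3) * d \<le> (e / 3) * prob ?E" using e by (intro mult_left_mono) auto
    also have "\<dots> \<le> (\<integral>x. norm (g x) \<partial>P)"
      using W zg e by (intro doob[OF zH]) auto
    finally show ?thesis .
  qed
  have fb: "bochner_integrable P (f n)" for n using f by (auto simp: terminal_value_def)
  let ?S = "{f. bochner_integrable P (f :: 'a \<Rightarrow> 'e)}"
  have "\<exists>l. linear l \<and> (\<forall>h\<in>?S. \<bar>l h\<bar> \<le> (\<integral>x. norm (h x) \<partial>P)) \<and> (\<forall>h\<in>convex hull (f ` {i..}). (e / 3) * d \<le> l h)"
  proof (rule mazur_orlicz_seminorm[OF seminorm_l1])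
    show "convex (convex hull (f ` {i..}))" by (rule convex_convex_hull)
    show "convex hull (f ` {i..}) \<subseteq> ?S"
      using fb by (intro hull_minimal subspace_imp_convex[OF seminorm_onD(1)[OF seminorm_l1]]) auto
    show "(e / 3) * d \<le> (\<integral>x. norm (h x) \<partial>P)" if "h \<in> convex hull (f ` {i..})" for h
      using that lower unfolding sndW[symmetric] by auto
  qed
  then obtain \<phi> where \<phi>: "linear \<phi>" "\<And>h. bochner_integrable P h \<Longrightarrow> \<bar>\<phi> h\<bar> \<le> (\<integral>x. norm (h x) \<partial>P)"
    "\<And>h. h \<in> convex hull (f ` {i..}) \<Longrightarrow> (e / 3) * d \<le> \<phi> h" by blast
  obtain C where C: "\<And>n. H1_norm P (Z n) \<le> C" using ui by (auto simp: equi_integrable_def)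
  have "(\<lambda>n. \<phi> (f n)) \<longlonglongrightarrow> 0"
  proof (rule l1_functional_weakly_null[OF \<phi>(1,2) RNP fb])
    show "(\<integral>x. norm (f n x) \<partial>P) \<le> C" for n
    proof -
      have "(\<integral>x. norm (f n x) \<partial>P) = (\<integral>x. indicator (space P) x * norm (f n x) \<partial>P)"
        by (intro Bochner_Integration.integral_cong) auto
      also have "\<dots> \<le> H1_norm P (Z n)"
        unfolding H1_norm_eq(1)[OF Z] by (rule integral_norm_terminal_le[OF Z f sets.top])
      finally show ?thesis using C[of n] by simp
    qed
    show "\<exists>d>0. \<forall>n. \<forall>A\<in>sets P. prob A \<le> d \<longrightarrow> (\<integral>x. indicator A x * norm (f n x) \<partial>P) \<le> r" if r: "r > 0" for r
    proof -
      obtain d where "d > 0" "\<And>n A. A \<in> sets P \<Longrightarrow> prob A \<le> d \<Longrightarrow> H1_norm_on A (Z n) \<le> r"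
        using ui r unfolding equi_integrable_def by blast
      then show ?thesis using integral_norm_terminal_le[OF Z f] order_trans by blast
    qed
    show "(\<lambda>n. \<integral>x. indicator B x * c (f n x) \<partial>P) \<longlonglongrightarrow> 0" if "B \<in> sets P" for c :: "'e \<Rightarrow>\<^sub>L real" and B
      by (rule terminal_weakly_null[OF Z f ui weak that])
  qed
  moreover have "(e / 3) * d \<le> \<phi> (f n)" if "n \<ge> i" for n using that by (intro \<phi>(3) hull_inc) auto
  ultimately have "(e / 3) * d \<le> 0" by (intro LIMSEQ_le_const) auto
  then show False using e d(1) by (simp add: mult_le_0_iff)
qed

text \<open>The differences from the limit form a weakly null, uniformly integrable sequence. Convex
  combinations of its tails, shifted back by \<open>N\<close>, are blocks of blocks and therefore
  blocks of the original sequence.\<close>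

lemma norm_blocks_of_weak_blocks:
  fixes K :: "(real \<Rightarrow> 'a \<Rightarrow> 'e::banach) set" and X :: "nat \<Rightarrow> real \<Rightarrow> 'a \<Rightarrow> 'e"
  assumes RNP: "RNP_wrt P TYPE('e \<Rightarrow>\<^sub>L real)" and K: "K \<subseteq> H1 P F" and ui: "equi_integrable K" and X: "range X \<subseteq> K"
    and N': "\<And>i. N' i \<in> convex hull (X ` {i..})" and N: "N \<in> H1 P F"
    and weak: "\<And>t. t \<ge> 0 \<Longrightarrow> AE x in P. limitin weak_topology (\<lambda>i. N' i t x) (N t x) sequentially"
  shows "\<exists>Y. \<exists>y\<in>H1 P F. (\<forall>i. Y i \<in> convex hull (X ` {i..})) \<and> (\<lambda>i. H1_norm P (Y i - y)) \<longlonglongrightarrow> 0"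
proof -
  define Z where "Z n = N' n - N" for n
  have XK: "X ` {n..} \<subseteq> H1 P F" "X ` {n..} \<subseteq> K" for n using X K by auto
  have N'H: "N' n \<in> H1 P F" and N'le: "H1_norm_on A (N' n) \<le> b"
    if "A \<in> sets P" "\<And>M. M \<in> K \<Longrightarrow> H1_norm_on A M \<le> b" for n A b
    using hull_H1_norm_on_le[OF XK(1) that(1) _ N'[of n]] that(2) XK(2) by blast+
  \<comment> \<open>The empty event with bound 0 satisfies the bound premises trivially and leaves
    membership in H1.\<close>
  have N'H: "N' n \<in> H1 P F" for n by (rule N'H[of "{}" 0]) (auto simp: H1_norm_on_def)
  have ZH: "Z n \<in> H1 P F" for n unfolding Z_def by (intro subspace_diff[OF subspace_H1] N'H N)
  have Zle: "H1_norm_on A (Z n) \<le> H1_norm_on A (N' n) + H1_norm_on A N" if A: "A \<in> sets P" for A n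
    using seminorm_onD(2)[OF seminorm_H1_norm_on[OF A] N'H[of n] subspace_neg[OF subspace_H1 N]]
      seminorm_onD(4)[OF seminorm_H1_norm_on[OF A] N] by (simp add: Z_def)
  \<comment> \<open>Convex combinations preserve uniform bounds, and the single martingale
    \<open>N\<close> is uniformly integrable on its own; each is allotted r/2.\<close>
  have uiZ: "equi_integrable (range Z)"
    unfolding equi_integrable_def
  proof (intro conjI allI impI)
    obtain C where C: "\<And>M. M \<in> K \<Longrightarrow> H1_norm P M \<le> C" using ui unfolding equi_integrable_def by blast
    have "H1_norm P (Z n) \<le> C + H1_norm_on (space P) N" for n
      unfolding H1_norm_eq(1)[OF ZH] using Zle[OF sets.top, of n] N'le[OF sets.top, of C n] C K H1_norm_eq(1) by fastforce
    then show "\<exists>C. \<forall>M\<in>range Z. H1_norm P M \<le> C" by blast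
    fix r :: real assume r: "r > 0"
    obtain d where d: "d > 0" "\<And>M A. M \<in> K \<Longrightarrow> A \<in> sets P \<Longrightarrow> prob A \<le> d \<Longrightarrow> H1_norm_on A M \<le> r / 2"
      using ui r unfolding equi_integrable_def by (meson half_gt_zero)
    obtain d' where d': "d' > 0" "\<And>A. A \<in> sets P \<Longrightarrow> prob A \<le> d' \<Longrightarrow> H1_norm_on A N \<le> r / 2"
      using H1_norm_on_small[OF N, of "r/2"] r by auto
    have "H1_norm_on A (Z n) \<le> r" if A: "A \<in> sets P" "prob A \<le> min d d'" for n A
      using Zle[OF A(1), of n] N'le[OF A(1), of "r/2" n] d(2)[OF _ A(1)] d'(2)[OF A(1)] A(2) by fastforce
    then show "\<exists>d>0. \<forall>M\<in>range Z. \<forall>A\<in>sets P. prob A \<le> d \<longrightarrow> H1_norm_on A M \<le> r"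
      using d(1) d'(1) by (intro exI[of _ "min d d'"]) auto
  qed
  have "AE x in P. (\<lambda>n. c (Z n t x)) \<longlonglongrightarrow> 0" if "t \<ge> 0" for t and c :: "'e \<Rightarrow>\<^sub>L real"
    using weak[OF that]
  proof eventually_elim
    case (elim x)
    have "(\<lambda>n. c (N' n t x) - c (N t x)) \<longlonglongrightarrow> c (N t x) - c (N t x)"
      by (intro tendsto_diff tendsto_const limitin_weak_topology_imp[OF elim])
    then show ?case by (simp add: Z_def fun_diff_def blinfun.diff_right)
  qed
  note w = this
  have "\<exists>z\<in>convex hull (Z ` {i..}). H1_norm P z < 1 / Suc i" for i :: nat
    by (rule norm_blocks_of_weakly_null[OF RNP ZH uiZ w]) simp_all
  then have "\<forall>i. \<exists>z. z \<in> convex hull (Z ` {i..}) \<and> H1_norm P z < 1 / Suc i" by blast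
  from choice[OF this] obtain z where z: "\<And>i. z i \<in> convex hull (Z ` {i..})" "\<And>i. H1_norm P (z i) < 1 / Suc i" by blast
  define Y where "Y i = z i + N" for i
  have "Y i \<in> convex hull (X ` {i..})" for i
  proof -
    have "Z ` {i..} = (\<lambda>x. x - N) ` (N' ` {i..})" by (auto simp: Z_def)
    then have "convex hull (Z ` {i..}) = (\<lambda>x. x - N) ` (convex hull (N' ` {i..}))"
      using convex_hull_translation[of "- N" "N' ` {i..}"] by (simp add: add.commute[of "- N"])
    then have "Y i \<in> convex hull (N' ` {i..})" using z(1)[of i] by (auto simp: Y_def)
    moreover have "N' ` {i..} \<subseteq> convex hull (X ` {i..})"
    proof safe
      fix n assume "i \<le> n"
      then have "convex hull (X ` {n..}) \<subseteq> convex hull (X ` {i..})" by (intro hull_mono image_mono) auto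
      then show "N' n \<in> convex hull (X ` {i..})" using N' by blast
    qed
    ultimately show ?thesis
      using hull_minimal[of "N' ` {i..}" "convex hull (X ` {i..})" convex] convex_convex_hull by blast
  qed
  moreover have "(\<lambda>i. H1_norm P (Y i - N)) \<longlonglongrightarrow> 0"
  proof (rule tendsto_sandwich[of "\<lambda>_. 0" _ _ "\<lambda>i. 1 / real (Suc i)"])
    show "(\<lambda>i. 1 / real (Suc i)) \<longlonglongrightarrow> 0" using LIMSEQ_inverse_real_of_nat by (simp add: inverse_eq_divide)
  qed (use z(2) in \<open>auto simp: Y_def H1_norm_def intro!: always_eventually less_imp_le\<close>)
  ultimately show ?thesis using N by blast
qed

text \<open>On disjoint events the localized norms add up to at most one norm. This makes sums of
  functionals living on disjoint events bounded, however many there are.\<close>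

lemma sum_H1_norm_on_le:
  fixes M :: "real \<Rightarrow> 'a \<Rightarrow> 'e::banach"
  assumes M: "M \<in> H1 P F" and I: "finite I" "disjoint_family_on B I" "\<And>i. i \<in> I \<Longrightarrow> B i \<in> sets P" "\<And>i. i \<in> I \<Longrightarrow> B i \<subseteq> U" and U: "U \<in> sets P"
  shows "(\<Sum>i\<in>I. H1_norm_on (B i) M) \<le> H1_norm_on U M"
proof -
  have "(\<Sum>i\<in>I. H1_norm_on (B i) M) = (\<integral>x. (\<Sum>i\<in>I. indicator (B i) x * max_fun M x) \<partial>P)"
    unfolding H1_norm_on_def using max_fun_integrable(2)[OF M I(3)] by (intro Bochner_Integration.integral_sum[symmetric])
  also have "\<dots> \<le> H1_norm_on U M"
    unfolding H1_norm_on_def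
  proof (rule integral_mono)
    show "integrable P (\<lambda>x. \<Sum>i\<in>I. indicator (B i) x * max_fun M x)"
      using max_fun_integrable(2)[OF M I(3)] by (intro Bochner_Integration.integrable_sum)
    fix x
    have "(\<Sum>i\<in>I. indicator (B i) x :: real) = indicator (\<Union>i\<in>I. B i) x"
      using I by (simp add: indicator_UN_disjoint)
    moreover have "indicator (\<Union>i\<in>I. B i) x \<le> (indicator U x :: real)" using I(4) by (auto simp: indicator_def)
    ultimately show "(\<Sum>i\<in>I. indicator (B i) x * max_fun M x) \<le> indicator U x * max_fun M x"
      unfolding sum_distrib_right[symmetric] by (intro mult_right_mono max_fun_nonneg) simp
  qed (rule max_fun_integrable(2)[OF M U])
  finally show ?thesis .
qed

end

section \<open>Characterization of weak compactness\<close>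

context stoch_basis
begin

text \<open>
  Gliding hump: the bumps of a sequence violating uniform integrability are detected by functionals
  \<open>\<phi>\<^sub>n\<close> living on disjoint events \<open>B\<^sub>n\<close>, obtained from Hahn-Banach applied to \<open>M \<mapsto> E[M\<^sup>*; B\<^sub>n]\<close>.
\<close>

lemma equi_integrable_of_weakly_compact:
  fixes K :: "(real \<Rightarrow> 'a \<Rightarrow> 'e::banach) set"
  assumes K: "K \<subseteq> H1 P F" and rc: "relatively_compact_in (weak_topology_on (H1 P F) (dual_on (H1 P F) (H1_norm P))) K"
  shows "equi_integrable K"
  unfolding equi_integrable_def
proof (intro conjI allI impI)
  let ?D = "dual_on (H1 P F) (H1_norm P :: (real \<Rightarrow> 'a \<Rightarrow> 'e) \<Rightarrow> real)"
  note cluster = weak_cluster_point[OF K rc]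
  \<comment> \<open>Weak boundedness is enough: a functional tending to infinity along a sequence
    would have to return near its value at a cluster point.\<close>
  show "\<exists>C. \<forall>M\<in>K. H1_norm P M \<le> C"
  proof (rule weakly_bounded_imp_bounded[OF seminorm_H1_norm K], rule ccontr)
    fix \<phi> :: "(real \<Rightarrow> 'a \<Rightarrow> 'e) \<Rightarrow> real" assume \<phi>: "\<phi> \<in> ?D" and "\<not> (\<exists>c. \<forall>x\<in>K. \<bar>\<phi> x\<bar> \<le> c)"
    then have "\<forall>n::nat. \<exists>x. x \<in> K \<and> real n < \<bar>\<phi> x\<bar>" by (meson not_le)
    from choice[OF this] obtain X where X: "\<And>n::nat. X n \<in> K" "\<And>n. real n < \<bar>\<phi> (X n)\<bar>" by blast
    have "range X \<subseteq> K" using X by blast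
    from cluster[OF this] obtain y where y: "\<And>A e i. finite A \<Longrightarrow> A \<subseteq> ?D \<Longrightarrow> e > 0 \<Longrightarrow> \<exists>n\<ge>i. \<forall>\<phi>\<in>A. \<bar>\<phi> (X n) - \<phi> y\<bar> < e"
      by blast
    obtain i :: nat where i: "\<bar>\<phi> y\<bar> + 1 \<le> real i" using real_arch_simple by blast
    obtain n where n: "n \<ge> i" "\<bar>\<phi> (X n) - \<phi> y\<bar> < 1" using y[of "{\<phi>}" 1 i] \<phi> by auto
    have "real i \<le> real n" using n by simp
    then show False using X(2)[of n] i n(2) by linarith
  qed
  fix e :: real assume e: "e > 0"
  show "\<exists>d>0. \<forall>M\<in>K. \<forall>A\<in>sets P. prob A \<le> d \<longrightarrow> H1_norm_on A M \<le> e"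
  proof (rule ccontr)
    assume "\<not> ?thesis"
    then have neg: "\<exists>M\<in>K. \<exists>A\<in>sets P. prob A \<le> d \<and> e < H1_norm_on A M" if "d > 0" for d
      using that by (meson not_le)
    \<comment> \<open>Each stage holds a martingale, an event on which its maximal function has
      integral above \<open>e\<close>, and a modulus \<open>\<delta>\<close> such that events of
      probability at most \<open>\<delta>\<close> carry at most e/8 of it. New events are so
      improbable that all of them together stay below every earlier modulus.\<close>
    define Q where "Q h n r \<longleftrightarrow> (case r of (M, A, \<delta>) \<Rightarrow> M \<in> K \<and> A \<in> sets P \<and> e < H1_norm_on A M \<and> 0 < \<delta> \<and> \<delta> \<le> 1 \<and>
        (\<forall>A\<in>sets P. prob A \<le> \<delta> \<longrightarrow> H1_norm_on A M \<le> e / 8) \<and> prob A \<le> (1/2)^n \<and>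
        (\<forall>m<n. prob A \<le> (1/2)^n * snd (snd (h m))))" for h :: "nat \<Rightarrow> (real \<Rightarrow> 'a \<Rightarrow> 'e) \<times> 'a set \<times> real" and n r
    have "\<exists>h. \<forall>n. Q h n (h n)"
    proof (rule dependent_wellorder_choice)
      fix r and f g :: "nat \<Rightarrow> (real \<Rightarrow> 'a \<Rightarrow> 'e) \<times> 'a set \<times> real" and n :: nat
      assume "\<And>m. m < n \<Longrightarrow> f m = g m"
      then show "Q f n r = Q g n r" by (auto simp: Q_def split: prod.splits)
    next
      fix n :: nat and h :: "nat \<Rightarrow> (real \<Rightarrow> 'a \<Rightarrow> 'e) \<times> 'a set \<times> real"
      assume h: "\<And>m. m < n \<Longrightarrow> Q h m (h m)"
      define \<eta> where "\<eta> = Min (insert 1 ((\<lambda>m. snd (snd (h m))) ` {..<n}))"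
      have pos: "snd (snd (h m)) > 0" if "m < n" for m using h[OF that] by (auto simp: Q_def split: prod.splits)
      have \<eta>: "\<eta> > 0" "\<eta> \<le> 1" "\<And>m. m < n \<Longrightarrow> \<eta> \<le> snd (snd (h m))"
        unfolding \<eta>_def using pos by (auto simp: Min_gr_iff)
      obtain M A where MA: "M \<in> K" "A \<in> sets P" "prob A \<le> (1/2)^n * \<eta>" "e < H1_norm_on A M"
        using neg[of "(1/2)^n * \<eta>"] \<eta> by auto
      obtain \<delta>' where \<delta>': "\<delta>' > 0" "\<forall>A\<in>sets P. prob A \<le> \<delta>' \<longrightarrow> H1_norm_on A M \<le> e / 8"
        using H1_norm_on_small[of M "e/8"] MA K e by auto
      have "prob A \<le> (1/2)^n * snd (snd (h m))" if "m < n" for m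
        by (rule order_trans[OF MA(3) mult_left_mono[OF \<eta>(3)[OF that]]]) simp
      moreover have "prob A \<le> (1/2)^n" 
        using order_trans[OF MA(3) mult_left_mono[OF \<eta>(2)]] by simp
      ultimately have "Q h n (M, A, min 1 \<delta>')" using MA \<delta>' by (simp add: Q_def)
      then show "\<exists>r. Q h n r" by blast
    qed
    then obtain h where h: "\<And>n. Q h n (h n)" by blast
    define X where "X n = fst (h n)" for n
    define A where "A n = fst (snd (h n))" for n
    define \<delta> where "\<delta> n = snd (snd (h n))" for n
    have X: "X n \<in> K" "X n \<in> H1 P F" and A: "A n \<in> sets P" "e < H1_norm_on (A n) (X n)" "prob (A n) \<le> (1/2)^n"
      and \<delta>: "0 < \<delta> n" "\<delta> n \<le> 1" "\<And>B. B \<in> sets P \<Longrightarrow> prob B \<le> \<delta> n \<Longrightarrow> H1_norm_on B (X n) \<le> e / 8"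
      and A\<delta>: "\<And>m. m < n \<Longrightarrow> prob (A n) \<le> (1/2)^n * \<delta> m" for n
      using h[of n] K by (auto simp: Q_def X_def A_def \<delta>_def split: prod.splits)
    define U where "U l = (\<Union>n. A (n + l))" for l
    have U: "U l \<in> sets P" for l unfolding U_def using A by auto
    have half: "summable (\<lambda>n. (1/2::real)^(n + l))" and half_sum: "(\<Sum>n. (1/2::real)^(n + l)) = 2 * (1/2)^l" for l
    proof -
      show "summable (\<lambda>n. (1/2::real)^(n + l))" by (rule summable_ignore_initial_segment) (simp add: summable_geometric)
      show "(\<Sum>n. (1/2::real)^(n + l)) = 2 * (1/2)^l"
        using suminf_mult2[of "\<lambda>j. (1/2::real)^j" "(1/2)^l"] by (simp add: suminf_geometric power_add)
    qed
    have U_le: "prob (U l) \<le> 2 * (1/2)^l * c" if c: "\<And>n. prob (A (n + l)) \<le> (1/2)^(n + l) * c" for l c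
    proof -
      have s: "summable (\<lambda>n. (1/2)^(n + l) * c)" by (rule summable_mult2[OF half])
      have sA: "summable (\<lambda>n. prob (A (n + l)))" by (rule summable_comparison_test'[OF s, of 0]) (use c in simp)
      have "prob (U l) \<le> (\<Sum>n. prob (A (n + l)))" unfolding U_def using A sA by (intro finite_measure_subadditive_countably) auto
      also have "\<dots> \<le> (\<Sum>n. (1/2)^(n + l) * c)" by (rule suminf_le[OF c sA s])
      also have "\<dots> = 2 * (1/2)^l * c" using suminf_mult2[OF half, of l c] half_sum[of l] by simp
      finally show ?thesis .
    qed
    have U0: "prob (U l) \<le> 2 * (1/2)^l" for l using U_le[of l 1] A(3) by simp
    \<comment> \<open>The probabilities of the events after \<open>m\<close> sum to at most 2 *
      (1/2)^(m+1) times the modulus of stage \<open>m\<close>, hence to at most that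
      modulus.\<close>
    have T_small: "H1_norm_on (U (Suc m)) (X m) \<le> e / 8" for m
    proof (rule \<delta>(3)[OF U])
      have "prob (U (Suc m)) \<le> 2 * (1/2)^(Suc m) * \<delta> m" by (rule U_le) (rule A\<delta>, simp)
      also have "\<dots> = (1/2)^m * \<delta> m" by simp
      also have "\<dots> \<le> 1 * \<delta> m" using \<delta>(1)[of m] by (intro mult_right_mono power_le_one) auto
      finally show "prob (U (Suc m)) \<le> \<delta> m" by simp
    qed
    \<comment> \<open>Removing all later events makes the sets disjoint at a loss of at most e/8,
      which leaves 7e/8.\<close>
    define B where "B n = A n - U (Suc n)" for n
    have B: "B n \<in> sets P" for n unfolding B_def using A U by auto
    have AU: "A n \<subseteq> U l" if "l \<le> n" for n l
    proof -
      have "A n = A ((n - l) + l)" using that by simp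
      then show ?thesis unfolding U_def by blast
    qed
    have BU: "B n \<subseteq> U l" if "l \<le> n" for n l using AU[OF that] by (auto simp: B_def)
    have disj: "B m \<inter> B n = {}" if "m < n" for m n
      using BU[of "Suc m" n] that by (auto simp: B_def)
    have disj': "disjoint_family_on B I" for I
      unfolding disjoint_family_on_def using disj by (metis Int_commute linorder_neqE_nat)
    have B_large: "H1_norm_on (B n) (X n) \<ge> 7 * e / 8" for n
    proof -
      have "H1_norm_on (A n) (X n) \<le> (\<integral>x. indicator (B n) x * max_fun (X n) x + indicator (U (Suc n)) x * max_fun (X n) x \<partial>P)"
        unfolding H1_norm_on_def
        by (intro integral_mono Bochner_Integration.integrable_add max_fun_integrable(2)[OF X(2)] A B U)
           (auto simp: B_def indicator_def max_fun_nonneg)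
      also have "\<dots> = H1_norm_on (B n) (X n) + H1_norm_on (U (Suc n)) (X n)"
        unfolding H1_norm_on_def by (intro Bochner_Integration.integral_add max_fun_integrable(2)[OF X(2)] B U)
      finally show ?thesis using T_small[of n] A(2)[of n] by simp
    qed
    have "\<forall>n. \<exists>l. linear l \<and> (\<forall>M\<in>H1 P F. \<bar>l M\<bar> \<le> H1_norm_on (B n) M) \<and> l (X n) = H1_norm_on (B n) (X n)"
      using hahn_banach_norming[OF seminorm_H1_norm_on[OF B] X(2)] by blast
    from choice[OF this] obtain \<phi> where \<phi>: "\<And>n. linear (\<phi> n)" "\<And>n M. M \<in> H1 P F \<Longrightarrow> \<bar>\<phi> n M\<bar> \<le> H1_norm_on (B n) M"
      "\<And>n. \<phi> n (X n) = H1_norm_on (B n) (X n)" by blast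
    have \<phi>D: "\<phi> n \<in> ?D" for n
    proof (rule linear_in_dual_on[OF \<phi>(1), of _ _ _ 1])
      show "bounded_on (H1 P F) (H1_norm P) (\<phi> n) 1"
        unfolding bounded_on_def mult_1 by (intro ballI order_trans[OF \<phi>(2) H1_norm_on_le_H1_norm[OF _ B]])
    qed
    have "range X \<subseteq> K" using X by blast
    from cluster[OF this] obtain N where N: "N \<in> H1 P F"
      "\<And>A e i. finite A \<Longrightarrow> A \<subseteq> ?D \<Longrightarrow> e > 0 \<Longrightarrow> \<exists>n\<ge>i. \<forall>\<phi>\<in>A. \<bar>\<phi> (X n) - \<phi> N\<bar> < e" by blast
    have U_null: "\<exists>l. H1_norm_on (U l) M \<le> r" if M: "M \<in> H1 P F" and r: "r > 0" for M :: "real \<Rightarrow> 'a \<Rightarrow> 'e" and r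
    proof -
      obtain d where d: "d > 0" "\<And>A. A \<in> sets P \<Longrightarrow> prob A \<le> d \<Longrightarrow> H1_norm_on A M \<le> r"
        using H1_norm_on_small[OF M r] by blast
      have "(\<lambda>l. 2 * (1/2) ^ l :: real) \<longlonglongrightarrow> 0" by (intro tendsto_mult_right_zero LIMSEQ_realpow_zero) auto
      then have "\<forall>\<^sub>F l in sequentially. 2 * (1/2) ^ l < d" by (rule order_tendstoD) (rule d(1))
      then obtain l where "2 * (1/2) ^ l < d" by (auto simp: eventually_sequentially)
      then show ?thesis using d(2)[OF U, of l] U0[of l] by (intro exI[of _ l]) auto
    qed
    \<comment> \<open>Beyond \<open>j0\<close> the cluster point \<open>N\<close> contributes at
      most e/8 to the functionals altogether.\<close>
    obtain j0 where j0: "H1_norm_on (U j0) N \<le> e / 8" using U_null[OF N(1), of "e/8"] e by auto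
    \<comment> \<open>A subsequence along which earlier functionals nearly take their values at
      \<open>N\<close>. The tolerances have sum at most e/8, however many functionals come
      before.\<close>
    define R where "R g k s \<longleftrightarrow> j0 \<le> s \<and> k \<le> s \<and> (\<forall>i<k. g i < s \<and> \<bar>\<phi> (g i) (X s) - \<phi> (g i) N\<bar> < (e / 8) * (1/2) ^ (Suc i))"
      for g :: "nat \<Rightarrow> nat" and k s :: nat
    have "\<exists>g. \<forall>k. R g k (g k)"
    proof (rule dependent_wellorder_choice)
      fix r and f g :: "nat \<Rightarrow> nat" and n :: nat
      assume "\<And>m. m < n \<Longrightarrow> f m = g m"
      then show "R f n r = R g n r" by (auto simp: R_def)
    next
      fix k and g :: "nat \<Rightarrow> nat"
      let ?e = "(e / 8) * (1/2) ^ (Suc k)"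
      define i0 where "i0 = Max (insert j0 (insert k ((\<lambda>i. Suc (g i)) ` {..<k})))"
      have i0: "j0 \<le> i0" "k \<le> i0" "\<And>i. i < k \<Longrightarrow> g i < i0"
        unfolding i0_def Suc_le_eq[symmetric] by (intro Max_ge; simp)+
      obtain s where s: "s \<ge> i0" "\<forall>f\<in>(\<lambda>i. \<phi> (g i)) ` {..<k}. \<bar>f (X s) - f N\<bar> < ?e"
        using N(2)[of "(\<lambda>i. \<phi> (g i)) ` {..<k}" ?e i0] \<phi>D e by auto
      have "\<bar>\<phi> (g i) (X s) - \<phi> (g i) N\<bar> < (e / 8) * (1/2) ^ (Suc i)" if i: "i < k" for i
      proof (rule less_le_trans)
        show "\<bar>\<phi> (g i) (X s) - \<phi> (g i) N\<bar> < ?e" using s(2) i by blast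
        show "?e \<le> (e / 8) * (1/2) ^ (Suc i)" using i e by (intro mult_left_mono power_decreasing) auto
      qed
      moreover have "g i < s" if "i < k" for i using less_le_trans[OF i0(3)[OF that] s(1)] .
      ultimately have "R g k s"
        unfolding R_def using order_trans[OF i0(1) s(1)] order_trans[OF i0(2) s(1)] by blast
      then show "\<exists>r. R g k r" by blast
    qed
    then obtain s where "\<And>k. R s k (s k)" by blast
    then have s: "j0 \<le> s k" "k \<le> s k" "\<And>i. i < k \<Longrightarrow> s i < s k"
      "\<And>i. i < k \<Longrightarrow> \<bar>\<phi> (s i) (X (s k)) - \<phi> (s i) N\<bar> < (e / 8) * (1/2) ^ (Suc i)" for k
      unfolding R_def by blast+
    have s_inj: "inj_on s I" for I using s(3) by (auto simp: inj_on_def) (metis linorder_neqE_nat less_irrefl)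
    have sum_le: "(\<Sum>i\<in>I. \<bar>\<phi> (s i) M\<bar>) \<le> H1_norm_on (U l) M" if I: "finite I" "\<And>i. i \<in> I \<Longrightarrow> l \<le> s i" and M: "M \<in> H1 P F" for I l M
    proof -
      have "(\<Sum>i\<in>I. \<bar>\<phi> (s i) M\<bar>) \<le> (\<Sum>i\<in>I. H1_norm_on (B (s i)) M)" by (intro sum_mono \<phi>(2) M)
      also have "\<dots> = (\<Sum>n\<in>s ` I. H1_norm_on (B n) M)" by (simp add: sum.reindex[OF s_inj])
      also have "\<dots> \<le> H1_norm_on (U l) M" using I BU B U by (intro sum_H1_norm_on_le[OF M] disj') auto
      finally show ?thesis .
    qed
    have summ: "summable (\<lambda>k. \<bar>\<phi> (s (k + l)) M\<bar>)" and suminf_abs_le: "(\<Sum>k. \<bar>\<phi> (s (k + l)) M\<bar>) \<le> H1_norm_on (U j) M"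
      if M: "M \<in> H1 P F" and j: "\<And>k. l \<le> k \<Longrightarrow> j \<le> s k" for l j M
    proof -
      have le: "(\<Sum>k<n. \<bar>\<phi> (s (k + l)) M\<bar>) \<le> H1_norm_on (U j) M" for n
      proof -
        have "(\<Sum>k<n. \<bar>\<phi> (s (k + l)) M\<bar>) = (\<Sum>i\<in>(\<lambda>k. k + l) ` {..<n}. \<bar>\<phi> (s i) M\<bar>)" by (simp add: sum.reindex)
        also have "\<dots> \<le> H1_norm_on (U j) M" using j by (intro sum_le M) auto
        finally show ?thesis .
      qed
      show 1: "summable (\<lambda>k. \<bar>\<phi> (s (k + l)) M\<bar>)" by (rule summableI_nonneg_bounded[OF _ le]) simp
      show "(\<Sum>k. \<bar>\<phi> (s (k + l)) M\<bar>) \<le> H1_norm_on (U j) M" by (rule suminf_le_const[OF 1 le])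
    qed
    \<comment> \<open>Tail sums rather than one sum: any fixed martingale has small value under a
      late tail, while the members of the subsequence do not.\<close>
    define \<psi> where "\<psi> l M = (\<Sum>k. \<phi> (s (k + l)) M)" for l M
    have ls: "l \<le> s k" if "l \<le> k" for l k using s(2)[of k] that by simp
    have sumr: "summable (\<lambda>k. \<phi> (s (k + l)) M)" if "M \<in> H1 P F" for l M
      using summ[OF that ls, of l] by (simp add: summable_rabs_cancel)
    have \<psi>_le: "\<bar>\<psi> l M\<bar> \<le> H1_norm_on (U j) M" if M: "M \<in> H1 P F" and j: "\<And>k. l \<le> k \<Longrightarrow> j \<le> s k" for l j M
      unfolding \<psi>_def using summable_rabs[OF summ[OF M j], of l] suminf_abs_le[OF M j, of l] by simp
    have \<psi>D: "\<psi> l \<in> ?D" for l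
    proof -
      have "\<psi> l (M + M') = \<psi> l M + \<psi> l M'" if "M \<in> H1 P F" "M' \<in> H1 P F" for M M'
        unfolding \<psi>_def using sumr that by (simp add: linear_add[OF \<phi>(1)] suminf_add)
      moreover have "\<psi> l (c *\<^sub>R M) = c * \<psi> l M" if "M \<in> H1 P F" for M c
        unfolding \<psi>_def using suminf_mult[OF sumr[OF that], of c] by (simp add: linear_scale[OF \<phi>(1)])
      moreover have "\<bar>\<psi> l M\<bar> \<le> 1 * H1_norm P M" if "M \<in> H1 P F" for M
        using \<psi>_le[OF that, of l l] ls H1_norm_on_le_H1_norm[OF that U, of l] by simp
      ultimately show ?thesis unfolding dual_on_def bounded_on_def by blast
    qed
    \<comment> \<open>The diagonal term is at least 7e/8. Later functionals take away at most e/8,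
      and earlier ones at most e/4: e/8 from \<open>N\<close> and e/8 from the tolerances.\<close>
    have \<psi>_large: "\<psi> l (X (s k)) \<ge> e / 2" if lk: "l \<le> k" for l k
    proof -
      let ?M = "X (s k)"
      have M: "?M \<in> H1 P F" by (rule X)
      have "\<psi> l ?M = (\<Sum>i. \<phi> (s (i + Suc (k - l) + l)) ?M) + (\<Sum>i<Suc (k - l). \<phi> (s (i + l)) ?M)"
        unfolding \<psi>_def by (rule suminf_split_initial_segment[OF sumr[OF M]])
      also have "(\<Sum>i. \<phi> (s (i + Suc (k - l) + l)) ?M) = \<psi> (Suc k) ?M"
        unfolding \<psi>_def using lk by (intro suminf_cong) simp
      also have "(\<Sum>i<Suc (k - l). \<phi> (s (i + l)) ?M) = (\<Sum>i<k - l. \<phi> (s (i + l)) ?M) + \<phi> (s k) ?M"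
        using lk by simp
      finally have eq: "\<psi> l ?M = \<psi> (Suc k) ?M + ((\<Sum>i<k - l. \<phi> (s (i + l)) ?M) + \<phi> (s k) ?M)" .
      have "\<bar>\<psi> (Suc k) ?M\<bar> \<le> H1_norm_on (U (Suc (s k))) ?M"
        using s(3) by (intro \<psi>_le[OF M]) (simp add: Suc_le_eq)
      then have tail: "\<bar>\<psi> (Suc k) ?M\<bar> \<le> e / 8" using T_small[of "s k"] by simp
      have "\<bar>\<Sum>i<k - l. \<phi> (s (i + l)) ?M\<bar> \<le> (\<Sum>i<k - l. \<bar>\<phi> (s (i + l)) ?M\<bar>)" by (rule sum_abs)
      also have "\<dots> \<le> (\<Sum>i<k - l. \<bar>\<phi> (s (i + l)) N\<bar> + (e / 8) * (1/2) ^ (Suc i))"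
      proof (rule sum_mono)
        fix i assume "i \<in> {..<k - l}"
        then have "\<bar>\<phi> (s (i + l)) ?M - \<phi> (s (i + l)) N\<bar> < (e / 8) * (1/2) ^ (Suc (i + l))" by (intro s(4)) auto
        also have "\<dots> \<le> (e / 8) * (1/2) ^ (Suc i)" using e by (intro mult_left_mono power_decreasing) auto
        finally show "\<bar>\<phi> (s (i + l)) ?M\<bar> \<le> \<bar>\<phi> (s (i + l)) N\<bar> + (e / 8) * (1/2) ^ (Suc i)" by linarith
      qed
      also have "\<dots> = (\<Sum>i<k - l. \<bar>\<phi> (s (i + l)) N\<bar>) + (e / 8) * (\<Sum>i<k - l. (1/2) ^ (Suc i))"
        by (simp add: sum.distrib sum_distrib_left)
      also have "(\<Sum>i<k - l. (1/2::real) ^ (Suc i)) \<le> 1"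
        using sum_le_suminf[OF sums_summable[OF power_half_series], of "{..<k - l}"] sums_unique[OF power_half_series] by simp
      also have "(\<Sum>i<k - l. \<bar>\<phi> (s (i + l)) N\<bar>) = (\<Sum>i\<in>(\<lambda>i. i + l) ` {..<k - l}. \<bar>\<phi> (s i) N\<bar>)" by (simp add: sum.reindex)
      also have "\<dots> \<le> H1_norm_on (U j0) N" using s(1) by (intro sum_le N) auto
      also have "\<dots> \<le> e / 8" by (rule j0)
      finally have head: "\<bar>\<Sum>i<k - l. \<phi> (s (i + l)) ?M\<bar> \<le> e / 4" using e by simp
      show ?thesis using eq tail head B_large[of "s k"] \<phi>(3)[of "s k"] by linarith
    qed
    \<comment> \<open>A second cluster point, now of the subsequence. A late tail is at most e/8 at
      it but at least e/2 along the subsequence, so the values cannot come within e/8.\<close>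
    have "range (\<lambda>k. X (s k)) \<subseteq> K" using X by blast
    from cluster[OF this] obtain y where y: "y \<in> H1 P F"
      "\<And>A e i. finite A \<Longrightarrow> A \<subseteq> ?D \<Longrightarrow> e > 0 \<Longrightarrow> \<exists>n\<ge>i. \<forall>\<phi>\<in>A. \<bar>\<phi> (X (s n)) - \<phi> y\<bar> < e" by blast
    obtain l where l: "H1_norm_on (U l) y \<le> e / 8" using U_null[OF y(1), of "e/8"] e by auto
    obtain n where n: "n \<ge> l" "\<bar>\<psi> l (X (s n)) - \<psi> l y\<bar> < e / 8" using y(2)[of "{\<psi> l}" "e/8" l] \<psi>D e by auto
    show False using \<psi>_le[OF y(1) ls[of l], of l] l n \<psi>_large[OF n(1)] e by linarith
  qed
qed

section \<open>Convergence uniformly on compacts in probability\<close>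

lemma ucp_dist_le_H1_norm:
  fixes M N :: "real \<Rightarrow> 'a \<Rightarrow> 'e::banach"
  assumes MN: "M - N \<in> H1 P F"
  shows "0 \<le> ucp_dist P M N" "ucp_dist P M N \<le> H1_norm P (M - N)"
    "(1/2) ^ Suc n * enn2real (\<integral>\<^sup>+x. min 1 (running_max (M - N) (real (Suc n)) x) \<partial>P) \<le> ucp_dist P M N"
proof -
  let ?a = "\<lambda>n. enn2real (\<integral>\<^sup>+x. min 1 (running_max (M - N) (real (Suc n)) x) \<partial>P)"
  let ?p = "H1_norm P (M - N)"
  have a: "?a n \<le> ?p" for n
    unfolding H1_norm_def
  proof (rule enn2real_mono)
    show "(\<integral>\<^sup>+x. min 1 (running_max (M - N) (real (Suc n)) x) \<partial>P) \<le> (\<integral>\<^sup>+x. total_max (M - N) x \<partial>P)"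
      by (intro nn_integral_mono) (auto intro: running_max_le_total_max min.coboundedI2)
    show "(\<integral>\<^sup>+x. total_max (M - N) x \<partial>P) < top" using H1D(3)[OF MN] by simp
  qed
  have hs: "(\<lambda>n. (1/2) ^ Suc n * ?p) sums (1 * ?p)" by (rule sums_mult2[OF power_half_series])
  have s: "summable (\<lambda>n. (1/2) ^ Suc n * ?a n)"
    by (rule summable_comparison_test'[OF sums_summable[OF hs], of 0]) (use a in \<open>simp add: mult_left_mono\<close>)
  show "0 \<le> ucp_dist P M N" unfolding ucp_dist_def by (intro suminf_nonneg s) simp
  have "ucp_dist P M N \<le> (\<Sum>n. (1/2) ^ Suc n * ?p)"
    unfolding ucp_dist_def using a by (intro suminf_le s sums_summable[OF hs] mult_left_mono) auto
  then show "ucp_dist P M N \<le> ?p" using sums_unique[OF hs] by simp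
  show "(1/2) ^ Suc n * ?a n \<le> ucp_dist P M N"
    unfolding ucp_dist_def using sum_le_suminf[OF s, of "{n}"] by simp
qed

text \<open>Borel-Cantelli with growing horizons: truncated running maxima with summable integrals
  tend to 0 almost everywhere, and the horizon i+1 finally passes every time. The selection need not
  be monotone; \<open>i \<le> r i\<close> keeps blocks inside their tails.\<close>

lemma ucp_convergent_subsequence:
  fixes N :: "real \<Rightarrow> 'a \<Rightarrow> 'e::banach" and X :: "nat \<Rightarrow> real \<Rightarrow> 'a \<Rightarrow> 'e"
  assumes X: "\<And>i. X i \<in> H1 P F" and N: "N \<in> H1 P F" and lim: "(\<lambda>i. ucp_dist P (X i) N) \<longlonglongrightarrow> 0"
  shows "\<exists>r. (\<forall>i. i \<le> r i) \<and> (AE x in P. \<forall>t\<ge>0. (\<lambda>i. X (r i) t x) \<longlonglongrightarrow> N t x)"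
proof -
  have D: "X i - N \<in> H1 P F" for i by (intro subspace_diff[OF subspace_H1] X N)
  \<comment> \<open>The first factor is the weight of horizon i+1 in the metric. Cancelling it
    leaves (1/2)^i for the truncated maximum.\<close>
  have "\<exists>r\<ge>i. ucp_dist P (X r) N < (1/2) ^ Suc i * (1/2) ^ i" for i
  proof -
    have "\<forall>\<^sub>F r in sequentially. ucp_dist P (X r) N < (1/2) ^ Suc i * (1/2) ^ i"
      using lim by (rule order_tendstoD) simp
    then obtain n where "\<And>r. r \<ge> n \<Longrightarrow> ucp_dist P (X r) N < (1/2) ^ Suc i * (1/2) ^ i"
      by (auto simp: eventually_sequentially)
    then show ?thesis by (intro exI[of _ "max i n"]) auto
  qed
  then obtain r where r: "\<And>i. i \<le> r i" "\<And>i. ucp_dist P (X (r i)) N < (1/2) ^ Suc i * (1/2) ^ i" by metis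
  define u where "u i x = min 1 (running_max (X (r i) - N) (real (Suc i)) x)" for i x
  have um: "u i \<in> borel_measurable P" for i
    unfolding u_def using running_max_measurable[OF H1D(1)[OF D] H1D(6)[OF D]] by measurable
  have ui: "(\<integral>\<^sup>+x. u i x \<partial>P) \<le> ennreal ((1/2) ^ i)" for i
  proof -
    have "(\<integral>\<^sup>+x. u i x \<partial>P) \<le> (\<integral>\<^sup>+x. 1 \<partial>P)" unfolding u_def by (intro nn_integral_mono) simp
    then have fin: "(\<integral>\<^sup>+x. u i x \<partial>P) < top" by (simp add: emeasure_space_1 le_less_trans)
    have "(1/2) ^ Suc i * enn2real (\<integral>\<^sup>+x. u i x \<partial>P) < (1/2) ^ Suc i * (1/2) ^ i"
      unfolding u_def by (rule le_less_trans[OF ucp_dist_le_H1_norm(3)[OF D] r(2)])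
    then have "enn2real (\<integral>\<^sup>+x. u i x \<partial>P) < (1/2) ^ i" by (subst (asm) mult_less_cancel_left_pos) auto
    then have "ennreal (enn2real (\<integral>\<^sup>+x. u i x \<partial>P)) \<le> ennreal ((1/2) ^ i)" by (intro ennreal_leI) simp
    then show ?thesis using fin by simp
  qed
  have "(\<integral>\<^sup>+x. (\<Sum>i. u i x) \<partial>P) = (\<Sum>i. \<integral>\<^sup>+x. u i x \<partial>P)" by (intro nn_integral_suminf um)
  also have "\<dots> \<le> (\<Sum>i. ennreal ((1/2) ^ (i + 0)))" using ui by (intro suminf_le) auto
  also have "\<dots> < \<infinity>" unfolding suminf_geometric_tail_ennreal by simp
  finally have "AE x in P. (\<Sum>i. u i x) \<noteq> \<infinity>" using um by (intro nn_integral_PInf_AE) auto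
  then have "AE x in P. \<forall>t\<ge>0. (\<lambda>i. X (r i) t x) \<longlonglongrightarrow> N t x"
  proof eventually_elim
    case (elim x)
    then have "(\<lambda>n. \<Sum>j. u (j + n) x) \<longlonglongrightarrow> 0" by (intro suminf_tail_ennreal_tendsto_0) (simp add: less_top)
    moreover have "u n x \<le> (\<Sum>j. u (j + n) x)" for n
      using sum_le_suminf[of "\<lambda>j. u (j + n) x" "{0}"] by simp
    ultimately have u0: "(\<lambda>n. u n x) \<longlonglongrightarrow> 0" by (rule ennreal_squeeze_0[rotated])
    show ?case
    proof (intro allI impI)
      fix t :: real assume t: "t \<ge> 0"
      obtain n0 where n0: "t \<le> real n0" using real_arch_simple by blast
      show "(\<lambda>i. X (r i) t x) \<longlonglongrightarrow> N t x"
      proof (rule LIMSEQ_I)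
        fix e :: real assume e: "e > 0"
        \<comment> \<open>Below 1 the truncation is inactive, so the running maximum itself is below
          \<open>e\<close>.\<close>
        have "\<forall>\<^sub>F n in sequentially. u n x < ennreal (min 1 e)" using u0 by (rule order_tendstoD) (use e in simp)
        then obtain n1 where n1: "\<And>n. n \<ge> n1 \<Longrightarrow> u n x < ennreal (min 1 e)" by (auto simp: eventually_sequentially)
        have "norm (X (r i) t x - N t x) < e" if "i \<ge> max n0 n1" for i
        proof -
          have "ennreal (norm (X (r i) t x - N t x)) \<le> running_max (X (r i) - N) (real (Suc i)) x"
            using norm_le_running_max[of t "real (Suc i)" "X (r i) - N" x] t n0 that by (simp add: fun_diff_def)
          moreover have "running_max (X (r i) - N) (real (Suc i)) x < ennreal e"
          proof -
            have "u i x < ennreal (min 1 e)" using n1 that by simp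
            moreover have "ennreal (min 1 e) \<le> 1" "ennreal (min 1 e) \<le> ennreal e" by (auto simp: ennreal_le_1 intro: ennreal_leI)
            ultimately have "u i x < 1" "u i x < ennreal e" by (auto intro: less_le_trans)
            then show ?thesis unfolding u_def by (auto simp: min_def split: if_splits)
          qed
          ultimately have "ennreal (norm (X (r i) t x - N t x)) < ennreal e" by (rule le_less_trans)
          then show ?thesis using e by (simp add: ennreal_less_iff)
        qed
        then show "\<exists>n0. \<forall>i\<ge>n0. norm (X (r i) t x - N t x) < e" by blast
      qed
    qed
  qed
  then show ?thesis using r(1) by blast
qed

lemma weak_compactness_characterization:
  fixes K :: "(real \<Rightarrow> 'a \<Rightarrow> 'e::banach) set"
  assumes RNP: "RNP_wrt P TYPE('e \<Rightarrow>\<^sub>L real)" and K: "K \<subseteq> H1 P F"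
  defines "ucp \<equiv> \<forall>M :: nat \<Rightarrow> real \<Rightarrow> 'a \<Rightarrow> 'e. range M \<subseteq> K \<longrightarrow>
          (\<exists>N' :: nat \<Rightarrow> real \<Rightarrow> 'a \<Rightarrow> 'e. \<exists>N\<in>H1 P F.
             (\<forall>i. N' i \<in> convex hull (M ` {i..})) \<and> (\<lambda>i. ucp_dist P (N' i) N) \<longlonglongrightarrow> 0)"
    and "weak \<equiv> \<forall>M :: nat \<Rightarrow> real \<Rightarrow> 'a \<Rightarrow> 'e. range M \<subseteq> K \<longrightarrow>
          (\<exists>N' :: nat \<Rightarrow> real \<Rightarrow> 'a \<Rightarrow> 'e. \<exists>N\<in>H1 P F.
             (\<forall>i. N' i \<in> convex hull (M ` {i..})) \<and>
             (\<forall>t\<ge>0. AE x in P. limitin weak_topology (\<lambda>i. N' i t x) (N t x) sequentially))"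
  shows "relatively_compact_in (H1_weak_topology P F) K \<longleftrightarrow> uniformly_integrable P (maximal_functions K) \<and> ucp"
    and "relatively_compact_in (H1_weak_topology P F) K \<longleftrightarrow> uniformly_integrable P (maximal_functions K) \<and> weak"
proof -
  define blocks where "blocks \<longleftrightarrow> (\<forall>M :: nat \<Rightarrow> real \<Rightarrow> 'a \<Rightarrow> 'e. range M \<subseteq> K \<longrightarrow>
      (\<exists>Y. \<exists>y\<in>H1 P F. (\<forall>i. Y i \<in> convex hull (M ` {i..})) \<and> (\<lambda>i. H1_norm P (Y i - y)) \<longlonglongrightarrow> 0))"
  let ?rc = "relatively_compact_in (H1_weak_topology P F) K"
  have rc_eq: "?rc \<longleftrightarrow> relatively_compact_in (weak_topology_on (H1 P F) (dual_on (H1 P F) (H1_norm P))) K"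
    by (simp add: H1_weak_topology_def H1_dual_eq)
  have hullH: "N \<in> H1 P F" if "range M \<subseteq> K" "N \<in> convex hull (M ` {i..})" for M :: "nat \<Rightarrow> real \<Rightarrow> 'a \<Rightarrow> 'e" and N i
    using hull_minimal[of "M ` {i..}" "H1 P F" convex] subspace_imp_convex[OF subspace_H1] that K by blast
  have 1: "equi_integrable K \<and> blocks" if "?rc"
    using equi_integrable_of_weakly_compact[OF K] blocks_of_relatively_weakly_compact[OF seminorm_H1_norm K] that
    unfolding rc_eq blocks_def by blast
  have 2: "?rc" if ui: "equi_integrable K" and b: "blocks"
  proof -
    \<comment> \<open>Norm boundedness, one half of uniform integrability, places the evaluations in
      compact intervals.\<close>
    obtain C where C: "\<And>M. M \<in> K \<Longrightarrow> H1_norm P M \<le> C" using ui unfolding equi_integrable_def by blast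
    show ?thesis
      unfolding rc_eq
      by (rule relatively_weakly_compact_of_blocks[OF seminorm_H1_norm H1_complete K C])
         (use b[unfolded blocks_def] in blast)+
  qed
  have 3: ucp if blocks
    unfolding ucp_def
  proof (intro allI impI)
    fix M :: "nat \<Rightarrow> real \<Rightarrow> 'a \<Rightarrow> 'e" assume M: "range M \<subseteq> K"
    then obtain Y y where Y: "y \<in> H1 P F" "\<And>i. Y i \<in> convex hull (M ` {i..})" "(\<lambda>i. H1_norm P (Y i - y)) \<longlonglongrightarrow> 0"
      using \<open>blocks\<close> unfolding blocks_def by blast
    have D: "Y i - y \<in> H1 P F" for i by (intro subspace_diff[OF subspace_H1] hullH[OF M Y(2)] Y(1))
    have "(\<lambda>i. ucp_dist P (Y i) y) \<longlonglongrightarrow> 0"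
      by (rule tendsto_sandwich[OF _ _ tendsto_const Y(3)]) (use ucp_dist_le_H1_norm[OF D] in auto)
    then show "\<exists>N'. \<exists>N\<in>H1 P F. (\<forall>i. N' i \<in> convex hull (M ` {i..})) \<and> (\<lambda>i. ucp_dist P (N' i) N) \<longlonglongrightarrow> 0"
      using Y by blast
  qed
  have 4: weak if ucp
    unfolding weak_def
  proof (intro allI impI)
    fix M :: "nat \<Rightarrow> real \<Rightarrow> 'a \<Rightarrow> 'e" assume M: "range M \<subseteq> K"
    then obtain Y y where Y: "y \<in> H1 P F" "\<And>i. Y i \<in> convex hull (M ` {i..})" "(\<lambda>i. ucp_dist P (Y i) y) \<longlonglongrightarrow> 0"
      using \<open>ucp\<close> unfolding ucp_def by blast
    obtain r where r: "\<And>i. i \<le> r i" "AE x in P. \<forall>t\<ge>0. (\<lambda>i. Y (r i) t x) \<longlonglongrightarrow> y t x"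
      using ucp_convergent_subsequence[OF hullH[OF M Y(2)] Y(1,3)] by blast
    have "Y (r i) \<in> convex hull (M ` {i..})" for i
    proof -
      have "convex hull (M ` {r i..}) \<subseteq> convex hull (M ` {i..})" using r(1)[of i] by (intro hull_mono image_mono) auto
      then show ?thesis using Y(2) by blast
    qed
    moreover have "AE x in P. limitin weak_topology (\<lambda>i. Y (r i) t x) (y t x) sequentially" if "t \<ge> 0" for t
      using r(2) by eventually_elim (use that in \<open>auto intro: limitin_weak_topologyI\<close>)
    ultimately show "\<exists>N'. \<exists>N\<in>H1 P F. (\<forall>i. N' i \<in> convex hull (M ` {i..})) \<and>
        (\<forall>t\<ge>0. AE x in P. limitin weak_topology (\<lambda>i. N' i t x) (N t x) sequentially)"
      using Y(1) by (intro exI[of _ "\<lambda>i. Y (r i)"] bexI[of _ y]) auto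
  qed
  have 5: blocks if ui: "equi_integrable K" and w: weak
    unfolding blocks_def
  proof (intro allI impI)
    fix M :: "nat \<Rightarrow> real \<Rightarrow> 'a \<Rightarrow> 'e" assume M: "range M \<subseteq> K"
    then obtain Y y where Y: "y \<in> H1 P F" "\<And>i. Y i \<in> convex hull (M ` {i..})"
      "\<And>t. t \<ge> 0 \<Longrightarrow> AE x in P. limitin weak_topology (\<lambda>i. Y i t x) (y t x) sequentially"
      using w unfolding weak_def by blast
    show "\<exists>Y. \<exists>y\<in>H1 P F. (\<forall>i. Y i \<in> convex hull (M ` {i..})) \<and> (\<lambda>i. H1_norm P (Y i - y)) \<longlonglongrightarrow> 0"
      by (rule norm_blocks_of_weak_blocks[OF RNP K ui M Y(2,1,3)])
  qed
  note ui_eq = uniformly_integrable_iff[OF K]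
  show "?rc \<longleftrightarrow> uniformly_integrable P (maximal_functions K) \<and> ucp" unfolding ui_eq using 1 2 3 4 5 by blast
  show "?rc \<longleftrightarrow> uniformly_integrable P (maximal_functions K) \<and> weak" unfolding ui_eq using 1 2 3 4 5 by blast
qed

end

theorem theorem1:
  fixes P :: "'a measure" and F :: "real \<Rightarrow> 'a measure"
    and K :: "(real \<Rightarrow> 'a \<Rightarrow> 'e::banach) set"
  assumes "stochastic_basis P F"
    and "radon_nikodym_property TYPE('a) TYPE('e \<Rightarrow>\<^sub>L real)"
    and "K \<subseteq> H1 P F"
  shows
    "(relatively_compact_in (H1_weak_topology P F) K \<longleftrightarrow>
        uniformly_integrable P (maximal_functions K) \<and>
        (\<forall>M :: nat \<Rightarrow> real \<Rightarrow> 'a \<Rightarrow> 'e. range M \<subseteq> K \<longrightarrow>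
          (\<exists>N' :: nat \<Rightarrow> real \<Rightarrow> 'a \<Rightarrow> 'e. \<exists>N\<in>H1 P F.
             (\<forall>i. N' i \<in> convex hull (M ` {i..})) \<and>
             (\<lambda>i. ucp_dist P (N' i) N) \<longlonglongrightarrow> 0))) \<and>
     (relatively_compact_in (H1_weak_topology P F) K \<longleftrightarrow>
        uniformly_integrable P (maximal_functions K) \<and>
        (\<forall>M :: nat \<Rightarrow> real \<Rightarrow> 'a \<Rightarrow> 'e. range M \<subseteq> K \<longrightarrow>
          (\<exists>N' :: nat \<Rightarrow> real \<Rightarrow> 'a \<Rightarrow> 'e. \<exists>N\<in>H1 P F.
             (\<forall>i. N' i \<in> convex hull (M ` {i..})) \<and>
             (\<forall>t\<ge>0. AE x in P. limitin weak_topology (\<lambda>i. N' i t x) (N t x) sequentially))))"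
proof -
  interpret stoch_basis P F by (rule stoch_basisI[OF assms(1)])
  \<comment> \<open>The given probability is itself among the finite measures over which the
    Radon-Nikodym property ranges.\<close>
  have "finite_measure P" by unfold_locales
  then have "RNP_wrt P TYPE('e \<Rightarrow>\<^sub>L real)" using assms(2) by (simp add: radon_nikodym_property_def)
  from weak_compactness_characterization[OF this assms(3)] show ?thesis by (rule conjI)
qed

end
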